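(* Let $\Delta$ be the $n$-simplex. For every two stellar $n$-simplexes $A,B$ there exist $k\ge0$ and a map $h\colon\beta^kB\to A$ with $h\in\mathcal C_\star(\Delta)$.
   Context: $\Delta=[\{0,\dots,n\}]$, the complex of non-empty subsets of $\{0,\dots,n\}$; $\beta$ is barycentric subdivision. Stellar notions (stellar moves, stellar balls, manifolds and boundaries) are the standard Alexander–Newman ones. A stellar $n$-simplex is a family $A=(A_X:X\in\Delta)$ of complexes with $A=A_{\{0,\dots,n\}}$ a stellar $n$-ball, each $A_X$ a stellar $(|X|-1)$-ball, $A_{X\cap Y}=A_X\cap A_Y$ ($A_\emptyset=\emptyset$), $\partial A_X=\bigcup_{Z\subsetneq X}A_Z$; $\beta^kB=(\beta^kB_X:X\in\Delta)$. A face-preserving map $f\colon B\to A$ is simplicial with $f_*(B_X)=A_X$ for all $X$; $f_X$ its restriction to $B_X$. For simplicial $f\colon B\to A$ and $\sigma\in A$, $D(\sigma,f)=\{\{\tau_0\subseteq\dots\subseteq\tau_k\}\in\beta B:\sigma\subseteq f_*(\tau_0)\}$; $f\colon M\to N$ between stellar manifolds is cellular if each $D(\sigma,f)$, $\sigma\in N$, is a stellar ball. $\mathcal C_\star(\Delta)$ is the class of face-preserving maps between stellar $n$-simplexes all of whose restrictions $f_X$ are cellular. *)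

theory Defs
  imports Main "HOL-Library.FSet"
begin

text \<open>
  Barycentric subdivision has the simplices of a complex as its vertices, so iterating it a variable
  number of times needs a vertex type closed under forming finite sets. Vertices are therefore
  hereditarily finite sets over atoms from an arbitrary type; a complex with vertices in
  \<^typ>\<open>'a\<close> is regarded as a complex on atoms. The vertex type is always infinite, so
  stellar moves never run out of new vertices.
\<close>

datatype 'a vertex = Atom 'a | Bary "'a vertex fset"

type_synonym 'a family = "'a vertex set set"

definition simplicial_complex :: "'a family \<Rightarrow> bool" where
  "simplicial_complex K \<longleftrightarrow>
     finite K \<and> (\<forall>\<sigma>\<in>K. finite \<sigma> \<and> \<sigma> \<noteq> {}) \<and>
     (\<forall>\<sigma>\<in>K. \<forall>\<tau>. \<tau> \<subseteq> \<sigma> \<and> \<tau> \<noteq> {} \<longrightarrow> \<tau> \<in> K)"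

definition full_complex :: "'v set \<Rightarrow> 'v set set" where
  "full_complex V = {\<sigma>. \<sigma> \<noteq> {} \<and> \<sigma> \<subseteq> V}"

definition simplex_boundary :: "'a vertex set \<Rightarrow> 'a family" where
  "simplex_boundary V = full_complex V - {V}"

definition link :: "'a vertex set \<Rightarrow> 'a family \<Rightarrow> 'a family" where
  "link \<sigma> K = {\<tau>\<in>K. \<tau> \<inter> \<sigma> = {} \<and> \<tau> \<union> \<sigma> \<in> K}"

text \<open>The empty simplex is not a member of a complex, hence the first two summands.\<close>

definition join :: "'a family \<Rightarrow> 'a family \<Rightarrow> 'a family" where
  "join K L = K \<union> L \<union> {\<sigma> \<union> \<tau> |\<sigma> \<tau>. \<sigma> \<in> K \<and> \<tau> \<in> L}"

definition starring :: "'a vertex set \<Rightarrow> 'a vertex \<Rightarrow> 'a family \<Rightarrow> 'a family" where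
  "starring \<sigma> a K =
     (K - {\<tau>\<in>K. \<sigma> \<subseteq> \<tau>}) \<union> join (full_complex {a}) (join (simplex_boundary \<sigma>) (link \<sigma> K))"

inductive stellar_move :: "'a family \<Rightarrow> 'a family \<Rightarrow> bool" where
  star: "simplicial_complex K \<Longrightarrow> \<sigma> \<in> K \<Longrightarrow> a \<notin> \<Union>K \<Longrightarrow> stellar_move K (starring \<sigma> a K)"
| iso: "simplicial_complex K \<Longrightarrow> inj_on f (\<Union>K) \<Longrightarrow> stellar_move K ((\<lambda>\<sigma>. f ` \<sigma>) ` K)"

definition stellar_equivalent :: "'a family \<Rightarrow> 'a family \<Rightarrow> bool" where
  "stellar_equivalent = equivclp stellar_move"

text \<open>
  Dimensions are integers because the empty complex, being the boundary of a point, is the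
  sphere of dimension \<open>-1\<close>; there is no ball of dimension \<open>-1\<close>.
\<close>

definition stellar_ball :: "int \<Rightarrow> 'a family \<Rightarrow> bool" where
  "stellar_ball d K \<longleftrightarrow>
     (\<exists>V. finite V \<and> V \<noteq> {} \<and> int (card V) = d + 1 \<and> stellar_equivalent (full_complex V) K)"

definition stellar_sphere :: "int \<Rightarrow> 'a family \<Rightarrow> bool" where
  "stellar_sphere d K \<longleftrightarrow>
     (\<exists>V. finite V \<and> V \<noteq> {} \<and> int (card V) = d + 2 \<and> stellar_equivalent (simplex_boundary V) K)"

definition stellar_manifold :: "int \<Rightarrow> 'a family \<Rightarrow> bool" where
  "stellar_manifold d K \<longleftrightarrow>
     simplicial_complex K \<and>
     (\<forall>v\<in>\<Union>K. stellar_ball (d - 1) (link {v} K) \<or> stellar_sphere (d - 1) (link {v} K))"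

definition manifold_boundary :: "'a family \<Rightarrow> 'a family" where
  "manifold_boundary K = {\<sigma>\<in>K. \<exists>d. stellar_ball d (link \<sigma> K)}"

abbreviation Delta :: "nat \<Rightarrow> nat set set" where
  "Delta n \<equiv> full_complex {0..n}"

text \<open>
  A family indexed by the faces of the simplex is a function on sets of naturals; only its values
  on subsets of \<open>{0..n}\<close> matter.
\<close>

definition stellar_simplex :: "nat \<Rightarrow> (nat set \<Rightarrow> 'a family) \<Rightarrow> bool" where
  "stellar_simplex n A \<longleftrightarrow>
     A {} = {} \<and>
     (\<forall>X\<in>Delta n. stellar_ball (int (card X) - 1) (A X)) \<and>
     (\<forall>X\<in>Delta n. \<forall>Y\<in>Delta n. A (X \<inter> Y) = A X \<inter> A Y) \<and>
     (\<forall>X\<in>Delta n. manifold_boundary (A X) = (\<Union>Z\<in>{Z. Z \<subset> X}. A Z))"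

definition bary :: "'a vertex set \<Rightarrow> 'a vertex" where
  "bary \<sigma> = Bary (Abs_fset \<sigma>)"

definition flags :: "'a family \<Rightarrow> 'a family set" where
  "flags K = {C. C \<noteq> {} \<and> C \<subseteq> K \<and> chain\<^sub>\<subseteq> C}"

definition subdivision :: "'a family \<Rightarrow> 'a family" where
  "subdivision K = (\<lambda>C. bary ` C) ` flags K"

definition simplicial_map :: "'b family \<Rightarrow> 'a family \<Rightarrow> ('b vertex \<Rightarrow> 'a vertex) \<Rightarrow> bool" where
  "simplicial_map K L f \<longleftrightarrow> (\<forall>\<sigma>\<in>K. f ` \<sigma> \<in> L)"

text \<open>Below, \<open>\<tau>\<^sub>0\<close> is the least element of the flag.\<close>

definition dual_cell ::
  "'b family \<Rightarrow> 'a vertex set \<Rightarrow> ('b vertex \<Rightarrow> 'a vertex) \<Rightarrow> 'b family" where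
  "dual_cell K \<sigma> f =
     (\<lambda>C. bary ` C) ` {C \<in> flags K. \<exists>\<tau>\<^sub>0\<in>C. (\<forall>\<tau>\<in>C. \<tau>\<^sub>0 \<subseteq> \<tau>) \<and> \<sigma> \<subseteq> f ` \<tau>\<^sub>0}"

definition cellular :: "'b family \<Rightarrow> 'a family \<Rightarrow> ('b vertex \<Rightarrow> 'a vertex) \<Rightarrow> bool" where
  "cellular M N f \<longleftrightarrow>
     (\<exists>d. stellar_manifold d M) \<and> (\<exists>d. stellar_manifold d N) \<and> simplicial_map M N f \<and>
     (\<forall>\<sigma>\<in>N. \<exists>d. stellar_ball d (dual_cell M \<sigma> f))"

definition face_preserving ::
  "nat \<Rightarrow> (nat set \<Rightarrow> 'b family) \<Rightarrow> (nat set \<Rightarrow> 'a family) \<Rightarrow> ('b vertex \<Rightarrow> 'a vertex) \<Rightarrow> bool" where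
  "face_preserving n B A f \<longleftrightarrow>
     simplicial_map (B {0..n}) (A {0..n}) f \<and>
     (\<forall>X\<in>Delta n. (\<lambda>\<sigma>. f ` \<sigma>) ` B X = A X)"

definition C_star ::
  "nat \<Rightarrow> (nat set \<Rightarrow> 'b family) \<Rightarrow> (nat set \<Rightarrow> 'a family) \<Rightarrow> ('b vertex \<Rightarrow> 'a vertex) \<Rightarrow> bool" where
  "C_star n B A f \<longleftrightarrow>
     stellar_simplex n B \<and> stellar_simplex n A \<and> face_preserving n B A f \<and>
     (\<forall>X\<in>Delta n. cellular (B X) (A X) f)"

end

(*
  Write a stellar move as a sequence of subdivisions of edges and their inverses. Subdividing the
  edge {i, j} at a new vertex z is covered by a simplicial map, sending z to i and fixing the other
  vertices, and this map is cellular; so an equivalence of stellar simplexes is a zigzag of such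
  maps. To turn the zigzag into a single map one labels the vertices by the vertices of A and
  shows that, after sufficiently many barycentric subdivisions, the labelling can be pulled back
  along the inverse of an edge subdivision by moves that respect labels. Label-preserving moves
  change neither the images of the simplexes nor the dual cells up to stellar equivalence, and for
  the identity of A the dual cells are cones over links.

  It remains to connect any two stellar simplexes by moves that are simultaneously moves of all
  faces. For this each face, in order of decreasing dimension, is replaced by the cone over its
  boundary, which leads to the order complex of the faces of the simplex. Complexes
  contain the empty simplex here. In a ball the link of a boundary simplex has an even, that of an
  interior simplex an odd number of elements, which gives a combinatorial description of the
  boundary that is compatible with stellar moves.
*)
theory Submission
  imports Defs
begin

text \<open>The obstacle to pulling a labelling back is that a complex \<open>Z\<close> labelled by
  the vertices of \<open>X\<close> may have many edges with end labels \<open>i\<close> and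
  \<open>j\<close>, whereas \<open>X\<close>, labelled by itself, has just one. The remedy is a
  rewriting process: subdividing all edges between two fixed labels at vertices of a third label
  terminates, and its outcome is, up to label-preserving moves, unique and invariant under such
  moves of the start. For \<open>X\<close> the outcome is the edge subdivision itself. For
  \<open>Z\<close> it is represented by the barycentric subdivision, with the third label on the
  barycentre of each simplex that meets both labels. So an edge subdivision costs at most one
  barycentric subdivision; its inverse costs none, since the new label is merged with an old one. In
  the comparison of stellar simplexes a face cannot be coned in isolation, because larger cells
  contain it. The claim about a ball is therefore made for all surroundings in which the ball may
  sit, and proved by induction over the moves that build the ball; dimension enters only when a
  boundary edge is subdivided.\<close>

definition down_closed :: "'v set set \<Rightarrow> bool" where
  "down_closed K \<longleftrightarrow> (\<forall>s\<in>K. \<forall>t. t \<subseteq> s \<longrightarrow> t \<in> K)"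

text \<open>Starring as a membership test: \<open>(t - {a}) \<union> E\<close> is the old simplex in
  whose subdivision a new simplex \<open>t\<close> appears. The formula is total and looks at one
  simplex at a time, which makes it compatible with unions, intersections and inclusions.\<close>

definition st :: "'v set \<Rightarrow> 'v \<Rightarrow> 'v set set \<Rightarrow> 'v set set" where
  "st E a K = {t. \<not> E \<subseteq> t \<and> (if a \<in> t then (t - {a}) \<union> E \<in> K else t \<in> K)}"

lemma down_closedD: "down_closed K \<Longrightarrow> s \<in> K \<Longrightarrow> t \<subseteq> s \<Longrightarrow> t \<in> K"
  unfolding down_closed_def by blast

lemma in_st: "t \<in> st E a K \<longleftrightarrow> \<not> E \<subseteq> t \<and> (if a \<in> t then (t - {a}) \<union> E \<in> K else t \<in> K)"
  unfolding st_def by simp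

lemma st_down_closed:
  assumes "down_closed K" shows "down_closed (st E a K)"
  unfolding down_closed_def
proof (intro ballI allI impI)
  fix s t assume s: "s \<in> st E a K" and t: "t \<subseteq> s"
  have "(t - {a}) \<union> E \<in> K" if "a \<in> t"
    using s t that by (intro down_closedD[OF assms, of "(s - {a}) \<union> E" "(t - {a}) \<union> E"]) (auto simp: in_st)
  moreover have "t \<in> K" if "a \<notin> t"
  proof (cases "a \<in> s")
    case True
    then show ?thesis using s t that down_closedD[OF assms, of "(s - {a}) \<union> E" t] by (auto simp: in_st)
  next
    case False
    then show ?thesis using s t that down_closedD[OF assms, of s t] by (auto simp: in_st)
  qed
  ultimately show "t \<in> st E a K" using s t by (auto simp: in_st)
qed

text \<open>This lets one move act on a whole indexed family: members that lack \<open>E\<close>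
  stay as they are.\<close>

lemma st_noop:
  assumes "down_closed K" "E \<notin> K" "a \<notin> \<Union>K"
  shows "st E a K = K"
proof -
  have "t \<in> st E a K \<longleftrightarrow> t \<in> K" for t
    using assms down_closedD[OF assms(1), of "(t - {a}) \<union> E" E] down_closedD[OF assms(1), of t E]
    by (auto simp: in_st)
  then show ?thesis by blast
qed

section \<open>Identities between composed starrings\<close>

lemma st_un: "st E a (K \<union> L) = st E a K \<union> st E a L"
  by (auto simp: st_def)

lemma st_mono: "K \<subseteq> L \<Longrightarrow> st E a K \<subseteq> st E a L"
  by (auto simp: st_def)

lemma st_commute:
  assumes "E \<inter> F = {}" "a \<noteq> b" "a \<notin> E" "a \<notin> F" "b \<notin> E" "b \<notin> F"
  shows "st E a (st F b K) = st F b (st E a K)"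
proof -
  have "t \<in> st E a (st F b K) \<longleftrightarrow> t \<in> st F b (st E a K)" for t
  proof -
    have 1: "E \<subseteq> (t - {b}) \<union> F \<longleftrightarrow> E \<subseteq> t" "F \<subseteq> (t - {a}) \<union> E \<longleftrightarrow> F \<subseteq> t"
      using assms by auto
    have 2: "((t - {a}) \<union> E - {b}) \<union> F = ((t - {b}) \<union> F - {a}) \<union> E"
      using assms by auto
    have 3: "b \<in> (t - {a}) \<union> E \<longleftrightarrow> b \<in> t" "a \<in> (t - {b}) \<union> F \<longleftrightarrow> a \<in> t" using assms by auto
    show ?thesis unfolding in_st 1 3 2 by (cases "a \<in> t"; cases "b \<in> t") (simp_all add: conj_ac)
  qed
  then show ?thesis by blast
qed


lemma in_st_insert:
  "a \<notin> E \<Longrightarrow> a \<notin> t \<Longrightarrow> insert a t \<in> st E a K \<longleftrightarrow> \<not> E \<subseteq> t \<and> t \<union> E \<in> K"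
  by (auto simp: in_st)

lemma in_st_old: "a \<notin> t \<Longrightarrow> t \<in> st E a K \<longleftrightarrow> \<not> E \<subseteq> t \<and> t \<in> K"
  by (auto simp: in_st)

lemma set_eq_by_traces:
  assumes "\<And>x Y. x \<inter> D = {} \<Longrightarrow> Y \<subseteq> D \<Longrightarrow> Y \<union> x \<in> A \<longleftrightarrow> Y \<union> x \<in> B"
  shows "A = B"
proof -
  have "t \<in> A \<longleftrightarrow> t \<in> B" for t
    using assms[of "t - D" "t \<inter> D"] by (metis Diff_disjoint Int_Diff_Un Int_commute Int_lower2)
  then show ?thesis by blast
qed

text \<open>After starring \<open>E\<close> at \<open>e\<close>, the part \<open>E\<close> of
  \<open>F\<close> is represented by the single vertex \<open>e\<close>. If \<open>E\<close> is an
  edge, the remaining simplex is smaller than \<open>F\<close>, so every starring reduces to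
  edges.\<close>

lemma st_nested:
  assumes "E \<subseteq> F" "e \<noteq> f" "e \<notin> F" "f \<notin> F" "E \<noteq> F" "e \<notin> \<Union>K" "f \<notin> \<Union>K"
  shows "st E e (st F f K) = st (insert e (F - E)) f (st E e K)"
proof (rule set_eq_by_traces[where D = "{e, f}"])
  fix x Y assume x: "x \<inter> {e, f} = {}" and Y: "Y \<subseteq> {e, f}"
  have a: "e \<notin> x" "f \<notin> x" "e \<notin> E" "f \<notin> E" using x assms by auto
  have 1: "F \<subseteq> x \<union> E \<longleftrightarrow> F - E \<subseteq> x" "E \<subseteq> insert e (x \<union> (F - E)) \<longleftrightarrow> E \<subseteq> x"
    "x \<union> (F - E) \<union> E = x \<union> F" "x \<union> E \<union> F = x \<union> F" "E \<subseteq> x \<union> (F - E) \<longleftrightarrow> E \<subseteq> x"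
    "E \<subseteq> x \<Longrightarrow> \<not> F \<subseteq> x \<longleftrightarrow> \<not> (F - E \<subseteq> x)"
    using assms by auto
  consider "Y = {}" | "Y = {e}" | "Y = {f}" | "Y = {e, f}" using Y by blast
  then show "Y \<union> x \<in> st E e (st F f K) \<longleftrightarrow> Y \<union> x \<in> st (insert e (F - E)) f (st E e K)"
  proof cases
    case 1 then show ?thesis using a assms(1-5) \<open>E \<subseteq> x \<Longrightarrow> _\<close> by (auto simp: in_st_old)
  next
    case 2
    have "insert e x \<in> st E e (st F f K) \<longleftrightarrow> \<not> E \<subseteq> x \<and> \<not> F - E \<subseteq> x \<and> x \<union> E \<in> K"
      using a assms(1-5) 1 by (simp add: in_st_old in_st_insert)
    moreover have "insert e x \<in> st (insert e (F - E)) f (st E e K) \<longleftrightarrow> \<not> E \<subseteq> x \<and> \<not> F - E \<subseteq> x \<and> x \<union> E \<in> K"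
      using a assms(1-5) by (auto simp: in_st_old in_st_insert)
    ultimately show ?thesis using 2 by simp
  next
    case 3
    have "insert f x \<in> st E e (st F f K) \<longleftrightarrow> \<not> E \<subseteq> x \<and> \<not> F \<subseteq> x \<and> x \<union> F \<in> K"
      using a assms(1-5) by (auto simp: in_st_old in_st_insert)
    moreover have "insert f x \<in> st (insert e (F - E)) f (st E e K) \<longleftrightarrow> \<not> E \<subseteq> x \<and> x \<union> F \<in> K"
      using a assms(1-5) 1 by (simp add: in_st_insert[of f] in_st_insert[of e] subset_insert)
    ultimately show ?thesis using 3 assms(1) by auto
  next
    case 4
    have "insert e (insert f x) \<in> st E e (st F f K) \<longleftrightarrow> \<not> E \<subseteq> x \<and> \<not> F - E \<subseteq> x \<and> x \<union> F \<in> K"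
      using a assms(1-5) 1 by (simp add: in_st_insert[of e] in_st_insert[of f] subset_insert)
    moreover have "insert f (insert e x) \<in> st (insert e (F - E)) f (st E e K) \<longleftrightarrow> \<not> E \<subseteq> x \<and> \<not> F - E \<subseteq> x \<and> x \<union> F \<in> K"
      using a assms(1-5) 1 by (simp add: in_st_insert[of f] in_st_insert[of e] subset_insert) blast
    ultimately show ?thesis using 4 by (simp add: insert_commute)
  qed
qed

text \<open>Encodes the presence of a vertex as a truth value, so that an identity between composed
  starrings becomes a finite case check.\<close>

definition pick :: "'v \<Rightarrow> bool \<Rightarrow> 'v set" where
  "pick v b = (if b then {v} else {})"

lemma in_pick [simp]: "u \<in> pick v b \<longleftrightarrow> u = v \<and> b"
  by (simp add: pick_def)

text \<open>In the triangle \<open>p\<close>, \<open>r\<close>, \<open>s\<close> the two orders of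
  subdividing the edges at \<open>p\<close> leave different diagonals in the quadrilateral
  \<open>e\<close>, \<open>y\<close>, \<open>s\<close>, \<open>r\<close>, namely
  \<open>{e, s}\<close> and \<open>{y, r}\<close>. Starring the diagonal at \<open>g\<close> removes
  the difference. This repairs the failure of two edges with a common end to commute.\<close>

lemma st_flip:
  assumes d: "distinct [p, r, s, e, y, g]"
  shows "st {e, s} g (st {p, s} y (st {p, r} e K)) = st {y, r} g (st {p, r} e (st {p, s} y K))"
proof -
  have n: "p \<noteq> r" "p \<noteq> s" "p \<noteq> e" "p \<noteq> y" "p \<noteq> g" "r \<noteq> s" "r \<noteq> e" "r \<noteq> y" "r \<noteq> g" "s \<noteq> e" "s \<noteq> y" "s \<noteq> g"
    "e \<noteq> y" "e \<noteq> g" "y \<noteq> g" using d by auto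
  note n' = n n[symmetric]
  have "t \<in> st {e, s} g (st {p, s} y (st {p, r} e K)) \<longleftrightarrow> t \<in> st {y, r} g (st {p, r} e (st {p, s} y K))" for t
  proof -
    define x where "x = t - {p, r, s, e, y, g}"
    have x: "p \<notin> x" "r \<notin> x" "s \<notin> x" "e \<notin> x" "y \<notin> x" "g \<notin> x" by (auto simp: x_def)
    define m where "m = (\<lambda>P R S E Y G. pick p P \<union> pick r R \<union> pick s S \<union> pick e E \<union> pick y Y \<union> pick g G \<union> x)"
    have t: "t = m (p \<in> t) (r \<in> t) (s \<in> t) (e \<in> t) (y \<in> t) (g \<in> t)"
      by (auto simp: m_def x_def)
    have mem: "p \<in> m P R S E Y G \<longleftrightarrow> P" "r \<in> m P R S E Y G \<longleftrightarrow> R" "s \<in> m P R S E Y G \<longleftrightarrow> S"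
      "e \<in> m P R S E Y G \<longleftrightarrow> E" "y \<in> m P R S E Y G \<longleftrightarrow> Y" "g \<in> m P R S E Y G \<longleftrightarrow> G" for P R S E Y G
      by (simp_all add: m_def n' x)
    have upd: "(m P R S E Y G - {e}) \<union> {p, r} = m True True S False Y G"
      "(m P R S E Y G - {y}) \<union> {p, s} = m True R True E False G"
      "(m P R S E Y G - {g}) \<union> {e, s} = m P R True True Y False"
      "(m P R S E Y G - {g}) \<union> {y, r} = m P True S E True False" for P R S E Y G
      using x n' by (auto simp: m_def)
    have "m P R S E Y G \<in> st {e, s} g (st {p, s} y (st {p, r} e K)) \<longleftrightarrow>
        m P R S E Y G \<in> st {y, r} g (st {p, r} e (st {p, s} y K))" for P R S E Y G
      by (cases P; cases R; cases S; cases E; cases Y; cases G) (simp_all only: in_st mem upd insert_subset empty_subsetI simp_thms if_True if_False n')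
    then show ?thesis by (subst (1 2) t)
  qed
  then show ?thesis by blast
qed

text \<open>Both sides cut the edge into the path \<open>i\<close>, \<open>z\<close>,
  \<open>e\<close>, \<open>j\<close>.\<close>

lemma st_edge_twice:
  assumes d: "distinct [i, j, e, z]"
  shows "st {i, e} z (st {i, j} e K) = st {z, j} e (st {i, j} z K)"
proof -
  have n: "i \<noteq> j" "i \<noteq> e" "i \<noteq> z" "j \<noteq> e" "j \<noteq> z" "e \<noteq> z" using d by auto
  note n' = n n[symmetric]
  have "t \<in> st {i, e} z (st {i, j} e K) \<longleftrightarrow> t \<in> st {z, j} e (st {i, j} z K)" for t
  proof -
    define x where "x = t - {i, j, e, z}"
    have x: "i \<notin> x" "j \<notin> x" "e \<notin> x" "z \<notin> x" by (auto simp: x_def)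
    define m where "m = (\<lambda>I J E Z. pick i I \<union> pick j J \<union> pick e E \<union> pick z Z \<union> x)"
    have t: "t = m (i \<in> t) (j \<in> t) (e \<in> t) (z \<in> t)"
      by (auto simp: m_def x_def)
    have mem: "i \<in> m I J E Z \<longleftrightarrow> I" "j \<in> m I J E Z \<longleftrightarrow> J" "e \<in> m I J E Z \<longleftrightarrow> E" "z \<in> m I J E Z \<longleftrightarrow> Z" for I J E Z
      by (simp_all add: m_def n' x)
    have upd: "(m I J E Z - {e}) \<union> {i, j} = m True True False Z" "(m I J E Z - {z}) \<union> {i, j} = m True True E False"
      "(m I J E Z - {z}) \<union> {i, e} = m True J True False" "(m I J E Z - {e}) \<union> {z, j} = m I True False True" for I J E Z
      using x n' by (auto simp: m_def)
    have "m I J E Z \<in> st {i, e} z (st {i, j} e K) \<longleftrightarrow> m I J E Z \<in> st {z, j} e (st {i, j} z K)" for I J E Z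
      by (cases I; cases J; cases E; cases Z) (simp_all only: in_st mem upd insert_subset empty_subsetI simp_thms if_True if_False n')
    then show ?thesis by (subst (1 2) t)
  qed
  then show ?thesis by blast
qed

section \<open>Labelled moves acting on all members of a family at once\<close>

definition simps :: "('i \<Rightarrow> 'v set set) \<Rightarrow> 'v set set" where
  "simps Z = (\<Union>X. Z X)"

definition verts :: "('i \<Rightarrow> 'v set set) \<Rightarrow> 'v set" where
  "verts Z = \<Union>(simps Z)"

definition fam :: "('i \<Rightarrow> 'v set set) \<Rightarrow> bool" where
  "fam Z \<longleftrightarrow> finite (simps Z) \<and> (\<forall>s\<in>simps Z. finite s) \<and> (\<forall>X. down_closed (Z X))"

definition sts :: "'v set \<Rightarrow> 'v \<Rightarrow> ('i \<Rightarrow> 'v set set) \<Rightarrow> 'i \<Rightarrow> 'v set set" where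
  "sts E a Z = (\<lambda>X. st E a (Z X))"

definition mapf :: "('v \<Rightarrow> 'w) \<Rightarrow> ('i \<Rightarrow> 'v set set) \<Rightarrow> 'i \<Rightarrow> 'w set set" where
  "mapf f Z = (\<lambda>X. (`) f ` Z X)"

text \<open>Labels are a fixed function of the vertex, so a new vertex of prescribed label must be
  found among infinitely many candidates.\<close>

definition rich :: "('v \<Rightarrow> 'l) \<Rightarrow> bool" where
  "rich lab \<longleftrightarrow> (\<forall>c. infinite {v. lab v = c})"

text \<open>The new vertex inherits the label of \<open>i\<close>, so sending it to \<open>i\<close>
  respects labels. The case \<open>i = j\<close> is allowed on purpose: starring a vertex renames
  it, and isomorphisms need no separate kind of move.\<close>

inductive lstep :: "('v \<Rightarrow> 'l) \<Rightarrow> ('i \<Rightarrow> 'v set set) \<Rightarrow> ('i \<Rightarrow> 'v set set) \<Rightarrow> bool" for lab where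
  "fam Z \<Longrightarrow> {i, j} \<in> simps Z \<Longrightarrow> z \<notin> verts Z \<Longrightarrow> lab z = lab i \<Longrightarrow> lstep lab Z (sts {i, j} z Z)"

definition lseq :: "('v \<Rightarrow> 'l) \<Rightarrow> ('i \<Rightarrow> 'v set set) \<Rightarrow> ('i \<Rightarrow> 'v set set) \<Rightarrow> bool" where
  "lseq lab = equivclp (lstep lab)"

lemma lseq_refl [simp]: "lseq lab Z Z"
  by (simp add: lseq_def)

lemma lseq_sym: "lseq lab Z Z' \<Longrightarrow> lseq lab Z' Z"
  unfolding lseq_def by (rule equivclp_sym)

lemma lseq_trans [trans]: "lseq lab Z Z' \<Longrightarrow> lseq lab Z' Z'' \<Longrightarrow> lseq lab Z Z''"
  unfolding lseq_def by (rule equivclp_trans)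

lemma lstep_lseq: "lstep lab Z Z' \<Longrightarrow> lseq lab Z Z'"
  unfolding lseq_def by blast

lemma lseq_induct [consumes 1, case_names base star weld]:
  assumes "lseq lab Z Z'" "P Z"
    and "\<And>Y i j a. fam Y \<Longrightarrow> {i, j} \<in> simps Y \<Longrightarrow> a \<notin> verts Y \<Longrightarrow> lab a = lab i \<Longrightarrow> P Y \<Longrightarrow> P (sts {i, j} a Y)"
    and "\<And>Y i j a. fam Y \<Longrightarrow> {i, j} \<in> simps Y \<Longrightarrow> a \<notin> verts Y \<Longrightarrow> lab a = lab i \<Longrightarrow> P (sts {i, j} a Y) \<Longrightarrow> P Y"
  shows "P Z'"
  using assms(1) unfolding lseq_def
proof (induction rule: equivclp_induct)
  case (step Y Z')
  then show ?case using assms(3,4) by (auto elim!: lstep.cases)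
qed (fact assms(2))

lemma rich_fresh: "rich lab \<Longrightarrow> finite A \<Longrightarrow> \<exists>v. v \<notin> A \<and> lab v = c"
  unfolding rich_def by (metis (mono_tags, lifting) finite_subset mem_Collect_eq subsetI)

lemma fam_finite_verts: "fam Z \<Longrightarrow> finite (verts Z)"
  by (auto simp: fam_def verts_def)

lemma fam_down_closed: "fam Z \<Longrightarrow> down_closed (Z X)"
  by (simp add: fam_def)

lemma simps_down_closed: "fam Z \<Longrightarrow> down_closed (simps Z)"
  unfolding fam_def down_closed_def simps_def by blast

lemma fam_fresh: "rich lab \<Longrightarrow> fam Z \<Longrightarrow> finite A \<Longrightarrow> \<exists>v. v \<notin> verts Z \<and> v \<notin> A \<and> lab v = c"
  using rich_fresh[of lab "verts Z \<union> A" c] fam_finite_verts by blast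

lemma in_simps: "Z X \<subseteq> simps Z"
  by (auto simp: simps_def)

lemma simps_sts: "simps (sts E a Z) = st E a (simps Z)"
  by (auto simp: simps_def sts_def st_def split: if_splits)

lemma verts_sts_subset: "verts (sts E a Z) \<subseteq> insert a (verts Z)"
  by (auto simp: verts_def simps_sts in_st split: if_splits)

lemma fam_sts:
  assumes "fam Z" shows "fam (sts E a Z)"
proof -
  have "t \<in> simps Z \<union> insert a ` simps Z" if t: "t \<in> simps (sts E a Z)" for t
  proof (cases "a \<in> t")
    case True
    then have "t - {a} \<in> simps Z"
      using t down_closedD[OF simps_down_closed[OF assms], of "t - {a} \<union> E" "t - {a}"] by (auto simp: simps_sts in_st)
    then have "insert a (t - {a}) \<in> insert a ` simps Z" by blast
    then show ?thesis using True by (simp add: insert_absorb)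
  qed (use t in \<open>auto simp: simps_sts in_st\<close>)
  then have s: "simps (sts E a Z) \<subseteq> simps Z \<union> insert a ` simps Z" by blast
  have "finite (simps (sts E a Z))" using s assms by (auto simp: fam_def intro: finite_subset)
  moreover have "\<forall>s\<in>simps (sts E a Z). finite s" using s assms by (auto simp: fam_def)
  ultimately show ?thesis using assms by (auto simp: fam_def sts_def st_down_closed)
qed

lemma lstep_fam: "lstep lab Z Z' \<Longrightarrow> fam Z \<and> fam Z'"
  by (auto elim!: lstep.cases intro: fam_sts)

lemma lseq_fam: "lseq lab Z Z' \<Longrightarrow> fam Z \<Longrightarrow> fam Z'"
  unfolding lseq_def by (induction rule: equivclp_induct) (auto dest: lstep_fam)

lemma sts_noop:
  assumes "fam Z" "E \<notin> simps Z" "a \<notin> verts Z" shows "sts E a Z = Z"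
proof
  fix X show "sts E a Z X = Z X"
    unfolding sts_def using assms in_simps[of Z X]
    by (intro st_noop) (auto simp: fam_def verts_def)
qed

lemma lseq_edge:
  assumes "fam Z" "z \<notin> verts Z" "lab z = lab i" shows "lseq lab Z (sts {i, j} z Z)"
  using assms sts_noop[of Z "{i, j}" z] lstep_lseq lstep.intros[of Z i j z lab] by (metis lseq_refl)

lemma sts_nested:
  assumes "E \<subseteq> F" "e \<noteq> f" "e \<notin> F" "f \<notin> F" "E \<noteq> F" "e \<notin> verts Z" "f \<notin> verts Z"
  shows "sts E e (sts F f Z) = sts (insert e (F - E)) f (sts E e Z)"
  unfolding sts_def using assms by (intro ext st_nested) (auto simp: verts_def simps_def)

text \<open>Induction on the size of \<open>F\<close>. An edge \<open>{i, j}\<close> of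
  \<open>F\<close> is starred at an auxiliary vertex \<open>e\<close> labelled like
  \<open>i\<close>; starring \<open>F\<close> then becomes starring a smaller set that contains
  \<open>e\<close>, so the label condition persists. Finally the auxiliary starring is
  undone.\<close>

lemma lseq_star:
  assumes "rich lab" "fam Z" "f \<notin> verts Z" "i \<in> F" "lab f = lab i"
  shows "lseq lab Z (sts F f Z)"
proof (cases "F \<in> simps Z")
  case True
  then have "finite F" using assms by (auto simp: fam_def)
  then show ?thesis using True assms(2-5)
  proof (induction "card F" arbitrary: F Z i rule: less_induct)
    case less
    have fF: "f \<notin> F" using less.prems by (auto simp: verts_def)
    show ?case
    proof (cases "\<exists>j. F = {i, j}")
      case True then show ?thesis using less.prems by (auto intro: lseq_edge)
    next
      case False
      have "F - {i} \<noteq> {}" using False less.prems by (metis Diff_eq_empty_iff empty_iff insert_absorb2 subset_singletonD)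
      then obtain j where j: "j \<in> F" "j \<noteq> i" by blast
      define E where "E = {i, j}"
      have E: "E \<subseteq> F" "E \<noteq> F" using j less.prems False by (auto simp: E_def)
      obtain e where e: "e \<notin> verts Z" "e \<noteq> f" "lab e = lab i"
        using fam_fresh[OF assms(1) less.prems(3), of "{f}" "lab i"] by auto
      have eF: "e \<notin> F" using e less.prems by (auto simp: verts_def)
      define Z1 where "Z1 = sts E e Z"
      define F1 where "F1 = insert e (F - E)"
      have eq: "sts E e (sts F f Z) = sts F1 f Z1"
        unfolding Z1_def F1_def using E e eF fF less.prems by (intro sts_nested) auto
      have cF: "card F1 < card F"
      proof -
        have "card (F - E) + 2 = card F" using E j less.prems(1) card_mono[OF less.prems(1), of E] by (simp add: E_def card_Diff_subset)
        then show ?thesis using less.prems(1) by (auto simp: F1_def card_insert_if)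
      qed
      have f1: "fam Z1" using less.prems by (simp add: Z1_def fam_sts)
      have f2: "f \<notin> verts Z1" using e less.prems verts_sts_subset[of E e Z] by (auto simp: Z1_def)
      have s: "lseq lab Z1 (sts F1 f Z1)"
      proof (cases "F1 \<in> simps Z1")
        case True
        show ?thesis using less.hyps[OF cF _ True f1 f2, of e] e less.prems by (auto simp: F1_def)
      qed (use f1 f2 in \<open>simp add: sts_noop\<close>)
      have "lseq lab Z Z1" unfolding Z1_def E_def using less.prems e by (intro lseq_edge) auto
      also note s
      also have "lseq lab (sts F1 f Z1) (sts F f Z)"
        unfolding eq[symmetric] E_def using less.prems e verts_sts_subset[of F f Z]
        by (intro lseq_sym[OF lseq_edge]) (auto simp: fam_sts)
      finally show ?thesis .
    qed
  qed
qed (use assms in \<open>simp add: sts_noop\<close>)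

subsection \<open>Renaming\<close>

lemma mapf_mapf: "mapf f (mapf g Z) = mapf (f \<circ> g) Z"
  by (simp add: mapf_def image_image image_comp comp_def)

lemma mapf_cong: "(\<And>v. v \<in> verts Z \<Longrightarrow> f v = g v) \<Longrightarrow> mapf f Z = mapf g Z"
  unfolding mapf_def verts_def simps_def by (intro ext image_cong refl) auto

lemma mapf_id [simp]: "mapf id Z = Z" "mapf (\<lambda>v. v) Z = Z"
  by (simp_all add: mapf_def)

lemma simps_mapf: "simps (mapf f Z) = (`) f ` simps Z"
  by (auto simp: mapf_def simps_def)

lemma verts_mapf: "verts (mapf f Z) = f ` verts Z"
  by (auto simp: verts_def simps_mapf)

lemma down_closed_image:
  assumes "down_closed K" shows "down_closed ((`) f ` K)"
  unfolding down_closed_def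
proof (intro ballI allI impI)
  fix s t assume "s \<in> (`) f ` K" "t \<subseteq> s"
  then obtain u where "u \<in> K" "t \<subseteq> f ` u" by auto
  then obtain w where "w \<subseteq> u" "t = f ` w" by (auto simp: subset_image_iff)
  then show "t \<in> (`) f ` K" using down_closedD[OF assms \<open>u \<in> K\<close>] by blast
qed

lemma fam_mapf: "fam Z \<Longrightarrow> fam (mapf f Z)"
  by (auto simp: fam_def simps_mapf) (simp add: mapf_def down_closed_image)

text \<open>Redirecting \<open>f\<close> at the new vertex alone keeps it injective on the enlarged
  vertex set. Thus a move can be carried out with any other choice of new vertex.\<close>

lemma st_image:
  assumes inj: "inj_on f V" and V: "\<Union>K \<subseteq> V" "E \<subseteq> V" and a: "a \<notin> V" and b: "b \<notin> f ` V"
  shows "(`) (f(a := b)) ` st E a K = st (f ` E) b ((`) f ` K)"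
proof -
  let ?g = "f(a := b)"
  have injg: "inj_on ?g (insert a V)"
    using inj a b by (auto simp: inj_on_def)
  have gE: "?g ` E = f ` E" using V a by (intro image_cong) auto
  have gt: "?g ` t = f ` t" if "t \<subseteq> V" for t using that a by (intro image_cong) auto
  have sub: "t \<subseteq> insert a V" if "t \<in> st E a K" for t
    using that V by (auto simp: in_st split: if_splits)
  have mem: "f ` t \<in> (`) f ` K \<longleftrightarrow> t \<in> K" if "t \<subseteq> V" for t
  proof
    assume "f ` t \<in> (`) f ` K"
    then obtain u where u: "u \<in> K" "f ` t = f ` u" by blast
    have "u \<subseteq> V" using u V by blast
    then have "t = u" using inj_on_image_eq_iff[OF inj that] u by blast
    then show "t \<in> K" using u by simp
  qed blast
  have key: "?g ` t \<in> st (f ` E) b ((`) f ` K) \<longleftrightarrow> t \<in> st E a K" if t: "t \<subseteq> insert a V" for t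
  proof -
    have 1: "f ` E \<subseteq> ?g ` t \<longleftrightarrow> E \<subseteq> t"
    proof
      assume l: "f ` E \<subseteq> ?g ` t"
      show "E \<subseteq> t"
      proof
        fix x assume x: "x \<in> E"
        then have "?g x \<in> ?g ` t" using l gE by blast
        then show "x \<in> t" using inj_on_image_mem_iff[OF injg _ t, of x] x V by auto
      qed
    qed (use gE in blast)
    have 2: "b \<in> ?g ` t \<longleftrightarrow> a \<in> t" using b t by (auto split: if_splits)
    have 3: "?g ` t - {b} \<union> f ` E = f ` (t - {a} \<union> E)"
      using b t by (auto split: if_splits)
    have 4: "f ` (t - {a} \<union> E) \<in> (`) f ` K \<longleftrightarrow> t - {a} \<union> E \<in> K"
      using t V by (intro mem) auto
    have 5: "a \<notin> t \<Longrightarrow> ?g ` t \<in> (`) f ` K \<longleftrightarrow> t \<in> K"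
      using t gt[of t] mem[of t] by (simp add: subset_insert)
    show ?thesis unfolding in_st 1 2 3 4 using 5 by (cases "a \<in> t") simp_all
  qed
  show ?thesis
  proof (intro equalityI subsetI)
    fix s assume "s \<in> (`) ?g ` st E a K" then show "s \<in> st (f ` E) b ((`) f ` K)" using key sub by blast
  next
    fix s assume s: "s \<in> st (f ` E) b ((`) f ` K)"
    have "s \<subseteq> insert b (f ` V)" using s V by (auto simp: in_st split: if_splits) blast+
    also have "\<dots> = ?g ` insert a V" using a by auto
    finally obtain t where "t \<subseteq> insert a V" "s = ?g ` t" by (rule subset_imageE)
    then show "s \<in> (`) ?g ` st E a K" using key s by blast
  qed
qed

lemma mapf_sts:
  assumes "inj_on f V" "verts Z \<subseteq> V" "E \<subseteq> V" "a \<notin> V" "b \<notin> f ` V"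
  shows "mapf (f(a := b)) (sts E a Z) = sts (f ` E) b (mapf f Z)"
  unfolding mapf_def sts_def using assms
  by (intro ext st_image) (auto simp: verts_def simps_def)

text \<open>A vertex has only the empty proper face, so its star simply reappears with
  \<open>b\<close> in its place.\<close>

lemma sts_vertex:
  assumes "w \<in> verts Z" "b \<notin> verts Z"
  shows "sts {w} b Z = mapf (id(w := b)) Z"
proof
  fix X
  have K: "b \<notin> t" if "t \<in> Z X" for t using assms that by (auto simp: verts_def simps_def)
  show "sts {w} b Z X = mapf (id(w := b)) Z X"
    unfolding sts_def mapf_def
  proof (intro equalityI subsetI)
    fix t assume t: "t \<in> st {w} b (Z X)"
    show "t \<in> (`) (id(w := b)) ` Z X"
    proof (cases "b \<in> t")
      case True
      have "t = (id(w := b)) ` (t - {b} \<union> {w})" using t True by (auto simp: in_st)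
      moreover have "t - {b} \<union> {w} \<in> Z X" using t True by (simp add: in_st)
      ultimately show ?thesis by (rule image_eqI)
    next
      case False
      then have "t = (id(w := b)) ` t" using t by (auto simp: in_st)
      moreover have "t \<in> Z X" using t False by (simp add: in_st)
      ultimately show ?thesis by (rule image_eqI)
    qed
  next
    fix t assume "t \<in> (`) (id(w := b)) ` Z X"
    then obtain s where s: "s \<in> Z X" "t = (id(w := b)) ` s" by blast
    have wb: "w \<noteq> b" using assms by blast
    show "t \<in> st {w} b (Z X)"
    proof (cases "w \<in> s")
      case True
      then have "t = insert b (s - {w})" using s by auto
      then show ?thesis using s True K[OF s(1)] wb by (auto simp: in_st insert_absorb)
    next
      case False
      then have "t = s" using s by auto
      then show ?thesis using s False K[OF s(1)] by (auto simp: in_st)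
    qed
  qed
qed

text \<open>Vertices are renamed one after the other by starring them; disjointness keeps every
  target fresh until its turn.\<close>

lemma lseq_rename_disjoint:
  assumes "fam Z" "inj_on f (verts Z)" "f ` verts Z \<inter> verts Z = {}" "\<And>v. v \<in> verts Z \<Longrightarrow> lab (f v) = lab v"
  shows "lseq lab Z (mapf f Z)"
proof -
  have "lseq lab Z (mapf (\<lambda>v. if v \<in> W then f v else v) Z)" if "finite W" "W \<subseteq> verts Z" for W
    using that
  proof (induction W)
    case empty then show ?case by simp
  next
    case (insert w W)
    let ?g = "\<lambda>W v. if v \<in> W then f v else v"
    let ?Y = "mapf (?g W) Z"
    have w: "w \<in> verts ?Y" unfolding verts_mapf using insert.prems insert.hyps by force
    have fw: "f w \<notin> verts ?Y"
      unfolding verts_mapf using insert assms(2,3) by (auto simp: inj_on_def split: if_splits)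
    have "lseq lab ?Y (sts {w, w} (f w) ?Y)"
      using fw assms insert.prems by (intro lseq_edge fam_mapf) auto
    also have "sts {w, w} (f w) ?Y = mapf (id(w := f w)) ?Y" using sts_vertex[OF w fw] by simp
    also have "\<dots> = mapf (?g (insert w W)) Z"
      unfolding mapf_mapf using insert assms(3) by (intro mapf_cong) auto
    finally show ?case using insert lseq_trans by blast
  qed
  from this[OF fam_finite_verts[OF assms(1)] order_refl]
  have "lseq lab Z (mapf (\<lambda>v. if v \<in> verts Z then f v else v) Z)" .
  also have "mapf (\<lambda>v. if v \<in> verts Z then f v else v) Z = mapf f Z" by (rule mapf_cong) simp
  finally show ?thesis .
qed

lemma ex_labelled_injection:
  assumes "rich lab" "finite V" "finite A"
  shows "\<exists>f. inj_on f V \<and> f ` V \<inter> A = {} \<and> (\<forall>v\<in>V. lab (f v) = g v)"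
  using assms(2)
proof (induction V)
  case empty then show ?case by simp
next
  case (insert x V)
  then obtain f where f: "inj_on f V" "f ` V \<inter> A = {}" "\<forall>v\<in>V. lab (f v) = g v" by blast
  obtain b where "b \<notin> f ` V \<union> A" "lab b = g x"
    using rich_fresh[OF assms(1), of "f ` V \<union> A" "g x"] insert.hyps(1) assms(3) by blast
  then have "inj_on (f(x := b)) (insert x V) \<and> (f(x := b)) ` insert x V \<inter> A = {} \<and> (\<forall>v\<in>insert x V. lab ((f(x := b)) v) = g v)"
    using f insert.hyps by (auto simp: inj_on_def)
  then show ?case by blast
qed

text \<open>A permutation of the vertices offers no fresh targets, hence the detour through a third
  vertex set that avoids the old and the new names.\<close>

lemma lseq_rename:
  assumes "rich lab" "fam Z" "inj_on f (verts Z)" "\<And>v. v \<in> verts Z \<Longrightarrow> lab (f v) = lab v"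
  shows "lseq lab Z (mapf f Z)"
proof -
  let ?V = "verts Z"
  obtain g where g: "inj_on g ?V" "g ` ?V \<inter> (?V \<union> f ` ?V) = {}" "\<forall>v\<in>?V. lab (g v) = lab v"
    using ex_labelled_injection[OF assms(1), of ?V "?V \<union> f ` ?V" lab] fam_finite_verts[OF assms(2)] by blast
  define h where "h = f \<circ> inv_into ?V g"
  have hg: "h (g v) = f v" if "v \<in> ?V" for v using that g by (simp add: h_def)
  have "lseq lab Z (mapf g Z)" using g assms by (intro lseq_rename_disjoint) auto
  also have "lseq lab (mapf g Z) (mapf h (mapf g Z))"
  proof (rule lseq_rename_disjoint)
    show "inj_on h (verts (mapf g Z))"
      unfolding verts_mapf using hg assms(3) by (auto simp: inj_on_def)
    show "h ` verts (mapf g Z) \<inter> verts (mapf g Z) = {}"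
      unfolding verts_mapf image_image using hg g(2) by auto
    show "\<And>v. v \<in> verts (mapf g Z) \<Longrightarrow> lab (h v) = lab v"
      unfolding verts_mapf using hg g(3) assms(4) by auto
  qed (simp add: fam_mapf assms)
  also have "mapf h (mapf g Z) = mapf f Z" unfolding mapf_mapf using hg by (intro mapf_cong) simp
  finally show ?thesis .
qed

lemma lseq_rename2:
  assumes "rich lab" "fam Z" "inj_on f (verts Z)" "inj_on f' (verts Z)" "\<And>v. v \<in> verts Z \<Longrightarrow> lab (f v) = lab (f' v)"
  shows "lseq lab (mapf f Z) (mapf f' Z)"
proof -
  define h where "h = f' \<circ> inv_into (verts Z) f"
  have hf: "h (f v) = f' v" if "v \<in> verts Z" for v using that assms by (simp add: h_def)
  have "lseq lab (mapf f Z) (mapf h (mapf f Z))"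
  proof (rule lseq_rename[OF assms(1)])
    show "inj_on h (verts (mapf f Z))"
      unfolding verts_mapf using hf assms(4) by (auto simp: inj_on_def)
    show "\<And>v. v \<in> verts (mapf f Z) \<Longrightarrow> lab (h v) = lab v"
      unfolding verts_mapf using hf assms(5) by auto
  qed (simp add: fam_mapf assms)
  also have "mapf h (mapf f Z) = mapf f' Z" unfolding mapf_mapf using hf by (intro mapf_cong) simp
  finally show ?thesis .
qed

text \<open>The vertex map must be injective, but the map \<open>g\<close> of labels may identify
  labels. The induction speaks of all admissible maps at once, because a fixed one could collide
  with the image chosen for the new vertex of a move.\<close>

lemma lseq_map:
  fixes Z Z' :: "'i \<Rightarrow> 'v set set"
  assumes "lseq lab Z Z'" "rich lab'" "fam Z"
    and f: "inj_on f (verts Z)" "\<And>v. v \<in> verts Z \<Longrightarrow> lab' (f v) = g (lab v)"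
    and f': "inj_on f' (verts Z')" "\<And>v. v \<in> verts Z' \<Longrightarrow> lab' (f' v) = g (lab v)"
  shows "lseq lab' (mapf f Z) (mapf f' Z')"
proof -
  define ok where "ok = (\<lambda>h (Y :: 'i \<Rightarrow> 'v set set). inj_on h (verts Y) \<and> (\<forall>v\<in>verts Y. lab' (h v) = g (lab v)))"
  have same: "lseq lab' (mapf h Y) (mapf h' Y)" if "fam Y" "ok h Y" "ok h' Y" for h h' Y
    using that assms(2) by (intro lseq_rename2) (auto simp: ok_def)
  have push: "\<exists>b. ok (h(a := b)) (sts {i, j} a Y) \<and> lseq lab' (mapf h Y) (mapf (h(a := b)) (sts {i, j} a Y))"
    if Y: "fam Y" "{i, j} \<in> simps Y" "a \<notin> verts Y" "lab a = lab i" and h: "ok h Y" for h i j a Y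
  proof -
    obtain b where b: "b \<notin> h ` verts Y" "lab' b = g (lab a)"
      using rich_fresh[OF assms(2), of "h ` verts Y"] fam_finite_verts[OF Y(1)] by auto
    have ij: "i \<in> verts Y" "j \<in> verts Y" using Y by (auto simp: verts_def)
    have "lseq lab' (mapf h Y) (sts {h i, h j} b (mapf h Y))"
      using b Y h ij by (intro lseq_edge fam_mapf) (auto simp: verts_mapf ok_def)
    also have "sts {h i, h j} b (mapf h Y) = mapf (h(a := b)) (sts {i, j} a Y)"
      using mapf_sts[of h "verts Y" Y "{i, j}" a b] h Y b ij by (simp add: ok_def)
    finally have "lseq lab' (mapf h Y) (mapf (h(a := b)) (sts {i, j} a Y))" .
    moreover have "ok (h(a := b)) (sts {i, j} a Y)"
      unfolding ok_def
    proof
      have "inj_on (h(a := b)) (insert a (verts Y))" using h b Y by (auto simp: ok_def inj_on_def)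
      then show "inj_on (h(a := b)) (verts (sts {i, j} a Y))" by (rule inj_on_subset) (rule verts_sts_subset)
      show "\<forall>v\<in>verts (sts {i, j} a Y). lab' ((h(a := b)) v) = g (lab v)"
        using h b verts_sts_subset[of "{i, j}" a Y] by (auto simp: ok_def)
    qed
    ultimately show ?thesis by blast
  qed
  have "fam Z' \<and> (\<forall>f'. ok f' Z' \<longrightarrow> lseq lab' (mapf f Z) (mapf f' Z'))"
    using assms(1)
  proof (induction rule: lseq_induct)
    case base
    then show ?case using same[OF assms(3)] f assms(3) by (simp add: ok_def)
  next
    case (star Y i j a)
    obtain h where h: "ok h Y"
      using ex_labelled_injection[OF assms(2), of "verts Y" "{}" "\<lambda>v. g (lab v)"] fam_finite_verts[OF star(1)]
      by (auto simp: ok_def)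
    obtain b where b: "ok (h(a := b)) (sts {i, j} a Y)" "lseq lab' (mapf h Y) (mapf (h(a := b)) (sts {i, j} a Y))"
      using push[OF star(1-4) h] by blast
    have F: "fam (sts {i, j} a Y)" by (rule fam_sts[OF star(1)])
    have "lseq lab' (mapf f Z) (mapf h Y)" using star.IH h by blast
    then have "lseq lab' (mapf f Z) (mapf (h(a := b)) (sts {i, j} a Y))" using b(2) by (rule lseq_trans)
    then have "lseq lab' (mapf f Z) (mapf f' (sts {i, j} a Y))" if "ok f' (sts {i, j} a Y)" for f'
      using same[OF F b(1) that] by (rule lseq_trans)
    then show ?case using F by blast
  next
    case (weld Y i j a)
    have "lseq lab' (mapf f Z) (mapf f' Y)" if f': "ok f' Y" for f'
    proof -
      obtain b where b: "ok (f'(a := b)) (sts {i, j} a Y)" "lseq lab' (mapf f' Y) (mapf (f'(a := b)) (sts {i, j} a Y))"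
        using push[OF weld(1-4) f'] by blast
      then have "lseq lab' (mapf f Z) (mapf (f'(a := b)) (sts {i, j} a Y))" using weld.IH by blast
      then show ?thesis using lseq_sym[OF b(2)] by (rule lseq_trans)
    qed
    then show ?case using weld(1) by blast
  qed
  then show ?thesis using f' by (auto simp: ok_def)
qed

section \<open>Completion: subdividing all edges between two given labels\<close>

lemma sts_commute:
  assumes "E \<inter> F = {}" "a \<noteq> b" "a \<notin> E" "a \<notin> F" "b \<notin> E" "b \<notin> F"
  shows "sts E a (sts F b Z) = sts F b (sts E a Z)"
  unfolding sts_def using assms by (intro ext st_commute)

lemma sts_flip:
  assumes "distinct [p, r, s, e, y, g]"
  shows "sts {e, s} g (sts {p, s} y (sts {p, r} e Z)) = sts {y, r} g (sts {p, r} e (sts {p, s} y Z))"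
  unfolding sts_def using assms by (intro ext st_flip)

lemma sts_edge_twice:
  assumes "distinct [i, j, e, z]"
  shows "sts {i, e} z (sts {i, j} e Z) = sts {z, j} e (sts {i, j} z Z)"
  unfolding sts_def using assms by (intro ext st_edge_twice)

lemma st_renamed:
  assumes "e \<notin> \<Union>K" "e' \<notin> \<Union>K" "e \<notin> E" "e' \<notin> E" "e \<noteq> e'"
  shows "st {e} e' (st E e K) = st E e' K"
proof -
  have "t \<in> st {e} e' (st E e K) \<longleftrightarrow> t \<in> st E e' K" for t
  proof (cases "e \<in> t")
    case True
    then have "t \<notin> K" "t - {e'} \<union> E \<notin> K" using assms by auto
    then show ?thesis using True by (simp add: in_st)
  next
    case False
    have 1: "E \<subseteq> t - {e'} \<union> {e} \<longleftrightarrow> E \<subseteq> t" using assms by auto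
    have 2: "t - {e'} \<union> {e} - {e} \<union> E = t - {e'} \<union> E" using False by auto
    show ?thesis unfolding in_st 1 2 using False by simp
  qed
  then show ?thesis by blast
qed

lemma sts_renamed:
  assumes "e \<notin> verts Z" "e' \<notin> verts Z" "e \<notin> E" "e' \<notin> E" "e \<noteq> e'"
  shows "sts {e} e' (sts E e Z) = sts E e' Z"
  unfolding sts_def using assms by (intro ext st_renamed) (auto simp: verts_def simps_def)

definition tedges :: "('v \<Rightarrow> 'l) \<Rightarrow> 'l \<Rightarrow> 'l \<Rightarrow> ('i \<Rightarrow> 'v set set) \<Rightarrow> 'v set set" where
  "tedges lab k l Z = {E \<in> simps Z. \<exists>p r. E = {p, r} \<and> lab p = k \<and> lab r = l}"

text \<open>A rewriting process with free choice of the next edge and of the new vertex, hence a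
  relation. It stops when no edge between the labels \<open>k\<close> and \<open>l\<close> is
  left.\<close>

inductive comp :: "('v \<Rightarrow> 'l) \<Rightarrow> 'l \<Rightarrow> 'l \<Rightarrow> 'l \<Rightarrow> ('i \<Rightarrow> 'v set set) \<Rightarrow> ('i \<Rightarrow> 'v set set) \<Rightarrow> bool"
  for lab k l a where
  "tedges lab k l Z = {} \<Longrightarrow> comp lab k l a Z Z"
| "{p, r} \<in> simps Z \<Longrightarrow> lab p = k \<Longrightarrow> lab r = l \<Longrightarrow> e \<notin> verts Z \<Longrightarrow> lab e = a \<Longrightarrow>
     comp lab k l a (sts {p, r} e Z) W \<Longrightarrow> comp lab k l a Z W"

text \<open>Because all completions on both sides are compared, reflexivity is not automatic:
  \<open>coequiv\<close> of a family with itself says that completion is confluent up to labelled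
  moves.\<close>

definition coequiv :: "('v \<Rightarrow> 'l) \<Rightarrow> 'l \<Rightarrow> 'l \<Rightarrow> 'l \<Rightarrow> ('i \<Rightarrow> 'v set set) \<Rightarrow> ('i \<Rightarrow> 'v set set) \<Rightarrow> bool" where
  "coequiv lab k l a Z Z' \<longleftrightarrow> (\<forall>W W'. comp lab k l a Z W \<longrightarrow> comp lab k l a Z' W' \<longrightarrow> lseq lab W W')"

lemma tedges_swap: "tedges lab k l = tedges lab l k"
  unfolding tedges_def by (intro ext) (metis doubleton_eq_iff)

lemma comp_swap: "comp lab k l a Z W \<Longrightarrow> comp lab l k a Z W"
proof (induction rule: comp.induct)
  case (1 Z) then show ?case by (intro comp.intros) (simp add: tedges_swap)
next
  case (2 p r Z e W)
  then show ?case using comp.intros(2)[of r p Z lab l k e a W] by (simp add: insert_commute)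
qed

lemma coequiv_swap: "coequiv lab k l a Z Z' = coequiv lab l k a Z Z'"
  unfolding coequiv_def using comp_swap by metis

lemma tedges_sts_neutral:
  assumes "lab z \<noteq> k" "lab z \<noteq> l"
  shows "tedges lab k l (sts F z Z) = {E \<in> tedges lab k l Z. \<not> F \<subseteq> E}"
  using assms by (auto simp: tedges_def simps_sts in_st)

lemma finite_tedges: "fam Z \<Longrightarrow> finite (tedges lab k l Z)"
  by (simp add: tedges_def fam_def)

context
  fixes lab :: "'v \<Rightarrow> 'l" and k l a :: 'l
  assumes rich: "rich lab" and kl: "k \<noteq> l" and ak: "a \<noteq> k" and al: "a \<noteq> l"
begin

abbreviation "T \<equiv> tedges lab k l"
abbreviation "Q \<equiv> coequiv lab k l a"

text \<open>Every new edge contains the new vertex, whose label \<open>a\<close> is neither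
  \<open>k\<close> nor \<open>l\<close>; so the count drops.\<close>

lemma card_tedges_less:
  assumes "fam Z" "{p, r} \<in> simps Z" "lab p = k" "lab r = l" "lab e = a"
  shows "card (T (sts {p, r} e Z)) < card (T Z)"
proof (rule psubset_card_mono[OF finite_tedges[OF assms(1)]])
  have "{p, r} \<in> T Z" using assms by (auto simp: tedges_def)
  moreover have "T (sts {p, r} e Z) = {E \<in> T Z. \<not> {p, r} \<subseteq> E}"
    using tedges_sts_neutral[of lab e k l "{p, r}" Z] assms ak al by simp
  ultimately show "T (sts {p, r} e Z) \<subset> T Z" by blast
qed

lemma ex_comp:
  assumes "fam Z" shows "\<exists>W. comp lab k l a Z W"
  using assms
proof (induction "card (T Z)" arbitrary: Z rule: less_induct)
  case less
  show ?case
  proof (cases "T Z = {}")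
    case True then show ?thesis by (blast intro: comp.intros(1))
  next
    case False
    then obtain p r where pr: "{p, r} \<in> simps Z" "lab p = k" "lab r = l" by (auto simp: tedges_def)
    obtain e where e: "e \<notin> verts Z" "lab e = a" using fam_fresh[OF rich less.prems, of "{}" a] by auto
    then obtain W where "comp lab k l a (sts {p, r} e Z) W"
      using less.hyps[OF card_tedges_less[OF less.prems pr e(2)] fam_sts[OF less.prems]] by blast
    then show ?thesis using comp.intros(2)[OF pr e] by blast
  qed
qed

lemma Q_sym: "Q Z Z' \<Longrightarrow> Q Z' Z"
  unfolding coequiv_def using lseq_sym by blast

text \<open>A completion of the middle family has to exist in order to link the outer two; this is
  where termination enters.\<close>

lemma Q_trans: "fam Z' \<Longrightarrow> Q Z Z' \<Longrightarrow> Q Z' Z'' \<Longrightarrow> Q Z Z''"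
  unfolding coequiv_def using lseq_trans ex_comp by metis

text \<open>A completion of the starred family is also one of \<open>Z\<close>, so confluence at
  \<open>Z\<close> is enough.\<close>

lemma Q_tstar:
  assumes "fam Z" "Q Z Z" "lab p = k" "lab r = l" "e \<notin> verts Z" "lab e = a"
  shows "Q Z (sts {p, r} e Z)"
proof (cases "{p, r} \<in> simps Z")
  case True
  then show ?thesis using assms comp.intros(2)[OF True assms(3-6)] unfolding coequiv_def by blast
qed (use assms in \<open>simp add: sts_noop\<close>)

lemma edge_verts: "{i, j} \<in> simps Z \<Longrightarrow> i \<in> verts Z \<and> j \<in> verts Z"
  by (auto simp: verts_def)

lemma sts_fresh: "v \<notin> verts Z \<Longrightarrow> v \<noteq> z \<Longrightarrow> v \<notin> verts (sts F z Z)"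
  using verts_sts_subset[of F z Z] by blast

text \<open>Induction on the number of edges still to be subdivided, in the style of Newman's lemma.
  Confluence and invariance under moves with a label other than \<open>k\<close> and
  \<open>l\<close> are proved together, because closing a fork of two subdivisions needs such moves
  on families with fewer edges left.\<close>

lemma Q_neutral:
  fixes Z :: "'i \<Rightarrow> 'v set set"
  assumes "fam Z"
  shows "Q Z Z \<and> (\<forall>i j z. z \<notin> verts Z \<longrightarrow> lab z = lab i \<longrightarrow> lab i \<noteq> k \<longrightarrow> lab i \<noteq> l \<longrightarrow> Q Z (sts {i, j} z Z))"
  using assms
proof (induction "card (T Z)" arbitrary: Z rule: less_induct)
  case (less Z0)
  let ?n = "card (T Z0)"
  have IHr: "Q Y Y" if "fam Y" "card (T Y) < ?n" for Y :: "'i \<Rightarrow> 'v set set"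
    using less.hyps that by blast
  have IHn: "Q Y (sts {i, j} z Y)"
    if "fam Y" "card (T Y) < ?n" "z \<notin> verts Y" "lab z = lab i" "lab i \<noteq> k" "lab i \<noteq> l" for Y :: "'i \<Rightarrow> 'v set set" and i j z
    using less.hyps that by blast
  have less_T: "card (T (sts {p, r} e Y)) < ?n"
    if "fam Y" "card (T Y) \<le> ?n" "{p, r} \<in> simps Y" "lab p = k" "lab r = l" "lab e = a" for Y :: "'i \<Rightarrow> 'v set set" and p r e
    using card_tedges_less[OF that(1,3-6)] that(2) by simp
  have less_T': "card (T (sts F y Y)) < ?n"
    if "fam Y" "card (T Y) < ?n" "lab y \<noteq> k" "lab y \<noteq> l" for Y :: "'i \<Rightarrow> 'v set set" and F y
  proof -
    have "T (sts F y Y) \<subseteq> T Y" using tedges_sts_neutral[of lab y k l F Y] that by auto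
    then show ?thesis using card_mono[OF finite_tedges[OF that(1)]] that(2) by (meson le_less_trans)
  qed
  \<comment> \<open>Edges with a common end \<open>c\<close>: once both are subdivided, the two
    orders differ by a flip, whose closing moves happen at the label \<open>a\<close>.\<close>
  have fork: "Q (sts {c, u} e1 Y) (sts {c, v} e2 Y)"
    if Y: "fam Y" "card (T Y) \<le> ?n" and E: "{c, u} \<in> T Y" "{c, v} \<in> T Y" "u \<noteq> v"
      and e: "e1 \<notin> verts Y" "e2 \<notin> verts Y" "e1 \<noteq> e2" "lab e1 = a" "lab e2 = a" for Y :: "'i \<Rightarrow> 'v set set" and c u v e1 e2
  proof -
    obtain g where g: "g \<notin> verts Y" "g \<noteq> e1" "g \<noteq> e2" "lab g = a"
      using fam_fresh[OF rich Y(1), of "{e1, e2}" a] by auto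
    have S: "{c, u} \<in> simps Y" "{c, v} \<in> simps Y" using E by (auto simp: tedges_def)
    have V: "c \<in> verts Y" "u \<in> verts Y" "v \<in> verts Y" using S by (auto dest: edge_verts)
    have lu: "lab c = k \<and> lab u = l \<and> lab v = l \<or> lab c = l \<and> lab u = k \<and> lab v = k"
      using E(1,2) kl by (auto simp: tedges_def doubleton_eq_iff)
    have d: "distinct [c, u, v, e1, e2, g]" using V e g lu kl E(3) by auto
    let ?A = "sts {c, u} e1 Y" let ?B = "sts {c, v} e2 Y"
    let ?A2 = "sts {c, v} e2 ?A" let ?B2 = "sts {c, u} e1 ?B"
    have fA: "fam ?A" "fam ?B" "fam ?A2" "fam ?B2" using Y by (simp_all add: fam_sts)
    have cA: "card (T ?A) < ?n" "card (T ?B) < ?n"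
      using lu less_T[OF Y, of c u e1] less_T[OF Y, of u c e1] less_T[OF Y, of c v e2] less_T[OF Y, of v c e2] S e
      by (auto simp: insert_commute)
    have cA2: "card (T ?A2) < ?n" "card (T ?B2) < ?n" using less_T' fA cA e ak al by simp_all
    have n1: "e2 \<notin> verts ?A" "e1 \<notin> verts ?B" using e by (simp_all add: sts_fresh)
    have n2: "g \<notin> verts ?A2" "g \<notin> verts ?B2" using g by (simp_all add: sts_fresh)
    have "Q ?A ?A2"
      using lu Q_tstar[OF fA(1) IHr[OF fA(1) cA(1)], of c v e2] Q_tstar[OF fA(1) IHr[OF fA(1) cA(1)], of v c e2] n1 e
      by (auto simp: insert_commute)
    moreover have "Q ?A2 (sts {e1, v} g ?A2)" using e g ak al by (intro IHn[OF fA(3) cA2(1) n2(1)]) simp_all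
    moreover have "sts {e1, v} g ?A2 = sts {e2, u} g ?B2" by (rule sts_flip[OF d])
    moreover have "Q ?B2 (sts {e2, u} g ?B2)" using e g ak al by (intro IHn[OF fA(4) cA2(2) n2(2)]) simp_all
    moreover have "Q ?B ?B2"
      using lu Q_tstar[OF fA(2) IHr[OF fA(2) cA(2)], of c u e1] Q_tstar[OF fA(2) IHr[OF fA(2) cA(2)], of u c e1] n1 e
      by (auto simp: insert_commute)
    moreover have "fam (sts {e2, u} g ?B2)" using fA by (simp add: fam_sts)
    ultimately show ?thesis using fA by (metis Q_sym Q_trans)
  qed
  have sep: "Q (sts E1 e1 Y) (sts E2 e2 Y)"
    if Y: "fam Y" "card (T Y) \<le> ?n" and E: "E1 \<in> T Y" "E2 \<in> T Y" "E1 \<inter> E2 = {}"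
      and e: "e1 \<notin> verts Y" "e2 \<notin> verts Y" "e1 \<noteq> e2" "lab e1 = a" "lab e2 = a" for Y :: "'i \<Rightarrow> 'v set set" and E1 E2 e1 e2
  proof -
    obtain p q where 1: "E1 = {p, q}" "lab p = k" "lab q = l" using E by (auto simp: tedges_def)
    obtain r s where 2: "E2 = {r, s}" "lab r = k" "lab s = l" using E by (auto simp: tedges_def)
    have S: "E1 \<in> simps Y" "E2 \<in> simps Y" using E by (auto simp: tedges_def)
    let ?A = "sts E1 e1 Y" let ?B = "sts E2 e2 Y"
    have fA: "fam ?A" "fam ?B" "fam (sts E2 e2 ?A)" using Y by (simp_all add: fam_sts)
    have cA: "card (T ?A) < ?n" "card (T ?B) < ?n"
      using less_T[OF Y, of p q e1] less_T[OF Y, of r s e2] S 1 2 e by auto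
    have "Q ?A (sts E2 e2 ?A)"
      unfolding 2(1) using fA IHr cA 2 e by (intro Q_tstar) (simp_all add: sts_fresh)
    moreover have "Q ?B (sts E1 e1 ?B)"
      unfolding 1(1) using fA IHr cA 1 e by (intro Q_tstar) (simp_all add: sts_fresh)
    moreover have "sts E2 e2 ?A = sts E1 e1 ?B"
      using E S e by (intro sts_commute) (auto simp: verts_def)
    ultimately show ?thesis using fA by (metis Q_sym Q_trans)
  qed
  have Qr: "Q Y Y" if Y: "fam Y" "card (T Y) = ?n" for Y :: "'i \<Rightarrow> 'v set set"
    unfolding coequiv_def
  proof (intro allI impI)
    fix W W' assume W: "comp lab k l a Y W" "comp lab k l a Y W'"
    show "lseq lab W W'"
    proof (cases "T Y = {}")
      case True
      have "W = Y" if "comp lab k l a Y W" for W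
        using that True by cases (auto simp: tedges_def)
      then have "W = Y" "W' = Y" using W by blast+
      then show ?thesis by simp
    next
      case False
      have first: "\<exists>E e. E \<in> T Y \<and> e \<notin> verts Y \<and> lab e = a \<and> comp lab k l a (sts E e Y) W" if "comp lab k l a Y W" for W
        using that
      proof cases
        case 1 then show ?thesis using False by simp
      next
        case (2 p r e)
        then have "{p, r} \<in> T Y" by (auto simp: tedges_def)
        then show ?thesis using 2 by blast
      qed
      obtain E1 e1 where 1: "E1 \<in> T Y" "e1 \<notin> verts Y" "lab e1 = a" "comp lab k l a (sts E1 e1 Y) W" using first[OF W(1)] by blast
      obtain E2 e2 where 2: "E2 \<in> T Y" "e2 \<notin> verts Y" "lab e2 = a" "comp lab k l a (sts E2 e2 Y) W'" using first[OF W(2)] by blast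
      obtain f1 where f1: "f1 \<notin> verts Y" "f1 \<noteq> e1" "f1 \<noteq> e2" "lab f1 = a" using fam_fresh[OF rich Y(1), of "{e1, e2}" a] by auto
      \<comment> \<open>The same edge subdivided at two different vertices: the results differ by
        renaming a vertex of label \<open>a\<close>, which is a neutral move.\<close>
      have ren: "Q (sts E e Y) (sts E e' Y)" if ee: "E \<in> T Y" "e \<notin> verts Y" "e' \<notin> verts Y" "lab e = a" "lab e' = a" "e \<noteq> e'" for E e e'
      proof -
        obtain p r where pr: "E = {p, r}" "lab p = k" "lab r = l" "E \<in> simps Y" using ee by (auto simp: tedges_def)
        have "Q (sts E e Y) (sts {e, e} e' (sts E e Y))"
          using ee pr Y less_T[OF Y(1), of p r e] ak al by (intro IHn fam_sts) (simp_all add: sts_fresh)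
        moreover have "sts {e} e' (sts E e Y) = sts E e' Y"
          using ee pr by (intro sts_renamed) (auto simp: verts_def)
        ultimately show ?thesis by simp
      qed
      have "Q (sts E1 f1 Y) (sts E2 e2 Y)"
      proof (cases "E1 = E2")
        case True then show ?thesis using ren 1 2 f1 by simp
      next
        case False
        obtain p q where p: "E1 = {p, q}" "lab p = k" "lab q = l" using 1 by (auto simp: tedges_def)
        obtain r s where r: "E2 = {r, s}" "lab r = k" "lab s = l" using 2 by (auto simp: tedges_def)
        consider "p = r" "q \<noteq> s" | "q = s" "p \<noteq> r" | "E1 \<inter> E2 = {}" using False p r kl by fastforce
        then show ?thesis
        proof cases
          case 1
          then show ?thesis using fork[OF Y(1), of p q s f1 e2] Y p r \<open>E1 \<in> T Y\<close> 2 f1 by simp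
        next
          case 2
          then show ?thesis using fork[OF Y(1), of q p r f1 e2] Y p r \<open>E1 \<in> T Y\<close> \<open>E2 \<in> T Y\<close> \<open>e2 \<notin> verts Y\<close> \<open>lab e2 = a\<close> f1
            by (simp add: insert_commute)
        next
          case 3
          then show ?thesis using sep[OF Y(1)] Y 1 2 f1 by simp
        qed
      qed
      then have "Q (sts E1 e1 Y) (sts E2 e2 Y)"
        using ren[OF 1(1,2) f1(1) 1(3) f1(4)] f1 Q_trans fam_sts[OF Y(1)] by metis
      then show ?thesis using 1 2 unfolding coequiv_def by blast
    qed
  qed
  \<comment> \<open>The given move is compared before and after subdividing one edge
    \<open>E\<close> between the labels; after that subdivision fewer such edges are left and the
    induction hypothesis is available.\<close>
  have neut: "Q Z0 (sts {i, j} z Z0)" if z: "z \<notin> verts Z0" "lab z = lab i" and li: "lab i \<noteq> k" "lab i \<noteq> l" for i j z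
  proof (cases "{i, j} \<in> simps Z0 \<and> T Z0 \<noteq> {}")
    case False
    show ?thesis
    proof (cases "{i, j} \<in> simps Z0")
      case True
      then have T0: "T Z0 = {}" "T (sts {i, j} z Z0) = {}" using False tedges_sts_neutral[of lab z k l "{i, j}" Z0] z li by auto
      have un: "W = Y" if "comp lab k l a Y W" "T Y = {}" for W and Y :: "'i \<Rightarrow> 'v set set"
        using that by cases (auto simp: tedges_def)
      show ?thesis using un T0 lseq_edge[OF less.prems z] unfolding coequiv_def by metis
    next
      case False
      then show ?thesis using sts_noop[OF less.prems False z(1)] Qr[OF less.prems refl] by simp
    qed
  next
    case True
    then obtain E where E: "E \<in> T Z0" by blast
    then obtain p r where pr: "E = {p, r}" "lab p = k" "lab r = l" "E \<in> simps Z0" by (auto simp: tedges_def)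
    have V: "i \<in> verts Z0" "j \<in> verts Z0" "p \<in> verts Z0" "r \<in> verts Z0" using True pr by (auto dest: edge_verts)
    obtain e where e: "e \<notin> verts Z0" "e \<noteq> z" "lab e = a" using fam_fresh[OF rich less.prems, of "{z}" a] by auto
    let ?A = "sts E e Z0" let ?B = "sts {i, j} z Z0"
    let ?A2 = "sts {i, j} z ?A" let ?B2 = "sts E e ?B"
    have fA: "fam ?A" "fam ?B" "fam ?A2" "fam ?B2" using less.prems by (simp_all add: fam_sts)
    have nE: "\<not> {i, j} \<subseteq> E" using pr li by auto
    have TB: "T ?B = T Z0" using tedges_sts_neutral[of lab z k l "{i, j}" Z0] z li by (auto simp: tedges_def)
    have cA: "card (T ?A) < ?n" using less_T[OF less.prems, of p r e] pr e by simp
    have EB: "E \<in> simps ?B" using TB E by (auto simp: tedges_def)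
    have cB2: "card (T ?B2) < ?n" using less_T[OF fA(2), of p r e] TB EB pr e by simp
    have cA2: "card (T ?A2) < ?n" using less_T'[OF fA(1) cA, of z] z li by simp
    have 1: "Q Z0 ?A" unfolding pr(1) using Qr less.prems pr e by (intro Q_tstar) auto
    have 2: "Q ?A ?A2" using z li e by (intro IHn[OF fA(1) cA]) (simp_all add: sts_fresh)
    have 3: "Q ?B ?B2" unfolding pr(1) using Qr fA TB pr e by (intro Q_tstar) (simp_all add: sts_fresh)
    have 4: "Q ?A2 ?B2"
    proof (cases "E \<inter> {i, j} = {}")
      case True
      then have "?A2 = ?B2" using e z V pr by (intro sts_commute) auto
      then show ?thesis using IHr[OF fA(3) cA2] by simp
    next
      case False
      \<comment> \<open>The label of \<open>i\<close> keeps \<open>i\<close> out of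
        \<open>E\<close>, so the two edges share exactly \<open>j\<close> and a flip
        applies.\<close>
      then have jE: "j \<in> E" using pr li by auto
      then obtain u where u: "E = {j, u}" "u \<noteq> j" "lab u = k \<or> lab u = l" "u \<in> verts Z0" "lab j = k \<or> lab j = l"
        using pr kl V by (auto simp: insert_commute)
      obtain g where g: "g \<notin> verts Z0" "g \<noteq> e" "g \<noteq> z" "lab g = lab i" using fam_fresh[OF rich less.prems, of "{e, z}" "lab i"] by auto
      have d: "distinct [j, u, i, e, z, g]" using u li V e z g by auto
      have eq: "sts {e, i} g ?A2 = sts {z, u} g ?B2"
        using sts_flip[OF d, of Z0] u(1) by (simp add: insert_commute)
      have "Q ?A2 (sts {i, e} g ?A2)" using g z e li by (intro IHn[OF fA(3) cA2]) (simp_all add: sts_fresh)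
      moreover have "Q ?B2 (sts {z, u} g ?B2)" using g z e li by (intro IHn[OF fA(4) cB2]) (simp_all add: sts_fresh)
      moreover have "fam (sts {z, u} g ?B2)" using fA by (simp add: fam_sts)
      moreover have "sts {i, e} g ?A2 = sts {z, u} g ?B2" using eq by (simp only: insert_commute[of e i])
      ultimately show ?thesis by (metis Q_sym Q_trans)
    qed
    show ?thesis using 1 2 3 4 fA by (metis Q_sym Q_trans)
  qed
  show ?case using Qr[OF less.prems refl] neut by blast
qed

text \<open>Confluence of completion, now free of the simultaneous induction.\<close>

lemma Q_refl: "fam Z \<Longrightarrow> Q Z Z"
  using Q_neutral by blast

lemma comp_terminal: "comp lab k l a Z W \<Longrightarrow> T Z = {} \<Longrightarrow> W = Z"
  by (erule comp.cases) (auto simp: tedges_def)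

text \<open>A move at the label \<open>k\<close> can create edges between the labels, since the new
  vertex itself has label \<open>k\<close>. The induction runs over the number of such edges before
  the move, with cases for the position of the moved edge relative to one of them.\<close>

lemma Q_move_first:
  fixes Z :: "'i \<Rightarrow> 'v set set"
  assumes "fam Z" "z \<notin> verts Z" "lab z = lab i" "lab i = k"
  shows "Q Z (sts {i, j} z Z)"
  using assms
proof (induction "card (T Z)" arbitrary: Z i j z rule: less_induct)
  case (less Z i j z)
  show ?case
  proof (cases "{i, j} \<in> simps Z")
    case False
    then show ?thesis using less.prems by (simp add: sts_noop Q_refl)
  next
    case H: True
    have V: "i \<in> verts Z" "j \<in> verts Z" using H by (auto dest: edge_verts)
    let ?B = "sts {i, j} z Z"
    have fB: "fam ?B" using less.prems by (simp add: fam_sts)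
    show ?thesis
    proof (cases "T Z = {}")
      case True
      have "T ?B = {}"
      proof (rule ccontr)
        assume "T ?B \<noteq> {}"
        then obtain p r where pr: "{p, r} \<in> simps ?B" "lab p = k" "lab r = l" by (auto simp: tedges_def)
        have "{p, r} \<in> simps Z \<or> {i, r} \<in> simps Z"
        proof (cases "z \<in> {p, r}")
          case True
          then have "z = p" using pr less.prems kl by auto
          then have "{p, r} - {z} \<union> {i, j} \<in> simps Z" using pr by (simp add: simps_sts in_st)
          moreover have "{i, r} \<subseteq> {p, r} - {z} \<union> {i, j}" using \<open>z = p\<close> pr kl by auto
          ultimately show ?thesis using down_closedD[OF simps_down_closed[OF less.prems(1)]] by blast
        qed (use pr in \<open>simp add: simps_sts in_st\<close>)
        then show False using True pr less.prems by (auto simp: tedges_def)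
      qed
      then show ?thesis
        using True comp_terminal lseq_edge[OF less.prems(1-3)] unfolding coequiv_def by metis
    next
      case False
      show ?thesis
      proof (cases "{i, j} \<in> T Z")
        case True
        then have lj: "lab j = l" using less.prems kl by (auto simp: tedges_def doubleton_eq_iff)
        obtain e where e: "e \<notin> verts Z" "e \<noteq> z" "lab e = a" using fam_fresh[OF rich less.prems(1), of "{z}" a] by auto
        let ?A = "sts {i, j} e Z"
        have fA: "fam ?A" using less.prems by (simp add: fam_sts)
        have "card (T ?A) < card (T Z)" using card_tedges_less[OF less.prems(1) H] less.prems lj e by simp
        then have "Q ?A (sts {i, e} z ?A)" using less.hyps[of ?A z i e] fA less.prems e by (simp add: sts_fresh)
        moreover have "Q Z ?A" using less.prems lj e by (intro Q_tstar) (simp_all add: Q_refl)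
        moreover have "distinct [i, j, e, z]" using V e less.prems lj kl by auto
        \<comment> \<open>The moved edge is itself due for subdivision; inserting \<open>z\<close>
          and \<open>e\<close> in either order gives the same path.\<close>
        then have "sts {i, e} z ?A = sts {z, j} e ?B" by (rule sts_edge_twice)
        moreover have "Q ?B (sts {z, j} e ?B)" using fB less.prems lj e by (intro Q_tstar) (simp_all add: Q_refl sts_fresh)
        moreover have "fam (sts {z, j} e ?B)" using fB by (simp add: fam_sts)
        ultimately show ?thesis using fA by (metis Q_sym Q_trans)
      next
        case HT: False
        obtain E where "E \<in> T Z" using False by blast
        then obtain p r where pr: "E = {p, r}" "lab p = k" "lab r = l" "E \<in> simps Z" by (auto simp: tedges_def)
        have V2: "p \<in> verts Z" "r \<in> verts Z" using pr by (auto dest: edge_verts)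
        obtain e where e: "e \<notin> verts Z" "e \<noteq> z" "lab e = a" using fam_fresh[OF rich less.prems(1), of "{z}" a] by auto
        obtain g where g: "g \<notin> verts Z" "g \<noteq> e" "g \<noteq> z" "lab g = a" using fam_fresh[OF rich less.prems(1), of "{e, z}" a] by auto
        let ?A = "sts E e Z" let ?A2 = "sts {i, j} z ?A" let ?B2 = "sts E e ?B"
        have fA: "fam ?A" "fam ?A2" "fam ?B2" using less.prems by (simp_all add: fam_sts)
        have "card (T ?A) < card (T Z)" using card_tedges_less[OF less.prems(1), of p r e] pr e by simp
        then have 2: "Q ?A ?A2" using less.hyps[of ?A z i j] fA less.prems e by (simp add: sts_fresh)
        have 1: "Q Z ?A" unfolding pr(1) using less.prems pr e by (intro Q_tstar) (simp_all add: Q_refl)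
        have 3: "Q ?B ?B2" unfolding pr(1) using fB pr e by (intro Q_tstar) (simp_all add: Q_refl sts_fresh)
        have ijT: "lab j \<noteq> l" using HT H less.prems by (auto simp: tedges_def)
        \<comment> \<open>On one side the closing move of the flip is neutral; on the other it is a
          step of the completion, because \<open>z\<close> has label \<open>k\<close> and
          \<open>r\<close> has label \<open>l\<close>.\<close>
        have flipped: "Q ?A2 ?B2" if eq: "sts {e, v} g ?A2 = sts {z, r} g ?B2" for v
        proof -
          have "Q ?A2 (sts {e, v} g ?A2)" using Q_neutral[OF fA(2)] g e ak al by (simp add: sts_fresh)
          moreover have "Q ?B2 (sts {z, r} g ?B2)"
            using fA pr e g less.prems by (intro Q_tstar) (simp_all add: Q_refl sts_fresh)
          moreover have "fam (sts {z, r} g ?B2)" using fA by (simp add: fam_sts)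
          ultimately show ?thesis using eq by (metis Q_sym Q_trans)
        qed
        consider "E \<inter> {i, j} = {}" | "i \<in> E" "i = j" | "i \<in> E" "i \<noteq> j" | "i \<notin> E" "j \<in> E" by blast
        then show ?thesis
        proof cases
          case 1
          then have "?A2 = ?B2" using e less.prems V V2 pr by (intro sts_commute) auto
          then show ?thesis using \<open>Q Z ?A\<close> 2 3 fA fB by (metis Q_sym Q_trans)
        next
          case c: 2
          then have ip: "i = p" using pr less.prems kl by auto
          have "?A2 = sts (insert z (E - {i})) e (sts {i} z Z)"
            unfolding c(2)[symmetric] insert_absorb2
            by (rule sts_nested) (use c e less.prems V V2 pr ip kl in auto)
          moreover have "insert z (E - {i}) = {z, r}" using pr ip kl by auto
          moreover have "Q ?B (sts {z, r} e ?B)" using fB pr e less.prems by (intro Q_tstar) (simp_all add: Q_refl sts_fresh)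
          ultimately show ?thesis using \<open>Q Z ?A\<close> 2 c fA fB by (metis Q_sym Q_trans insert_absorb2)
        next
          case c: 3
          then have ip: "i = p" using pr less.prems kl by auto
          have "distinct [i, r, j, e, z, g]" using c ip pr ijT kl V V2 e g less.prems by auto
          then have "sts {e, j} g ?A2 = sts {z, r} g ?B2" unfolding pr(1) ip[symmetric] by (rule sts_flip)
          then show ?thesis using flipped \<open>Q Z ?A\<close> 2 3 fA fB by (metis Q_sym Q_trans)
        next
          case c: 4
          then have ip: "j = p" using pr ijT by auto
          have "distinct [j, r, i, e, z, g]" using c ip pr kl V V2 e g less.prems by auto
          then have "sts {e, i} g ?A2 = sts {z, r} g ?B2"
            unfolding pr(1) ip[symmetric] insert_commute[of i j] by (rule sts_flip)
          then show ?thesis using flipped \<open>Q Z ?A\<close> 2 3 fA fB by (metis Q_sym Q_trans)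
        qed
      qed
    qed
  qed
qed

end

lemma coequiv_move:
  assumes "rich lab" "k \<noteq> l" "a \<noteq> k" "a \<noteq> l" "fam Z" "z \<notin> verts Z" "lab z = lab i"
  shows "coequiv lab k l a Z (sts {i, j} z Z)"
proof -
  consider "lab i = k" | "lab i = l" | "lab i \<noteq> k" "lab i \<noteq> l" by blast
  then show ?thesis
  proof cases
    case 1 then show ?thesis using Q_move_first assms by metis
  next
    case 2 then show ?thesis using Q_move_first[of lab l k a] assms coequiv_swap by metis
  next
    case 3 then show ?thesis using Q_neutral assms by metis
  qed
qed

lemma coequiv_lseq:
  assumes kl: "rich lab" "k \<noteq> l" "a \<noteq> k" "a \<noteq> l" and "lseq lab Z Z'" "fam Z"
  shows "coequiv lab k l a Z Z'"
  using assms(5)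
proof (induction rule: lseq_induct)
  case base then show ?case using Q_refl assms by metis
next
  case (star Y i j z)
  have "coequiv lab k l a Y (sts {i, j} z Y)" using star by (intro coequiv_move[OF kl])
  then show ?case using star Q_trans[OF kl] by blast
next
  case (weld Y i j z)
  have "coequiv lab k l a Y (sts {i, j} z Y)" using weld by (intro coequiv_move[OF kl])
  then show ?case using weld Q_trans[OF kl] Q_sym[OF kl] fam_sts by metis
qed

text \<open>After one edge of \<open>F\<close> between the labels is subdivided at \<open>e\<close>,
  starring \<open>F\<close> becomes the starring of a set through \<open>e\<close>, and
  \<open>f\<close> may inherit its label from \<open>e\<close>. So the starring is a completion step
  combined with a labelled equivalence.\<close>

lemma coequiv_star:
  assumes kl: "rich lab" "k \<noteq> l" "a \<noteq> k" "a \<noteq> l" and Z: "fam Z" "f \<notin> verts Z" "lab f = a"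
    and p: "p \<in> F" "lab p = k" and r: "r \<in> F" "lab r = l"
  shows "coequiv lab k l a Z (sts F f Z)"
proof -
  consider "F \<notin> simps Z" | "F = {p, r}" | "F \<noteq> {p, r}" "F \<in> simps Z" by blast
  then show ?thesis
  proof cases
    case 1 then show ?thesis using sts_noop[OF Z(1) _ Z(2)] Q_refl[OF kl Z(1)] by metis
  next
    case 2 then show ?thesis using Q_tstar[OF kl Z(1) Q_refl[OF kl Z(1)] p(2) r(2) Z(2,3)] by simp
  next
    case 3
    obtain e where e: "e \<notin> verts Z" "e \<noteq> f" "lab e = a" using fam_fresh[OF kl(1) Z(1), of "{f}" a] by auto
    let ?A = "sts {p, r} e Z" let ?G = "insert e (F - {p, r})" let ?B = "sts F f Z"
    have fA: "fam ?A" "fam ?B" "fam (sts ?G f ?A)" using Z by (simp_all add: fam_sts)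
    have eF: "e \<notin> F" "f \<notin> F" using 3 Z e by (auto simp: verts_def)
    have "coequiv lab k l a Z ?A" using Q_tstar[OF kl Z(1) Q_refl[OF kl Z(1)] p(2) r(2) e(1,3)] .
    moreover have "lseq lab ?A (sts ?G f ?A)"
      using e Z verts_sts_subset[of "{p, r}" e Z] by (intro lseq_star[OF kl(1) fA(1), of f e]) auto
    then have "coequiv lab k l a ?A (sts ?G f ?A)" using coequiv_lseq[OF kl _ fA(1)] by blast
    moreover have "sts {p, r} e ?B = sts ?G f ?A" using p r 3 e eF Z by (intro sts_nested) auto
    moreover have "e \<notin> verts ?B" using e verts_sts_subset[of F f Z] by auto
    then have "coequiv lab k l a ?B (sts {p, r} e ?B)"
      using Q_tstar[OF kl fA(2) Q_refl[OF kl fA(2)] p(2) r(2) _ e(3)] by blast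
    ultimately show ?thesis using Q_trans[OF kl] Q_sym[OF kl] fA by metis
  qed
qed

section \<open>Barycentric subdivision as a sequence of starrings\<close>

definition oc :: "'v set set \<Rightarrow> 'v set set set" where
  "oc K = {C. {} \<in> K \<and> C \<subseteq> K - {{}} \<and> chain\<^sub>\<subseteq> C}"

text \<open>The naming \<open>N\<close> of barycentres is a parameter, so that they can be given
  prescribed labels before the canonical names are used. The condition \<open>{} \<in> K\<close> in
  \<open>oc\<close> keeps void members of a family void.\<close>

definition bs :: "('v set \<Rightarrow> 'w) \<Rightarrow> ('i \<Rightarrow> 'v set set) \<Rightarrow> 'i \<Rightarrow> 'w set set" where
  "bs N Z = mapf N (\<lambda>X. oc (Z X))"

lemma simps_oc: "simps (\<lambda>X. oc (Z X)) \<subseteq> Pow (simps Z - {{}})"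
  by (auto simp: simps_def oc_def)

lemma verts_oc: "verts (\<lambda>X. oc (Z X)) \<subseteq> simps Z - {{}}"
  using simps_oc[of Z] by (auto simp: verts_def)

lemma chain_subset_mono: "chain\<^sub>\<subseteq> C \<Longrightarrow> D \<subseteq> C \<Longrightarrow> chain\<^sub>\<subseteq> D"
  by (auto simp: chain_subset_def)

lemma fam_oc: "fam Z \<Longrightarrow> fam (\<lambda>X. oc (Z X))"
  unfolding fam_def
proof (intro conjI ballI allI)
  assume Z: "finite (simps Z) \<and> (\<forall>s\<in>simps Z. finite s) \<and> (\<forall>X. down_closed (Z X))"
  show "finite (simps (\<lambda>X. oc (Z X)))" using finite_subset[OF simps_oc[of Z]] Z by simp
  show "finite s" if "s \<in> simps (\<lambda>X. oc (Z X))" for s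
    using that simps_oc[of Z] Z finite_subset[of s "simps Z"] by auto
  show "down_closed (oc (Z X))" for X
    unfolding down_closed_def oc_def using chain_subset_mono by blast
qed

lemma fam_bs: "fam Z \<Longrightarrow> fam (bs N Z)"
  unfolding bs_def by (intro fam_mapf fam_oc)

lemma oc_image:
  assumes "inj_on f (\<Union>K)"
  shows "oc ((`) f ` K) = (`) ((`) f) ` oc K"
proof (intro equalityI subsetI)
  have sub: "f ` s \<subseteq> f ` t \<longleftrightarrow> s \<subseteq> t" if "s \<in> K" "t \<in> K" for s t
  proof
    assume l: "f ` s \<subseteq> f ` t"
    show "s \<subseteq> t"
    proof
      fix x assume "x \<in> s"
      then obtain y where "y \<in> t" "f x = f y" using l by blast
      then show "x \<in> t" using inj_onD[OF assms, of x y] \<open>x \<in> s\<close> that by auto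
    qed
  qed blast
  have e: "{} \<in> (`) f ` K \<longleftrightarrow> {} \<in> K" by auto
  fix C
  { assume "C \<in> oc ((`) f ` K)"
    then have C: "{} \<in> K" "C \<subseteq> (`) f ` K - {{}}" "chain\<^sub>\<subseteq> C" using e by (auto simp: oc_def)
    define D where "D = {s \<in> K. f ` s \<in> C}"
    have "C = (`) f ` D" using C by (auto simp: D_def)
    moreover have "D \<in> oc K"
    proof -
      have "chain\<^sub>\<subseteq> D"
        unfolding chain_subset_def
      proof (intro ballI)
        fix s t assume st: "s \<in> D" "t \<in> D"
        then have "f ` s \<subseteq> f ` t \<or> f ` t \<subseteq> f ` s" using C(3) by (auto simp: D_def chain_subset_def)
        then show "s \<subseteq> t \<or> t \<subseteq> s" using sub st by (auto simp: D_def)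
      qed
      moreover have "{} \<notin> D" using C(2) by (auto simp: D_def)
      ultimately show ?thesis using C(1) by (auto simp: oc_def D_def)
    qed
    ultimately show "C \<in> (`) ((`) f) ` oc K" by blast }
  { assume "C \<in> (`) ((`) f) ` oc K"
    then obtain D where "D \<in> oc K" "C = (`) f ` D" by blast
    moreover have "chain\<^sub>\<subseteq> ((`) f ` D)"
      unfolding chain_subset_def
    proof (intro ballI)
      fix A B assume "A \<in> (`) f ` D" "B \<in> (`) f ` D"
      then obtain s t where "s \<in> D" "t \<in> D" "A = f ` s" "B = f ` t" by blast
      moreover from this have "s \<subseteq> t \<or> t \<subseteq> s" using \<open>D \<in> oc K\<close> unfolding oc_def chain_subset_def by blast
      ultimately show "A \<subseteq> B \<or> B \<subseteq> A" by (metis image_mono)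
    qed
    ultimately show "C \<in> oc ((`) f ` K)" using e by (auto simp: oc_def) }
qed

text \<open>The barycentric subdivision of the simplices in an upper set, the others being kept.\<close>

definition partial_bs :: "('v set \<Rightarrow> 'v) \<Rightarrow> 'v set set \<Rightarrow> ('i \<Rightarrow> 'v set set) \<Rightarrow> 'i \<Rightarrow> 'v set set" where
  "partial_bs N D Z = (\<lambda>X. {t. t \<subseteq> verts Z \<union> N ` D \<and> t \<inter> verts Z \<in> Z X - D \<and>
     chain\<^sub>\<subseteq> {G \<in> D. N G \<in> t} \<and> (\<forall>G\<in>D. N G \<in> t \<longrightarrow> G \<in> Z X \<and> t \<inter> verts Z \<subseteq> G)})"

lemma partial_bs_empty: "partial_bs N {} Z = Z"
proof
  fix X
  have "t \<subseteq> verts Z" if "t \<in> Z X" for t using that by (auto simp: verts_def simps_def)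
  moreover have "t \<inter> verts Z = t" if "t \<subseteq> verts Z" for t using that by blast
  ultimately have "t \<in> partial_bs N {} Z X \<longleftrightarrow> t \<in> Z X" for t
    unfolding partial_bs_def by (auto simp: chain_subset_def)
  then show "partial_bs N {} Z X = Z X" by blast
qed

lemma partial_bs_full:
  assumes "fam Z" "N ` (simps Z - {{}}) \<inter> verts Z = {}" "inj_on N (simps Z - {{}})"
  shows "partial_bs N (simps Z - {{}}) Z = bs N Z"
proof
  fix X
  let ?D = "simps Z - {{}}"
  show "partial_bs N ?D Z X = bs N Z X"
  proof (intro equalityI subsetI)
    fix t assume t: "t \<in> partial_bs N ?D Z X"
    have e: "t \<inter> verts Z = {}" "{} \<in> Z X" using t in_simps[of Z X] by (auto simp: partial_bs_def)
    have 1: "t = N ` {G \<in> ?D. N G \<in> t}" using t e by (auto simp: partial_bs_def)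
    have 2: "{G \<in> ?D. N G \<in> t} \<in> oc (Z X)" using t e by (auto simp: partial_bs_def oc_def)
    show "t \<in> bs N Z X" unfolding bs_def mapf_def by (rule image_eqI[where x = "{G \<in> ?D. N G \<in> t}"], rule 1, rule 2)
  next
    fix t assume "t \<in> bs N Z X"
    then obtain C where C: "C \<in> oc (Z X)" "t = N ` C" by (auto simp: bs_def mapf_def)
    have CD: "C \<subseteq> ?D" using C in_simps[of Z X] by (auto simp: oc_def)
    have "{G \<in> ?D. N G \<in> t} = C"
      using C(2) CD assms(3) by (auto dest: inj_onD)
    moreover have "t \<inter> verts Z = {}" using C CD assms(2) by auto
    moreover have "t \<subseteq> verts Z \<union> N ` ?D" using C CD by blast
    moreover have "{} \<in> Z X" "C \<subseteq> Z X" "chain\<^sub>\<subseteq> C" using C by (auto simp: oc_def)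
    moreover from calculation have "\<forall>G\<in>?D. N G \<in> t \<longrightarrow> G \<in> Z X" by blast
    ultimately show "t \<in> partial_bs N ?D Z X"
      unfolding partial_bs_def mem_Collect_eq by simp
  qed
qed

text \<open>\<open>F\<close> is maximal among the simplices outside \<open>D\<close>, so
  \<open>F\<close> is the only simplex outside \<open>D\<close> that contains it. Hence a simplex
  through the new vertex consists of a proper face of \<open>F\<close> and barycentres of a chain
  above \<open>F\<close>, as the definition demands.\<close>

lemma partial_bs_star:
  assumes Z: "fam Z" and N: "inj_on N (simps Z - {{}})" "N ` (simps Z - {{}}) \<inter> verts Z = {}"
    and D: "D \<subseteq> simps Z - {{}}" "\<And>G H. G \<in> D \<Longrightarrow> H \<in> simps Z \<Longrightarrow> G \<subseteq> H \<Longrightarrow> H \<in> D"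
    and F: "F \<in> simps Z - {{}} - D" "\<And>H. H \<in> simps Z \<Longrightarrow> F \<subset> H \<Longrightarrow> H \<in> D"
  shows "sts F (N F) (partial_bs N D Z) = partial_bs N (insert F D) Z"
proof
  fix X
  let ?V = "verts Z"
  have NF: "N F \<notin> ?V" "N F \<notin> N ` D" using N F(1) D(1) by (auto dest: inj_onD)
  have FV: "F \<subseteq> ?V" using F(1) by (auto simp: verts_def)
  have sub: "Z X \<subseteq> simps Z" by (rule in_simps)
  have key: "t \<in> st F (N F) (partial_bs N D Z X) \<longleftrightarrow> t \<in> partial_bs N (insert F D) Z X" for t
  proof -
    define e where "e = t \<inter> ?V"
    have Fe: "F \<subseteq> t \<longleftrightarrow> F \<subseteq> e" using FV by (auto simp: e_def)
    show ?thesis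
    proof (cases "N F \<in> t")
      case True
      have e': "(t - {N F} \<union> F) \<inter> ?V = e \<union> F" using FV NF by (auto simp: e_def)
      have C': "N G \<in> t - {N F} \<union> F \<longleftrightarrow> N G \<in> t" if "G \<in> D" for G
      proof -
        have "N G \<notin> F" using that FV N(2) D(1) by auto
        moreover have "N G \<noteq> N F" using that NF(2) by (metis imageI)
        ultimately show ?thesis by blast
      qed
      have sub': "t - {N F} \<union> F \<subseteq> ?V \<union> N ` D \<longleftrightarrow> t \<subseteq> ?V \<union> N ` insert F D"
        using FV by auto
      have "t \<in> st F (N F) (partial_bs N D Z X) \<longleftrightarrow> \<not> F \<subseteq> e \<and> t \<subseteq> ?V \<union> N ` insert F D \<and> e \<union> F \<in> Z X - D \<and>
          chain\<^sub>\<subseteq> {G \<in> D. N G \<in> t} \<and> (\<forall>G\<in>D. N G \<in> t \<longrightarrow> G \<in> Z X \<and> e \<union> F \<subseteq> G)" (is "_ \<longleftrightarrow> ?L")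
        unfolding in_st Fe partial_bs_def mem_Collect_eq e' sub' using True C'
        by (simp cong: conj_cong ball_cong Collect_cong)
      moreover have "t \<in> partial_bs N (insert F D) Z X \<longleftrightarrow> t \<subseteq> ?V \<union> N ` insert F D \<and> e \<in> Z X - insert F D \<and>
          chain\<^sub>\<subseteq> (insert F {G \<in> D. N G \<in> t}) \<and> F \<in> Z X \<and> e \<subseteq> F \<and> (\<forall>G\<in>D. N G \<in> t \<longrightarrow> G \<in> Z X \<and> e \<subseteq> G)" (is "_ \<longleftrightarrow> ?R")
      proof -
        have "{G \<in> insert F D. N G \<in> t} = insert F {G \<in> D. N G \<in> t}" using True by auto
        then show ?thesis unfolding partial_bs_def mem_Collect_eq e_def[symmetric] using True by auto
      qed
      moreover have "?L \<longleftrightarrow> ?R"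
      proof
        assume L: ?L
        have "e \<union> F = F" using L F(2)[of "e \<union> F"] sub by blast
        then have eF: "e \<subseteq> F" "F \<in> Z X" using L by auto
        have "e \<in> Z X" using down_closedD[OF fam_down_closed[OF Z] eF(2,1)] .
        moreover have "e \<notin> insert F D" using L eF D(2)[of e F] F(1) by auto
        moreover have "chain\<^sub>\<subseteq> (insert F {G \<in> D. N G \<in> t})" using L unfolding chain_subset_def by auto
        ultimately show ?R using L eF by auto
      next
        assume R: ?R
        have "F \<subseteq> G" if "G \<in> D" "N G \<in> t" for G
        proof -
          have "F \<subseteq> G \<or> G \<subseteq> F" using R that unfolding chain_subset_def by auto
          then show ?thesis using D(2)[of G F] that F(1) by auto
        qed
        moreover have "e \<union> F = F" using R by auto
        moreover have "\<not> F \<subseteq> e" using R by auto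
        moreover have "chain\<^sub>\<subseteq> {G \<in> D. N G \<in> t}" using R by (auto simp: chain_subset_def)
        ultimately show ?L using R F(1) by auto
      qed
      ultimately show ?thesis by blast
    next
      case False
      have "t \<subseteq> ?V \<union> N ` insert F D \<longleftrightarrow> t \<subseteq> ?V \<union> N ` D" using False by auto
      moreover have "{G \<in> insert F D. N G \<in> t} = {G \<in> D. N G \<in> t}" using False by auto
      moreover have "\<not> F \<subseteq> e \<and> e \<in> Z X - D \<longleftrightarrow> e \<in> Z X - insert F D"
        using F(2)[of e] sub by blast
      ultimately show ?thesis
        unfolding in_st Fe partial_bs_def mem_Collect_eq e_def[symmetric] using False by auto
    qed
  qed
  then show "sts F (N F) (partial_bs N D Z) X = partial_bs N (insert F D) Z X"
    unfolding sts_def by blast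
qed

text \<open>The simplices are starred from the largest down. The form of an induction rule serves
  two uses: following a completion class and following unlabelled equivalence.\<close>

lemma bs_induct:
  assumes Z: "fam Z" and N: "inj_on N (simps Z - {{}})" "N ` (simps Z - {{}}) \<inter> verts Z = {}"
    and "P Z"
    and step: "\<And>Y F. fam Y \<Longrightarrow> P Y \<Longrightarrow> F \<in> simps Z - {{}} \<Longrightarrow> F \<in> simps Y \<Longrightarrow> N F \<notin> verts Y \<Longrightarrow> P (sts F (N F) Y)"
  shows "P (bs N Z)"
proof -
  let ?S = "simps Z - {{}}"
  have finS: "finite ?S" using Z by (simp add: fam_def)
  have "\<exists>D\<subseteq>?S. card D = n \<and> (\<forall>G H. G \<in> D \<longrightarrow> H \<in> simps Z \<longrightarrow> G \<subseteq> H \<longrightarrow> H \<in> D) \<and>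
      fam (partial_bs N D Z) \<and> P (partial_bs N D Z)" if "n \<le> card ?S" for n
    using that
  proof (induction n)
    case 0
    show ?case using Z assms(4) by (intro exI[of _ "{}"]) (simp add: partial_bs_empty)
  next
    case (Suc n)
    then obtain D where D: "D \<subseteq> ?S" "card D = n" "\<And>G H. G \<in> D \<Longrightarrow> H \<in> simps Z \<Longrightarrow> G \<subseteq> H \<Longrightarrow> H \<in> D"
      "fam (partial_bs N D Z)" "P (partial_bs N D Z)" by (metis Suc_leD)
    have "?S - D \<noteq> {}" using D Suc.prems finS card_mono[of D ?S] finite_subset by fastforce
    moreover have "finite (?S - D)" using finS by simp
    ultimately obtain F where F: "F \<in> ?S - D" "\<And>H. H \<in> ?S - D \<Longrightarrow> \<not> F \<subset> H"
      using finite_has_maximal[of "?S - D"] by (metis psubsetE)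
    have F2: "H \<in> D" if "H \<in> simps Z" "F \<subset> H" for H using F(2)[of H] that by blast
    have eq: "sts F (N F) (partial_bs N D Z) = partial_bs N (insert F D) Z"
      by (rule partial_bs_star[OF Z N D(1,3)]) (use F F2 in auto)
    have NF: "N F \<notin> verts (partial_bs N D Z)"
    proof -
      have "verts (partial_bs N D Z) \<subseteq> verts Z \<union> N ` D" by (auto simp: verts_def simps_def partial_bs_def)
      then show ?thesis using N F(1) D(1) by (auto dest: inj_onD)
    qed
    have FY: "F \<in> simps (partial_bs N D Z)"
    proof -
      obtain X where "F \<in> Z X" using F(1) by (auto simp: simps_def)
      moreover have "F \<subseteq> verts Z" using F(1) by (auto simp: verts_def)
      moreover have "{G \<in> D. N G \<in> F} = {}" using \<open>F \<subseteq> verts Z\<close> N(2) D(1) by auto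
      ultimately have "F \<in> partial_bs N D Z X" using F(1) by (auto simp: partial_bs_def chain_subset_def Int_absorb2)
      then show ?thesis by (auto simp: simps_def)
    qed
    have "P (partial_bs N (insert F D) Z)" unfolding eq[symmetric] using step[OF D(4,5) _ FY NF] F(1) by blast
    moreover have "fam (partial_bs N (insert F D) Z)" unfolding eq[symmetric] using D(4) by (rule fam_sts)
    moreover have "card (insert F D) = Suc n" using D F(1) finS finite_subset[of D ?S] by simp
    moreover have "\<forall>G H. G \<in> insert F D \<longrightarrow> H \<in> simps Z \<longrightarrow> G \<subseteq> H \<longrightarrow> H \<in> insert F D"
      using D(3) F2 by blast
    ultimately show ?case using D(1) F(1) by (intro exI[of _ "insert F D"]) blast
  qed
  from this[of "card ?S"] obtain D where "D \<subseteq> ?S" "card D = card ?S" "P (partial_bs N D Z)" by blast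
  then have "P (partial_bs N ?S Z)" using card_subset_eq[OF finS] by metis
  then show ?thesis using partial_bs_full[OF Z N(2,1)] by simp
qed

text \<open>The lifting step. The subdivision of \<open>Z\<close> has no edge between the labels, so
  it is its own completion, and every starring that leads to it keeps the completion class of
  \<open>Z\<close>. The only such edge of \<open>X\<close> is \<open>{p, r}\<close>, so subdividing
  it completes \<open>X\<close>. Uniqueness of completions identifies the two results.\<close>

lemma lseq_bs_lift:
  fixes lab :: "'v \<Rightarrow> 'l" and Z X :: "'i \<Rightarrow> 'v set set"
  assumes kl: "rich lab" "k \<noteq> l" "a \<noteq> k" "a \<noteq> l"
    and Z: "fam Z" and X: "lseq lab Z X" "tedges lab k l X = {{p, r}}" "lab p = k" "lab r = l"
    and e: "e \<notin> verts X" "lab e = a"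
    and N: "inj_on N (simps Z - {{}})"
      "\<And>F. F \<in> simps Z - {{}} \<Longrightarrow> {k, l} \<subseteq> lab ` F \<Longrightarrow> lab (N F) = a"
      "\<And>F. F \<in> simps Z - {{}} \<Longrightarrow> \<not> {k, l} \<subseteq> lab ` F \<Longrightarrow> lab (N F) \<in> lab ` F"
  shows "lseq lab (bs N Z) (sts {p, r} e X)"
proof -
  let ?S = "simps Z - {{}}"
  have finS: "finite ?S" using Z by (simp add: fam_def)
  have fX: "fam X" using lseq_fam[OF X(1) Z] .
  \<comment> \<open>The names \<open>N\<close> may already occur in \<open>Z\<close>; the starrings
    are done with fresh names of the same labels, which are exchanged at the end.\<close>
  obtain M where M: "inj_on M ?S" "M ` ?S \<inter> verts Z = {}" "\<forall>F\<in>?S. lab (M F) = lab (N F)"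
    using ex_labelled_injection[OF kl(1) finS, of "verts Z" "\<lambda>F. lab (N F)"] fam_finite_verts[OF Z] by blast
  have labM: "lab (M F) = a" if "F \<in> ?S" "{k, l} \<subseteq> lab ` F" for F using M N that by simp
  have labM': "lab (M F) \<in> lab ` F" if "F \<in> ?S" "\<not> {k, l} \<subseteq> lab ` F" for F using M N that by simp
  have co: "coequiv lab k l a Z (bs M Z)"
  proof (rule bs_induct[where P = "coequiv lab k l a Z", OF Z M(1,2)])
    show "coequiv lab k l a Z Z" by (rule Q_refl[OF kl Z])
    fix Y F assume Y: "fam Y" "coequiv lab k l a Z Y" "F \<in> ?S" "M F \<notin> verts Y"
    have "coequiv lab k l a Y (sts F (M F) Y)"
    proof (cases "{k, l} \<subseteq> lab ` F")
      case True
      then obtain p r where "p \<in> F" "lab p = k" "r \<in> F" "lab r = l" by auto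
      then show ?thesis using coequiv_star[OF kl Y(1,4) labM[OF Y(3) True]] by blast
    next
      case False
      then obtain i where "i \<in> F" "lab (M F) = lab i" using labM'[OF Y(3)] by auto
      then have "lseq lab Y (sts F (M F) Y)" using lseq_star[OF kl(1) Y(1,4)] by blast
      then show ?thesis using coequiv_lseq[OF kl _ Y(1)] by blast
    qed
    then show "coequiv lab k l a Z (sts F (M F) Y)" using Q_trans[OF kl Y(1,2)] by blast
  qed
  have T: "tedges lab k l (bs M Z) = {}"
  proof (rule ccontr)
    assume "tedges lab k l (bs M Z) \<noteq> {}"
    then obtain x y where xy: "{x, y} \<in> simps (bs M Z)" "lab x = k" "lab y = l" by (auto simp: tedges_def)
    then obtain I C where C: "C \<in> oc (Z I)" "{x, y} = M ` C" by (auto simp: bs_def mapf_def simps_def)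
    then obtain F G where FG: "F \<in> C" "x = M F" "G \<in> C" "y = M G" by (metis imageE insertCI)
    have S: "F \<in> ?S" "G \<in> ?S" using C FG in_simps[of Z I] by (auto simp: oc_def)
    \<comment> \<open>The larger of the two comparable simplices would carry both labels, and its
      barycentre would then have label \<open>a\<close>.\<close>
    have "F \<subseteq> G \<or> G \<subseteq> F" using C FG by (auto simp: oc_def chain_subset_def)
    moreover have "\<not> {k, l} \<subseteq> lab ` F" "\<not> {k, l} \<subseteq> lab ` G" using labM S FG xy kl by auto
    moreover have "k \<in> lab ` F" "l \<in> lab ` G" using labM' S FG xy calculation by auto
    ultimately show False by blast
  qed
  have TX: "tedges lab k l (sts {p, r} e X) = {}"
    using tedges_sts_neutral[of lab e k l "{p, r}" X] e kl X by auto
  have pr: "{p, r} \<in> simps X" using X(2) by (auto simp: tedges_def)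
  have "comp lab k l a X (sts {p, r} e X)"
    by (rule comp.intros(2)[OF pr X(3,4) e comp.intros(1)[OF TX]])
  moreover have "comp lab k l a (bs M Z) (bs M Z)" by (rule comp.intros(1)[OF T])
  moreover have "coequiv lab k l a (bs M Z) X"
    using Q_trans[OF kl Z Q_sym[OF kl co] coequiv_lseq[OF kl X(1) Z]] .
  ultimately have "lseq lab (bs M Z) (sts {p, r} e X)" unfolding coequiv_def by blast
  moreover have "lseq lab (bs N Z) (bs M Z)"
    unfolding bs_def
  proof (intro lseq_rename2 kl(1) fam_oc Z inj_on_subset[OF M(1) verts_oc] inj_on_subset[OF N(1) verts_oc])
    fix v assume "v \<in> verts (\<lambda>X. oc (Z X))"
    then have "v \<in> ?S" using verts_oc by blast
    then show "lab (N v) = lab (M v)" using M(3) by simp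
  qed
  ultimately show ?thesis by (rule lseq_trans[rotated])
qed

section \<open>Lifting sequences of moves to iterated barycentric subdivisions\<close>

lemma infinite_vertex: "infinite (UNIV :: 'a vertex set)"
proof
  assume f: "finite (UNIV :: 'a vertex set)"
  have "inj (\<lambda>v :: 'a vertex. Bary {|v|})" by (auto simp: inj_def)
  then have "surj (\<lambda>v :: 'a vertex. Bary {|v|})" by (rule finite_UNIV_inj_surj[OF f])
  then obtain v :: "'a vertex" where "Atom undefined = Bary {|v|}" by (rule surjE)
  then show False by simp
qed

lemma rich_const: "rich (\<lambda>_ :: 'a vertex. ())"
  by (simp add: rich_def infinite_vertex)

lemma rich_snd: "rich (snd :: 'a vertex \<times> 'l \<Rightarrow> 'l)"
  unfolding rich_def
proof
  fix c :: 'l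
  have "range (\<lambda>x :: 'a vertex. (x, c)) \<subseteq> {v. snd v = c}" by auto
  moreover have "infinite (range (\<lambda>x :: 'a vertex. (x, c)))"
    using infinite_vertex finite_imageD[of "\<lambda>x :: 'a vertex. (x, c)" UNIV] by (auto simp: inj_on_def)
  ultimately show "infinite {v :: 'a vertex \<times> 'l. snd v = c}" using finite_subset by blast
qed

definition sub :: "('i \<Rightarrow> 'a family) \<Rightarrow> 'i \<Rightarrow> 'a family" where
  "sub Z = bs bary Z"

text \<open>A labelling by arbitrary values is made a fixed function of the vertex, namely
  \<open>snd\<close>, by pairing each vertex with its label.\<close>

definition lift :: "('a \<Rightarrow> 'b) \<Rightarrow> ('i \<Rightarrow> 'a set set) \<Rightarrow> 'i \<Rightarrow> ('a \<times> 'b) set set" where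
  "lift h Z = mapf (\<lambda>x. (x, h x)) Z"

text \<open>The labelling \<open>h\<close> is the vertex map that is wanted in the end; the target
  \<open>X\<close> is labelled by its own vertices.\<close>

definition reach :: "('i \<Rightarrow> 'b family) \<Rightarrow> ('i \<Rightarrow> 'b family) \<Rightarrow> bool" where
  "reach B X \<longleftrightarrow> (\<exists>k h. lseq snd (lift h ((sub ^^ k) B)) (lift id X))"

lemma bary_inj: "inj_on bary {s. finite s}"
  by (auto simp: inj_on_def bary_def Abs_fset_inject)

lemma fam_sub: "fam Z \<Longrightarrow> fam (sub Z)"
  unfolding sub_def by (rule fam_bs)

lemma fam_sub_iter: "fam Z \<Longrightarrow> fam ((sub ^^ k) Z)"
  by (induction k) (auto intro: fam_sub)

lemma fam_lift: "fam Z \<Longrightarrow> fam (lift h Z)"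
  unfolding lift_def by (rule fam_mapf)

lemma verts_lift: "verts (lift h Z) = (\<lambda>x. (x, h x)) ` verts Z"
  unfolding lift_def by (rule verts_mapf)

lemma inj_lift: "inj_on (\<lambda>x. (x, h x)) V"
  by (auto simp: inj_on_def)

lemma reach_refl: "reach B B"
  unfolding reach_def by (intro exI[of _ 0] exI[of _ id]) simp

lemma lift_star:
  assumes "{i, j} \<in> simps X" "e \<notin> verts X"
  shows "mapf ((\<lambda>x. (x, x))(e := (e, c))) (sts {i, j} e X) = sts {(i, i), (j, j)} (e, c) (lift id X)"
proof -
  have "{i, j} \<subseteq> verts X" using assms by (auto simp: verts_def)
  then show ?thesis
    using mapf_sts[of "\<lambda>x. (x, x)" "verts X" X "{i, j}" e "(e, c)"] assms
    by (auto simp: lift_def inj_on_def)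
qed

lemma lift_star_id:
  assumes "{i, j} \<in> simps X" "e \<notin> verts X"
  shows "lift id (sts {i, j} e X) = sts {(i, i), (j, j)} (e, e) (lift id X)"
proof -
  have "(\<lambda>x. (x, x))(e := (e, e)) = (\<lambda>x. (x, x))" by auto
  then show ?thesis using lift_star[OF assms, of e] by (simp add: lift_def)
qed

text \<open>Once the label \<open>e\<close> is merged with \<open>i\<close>, the vertex
  \<open>e\<close> is a new vertex labelled like \<open>i\<close>, and its starring is undone by a
  labelled move. The number of subdivisions stays the same.\<close>

lemma reach_weld:
  assumes B: "fam B" and X: "fam X" "{i, j} \<in> simps X" "e \<notin> verts X" and "reach B (sts {i, j} e X)"
  shows "reach B X"
proof -
  let ?g = "id(e := i)"
  let ?f = "\<lambda>(x, c). (x, ?g c)"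
  obtain k h where kh: "lseq snd (lift h ((sub ^^ k) B)) (lift id (sts {i, j} e X))"
    using assms(5) by (auto simp: reach_def)
  have "lseq snd (mapf ?f (lift h ((sub ^^ k) B))) (mapf ?f (lift id (sts {i, j} e X)))"
    by (rule lseq_map[OF kh rich_snd fam_lift[OF fam_sub_iter[OF B]], where g = ?g])
      (auto simp: verts_lift inj_on_def)
  also have "mapf ?f (lift h ((sub ^^ k) B)) = lift (\<lambda>x. ?g (h x)) ((sub ^^ k) B)"
    unfolding lift_def mapf_mapf by (intro mapf_cong) auto
  also have "mapf ?f (lift id (sts {i, j} e X)) = mapf ((\<lambda>x. (x, x))(e := (e, i))) (sts {i, j} e X)"
    unfolding lift_def mapf_mapf by (intro mapf_cong) auto
  also have "\<dots> = sts {(i, i), (j, j)} (e, i) (lift id X)" by (rule lift_star[OF X(2,3)])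
  finally have "lseq snd (lift (\<lambda>x. ?g (h x)) ((sub ^^ k) B)) (sts {(i, i), (j, j)} (e, i) (lift id X))" .
  also have "lseq snd (sts {(i, i), (j, j)} (e, i) (lift id X)) (lift id X)"
    using X by (intro lseq_sym[OF lseq_edge] fam_lift) (auto simp: verts_lift)
  finally show ?thesis unfolding reach_def by blast
qed

text \<open>One more subdivision makes room for the new label: barycentres of simplices that meet
  both labels \<open>i\<close> and \<open>j\<close> receive it, the others keep some label of their
  simplex. In the degenerate case \<open>i = j\<close> it suffices to rename a label.\<close>

lemma reach_star:
  fixes B X :: "'i \<Rightarrow> 'b family"
  assumes B: "fam B" and X: "fam X" "{i, j} \<in> simps X" "e \<notin> verts X" and "reach B X"
  shows "reach B (sts {i, j} e X)"
proof -
  obtain k h where kh: "lseq snd (lift h ((sub ^^ k) B)) (lift id X)"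
    using assms(5) by (auto simp: reach_def)
  have V: "i \<in> verts X" "j \<in> verts X" using X by (auto simp: verts_def)
  show ?thesis
  proof (cases "i = j")
    case True
    let ?g = "id(i := e)"
    let ?f = "\<lambda>(x, c). (x, ?g c)" and ?f' = "\<lambda>(x, c). (?g x, ?g c)"
    have "lseq snd (mapf ?f (lift h ((sub ^^ k) B))) (mapf ?f' (lift id X))"
      by (rule lseq_map[OF kh rich_snd fam_lift[OF fam_sub_iter[OF B]], where g = ?g])
        (use X in \<open>auto simp: verts_lift inj_on_def split: if_splits\<close>)
    also have "mapf ?f (lift h ((sub ^^ k) B)) = lift (\<lambda>x. ?g (h x)) ((sub ^^ k) B)"
      unfolding lift_def mapf_mapf by (intro mapf_cong) auto
    also have "mapf ?f' (lift id X) = lift id (mapf ?g X)"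
      unfolding lift_def mapf_mapf by (intro mapf_cong) auto
    also have "mapf ?g X = sts {i, j} e X" using sts_vertex[OF V(1) X(3)] True by simp
    finally show ?thesis unfolding reach_def by blast
  next
    case False
    let ?Bk = "(sub ^^ k) B"
    let ?Z = "lift h ?Bk" let ?X = "lift id X"
    define lb where "lb = (\<lambda>F :: ('b vertex \<times> 'b vertex) set. if {i, j} \<subseteq> snd ` F then e else SOME c. c \<in> snd ` F)"
    \<comment> \<open>The first component is the true barycentre, so that forgetting the labels
      returns the canonical barycentric subdivision.\<close>
    define N where "N = (\<lambda>F :: ('b vertex \<times> 'b vertex) set. (bary (fst ` F), lb F))"
    have fBk: "fam ?Bk" by (rule fam_sub_iter[OF B])
    have fZ: "fam ?Z" by (rule fam_lift[OF fBk])
    \<comment> \<open>Vertices of \<open>X\<close> are their own labels, so two labels determine at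
      most one edge.\<close>
    have T: "tedges snd i j ?X = {{(i, i), (j, j)}}"
    proof -
      have "{(i, i), (j, j)} \<in> simps ?X"
        unfolding lift_def simps_mapf by (rule image_eqI[OF _ X(2)]) simp
      moreover have "E = {(i, i), (j, j)}" if E: "E \<in> simps ?X" "E = {p, r}" "snd p = i" "snd r = j" for E p r
      proof -
        have "p \<in> verts ?X" "r \<in> verts ?X" using E by (auto simp: verts_def)
        then show ?thesis using E by (auto simp: verts_lift)
      qed
      moreover have "\<exists>p r. {(i, i), (j, j)} = {p, r} \<and> snd p = i \<and> snd r = j"
        by (intro exI[of _ "(i, i)"] exI[of _ "(j, j)"]) simp
      ultimately show ?thesis unfolding tedges_def by blast
    qed
    have injN: "inj_on N (simps ?Z - {{}})"
    proof (rule inj_onI)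
      fix F G assume FG: "F \<in> simps ?Z - {{}}" "G \<in> simps ?Z - {{}}" "N F = N G"
      then obtain s t where st: "s \<in> simps ?Bk" "t \<in> simps ?Bk" "F = (\<lambda>x. (x, h x)) ` s" "G = (\<lambda>x. (x, h x)) ` t"
        by (auto simp: lift_def simps_mapf)
      have "fst ` F = s" "fst ` G = t" using st by (auto simp: image_image)
      moreover have "finite s" "finite t" using st fBk by (auto simp: fam_def)
      ultimately have "s = t" using FG(3) inj_onD[OF bary_inj, of s t] by (simp add: N_def)
      then show "F = G" using st by simp
    qed
    have "lseq snd (bs N ?Z) (sts {(i, i), (j, j)} (e, e) ?X)"
    proof (rule lseq_bs_lift[OF rich_snd False _ _ fZ kh T _ _ _ _ injN, of e])
      show "e \<noteq> i" "e \<noteq> j" using X V by auto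
      show "(e, e) \<notin> verts ?X" using X by (auto simp: verts_lift)
      fix F assume F: "F \<in> simps ?Z - {{}}"
      show "{i, j} \<subseteq> snd ` F \<Longrightarrow> snd (N F) = e" by (simp add: N_def lb_def)
      assume "\<not> {i, j} \<subseteq> snd ` F"
      moreover have "(SOME c. c \<in> snd ` F) \<in> snd ` F" using F by (intro someI_ex[of "\<lambda>c. c \<in> snd ` F"]) auto
      ultimately show "snd (N F) \<in> snd ` F" by (auto simp: N_def lb_def)
    qed auto
    also have "sts {(i, i), (j, j)} (e, e) ?X = lift id (sts {i, j} e X)"
      by (rule lift_star_id[symmetric, OF X(2,3)])
    also have "bs N ?Z = lift (\<lambda>y. lb ((\<lambda>x. (x, h x)) ` inv_into {s. finite s} bary y)) (sub ?Bk)"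
    proof -
      have "(\<lambda>I. oc (?Z I)) = mapf ((`) (\<lambda>x. (x, h x))) (\<lambda>I. oc (?Bk I))"
        unfolding lift_def mapf_def by (intro ext oc_image inj_lift)
      then have "bs N ?Z = mapf (\<lambda>s. N ((\<lambda>x. (x, h x)) ` s)) (\<lambda>I. oc (?Bk I))"
        by (simp add: bs_def mapf_mapf comp_def)
      also have "\<dots> = mapf (\<lambda>s. (bary s, lb ((\<lambda>x. (x, h x)) ` inv_into {s. finite s} bary (bary s)))) (\<lambda>I. oc (?Bk I))"
      proof (rule mapf_cong)
        fix s assume "s \<in> verts (\<lambda>I. oc (?Bk I))"
        then have "finite s" using verts_oc[of ?Bk] fBk by (auto simp: fam_def)
        then have "inv_into {s. finite s} bary (bary s) = s" by (intro inv_into_f_f[OF bary_inj]) simp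
        then show "N ((\<lambda>x. (x, h x)) ` s) = (bary s, lb ((\<lambda>x. (x, h x)) ` inv_into {s. finite s} bary (bary s)))"
          by (simp add: N_def image_image)
      qed
      also have "\<dots> = lift (\<lambda>y. lb ((\<lambda>x. (x, h x)) ` inv_into {s. finite s} bary y)) (sub ?Bk)"
        unfolding lift_def sub_def bs_def mapf_mapf comp_def ..
      finally show ?thesis .
    qed
    also have "sub ?Bk = (sub ^^ Suc k) B" by simp
    finally show ?thesis unfolding reach_def by blast
  qed
qed

lemma reach_lseq:
  assumes "lseq (\<lambda>_. ()) B X" "fam B"
  shows "reach B X"
  using assms(1)
proof (induction rule: lseq_induct)
  case base then show ?case by (rule reach_refl)
next
  case (star Y i j a) then show ?case by (intro reach_star assms(2))
next
  case (weld Y i j a) then show ?case using reach_weld[OF assms(2)] by blast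
qed

section \<open>Clique complexes and the exchange of edges\<close>

definition clq :: "'x set \<Rightarrow> ('x \<Rightarrow> 'x \<Rightarrow> bool) \<Rightarrow> 'x set set" where
  "clq S R = {C. C \<subseteq> S \<and> (\<forall>x\<in>C. \<forall>y\<in>C. x \<noteq> y \<longrightarrow> R x y)}"

text \<open>A single unlabelled complex is treated as a family over \<open>unit\<close>, so that all
  results on families apply.\<close>

definition sq :: "'x set set \<Rightarrow> 'x set set \<Rightarrow> bool" where
  "sq K L = lseq (\<lambda>_. ()) (\<lambda>_ :: unit. K) (\<lambda>_. L)"

lemma sq_refl [simp]: "sq K K"
  by (simp add: sq_def)

lemma sq_sym: "sq K L \<Longrightarrow> sq L K"
  unfolding sq_def by (rule lseq_sym)

lemma sq_trans [trans]: "sq K L \<Longrightarrow> sq L M \<Longrightarrow> sq K M"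
  unfolding sq_def by (rule lseq_trans)

lemma simps_unit [simp]: "simps (\<lambda>_ :: unit. K) = K"
  by (simp add: simps_def)

lemma fam_unit: "fam (\<lambda>_ :: unit. K) \<longleftrightarrow> finite K \<and> (\<forall>s\<in>K. finite s) \<and> down_closed K"
  by (simp add: fam_def)

lemma sq_edge:
  assumes "fam (\<lambda>_ :: unit. K)" "z \<notin> \<Union>K" shows "sq K (st {i, j} z K)"
  using lseq_edge[OF assms(1), of z "\<lambda>_. ()" i j] assms(2) by (simp add: sq_def sts_def verts_def)

lemma fam_clq: "finite S \<Longrightarrow> fam (\<lambda>_ :: unit. clq S R)"
  unfolding fam_unit
proof (intro conjI ballI)
  assume S: "finite S"
  have "clq S R \<subseteq> Pow S" by (auto simp: clq_def)
  then show "finite (clq S R)" using S finite_subset by blast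
  show "finite s" if "s \<in> clq S R" for s using that S finite_subset by (auto simp: clq_def)
  show "down_closed (clq S R)" by (auto simp: clq_def down_closed_def)
qed

text \<open>Clique complexes are closed under starring an edge, so only the adjacency relation has
  to be tracked from here on.\<close>

lemma clq_star:
  assumes S: "x \<in> S" "y \<in> S" "x \<noteq> y" "w \<notin> S" and sym: "\<And>p q. R p q \<Longrightarrow> R q p" and xy: "R x y"
    and R': "\<And>p q. p \<in> S \<Longrightarrow> q \<in> S \<Longrightarrow> p \<noteq> q \<Longrightarrow> R' p q \<longleftrightarrow> R p q \<and> {p, q} \<noteq> {x, y}"
    and w: "\<And>p. p \<in> S \<Longrightarrow> R' w p \<longleftrightarrow> p \<in> {x, y} \<or> R p x \<and> R p y" "\<And>p. p \<in> S \<Longrightarrow> R' p w \<longleftrightarrow> R' w p"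
  shows "st {x, y} w (clq S R) = clq (insert w S) R'"
proof -
  have agree: "(\<forall>p\<in>t. \<forall>q\<in>t. p \<noteq> q \<longrightarrow> R' p q) \<longleftrightarrow> \<not> {x, y} \<subseteq> t \<and> (\<forall>p\<in>t. \<forall>q\<in>t. p \<noteq> q \<longrightarrow> R p q)"
    if t: "t \<subseteq> S" for t
  proof
    assume l: "\<forall>p\<in>t. \<forall>q\<in>t. p \<noteq> q \<longrightarrow> R' p q"
    have "\<not> {x, y} \<subseteq> t" using l R'[of x y] S by auto
    then show "\<not> {x, y} \<subseteq> t \<and> (\<forall>p\<in>t. \<forall>q\<in>t. p \<noteq> q \<longrightarrow> R p q)" using l R' t by blast
  next
    assume r: "\<not> {x, y} \<subseteq> t \<and> (\<forall>p\<in>t. \<forall>q\<in>t. p \<noteq> q \<longrightarrow> R p q)"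
    show "\<forall>p\<in>t. \<forall>q\<in>t. p \<noteq> q \<longrightarrow> R' p q"
    proof (intro ballI impI)
      fix p q assume pq: "p \<in> t" "q \<in> t" "p \<noteq> q"
      then have "{p, q} \<noteq> {x, y}" using r by auto
      then show "R' p q" using pq r R' t by blast
    qed
  qed
  have "t \<in> st {x, y} w (clq S R) \<longleftrightarrow> t \<in> clq (insert w S) R'" for t
  proof (cases "w \<in> t")
    case False
    then have "t \<subseteq> insert w S \<longleftrightarrow> t \<subseteq> S" by auto
    then show ?thesis using False agree[of t] by (auto simp: in_st clq_def)
  next
    case True
    define s where "s = t - {w}"
    have t: "t = insert w s" "w \<notin> s" using True by (auto simp: s_def)
    have 1: "t \<in> st {x, y} w (clq S R) \<longleftrightarrow> \<not> {x, y} \<subseteq> s \<and> s \<union> {x, y} \<in> clq S R"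
      using t S by (auto simp: in_st)
    have 2: "t \<in> clq (insert w S) R' \<longleftrightarrow> s \<subseteq> S \<and> (\<forall>p\<in>s. \<forall>q\<in>s. p \<noteq> q \<longrightarrow> R' p q) \<and> (\<forall>p\<in>s. R' w p)"
    proof -
      have "s \<subseteq> S \<Longrightarrow> (\<forall>p\<in>s. R' p w) \<longleftrightarrow> (\<forall>p\<in>s. R' w p)" using w(2) by blast
      moreover have "t \<subseteq> insert w S \<longleftrightarrow> s \<subseteq> S" using t by auto
      moreover have "(\<forall>p\<in>t. \<forall>q\<in>t. p \<noteq> q \<longrightarrow> R' p q) \<longleftrightarrow>
          (\<forall>p\<in>s. \<forall>q\<in>s. p \<noteq> q \<longrightarrow> R' p q) \<and> (\<forall>p\<in>s. R' w p) \<and> (\<forall>p\<in>s. R' p w)"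
        unfolding t(1) using t(2) by auto
      ultimately show ?thesis unfolding clq_def mem_Collect_eq by argo
    qed
    have 3: "s \<union> {x, y} \<in> clq S R \<longleftrightarrow> s \<subseteq> S \<and> (\<forall>p\<in>s. \<forall>q\<in>s. p \<noteq> q \<longrightarrow> R p q) \<and> (\<forall>p\<in>s. p \<in> {x, y} \<or> R p x \<and> R p y)"
      if "\<not> {x, y} \<subseteq> s"
    proof
      assume "s \<union> {x, y} \<in> clq S R"
      then show "s \<subseteq> S \<and> (\<forall>p\<in>s. \<forall>q\<in>s. p \<noteq> q \<longrightarrow> R p q) \<and> (\<forall>p\<in>s. p \<in> {x, y} \<or> R p x \<and> R p y)"
        unfolding clq_def by blast
    next
      assume a: "s \<subseteq> S \<and> (\<forall>p\<in>s. \<forall>q\<in>s. p \<noteq> q \<longrightarrow> R p q) \<and> (\<forall>p\<in>s. p \<in> {x, y} \<or> R p x \<and> R p y)"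
      have h: "p \<in> s \<Longrightarrow> p \<noteq> x \<Longrightarrow> R p x" "p \<in> s \<Longrightarrow> p \<noteq> y \<Longrightarrow> R p y" for p
        using a xy sym[OF xy] by auto
      have "R p q" if pq: "p \<in> s \<union> {x, y}" "q \<in> s \<union> {x, y}" "p \<noteq> q" for p q
      proof -
        consider "p \<in> s" "q \<in> s" | "p \<in> s" "q = x" | "p \<in> s" "q = y" | "q \<in> s" "p = x" | "q \<in> s" "p = y"
          | "p = x" "q = y" | "p = y" "q = x" using pq by auto
        then show ?thesis
          by cases (use pq(3) a h sym[OF h(1)] sym[OF h(2)] xy sym[OF xy] in auto)
      qed
      then show "s \<union> {x, y} \<in> clq S R"
        unfolding clq_def mem_Collect_eq using S(1,2) a by (metis Un_insert_right insert_subset sup_bot_right)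
    qed
    have 4: "s \<subseteq> S \<Longrightarrow> (\<forall>p\<in>s. R' w p) \<longleftrightarrow> (\<forall>p\<in>s. p \<in> {x, y} \<or> R p x \<and> R p y)" using w(1) by blast
    show ?thesis unfolding 1 2 using 3 4 agree[of s] by argo
  qed
  then show ?thesis by blast
qed

lemma clq_weld:
  assumes "finite S" "x \<in> S" "y \<in> S" "x \<noteq> y" "w \<notin> S" "\<And>p q. R p q \<Longrightarrow> R q p" "R x y"
    and "\<And>p q. p \<in> S \<Longrightarrow> q \<in> S \<Longrightarrow> p \<noteq> q \<Longrightarrow> R' p q \<longleftrightarrow> R p q \<and> {p, q} \<noteq> {x, y}"
    and "\<And>p. p \<in> S \<Longrightarrow> R' w p \<longleftrightarrow> p \<in> {x, y} \<or> R p x \<and> R p y" "\<And>p. p \<in> S \<Longrightarrow> R' p w \<longleftrightarrow> R' w p"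
  shows "sq (clq (insert w S) R') (clq S R)"
proof -
  have "sq (clq S R) (st {x, y} w (clq S R))"
    using assms(5) by (intro sq_edge fam_clq assms(1)) (auto simp: clq_def)
  moreover have "st {x, y} w (clq S R) = clq (insert w S) R'" by (rule clq_star) (fact assms)+
  ultimately show ?thesis by (simp add: sq_sym)
qed

text \<open>Condition \<open>nb\<close> matches the ends and common neighbours of \<open>x\<close>,
  \<open>y\<close> before the exchange with those of \<open>u\<close>, \<open>v\<close> after it. So
  both complexes are welds of one complex with an extra vertex \<open>w\<close>.\<close>

lemma clq_flip:
  fixes S :: "'x set"
  assumes inf: "infinite (UNIV :: 'x set)" and S: "finite S" "x \<in> S" "y \<in> S" "u \<in> S" "v \<in> S" "x \<noteq> y" "u \<noteq> v" "{x, y} \<noteq> {u, v}"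
    and sym: "\<And>p q. R p q \<Longrightarrow> R q p" "\<And>p q. R' p q \<Longrightarrow> R' q p" and xy: "R x y" "\<not> R u v"
    and R': "\<And>p q. p \<in> S \<Longrightarrow> q \<in> S \<Longrightarrow> p \<noteq> q \<Longrightarrow> R' p q \<longleftrightarrow> R p q \<and> {p, q} \<noteq> {x, y} \<or> {p, q} = {u, v}"
    and nb: "\<And>p. p \<in> S \<Longrightarrow> p \<in> {x, y} \<or> R p x \<and> R p y \<longleftrightarrow> p \<in> {u, v} \<or> R' p u \<and> R' p v"
  shows "sq (clq S R) (clq S R')"
proof -
  obtain w where w: "w \<notin> S" using inf S(1) ex_new_if_finite by blast
  define Rw where "Rw = (\<lambda>p q. if p = w then q \<in> {x, y} \<or> R q x \<and> R q y
     else if q = w then p \<in> {x, y} \<or> R p x \<and> R p y else R p q \<and> {p, q} \<noteq> {x, y})"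
  have "sq (clq (insert w S) Rw) (clq S R)"
  proof (rule clq_weld[where x = x and y = y])
    show "\<And>p q. R p q \<Longrightarrow> R q p" by (rule sym(1))
  qed (use w S xy in \<open>auto simp: Rw_def\<close>)
  moreover have "sq (clq (insert w S) Rw) (clq S R')"
  proof (rule clq_weld[where x = u and y = v])
    show "\<And>p q. R' p q \<Longrightarrow> R' q p" by (rule sym(2))
    show "R' u v" using R'[OF S(4,5,7)] by blast
    fix p assume p: "p \<in> S"
    show "Rw w p \<longleftrightarrow> p \<in> {u, v} \<or> R' p u \<and> R' p v" using nb[OF p] by (simp add: Rw_def)
    show "Rw p w \<longleftrightarrow> Rw w p" using p w by (auto simp: Rw_def)
    fix q assume q: "q \<in> S" "p \<noteq> q"
    have "{p, q} = {u, v} \<Longrightarrow> \<not> R p q" using xy(2) sym(1) by (auto simp: doubleton_eq_iff)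
    moreover have "Rw p q \<longleftrightarrow> R p q \<and> {p, q} \<noteq> {x, y}" using p q w by (auto simp: Rw_def)
    ultimately show "Rw p q \<longleftrightarrow> R' p q \<and> {p, q} \<noteq> {u, v}"
      using R'[OF p q] S(8) by blast
  qed (use w S in auto)
  ultimately show ?thesis using sq_sym sq_trans by metis
qed

text \<open>A linear extension of inclusion in the form of an induction rule: whenever a member is
  added, all smaller ones are already present.\<close>

lemma lower_set_induct [consumes 1, case_names empty insert]:
  fixes T :: "'k set set"
  assumes T: "finite T" and "P {}"
    and step: "\<And>Q x. Q \<subseteq> T \<Longrightarrow> (\<And>l m. l \<in> Q \<Longrightarrow> m \<in> T \<Longrightarrow> m \<subseteq> l \<Longrightarrow> m \<in> Q) \<Longrightarrow> x \<in> T - Q \<Longrightarrow>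
      (\<And>m. m \<in> T \<Longrightarrow> m \<subset> x \<Longrightarrow> m \<in> Q) \<Longrightarrow> P Q \<Longrightarrow> P (insert x Q)"
  shows "P T"
proof -
  have "P T" if "Q \<subseteq> T" "\<forall>l\<in>Q. \<forall>m\<in>T. m \<subseteq> l \<longrightarrow> m \<in> Q" "P Q" for Q
    using that
  proof (induction "card (T - Q)" arbitrary: Q rule: less_induct)
    case less
    show ?case
    proof (cases "Q = T")
      case False
      then have "T - Q \<noteq> {}" using less.prems by blast
      then obtain x where x: "x \<in> T - Q" "\<forall>m\<in>T - Q. m \<le> x \<longrightarrow> x = m"
        using finite_has_minimal[of "T - Q"] T by blast
      have m: "m \<in> Q" if "m \<in> T" "m \<subset> x" for m using x(2) that by blast
      have "P (insert x Q)"
        by (rule step[OF less.prems(1) _ x(1) m less.prems(3)]) (use less.prems(2) in blast)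
      moreover have "card (T - insert x Q) < card (T - Q)"
        using T x(1) by (intro psubset_card_mono) auto
      moreover have "\<forall>l\<in>insert x Q. \<forall>m\<in>T. m \<subseteq> l \<longrightarrow> m \<in> insert x Q"
        using less.prems(2) m by blast
      moreover have "insert x Q \<subseteq> T" using less.prems(1) x(1) by blast
      ultimately show ?thesis using less.hyps[of "insert x Q"] by simp
    qed (use less.prems in simp)
  qed
  from this[of "{}"] show ?thesis using assms(2) by simp
qed

lemma upper_set_induct [consumes 1, case_names empty insert]:
  fixes T :: "'k set set"
  assumes T: "finite T" and "P {}"
    and step: "\<And>Q x. Q \<subseteq> T \<Longrightarrow> (\<And>l m. l \<in> Q \<Longrightarrow> m \<in> T \<Longrightarrow> l \<subseteq> m \<Longrightarrow> m \<in> Q) \<Longrightarrow> x \<in> T - Q \<Longrightarrow>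
      (\<And>m. m \<in> T \<Longrightarrow> x \<subset> m \<Longrightarrow> m \<in> Q) \<Longrightarrow> P Q \<Longrightarrow> P (insert x Q)"
  shows "P T"
proof -
  \<comment> \<open>On sets \<open>uminus\<close> is complementation, which reverses
    inclusion.\<close>
  have "P (uminus ` (uminus ` T))"
  proof (rule lower_set_induct[where T = "uminus ` T" and P = "\<lambda>Q. P (uminus ` Q)"])
    fix Q x assume Q: "Q \<subseteq> uminus ` T" "\<And>l m. l \<in> Q \<Longrightarrow> m \<in> uminus ` T \<Longrightarrow> m \<subseteq> l \<Longrightarrow> m \<in> Q"
      and x: "x \<in> uminus ` T - Q" "\<And>m. m \<in> uminus ` T \<Longrightarrow> m \<subset> x \<Longrightarrow> m \<in> Q" and P: "P (uminus ` Q)"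
    have in_un: "l \<in> uminus ` Q \<longleftrightarrow> - l \<in> Q" for l :: "'k set" and Q by (metis double_complement image_iff)
    have "P (insert (- x) (uminus ` Q))"
    proof (rule step)
      show "uminus ` Q \<subseteq> T" using Q(1) by (auto simp: in_un)
      show "- x \<in> T - uminus ` Q" using x(1) by (auto simp: in_un)
      fix m assume m: "m \<in> T"
      then have m': "- m \<in> uminus ` T" by blast
      show "m \<in> uminus ` Q" if "- x \<subset> m" using x(2)[OF m'] that by (auto simp: in_un compl_less_swap2)
      show "m \<in> uminus ` Q" if "l \<in> uminus ` Q" "l \<subseteq> m" for l
        using Q(2)[OF _ m', of "- l"] that by (auto simp: in_un)
    qed (fact P)
    then show "P (uminus ` insert x Q)" by simp
  qed (use assms in auto)
  then show ?thesis by (simp add: image_image)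
qed

section \<open>Contracting zigzags in a poset\<close>

datatype ('k, 'r) tok = Ta 'k | Tm 'k | Tn 'k | Tb 'k | Tr 'r

text \<open>
  Starring the edge from \<open>i\<close> to \<open>j\<close> at \<open>z\<close> replaces, in an upper set of faces, the pair
  \<open>{i} \<union> \<kappa> \<subset> {i, j} \<union> \<kappa>\<close> by the zigzag
  \<open>{i} \<union> \<kappa> \<subset> {z, i} \<union> \<kappa> \<supset> {z} \<union> \<kappa> \<subset> {z, j} \<union> \<kappa>\<close>; these are the tokens \<open>Ta\<close>, \<open>Tm\<close>, \<open>Tn\<close>, \<open>Tb\<close>. The zigzags are
  contracted one at a time; the four relations record how far the contraction has come.
\<close>

locale zigzag =
  fixes I :: "'v set set" and Rs :: "'r set" and \<alpha> \<delta> \<beta> :: "'r \<Rightarrow> 'v set \<Rightarrow> bool" and \<rho> :: "'r \<Rightarrow> 'r \<Rightarrow> bool"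
  assumes fin: "finite I" "finite Rs"
    and mono: "\<And>r k k'. r \<in> Rs \<Longrightarrow> k \<in> I \<Longrightarrow> k' \<in> I \<Longrightarrow> k \<subseteq> k' \<Longrightarrow> \<delta> r k \<Longrightarrow> \<delta> r k'"
    and imp: "\<And>r k. r \<in> Rs \<Longrightarrow> k \<in> I \<Longrightarrow> \<delta> r k \<Longrightarrow> \<alpha> r k \<and> \<beta> r k"
    and meet: "\<And>r k k'. r \<in> Rs \<Longrightarrow> k \<in> I \<Longrightarrow> k' \<in> I \<Longrightarrow> k \<subseteq> k' \<Longrightarrow> \<alpha> r k \<Longrightarrow> \<delta> r k' \<or> \<beta> r k' \<Longrightarrow> \<delta> r k"
    and inf: "infinite (UNIV :: ('v set, 'r) tok set)"
begin

text \<open>The letters of \<open>AN\<close>, \<open>AB\<close>, \<open>NM\<close>,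
  \<open>NN\<close> name the two kinds of tokens being related; only these relations vary.
  \<open>\<alpha>\<close> and \<open>\<beta>\<close> say which remaining simplices are comparable
  with the lower end \<open>Ta\<close> and the upper end \<open>Tb\<close> of a zigzag, and
  \<open>\<delta>\<close> serves both middle tokens.\<close>

fun ad :: "('v set \<Rightarrow> 'v set \<Rightarrow> bool) \<Rightarrow> ('v set \<Rightarrow> 'v set \<Rightarrow> bool) \<Rightarrow> ('v set \<Rightarrow> 'v set \<Rightarrow> bool) \<Rightarrow> ('v set \<Rightarrow> 'v set \<Rightarrow> bool) \<Rightarrow>
    ('v set, 'r) tok \<Rightarrow> ('v set, 'r) tok \<Rightarrow> bool" where
  "ad AN AB NM NN (Ta k) (Ta k') = (k \<subset> k')"
| "ad AN AB NM NN (Ta k) (Tm k') = (k \<subseteq> k')"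
| "ad AN AB NM NN (Ta k) (Tn k') = AN k k'"
| "ad AN AB NM NN (Ta k) (Tb k') = AB k k'"
| "ad AN AB NM NN (Tn k) (Tn k') = NN k k'"
| "ad AN AB NM NN (Tn k) (Tm k') = NM k k'"
| "ad AN AB NM NN (Tn k) (Tb k') = (k \<subseteq> k')"
| "ad AN AB NM NN (Tm k) (Tm k') = (k \<subset> k')"
| "ad AN AB NM NN (Tb k) (Tb k') = (k \<subset> k')"
| "ad AN AB NM NN (Tr r) (Ta k) = \<alpha> r k"
| "ad AN AB NM NN (Tr r) (Tn k) = \<delta> r k"
| "ad AN AB NM NN (Tr r) (Tm k) = \<delta> r k"
| "ad AN AB NM NN (Tr r) (Tb k) = \<beta> r k"
| "ad AN AB NM NN (Tr r) (Tr r') = \<rho> r r'"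
| "ad AN AB NM NN _ _ = False"

definition adj where
  "adj AN AB NM NN x y \<longleftrightarrow> ad AN AB NM NN x y \<or> ad AN AB NM NN y x"

lemma adj_sym: "adj AN AB NM NN x y \<Longrightarrow> adj AN AB NM NN y x"
  by (auto simp: adj_def)

definition toks where "toks J L = Ta ` I \<union> Tm ` J \<union> Tn ` L \<union> Tb ` I \<union> Tr ` Rs"

lemma in_toks [simp]: "Ta k \<in> toks J L \<longleftrightarrow> k \<in> I" "Tm k \<in> toks J L \<longleftrightarrow> k \<in> J" "Tn k \<in> toks J L \<longleftrightarrow> k \<in> L" "Tb k \<in> toks J L \<longleftrightarrow> k \<in> I"
  "Tr r \<in> toks J L \<longleftrightarrow> r \<in> Rs"
  by (auto simp: toks_def)

lemma finite_toks: "J \<subseteq> I \<Longrightarrow> L \<subseteq> I \<Longrightarrow> finite (toks J L)"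
  using fin finite_subset[of J I] finite_subset[of L I] by (simp add: toks_def)

text \<open>For \<open>k\<close> in \<open>P\<close> the middle tokens are gone, and
  \<open>Ta k\<close> lies directly below the tokens \<open>Tn\<close> and \<open>Tb\<close> of the
  faces above \<open>k\<close> that are still present. Outside \<open>P\<close> the relations are
  the original ones.\<close>

definition stage where
  "stage P = clq (toks (I - P) (I - P)) (adj (\<lambda>k k'. k \<in> P \<and> k \<subseteq> k') (\<lambda>k k'. k \<in> P \<and> k \<subseteq> k') (\<subseteq>) (\<subset>))"

text \<open>As \<open>k\<close> is minimal outside \<open>P\<close>, all smaller zigzags are
  contracted already. The remaining work is to remove \<open>Tm k\<close> and \<open>Tn k\<close>;
  between the two removals the edges that link \<open>Tn k\<close> to larger faces have to be handed
  over to \<open>Ta k\<close>.\<close>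

lemma contract:
  assumes P: "P \<subseteq> I" "\<And>k k'. k \<in> P \<Longrightarrow> k' \<in> I \<Longrightarrow> k' \<subseteq> k \<Longrightarrow> k' \<in> P"
    and k: "k \<in> I - P" "\<And>k'. k' \<in> I \<Longrightarrow> k' \<subset> k \<Longrightarrow> k' \<in> P"
  shows "sq (stage P) (stage (insert k P))"
proof -
  let ?J = "I - insert k P"
  let ?T = "{k' \<in> I. k \<subset> k'}"
  have PT: "k' \<notin> P" if "k \<subseteq> k'" for k' using P(2)[of k' k] that k(1) by blast
  define AN where "AN = (\<lambda>Q a b. a \<in> P \<and> a \<subseteq> b \<or> a = k \<and> (b = k \<or> b \<in> Q))"
  define NM where "NM = (\<lambda>Q a b. a \<subseteq> b \<and> \<not> (a = k \<and> b \<in> Q))"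
  define AB where "AB = (\<lambda>Q a b. a \<in> P \<and> a \<subseteq> b \<or> a = k \<and> b \<in> Q)"
  define NN where "NN = (\<lambda>Q a b. a \<subset> b \<and> \<not> (a = k \<and> b \<in> Q))"
  define G where "G = (\<lambda>Q2 Q3. clq (toks ?J (I - P)) (adj (AN Q2) (AB Q3) (NM Q2) (NN Q3)))"
  have fV: "finite (toks ?J (I - P))" by (rule finite_toks) auto
  \<comment> \<open>\<open>Tm k\<close> is the vertex that subdivides an edge from
    \<open>Ta k\<close> to \<open>Tn k\<close>.\<close>
  have 1: "sq (stage P) (G {} {})"
  proof -
    have V: "toks (I - P) (I - P) = insert (Tm k) (toks ?J (I - P))" using k by (auto simp: toks_def)
    show ?thesis
      unfolding stage_def G_def V
    proof (rule clq_weld[where x = "Ta k" and y = "Tn k"])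
      show "finite (toks ?J (I - P))" by (rule fV)
      fix p assume p: "p \<in> toks ?J (I - P)"
      show "adj (\<lambda>k k'. k \<in> P \<and> k \<subseteq> k') (\<lambda>k k'. k \<in> P \<and> k \<subseteq> k') (\<subseteq>) (\<subset>) (Tm k) p \<longleftrightarrow>
        p \<in> {Ta k, Tn k} \<or> adj (AN {}) (AB {}) (NM {}) (NN {}) p (Ta k) \<and> adj (AN {}) (AB {}) (NM {}) (NN {}) p (Tn k)"
        using p k(1) PT k(2) imp meet[of _ k k]
        by (cases p) (simp_all add: adj_def AN_def AB_def NM_def NN_def, (blast+)?)
      fix q assume "q \<in> toks ?J (I - P)" "p \<noteq> q"
      then show "adj (\<lambda>k k'. k \<in> P \<and> k \<subseteq> k') (\<lambda>k k'. k \<in> P \<and> k \<subseteq> k') (\<subseteq>) (\<subset>) p q \<longleftrightarrow>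
         adj (AN {}) (AB {}) (NM {}) (NN {}) p q \<and> {p, q} \<noteq> {Ta k, Tn k}"
        using p k(1) PT
        by (cases p; cases q) (simp_all add: adj_def AN_def AB_def NM_def NN_def doubleton_eq_iff, (blast+)?)
    qed (use k(1) in \<open>auto simp: adj_def AN_def\<close>)
  qed
  \<comment> \<open>The edge from \<open>Tn k\<close> to \<open>Tm k'\<close> is exchanged for one
    from \<open>Ta k\<close> to \<open>Tn k'\<close>. Taking \<open>k'\<close> in increasing order
    makes the common neighbours agree.\<close>
  have 2: "sq (G Q {}) (G (insert k' Q) {})"
    if Q: "Q \<subseteq> ?T" "k' \<in> ?T - Q" "\<And>l. l \<in> I \<Longrightarrow> k \<subset> l \<Longrightarrow> l \<subset> k' \<Longrightarrow> l \<in> Q" "\<And>l. l \<in> Q \<Longrightarrow> \<not> k' \<subset> l" for Q k'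
    unfolding G_def
  proof (rule clq_flip[OF inf fV, where x = "Tn k" and y = "Tm k'" and u = "Ta k" and v = "Tn k'"])
    have k': "k' \<in> I" "k \<subset> k'" "k' \<notin> P" using Q PT by auto
    show "Tn k \<in> toks ?J (I - P)" "Tm k' \<in> toks ?J (I - P)" "Ta k \<in> toks ?J (I - P)" "Tn k' \<in> toks ?J (I - P)" using k k' by auto
    show "adj (AN Q) (AB {}) (NM Q) (NN {}) (Tn k) (Tm k')" using k' Q by (auto simp: adj_def NM_def)
    show "\<not> adj (AN Q) (AB {}) (NM Q) (NN {}) (Ta k) (Tn k')" using k' Q k by (auto simp: adj_def AN_def)
    fix p assume p: "p \<in> toks ?J (I - P)"
    show "p \<in> {Tn k, Tm k'} \<or> adj (AN Q) (AB {}) (NM Q) (NN {}) p (Tn k) \<and> adj (AN Q) (AB {}) (NM Q) (NN {}) p (Tm k') \<longleftrightarrow>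
      p \<in> {Ta k, Tn k'} \<or> adj (AN (insert k' Q)) (AB {}) (NM (insert k' Q)) (NN {}) p (Ta k) \<and>
        adj (AN (insert k' Q)) (AB {}) (NM (insert k' Q)) (NN {}) p (Tn k')"
    proof (cases p)
      case (Ta l) then show ?thesis using p k(1) k(2)[of l] k' Q PT[of l] P(2) by (auto simp: adj_def AN_def NM_def NN_def AB_def)
    next
      case (Tm l) then show ?thesis using p k(1) k(2)[of l] k' Q by (auto simp: adj_def AN_def NM_def NN_def AB_def)
    next
      case (Tn l) then show ?thesis using p k(1) k(2)[of l] k' Q PT[of l] by (auto simp: adj_def AN_def NM_def NN_def AB_def)
    next
      case (Tb l) then show ?thesis using p k(1) k(2)[of l] k' Q by (auto simp: adj_def AN_def NM_def NN_def AB_def)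
    next
      case (Tr r)
      then have "r \<in> Rs" "k \<subseteq> k'" using p k' by auto
      then have "\<delta> r k \<and> \<delta> r k' \<longleftrightarrow> \<alpha> r k \<and> \<delta> r k'" using mono[of r k k'] imp[of r k] meet[of r k k'] k(1) k'(1) by blast
      then show ?thesis using Tr by (simp add: adj_def)
    qed
    fix q assume "q \<in> toks ?J (I - P)" "p \<noteq> q"
    then show "adj (AN (insert k' Q)) (AB {}) (NM (insert k' Q)) (NN {}) p q \<longleftrightarrow>
       adj (AN Q) (AB {}) (NM Q) (NN {}) p q \<and> {p, q} \<noteq> {Tn k, Tm k'} \<or> {p, q} = {Ta k, Tn k'}"
      using p k(1) k' Q(1,2)
      by (cases p; cases q) (simp_all add: adj_def AN_def AB_def NM_def NN_def doubleton_eq_iff, (blast+)?)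
  qed (use Q(2) in \<open>auto simp: adj_sym doubleton_eq_iff\<close>)
  \<comment> \<open>The edge from \<open>Tn k\<close> to \<open>Tn k'\<close> is exchanged for one
    from \<open>Ta k\<close> to \<open>Tb k'\<close>, this time with \<open>k'\<close> in decreasing
    order.\<close>
  have 3: "sq (G ?T Q) (G ?T (insert k' Q))"
    if Q: "Q \<subseteq> ?T" "k' \<in> ?T - Q" "\<And>l. l \<in> I \<Longrightarrow> k' \<subset> l \<Longrightarrow> l \<in> Q" "\<And>l. l \<in> Q \<Longrightarrow> \<not> l \<subset> k'" for Q k'
    unfolding G_def
  proof (rule clq_flip[OF inf fV, where x = "Tn k" and y = "Tn k'" and u = "Ta k" and v = "Tb k'"])
    have k': "k' \<in> I" "k \<subset> k'" "k' \<notin> P" using Q PT by auto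
    show "Tn k \<in> toks ?J (I - P)" "Tn k' \<in> toks ?J (I - P)" "Ta k \<in> toks ?J (I - P)" "Tb k' \<in> toks ?J (I - P)" using k k' by auto
    show "adj (AN ?T) (AB Q) (NM ?T) (NN Q) (Tn k) (Tn k')" using k' Q by (auto simp: adj_def NN_def)
    show "\<not> adj (AN ?T) (AB Q) (NM ?T) (NN Q) (Ta k) (Tb k')" using k' Q k by (auto simp: adj_def AB_def)
    fix p assume p: "p \<in> toks ?J (I - P)"
    show "p \<in> {Tn k, Tn k'} \<or> adj (AN ?T) (AB Q) (NM ?T) (NN Q) p (Tn k) \<and> adj (AN ?T) (AB Q) (NM ?T) (NN Q) p (Tn k') \<longleftrightarrow>
      p \<in> {Ta k, Tb k'} \<or> adj (AN ?T) (AB (insert k' Q)) (NM ?T) (NN (insert k' Q)) p (Ta k) \<and>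
        adj (AN ?T) (AB (insert k' Q)) (NM ?T) (NN (insert k' Q)) p (Tb k')"
    proof (cases p)
      case (Ta l) then show ?thesis using p k(1) k(2)[of l] k' Q PT[of l] P(2) by (auto simp: adj_def AN_def NM_def NN_def AB_def)
    next
      case (Tm l) then show ?thesis using p k(1) k(2)[of l] k' Q by (auto simp: adj_def AN_def NM_def NN_def AB_def)
    next
      case (Tn l) then show ?thesis using p k(1) k(2)[of l] k' Q PT[of l] by (auto simp: adj_def AN_def NM_def NN_def AB_def)
    next
      case (Tb l) then show ?thesis using p k(1) k(2)[of l] k' Q by (auto simp: adj_def AN_def NM_def NN_def AB_def)
    next
      case (Tr r)
      then have "r \<in> Rs" "k \<subseteq> k'" using p k' by auto
      then have "\<delta> r k \<and> \<delta> r k' \<longleftrightarrow> \<alpha> r k \<and> \<beta> r k'"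
        using mono[of r k k'] imp[of r k] imp[of r k'] meet[of r k k'] k(1) k'(1) by blast
      then show ?thesis using Tr by (simp add: adj_def)
    qed
    fix q assume "q \<in> toks ?J (I - P)" "p \<noteq> q"
    then show "adj (AN ?T) (AB (insert k' Q)) (NM ?T) (NN (insert k' Q)) p q \<longleftrightarrow>
       adj (AN ?T) (AB Q) (NM ?T) (NN Q) p q \<and> {p, q} \<noteq> {Tn k, Tn k'} \<or> {p, q} = {Ta k, Tb k'}"
      using p k(1) k' Q(1,2)
      by (cases p; cases q) (simp_all add: adj_def AN_def AB_def NM_def NN_def doubleton_eq_iff, (blast+)?)
  qed (use Q(2) in \<open>auto simp: adj_sym doubleton_eq_iff\<close>)
  \<comment> \<open>By now \<open>Tn k\<close> has the neighbours of a vertex that subdivides an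
    edge from \<open>Ta k\<close> to \<open>Tb k\<close>.\<close>
  have 4: "sq (G ?T ?T) (stage (insert k P))"
  proof -
    have V: "toks ?J (I - P) = insert (Tn k) (toks ?J ?J)" using k by (auto simp: toks_def)
    show ?thesis
      unfolding stage_def G_def V
    proof (rule clq_weld[where x = "Ta k" and y = "Tb k"])
      show "finite (toks ?J ?J)" by (rule finite_toks) auto
      fix p assume p: "p \<in> toks ?J ?J"
      show "adj (AN ?T) (AB ?T) (NM ?T) (NN ?T) (Tn k) p \<longleftrightarrow> p \<in> {Ta k, Tb k} \<or>
         adj (\<lambda>l k'. l \<in> insert k P \<and> l \<subseteq> k') (\<lambda>l k'. l \<in> insert k P \<and> l \<subseteq> k') (\<subseteq>) (\<subset>) p (Ta k) \<and>
         adj (\<lambda>l k'. l \<in> insert k P \<and> l \<subseteq> k') (\<lambda>l k'. l \<in> insert k P \<and> l \<subseteq> k') (\<subseteq>) (\<subset>) p (Tb k)"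
        using p k(1) PT k(2) imp meet[of _ k k]
        by (cases p) (simp_all add: adj_def AN_def AB_def NM_def NN_def, (blast+)?)
      fix q assume "q \<in> toks ?J ?J" "p \<noteq> q"
      then show "adj (AN ?T) (AB ?T) (NM ?T) (NN ?T) p q \<longleftrightarrow>
         adj (\<lambda>l k'. l \<in> insert k P \<and> l \<subseteq> k') (\<lambda>l k'. l \<in> insert k P \<and> l \<subseteq> k') (\<subseteq>) (\<subset>) p q \<and> {p, q} \<noteq> {Ta k, Tb k}"
        using p k(1) PT
        by (cases p; cases q) (simp_all add: adj_def AN_def AB_def NM_def NN_def doubleton_eq_iff, (blast+)?)
    qed (use k(1) in \<open>auto simp: adj_def\<close>)
  qed
  have fT: "finite ?T" using fin by simp
  have 5: "sq (G {} {}) (G ?T {})"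
  proof (rule lower_set_induct[OF fT, where P = "\<lambda>Q. sq (G {} {}) (G Q {})"])
    fix Q k' assume insert: "Q \<subseteq> ?T" "\<And>l m. l \<in> Q \<Longrightarrow> m \<in> ?T \<Longrightarrow> m \<subseteq> l \<Longrightarrow> m \<in> Q" "k' \<in> ?T - Q"
      "\<And>m. m \<in> ?T \<Longrightarrow> m \<subset> k' \<Longrightarrow> m \<in> Q" "sq (G {} {}) (G Q {})"
    have "sq (G Q {}) (G (insert k' Q) {})"
      by (rule 2[OF insert(1,3)]) (use insert in blast)+
    then show "sq (G {} {}) (G (insert k' Q) {})" by (rule sq_trans[OF insert(5)])
  qed simp
  have 6: "sq (G ?T {}) (G ?T ?T)"
  proof (rule upper_set_induct[OF fT, where P = "\<lambda>Q. sq (G ?T {}) (G ?T Q)"])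
    fix Q k' assume insert: "Q \<subseteq> ?T" "\<And>l m. l \<in> Q \<Longrightarrow> m \<in> ?T \<Longrightarrow> l \<subseteq> m \<Longrightarrow> m \<in> Q" "k' \<in> ?T - Q"
      "\<And>m. m \<in> ?T \<Longrightarrow> k' \<subset> m \<Longrightarrow> m \<in> Q" "sq (G ?T {}) (G ?T Q)"
    have "sq (G ?T Q) (G ?T (insert k' Q))"
      by (rule 3[OF insert(1,3)]) (use insert in blast)+
    then show "sq (G ?T {}) (G ?T (insert k' Q))" by (rule sq_trans[OF insert(5)])
  qed simp
  show ?thesis by (rule sq_trans[OF 1 sq_trans[OF 5 sq_trans[OF 6 4]]])
qed

lemma contract_all: "sq (stage {}) (stage I)"
proof (rule lower_set_induct[OF fin(1), where P = "\<lambda>P. sq (stage {}) (stage P)"])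
  fix P k assume P: "P \<subseteq> I" "\<And>l m. l \<in> P \<Longrightarrow> m \<in> I \<Longrightarrow> m \<subseteq> l \<Longrightarrow> m \<in> P" "k \<in> I - P"
    "\<And>m. m \<in> I \<Longrightarrow> m \<subset> k \<Longrightarrow> m \<in> P" "sq (stage {}) (stage P)"
  show "sq (stage {}) (stage (insert k P))" by (rule sq_trans[OF P(5) contract[OF P(1-4)]])
qed simp

end

section \<open>Order complexes of upper sets of simplices under labelled moves\<close>

definition ocp :: "'v set set \<Rightarrow> 'v set set set" where
  "ocp V = {C. C \<subseteq> V \<and> chain\<^sub>\<subseteq> C}"

text \<open>Order complexes are the clique complexes of comparability; this is the passage from
  tokens to simplices.\<close>

lemma ocp_image:
  assumes f: "inj_on f S" and R: "\<And>x y. x \<in> S \<Longrightarrow> y \<in> S \<Longrightarrow> Rl x y \<longleftrightarrow> f x \<subset> f y \<or> f y \<subset> f x"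
  shows "(`) f ` clq S Rl = ocp (f ` S)"
proof -
  have *: "chain\<^sub>\<subseteq> (f ` C) \<longleftrightarrow> (\<forall>x\<in>C. \<forall>y\<in>C. x \<noteq> y \<longrightarrow> Rl x y)" if C: "C \<subseteq> S" for C
  proof -
    have "f x \<subseteq> f y \<or> f y \<subseteq> f x \<longleftrightarrow> (x \<noteq> y \<longrightarrow> Rl x y)" if "x \<in> C" "y \<in> C" for x y
      using R[of x y] that C inj_onD[OF f, of x y] by (cases "x = y") (auto simp: less_le)
    then show ?thesis unfolding chain_subset_def by auto
  qed
  show ?thesis
  proof (intro equalityI subsetI)
    fix D assume "D \<in> (`) f ` clq S Rl"
    then show "D \<in> ocp (f ` S)" using * by (auto simp: clq_def ocp_def)
  next
    fix D assume "D \<in> ocp (f ` S)"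
    then obtain C where "C \<subseteq> S" "D = f ` C" "chain\<^sub>\<subseteq> D" by (auto simp: ocp_def subset_image_iff)
    then show "D \<in> (`) f ` clq S Rl" using *[of C] by (auto simp: clq_def)
  qed
qed

lemma sq_map:
  fixes f f' :: "'x \<Rightarrow> 'y"
  assumes "sq K L" "fam (\<lambda>_ :: unit. K)" "infinite (UNIV :: 'y set)" "inj_on f (\<Union>K)" "inj_on f' (\<Union>L)"
  shows "sq ((`) f ` K) ((`) f' ` L)"
proof -
  have "lseq (\<lambda>_. ()) (mapf f (\<lambda>_ :: unit. K)) (mapf f' (\<lambda>_. L))"
    using assms by (intro lseq_map[OF assms(1)[unfolded sq_def], where g = id]) (auto simp: rich_def verts_def)
  then show ?thesis by (simp add: sq_def mapf_def)
qed

lemma infinite_sets: "infinite (UNIV :: 'v set) \<Longrightarrow> infinite (UNIV :: 'v set set)"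
  by (simp add: Finite_Set.finite_set)

text \<open>After the move, the counterpart of the upper set \<open>V\<close> consists of the
  simplices that land in \<open>V\<close> when \<open>z\<close> is sent to \<open>i\<close>. Both
  posets are read off one set of tokens, as the first and the last stage of a contraction.\<close>

lemma ocp_edge_star:
  fixes K :: "'v set set"
  assumes inf: "infinite (UNIV :: 'v set)" and K: "fam (\<lambda>_ :: unit. K)" and ij: "{i, j} \<in> K" "i \<noteq> j" and z: "z \<notin> \<Union>K"
    and V: "V \<subseteq> K" "\<And>s t. s \<in> V \<Longrightarrow> t \<in> K \<Longrightarrow> s \<subseteq> t \<Longrightarrow> t \<in> V"
  shows "sq (ocp V) (ocp {t \<in> st {i, j} z K. (if z \<in> t then insert i (t - {z}) else t) \<in> V})" (is "sq _ (ocp ?V')")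
proof -
  have dc: "s \<in> K \<Longrightarrow> t \<subseteq> s \<Longrightarrow> t \<in> K" for s t using K down_closedD by (auto simp: fam_unit)
  have finK: "finite K" using K by (simp add: fam_unit)
  have zij: "z \<noteq> i" "z \<noteq> j" using ij z by auto
  \<comment> \<open>These are the places where the poset changes: the pair
    \<open>insert i k\<close>, \<open>insert i (insert j k)\<close> of \<open>V\<close> is replaced
    by a zigzag.\<close>
  define I where "I = {k. i \<notin> k \<and> j \<notin> k \<and> insert i (insert j k) \<in> K \<and> insert i k \<in> V}"
  \<comment> \<open>The simplices outside all zigzags. One that contains \<open>z\<close> but not
    \<open>j\<close> always belongs to a zigzag, so it does not occur here.\<close>
  define Rs where "Rs = {r \<in> ?V'. (z \<notin> r \<and> \<not> (i \<in> r \<and> r - {i} \<in> I)) \<or> (z \<in> r \<and> j \<in> r \<and> r - {z, j} \<notin> I)}"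
  have I: "i \<notin> k" "j \<notin> k" "z \<notin> k" "insert i (insert j k) \<in> K" "insert i k \<in> V" if "k \<in> I" for k
    using that z by (auto simp: I_def)
  have V'z: "t \<in> ?V' \<longleftrightarrow> \<not> {i, j} \<subseteq> t \<and> t \<in> V" if "z \<notin> t" for t using that V by (auto simp: in_st)
  have V'n: "t \<in> ?V' \<longleftrightarrow> \<not> {i, j} \<subseteq> t \<and> insert i (insert j (t - {z})) \<in> K \<and> insert i (t - {z}) \<in> V" if "z \<in> t" for t
    using that by (simp add: in_st)
  have zV: "z \<notin> t" if "t \<in> V" for t using that V z by blast
  have Rs0: "\<not> {i, j} \<subseteq> r" "r \<in> V" "i \<in> r \<Longrightarrow> r - {i} \<notin> I" if "r \<in> Rs" "z \<notin> r" for r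
    using that V'z[of r] by (auto simp: Rs_def)
  have Rs1: "i \<notin> r" "j \<in> r" "r - {z, j} \<notin> I" "insert i (r - {z}) \<in> V" "insert i (r - {z}) \<in> K" if "r \<in> Rs" "z \<in> r" for r
  proof -
    have r: "r \<in> ?V'" "j \<in> r" "r - {z, j} \<notin> I" using that by (auto simp: Rs_def)
    then show "i \<notin> r" "j \<in> r" "r - {z, j} \<notin> I" "insert i (r - {z}) \<in> V" "insert i (r - {z}) \<in> K"
      using V'n[OF that(2)] V by auto
  qed
  \<comment> \<open>If \<open>i\<close> were in \<open>r\<close>, then \<open>r - {i}\<close> would
    be an index and \<open>r\<close> the lower end of its zigzag.\<close>
  have F2: "i \<notin> r" if r: "r \<in> Rs" "z \<notin> r" and l: "insert i (insert j l) \<in> K" "r \<subseteq> insert i (insert j l)" for r l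
  proof
    assume "i \<in> r"
    then have "j \<notin> r" using Rs0[OF r] by auto
    then have "r - {i} \<in> I" unfolding I_def using Rs0(2)[OF r] \<open>i \<in> r\<close> dc[OF l(1), of "insert i (insert j (r - {i}))"] l(2)
      by (auto simp: insert_absorb)
    then show False using Rs0(3)[OF r \<open>i \<in> r\<close>] by simp
  qed
  have F1: "r \<subseteq> k" if r: "r \<in> Rs" "z \<notin> r" "k \<in> I" "r \<subseteq> insert i k" for r k
  proof -
    have "i \<notin> r" using F2[OF r(1,2) I(4)[OF r(3)]] r(4) by auto
    then show ?thesis using r(4) by auto
  qed
  \<comment> \<open>Otherwise \<open>r - {z, j}\<close> contains \<open>k\<close> and,
    \<open>V\<close> being an upper set, would be an index itself.\<close>
  have F3: "\<not> k \<subseteq> r" if r: "r \<in> Rs" "z \<in> r" and k: "k \<in> I" for r k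
  proof
    assume "k \<subseteq> r"
    then have "insert i k \<subseteq> insert i (r - {z, j})" using I[OF k] by auto
    moreover have "insert i (r - {z, j}) \<in> K" by (rule dc[OF Rs1(5)[OF r]]) auto
    ultimately have "insert i (r - {z, j}) \<in> V" using V(2)[OF I(5)[OF k]] by blast
    moreover have "insert j (r - {z, j}) = r - {z}" using Rs1(2)[OF r] zij by auto
    then have "insert i (insert j (r - {z, j})) \<in> K" using Rs1(5)[OF r] by simp
    ultimately have "r - {z, j} \<in> I" using Rs1(1)[OF r] by (simp add: I_def)
    then show False using Rs1(3)[OF r] by simp
  qed
  define al where "al = (\<lambda>r k. r \<subset> insert i k \<or> insert i k \<subset> r)"
  define be where "be = (\<lambda>r k. r \<subset> insert z (insert j k) \<or> insert z (insert j k) \<subset> r)"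
  have "inj (Ta :: 'v set \<Rightarrow> ('v set, 'v set) tok)" by (auto simp: inj_def)
  then have inft: "infinite (UNIV :: ('v set, 'v set) tok set)"
    using infinite_sets[OF inf] by (metis finite_imageD finite_subset subset_UNIV)
  interpret zigzag I Rs al "(\<subseteq>)" be "(\<subset>)"
  proof
    have "I \<subseteq> (\<lambda>s. s - {i}) ` K"
    proof
      fix k assume "k \<in> I"
      then have "k = insert i k - {i}" "insert i k \<in> K" using I V by blast+
      then show "k \<in> (\<lambda>s. s - {i}) ` K" by (rule image_eqI)
    qed
    then show "finite I" using finK finite_surj by blast
    have "fam (sts {i, j} z (\<lambda>_ :: unit. K))" by (rule fam_sts[OF K])
    then have "finite (st {i, j} z K)" unfolding sts_def fam_unit by blast
    then show "finite Rs" unfolding Rs_def by simp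
    show "infinite (UNIV :: ('v set, 'v set) tok set)" by (rule inft)
    fix r k assume r: "r \<in> Rs" and k: "k \<in> I"
    { assume "r \<subseteq> k" then show "al r k \<and> be r k" using I[OF k] unfolding al_def be_def by blast }
    fix k' assume k': "k' \<in> I" and kk: "k \<subseteq> k'"
    { assume "r \<subseteq> k" then show "r \<subseteq> k'" using kk by blast }
    assume a: "al r k" "r \<subseteq> k' \<or> be r k'"
    show "r \<subseteq> k"
    proof (cases "z \<in> r")
      case True
      then show ?thesis using a Rs1[OF r True] I[OF k] unfolding al_def using zij by blast
    next
      case False
      have "i \<notin> r" using a(2) False I[OF k'] zij ij(2) unfolding be_def by blast
      then show ?thesis using a(1) unfolding al_def by blast
    qed
  qed
  \<comment> \<open>\<open>f0\<close> reads the tokens in the starred complex, \<open>f1\<close> in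
    the original one, where \<open>i\<close> takes the place of \<open>z\<close> in a remaining
    simplex and \<open>Tb k\<close> is the upper member of the pair.\<close>
  define f0 where "f0 = case_tok (insert i) (\<lambda>k. insert z (insert i k)) (insert z) (\<lambda>k. insert z (insert j k)) (\<lambda>r. r)"
  define f1 where "f1 = case_tok (insert i) (\<lambda>k. insert z (insert i k)) (insert z) (\<lambda>k. insert i (insert j k)) (\<lambda>r. if z \<in> r then insert i (r - {z}) else r)"
  have [simp]: "f0 (Ta k) = insert i k" "f0 (Tm k) = insert z (insert i k)" "f0 (Tn k) = insert z k" "f0 (Tb k) = insert z (insert j k)" "f0 (Tr r) = r" for k r
    by (simp_all add: f0_def)
  have f1A: "f1 (Ta k) = insert i k" and f1B: "f1 (Tb k) = insert i (insert j k)" and f1s [simp]: "f1 (Tr r) = (if z \<in> r then insert i (r - {z}) else r)" for k r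
    by (simp_all add: f1_def)
  note [simp] = f1A f1B
  have nn: "i \<noteq> j" "j \<noteq> i" "z \<noteq> i" "z \<noteq> j" "i \<noteq> z" "j \<noteq> z" using ij zij by auto
  have e1: "r \<subset> insert z k \<or> insert z k \<subset> r \<longleftrightarrow> r \<subseteq> k" if r: "r \<in> Rs" and k: "k \<in> I" for r k
  proof (cases "z \<in> r")
    case True
    then show ?thesis using Rs1[OF r True] F3[OF r True k] I[OF k] nn by blast
  qed (use I[OF k] in blast)
  have e2: "r \<subset> insert z (insert i k) \<or> insert z (insert i k) \<subset> r \<longleftrightarrow> r \<subseteq> k" if r: "r \<in> Rs" and k: "k \<in> I" for r k
  proof (cases "z \<in> r")
    case True
    then show ?thesis using Rs1[OF r True] I[OF k] nn by blast
  next
    case False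
    then show ?thesis using F1[OF r False k] I[OF k] by blast
  qed
  have e3: "f1 (Tr r) \<subset> insert i k \<or> insert i k \<subset> f1 (Tr r) \<longleftrightarrow> al r k" if r: "r \<in> Rs" and k: "k \<in> I" for r k
  proof (cases "z \<in> r")
    case True
    have "\<not> al r k" using Rs1[OF r True] I[OF k] nn True unfolding al_def by blast
    moreover have "\<not> k \<subseteq> insert i (r - {z})" using F3[OF r True k] I[OF k] by blast
    moreover have "\<not> insert i (r - {z}) \<subseteq> insert i k" using Rs1[OF r True] I[OF k] nn by blast
    ultimately show ?thesis using True by auto
  qed (simp add: al_def)
  have e4: "f1 (Tr r) \<subset> insert i (insert j k) \<or> insert i (insert j k) \<subset> f1 (Tr r) \<longleftrightarrow> be r k" if r: "r \<in> Rs" and k: "k \<in> I" for r k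
  proof (cases "z \<in> r")
    case True
    have "insert i (r - {z}) \<subseteq> insert i (insert j k) \<longleftrightarrow> r \<subseteq> insert z (insert j k)"
      "insert i (insert j k) \<subseteq> insert i (r - {z}) \<longleftrightarrow> insert z (insert j k) \<subseteq> r"
      using Rs1[OF r True] I[OF k] nn True by blast+
    then show ?thesis using True by (simp add: be_def less_le_not_le)
  next
    case False
    have "r \<subseteq> insert i (insert j k) \<longleftrightarrow> r \<subseteq> insert z (insert j k)"
      using F2[OF r False I(4)[OF k]] False nn I[OF k] by blast
    moreover have "\<not> insert i (insert j k) \<subseteq> r" using Rs0(1)[OF r False] by blast
    moreover have "\<not> insert z (insert j k) \<subseteq> r" using False by blast
    ultimately show ?thesis using False by (auto simp: be_def less_le_not_le)
  qed
  have e5': "f1 (Tr r') \<subset> f1 (Tr r) \<longleftrightarrow> r' \<subset> r" if r: "r \<in> Rs" and r': "r' \<in> Rs" for r r'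
  proof (cases "z \<in> r")
    case zr: True
    show ?thesis
    proof (cases "z \<in> r'")
      case True
      then show ?thesis using zr Rs1[OF r zr] Rs1[OF r' True] nn by auto
    next
      case False
      have K: "insert i (insert j (r - {z})) \<in> K" using Rs1[OF r zr] nn by (simp add: insert_absorb)
      have "i \<notin> r'" if "r' \<subseteq> insert i (r - {z})" using F2[OF r' False K] that by blast
      then show ?thesis using zr False Rs1[OF r zr] by auto
    qed
  next
    case zr: False
    show ?thesis
    proof (cases "z \<in> r'")
      case True
      then show ?thesis using zr Rs1[OF r' True] Rs0[OF r zr] nn by auto
    qed (use zr in simp)
  qed
  have im0: "f0 ` toks (I - {}) (I - {}) = ?V'"
  proof (intro equalityI subsetI)
    fix t assume "t \<in> f0 ` toks (I - {}) (I - {})"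
    then obtain x where x: "x \<in> toks I I" "t = f0 x" by auto
    show "t \<in> ?V'"
    proof (cases x)
      case (Ta k)
      then have k: "k \<in> I" using x by simp
      have "z \<notin> t" using x Ta I[OF k] nn by simp
      then show ?thesis using V'z[of t] x Ta I[OF k] nn by auto
    next
      case (Tm k)
      then have k: "k \<in> I" using x by simp
      have t: "t - {z} = insert i k" "z \<in> t" using x Tm I[OF k] nn by auto
      show ?thesis unfolding V'n[OF t(2)] t(1) using x Tm I[OF k] nn by (simp add: insert_commute[of j i])
    next
      case (Tn k)
      then have k: "k \<in> I" using x by simp
      have t: "t - {z} = k" "z \<in> t" using x Tn I[OF k] nn by auto
      show ?thesis unfolding V'n[OF t(2)] t(1) using x Tn I[OF k] nn by simp
    next
      case (Tb k)
      then have k: "k \<in> I" using x by simp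
      have t: "t - {z} = insert j k" "z \<in> t" using x Tb I[OF k] nn by auto
      have "insert i (insert j k) \<in> V" using V(2)[OF I(5)[OF k] I(4)[OF k]] by blast
      then show ?thesis unfolding V'n[OF t(2)] t(1) using x Tb I[OF k] nn by simp
    next
      case (Tr r)
      then have "r \<in> Rs" using x by simp
      then have "r \<in> ?V'" unfolding Rs_def by blast
      then show ?thesis using x Tr by simp
    qed
  next
    fix t assume t: "t \<in> ?V'"
    have "\<exists>x\<in>toks I I. t = f0 x"
    proof (cases "t \<in> Rs")
      case True
      then show ?thesis by (intro bexI[of _ "Tr t"]) auto
    next
      case nR: False
      show ?thesis
      proof (cases "z \<in> t")
        case False
        then have "i \<in> t" "t - {i} \<in> I" using nR t by (auto simp: Rs_def)
        then show ?thesis by (intro bexI[of _ "Ta (t - {i})"]) auto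
      next
        case zt: True
        have t': "\<not> {i, j} \<subseteq> t" "insert i (insert j (t - {z})) \<in> K" "insert i (t - {z}) \<in> V" using t V'n[OF zt] by auto
        show ?thesis
        proof (cases "j \<in> t")
          case True
          then have "t - {z, j} \<in> I" using nR t zt by (auto simp: Rs_def)
          moreover have "t = insert z (insert j (t - {z, j}))" using zt True by auto
          ultimately show ?thesis by (intro bexI[of _ "Tb (t - {z, j})"]) simp_all
        next
          case False
          have "t - {z, i} \<in> I"
          proof -
            have "insert i (t - {z, i}) = insert i (t - {z})" "insert i (insert j (t - {z, i})) = insert i (insert j (t - {z}))" by auto
            then show ?thesis using False t' unfolding I_def by simp
          qed
          moreover have "t = insert z (insert i (t - {z, i}))" if "i \<in> t" using zt that by auto
          moreover have "t = insert z (t - {z, i})" if "i \<notin> t" using zt that by auto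
          ultimately show ?thesis
            by (cases "i \<in> t") (force intro: bexI[of _ "Tm (t - {z, i})"] bexI[of _ "Tn (t - {z, i})"])+
        qed
      qed
    qed
    then show "t \<in> f0 ` toks (I - {}) (I - {})" by auto
  qed
  have im1: "f1 ` toks (I - I) (I - I) = V"
  proof (intro equalityI subsetI)
    fix t assume "t \<in> f1 ` toks (I - I) (I - I)"
    then obtain x where x: "x \<in> toks {} {}" "t = f1 x" by auto
    show "t \<in> V"
    proof (cases x)
      case (Ta k) then show ?thesis using x I by simp
    next
      case (Tb k)
      then have k: "k \<in> I" using x by simp
      then have "insert i (insert j k) \<in> V" using V(2)[OF I(5)[OF k] I(4)[OF k]] by blast
      then show ?thesis using x Tb by simp
    next
      case (Tr r) then show ?thesis using x Rs0(2) Rs1(4) by simp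
    qed (use x in simp_all)
  next
    fix t assume t: "t \<in> V"
    have zt: "z \<notin> t" by (rule zV[OF t])
    have "\<exists>x\<in>toks {} {}. t = f1 x"
    proof (cases "{i, j} \<subseteq> t")
      case True
      define k where "k = t - {i, j}"
      have tk: "t = insert i (insert j k)" using True by (auto simp: k_def)
      show ?thesis
      proof (cases "k \<in> I")
        case True then show ?thesis using tk by (intro bexI[of _ "Tb k"]) simp_all
      next
        case False
        \<comment> \<open>A simplex on the edge that is not the top of a pair comes from the
          remaining simplex with \<open>z\<close> in place of \<open>i\<close>.\<close>
        define r where "r = insert z (t - {i})"
        have r: "z \<in> r" "j \<in> r" "i \<notin> r" "r - {z, j} = k" "r - {z} = t - {i}" using True zt nn by (auto simp: r_def k_def)
        have tt: "insert i (t - {i}) = t" "insert i (insert j (t - {i})) = t" using True nn by auto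
        have "r \<in> ?V'" unfolding V'n[OF r(1)] r(5) tt using r t V by auto
        then have "r \<in> Rs" using r False by (simp add: Rs_def)
        moreover have "f1 (Tr r) = t" using r tt by simp
        ultimately show ?thesis by (intro bexI[of _ "Tr r"]) simp_all
      qed
    next
      case False
      then have tV: "t \<in> ?V'" using V'z[OF zt] t by simp
      show ?thesis
      proof (cases "i \<in> t \<and> t - {i} \<in> I")
        case True then show ?thesis by (intro bexI[of _ "Ta (t - {i})"]) auto
      next
        case False
        then have "t \<in> Rs" using tV zt by (auto simp: Rs_def)
        then show ?thesis using zt by (intro bexI[of _ "Tr t"]) simp_all
      qed
    qed
    then show "t \<in> f1 ` toks (I - I) (I - I)" by auto
  qed
  have sub: "insert x k \<subset> insert x k' \<longleftrightarrow> k \<subset> k'" "insert x k \<subseteq> insert x k' \<longleftrightarrow> k \<subseteq> k'" "insert x k = insert x k' \<longleftrightarrow> k = k'"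
    if "x \<notin> k" "x \<notin> k'" for x :: 'v and k k'
    using that by (auto simp: less_le_not_le subset_insert)
  have in0: "x = y" if xy: "x \<in> toks I I" "y \<in> toks I I" "f0 x = f0 y" for x y
  proof -
    have ra: "r \<noteq> insert i k" if "r \<in> Rs" "k \<in> I" for r k using Rs0(3)[OF that(1)] I[OF that(2)] that nn by auto
    have rm: "r \<noteq> insert z (insert i k)" if "r \<in> Rs" for r k using Rs1(1)[OF that] by auto
    have rn: "r \<noteq> insert z k" if "r \<in> Rs" "k \<in> I" for r k using Rs1(2)[OF that(1)] I[OF that(2)] nn by auto
    have rb: "r \<noteq> insert z (insert j k)" if "r \<in> Rs" "k \<in> I" for r k
    proof
      assume r: "r = insert z (insert j k)"
      then have "r - {z, j} = k" using I[OF that(2)] by auto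
      then show False using Rs1(3)[OF that(1)] r that(2) by auto
    qed
    have di: "insert i k \<noteq> insert z (insert i k')" "insert i k \<noteq> insert z k'" "insert i k \<noteq> insert z (insert j k')"
      "insert z (insert i k) \<noteq> insert z k'" "insert z (insert i k) \<noteq> insert z (insert j k')" "insert z k \<noteq> insert z (insert j k')"
      if "k \<in> I" "k' \<in> I" for k k' using I[OF that(1)] I[OF that(2)] nn by blast+
    have eq: "insert i k = insert i k' \<Longrightarrow> k = k'" "insert z (insert i k) = insert z (insert i k') \<Longrightarrow> k = k'"
      "insert z k = insert z k' \<Longrightarrow> k = k'" "insert z (insert j k) = insert z (insert j k') \<Longrightarrow> k = k'"
      if "k \<in> I" "k' \<in> I" for k k' using I[OF that(1)] I[OF that(2)] nn by (simp_all add: sub)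
    note ne = ra rm rn rb di ra[symmetric] rm[symmetric] rn[symmetric] rb[symmetric] di[symmetric]
    show ?thesis using xy by (cases x; cases y) (simp_all add: ne eq)
  qed
  have in1: "x = y" if xy: "x \<in> toks {} {}" "y \<in> toks {} {}" "f1 x = f1 y" for x y
  proof -
    have ra: "f1 (Tr r) \<noteq> insert i k" if "r \<in> Rs" "k \<in> I" for r k
    proof (cases "z \<in> r")
      case True then show ?thesis using Rs1(2)[OF that(1) True] I[OF that(2)] nn by auto
    next
      case False then show ?thesis using Rs0(3)[OF that(1)] I[OF that(2)] that by auto
    qed
    have rb: "f1 (Tr r) \<noteq> insert i (insert j k)" if "r \<in> Rs" "k \<in> I" for r k
    proof (cases "z \<in> r")
      case True
      show ?thesis
      proof
        assume "f1 (Tr r) = insert i (insert j k)"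
        then have "insert i (r - {z}) = insert i (insert j k)" using True by simp
        then have "r - {z} = insert j k" using Rs1(1)[OF that(1) True] I[OF that(2)] nn by (subst (asm) sub(3)) auto
        then have "r - {z, j} = k" using I[OF that(2)] by auto
        then show False using Rs1(3)[OF that(1) True] that by simp
      qed
    next
      case False then show ?thesis using Rs0(1)[OF that(1) False] by auto
    qed
    have rr: "r = r'" if "r \<in> Rs" "r' \<in> Rs" "f1 (Tr r) = f1 (Tr r')" for r r'
    proof -
      have mixed: False if "r \<in> Rs" "r' \<in> Rs" "f1 (Tr r) = f1 (Tr r')" "z \<in> r" "z \<notin> r'" for r r'
      proof -
        have "r' = insert i (r - {z})" using that by simp
        then show False using Rs0(1)[OF that(2,5)] Rs1(2)[OF that(1,4)] nn by auto
      qed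
      show ?thesis
      proof (cases "z \<in> r")
        case zr: True
        then have zr': "z \<in> r'" using mixed that by blast
        then have "r - {z} = r' - {z}" using that(3) zr Rs1(1)[OF that(1) zr] Rs1(1)[OF that(2) zr'] by (subst sub(3)[symmetric, of i]) auto
        then show ?thesis using zr zr' by blast
      next
        case zr: False
        then have "z \<notin> r'" using mixed[OF that(2,1) that(3)[symmetric]] by blast
        then show ?thesis using that(3) zr by simp
      qed
    qed
    have di: "insert i k \<noteq> insert i (insert j k')" if "k \<in> I" "k' \<in> I" for k k' using I[OF that(1)] I[OF that(2)] nn by blast
    have eq: "insert i k = insert i k' \<Longrightarrow> k = k'" "insert i (insert j k) = insert i (insert j k') \<Longrightarrow> k = k'"
      if "k \<in> I" "k' \<in> I" for k k' using I[OF that(1)] I[OF that(2)] nn by (simp_all add: sub)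
    note ne = ra rb di ra[symmetric] rb[symmetric] di[symmetric]
    show ?thesis using xy by (cases x; cases y) (simp_all add: ne eq rr del: f1s)
  qed
  let ?a0 = "adj (\<lambda>k k'. k \<in> {} \<and> k \<subseteq> k') (\<lambda>k k'. k \<in> {} \<and> k \<subseteq> k') (\<subseteq>) (\<subset>)"
  let ?a1 = "adj (\<lambda>k k'. k \<in> I \<and> k \<subseteq> k') (\<lambda>k k'. k \<in> I \<and> k \<subseteq> k') (\<subseteq>) (\<subset>)"
  have ad0: "?a0 x y \<longleftrightarrow> f0 x \<subset> f0 y \<or> f0 y \<subset> f0 x" if xy: "x \<in> toks I I" "y \<in> toks I I" for x y
  proof -
    have same: "insert i k \<subset> insert i k' \<longleftrightarrow> k \<subset> k'" "insert z (insert i k) \<subset> insert z (insert i k') \<longleftrightarrow> k \<subset> k'"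
      "insert z k \<subset> insert z k' \<longleftrightarrow> k \<subset> k'" "insert z (insert j k) \<subset> insert z (insert j k') \<longleftrightarrow> k \<subset> k'"
      "insert i k \<subset> insert z (insert i k') \<longleftrightarrow> k \<subseteq> k'" "\<not> insert z (insert i k) \<subset> insert i k'"
      "\<not> insert i k \<subset> insert z k'" "\<not> insert z k \<subset> insert i k'"
      "\<not> insert i k \<subset> insert z (insert j k')" "\<not> insert z (insert j k) \<subset> insert i k'"
      "insert z k \<subset> insert z (insert i k') \<longleftrightarrow> k \<subseteq> k'" "\<not> insert z (insert i k) \<subset> insert z k'"
      "insert z k \<subset> insert z (insert j k') \<longleftrightarrow> k \<subseteq> k'" "\<not> insert z (insert j k) \<subset> insert z k'"
      "\<not> insert z (insert i k) \<subset> insert z (insert j k')" "\<not> insert z (insert j k) \<subset> insert z (insert i k')"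
      if "k \<in> I" "k' \<in> I" for k k' using I(1-3)[OF that(1)] I(1-3)[OF that(2)] nn by (simp_all add: less_le_not_le subset_insert)
    have com: "insert z k \<subset> r \<or> r \<subset> insert z k \<longleftrightarrow> r \<subseteq> k" "insert z (insert i k) \<subset> r \<or> r \<subset> insert z (insert i k) \<longleftrightarrow> r \<subseteq> k"
      if "r \<in> Rs" "k \<in> I" for r k using e1[OF that] e2[OF that] by argo+
    have ab: "r \<subset> insert i k \<or> insert i k \<subset> r \<longleftrightarrow> al r k" "insert i k \<subset> r \<or> r \<subset> insert i k \<longleftrightarrow> al r k"
      "r \<subset> insert z (insert j k) \<or> insert z (insert j k) \<subset> r \<longleftrightarrow> be r k"
      "insert z (insert j k) \<subset> r \<or> r \<subset> insert z (insert j k) \<longleftrightarrow> be r k" for r k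
      unfolding al_def be_def by blast+
    show ?thesis using xy
      by (cases x; cases y) (simp_all add: adj_def same e1 e2 com ab)
  qed
  have ad1: "?a1 x y \<longleftrightarrow> f1 x \<subset> f1 y \<or> f1 y \<subset> f1 x" if xy: "x \<in> toks {} {}" "y \<in> toks {} {}" for x y
  proof -
    have same: "insert i k \<subset> insert i k' \<longleftrightarrow> k \<subset> k'" "insert i (insert j k) \<subset> insert i (insert j k') \<longleftrightarrow> k \<subset> k'"
      "insert i k \<subset> insert i (insert j k') \<longleftrightarrow> k \<subseteq> k'" "\<not> insert i (insert j k) \<subset> insert i k'"
      if "k \<in> I" "k' \<in> I" for k k' using I(1-3)[OF that(1)] I(1-3)[OF that(2)] nn by (simp_all add: less_le_not_le subset_insert)
    have com: "insert i k \<subset> f1 (Tr r) \<or> f1 (Tr r) \<subset> insert i k \<longleftrightarrow> al r k"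
      "insert i (insert j k) \<subset> f1 (Tr r) \<or> f1 (Tr r) \<subset> insert i (insert j k) \<longleftrightarrow> be r k"
      if "r \<in> Rs" "k \<in> I" for r k using e3[OF that] e4[OF that] by argo+
    show ?thesis using xy
      by (cases x; cases y) (simp_all add: adj_def same e3 e4 com e5' f1A f1B del: f1s)
  qed
  have "(`) f0 ` stage {} = ocp ?V'"
    unfolding stage_def im0[symmetric] using in0 ad0 by (intro ocp_image) (auto simp: inj_on_def)
  moreover have "(`) f1 ` stage I = ocp V"
    unfolding stage_def im1[symmetric] using in1 ad1 by (intro ocp_image) (auto simp: inj_on_def)
  moreover have "sq ((`) f0 ` stage {}) ((`) f1 ` stage I)"
  proof (rule sq_map[OF contract_all _ infinite_sets[OF assms(1)], where f = f0 and f' = f1])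
    show "fam (\<lambda>_ :: unit. stage {})" unfolding stage_def by (intro fam_clq finite_toks) auto
    have "inj_on f0 (toks I I)" "inj_on f1 (toks {} {})" using in0 in1 by (simp_all add: inj_on_def)
    then show "inj_on f0 (\<Union>(stage {}))" "inj_on f1 (\<Union>(stage I))"
      by (auto intro: inj_on_subset simp: stage_def clq_def)
  qed
  ultimately show ?thesis using sq_sym by metis
qed

lemma fam_ocp: "finite V \<Longrightarrow> fam (\<lambda>_ :: unit. ocp V)"
  unfolding fam_unit ocp_def down_closed_def chain_subset_def
  by (auto intro: finite_subset[of _ "Pow V"] finite_subset[of _ V])

text \<open>The simplices carrying given labels form an upper set, and sending the new vertex to
  \<open>i\<close> does not change labels; so \<open>ocp_edge_star\<close> applies. For
  \<open>i = j\<close> the move only renames a vertex.\<close>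

lemma ocp_lseq_step:
  fixes lab :: "'v \<Rightarrow> 'l"
  assumes inf: "infinite (UNIV :: 'v set)" and Y: "fam Y" and z: "z \<notin> verts Y" "lab z = lab i"
  shows "sq (ocp {t \<in> Y X. s \<subseteq> lab ` t}) (ocp {t \<in> sts {i, j} z Y X. s \<subseteq> lab ` t})"
proof -
  let ?K = "Y X" let ?W = "{t \<in> Y X. s \<subseteq> lab ` t}"
  have fK: "fam (\<lambda>_ :: unit. ?K)"
    using Y finite_subset[OF in_simps[of Y X]] in_simps[of Y X] by (auto simp: fam_def)
  have zK: "z \<notin> \<Union>?K" using z in_simps[of Y X] by (auto simp: verts_def)
  have dc: "down_closed ?K" using Y by (rule fam_down_closed)
  consider "{i, j} \<notin> ?K" | "{i, j} \<in> ?K" "i \<noteq> j" | "{i, j} \<in> ?K" "i = j" by blast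
  then show ?thesis
  proof cases
    case 1
    then have "sts {i, j} z Y X = ?K" unfolding sts_def by (intro st_noop dc zK)
    then show ?thesis by simp
  next
    case 2
    have "sq (ocp ?W) (ocp {t \<in> st {i, j} z ?K. (if z \<in> t then insert i (t - {z}) else t) \<in> ?W})"
      by (rule ocp_edge_star[OF inf fK 2 zK]) blast+
    moreover have "{t \<in> st {i, j} z ?K. (if z \<in> t then insert i (t - {z}) else t) \<in> ?W} = {t \<in> st {i, j} z ?K. s \<subseteq> lab ` t}"
    proof -
      have "(if z \<in> t then insert i (t - {z}) else t) \<in> ?W \<longleftrightarrow> s \<subseteq> lab ` t" if t: "t \<in> st {i, j} z ?K" for t
      proof (cases "z \<in> t")
        case True
        have "insert i (t - {z}) \<in> ?K"
          by (rule down_closedD[OF dc, of "t - {z} \<union> {i, j}"]) (use t True in \<open>auto simp: in_st\<close>)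
        moreover have "lab ` insert i (t - {z}) = lab ` t" using z(2) True by (metis image_insert insert_Diff)
        ultimately show ?thesis using True by simp
      qed (use t in \<open>simp add: in_st\<close>)
      then show ?thesis by blast
    qed
    ultimately show ?thesis by (simp add: sts_def)
  next
    case 3
    let ?g = "id(i := z)"
    have inj: "inj_on ?g (\<Union>?K)" using zK by (auto simp: inj_on_def)
    have iV: "i \<in> verts Y" using 3 in_simps[of Y X] by (auto simp: verts_def)
    have st: "sts {i, j} z Y X = (`) ?g ` ?K" using sts_vertex[OF iV z(1)] 3 by (simp add: mapf_def)
    have labg: "lab ` ?g ` t = lab ` t" for t
    proof -
      have "lab (?g v) = lab v" for v using z(2) by simp
      then show ?thesis unfolding image_image by simp
    qed
    have W: "{t \<in> sts {i, j} z Y X. s \<subseteq> lab ` t} = (`) ?g ` ?W" 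
    proof (intro equalityI subsetI)
      fix t assume t: "t \<in> {t \<in> sts {i, j} z Y X. s \<subseteq> lab ` t}"
      then obtain u where u: "u \<in> ?K" "t = ?g ` u" unfolding st by blast
      then have "u \<in> ?W" using t labg[of u] by simp
      then show "t \<in> (`) ?g ` ?W" using u(2) by blast
    next
      fix t assume "t \<in> (`) ?g ` ?W"
      then obtain u where u: "u \<in> ?W" "t = ?g ` u" by blast
      then show "t \<in> {t \<in> sts {i, j} z Y X. s \<subseteq> lab ` t}" unfolding st using labg[of u] by simp
    qed
    have inj2: "inj_on ((`) ?g) ?W" using inj_on_image_Pow[OF inj] by (rule inj_on_subset) auto
    have ss: "t \<subseteq> u \<longleftrightarrow> ?g ` t \<subseteq> ?g ` u" if "t \<in> ?W" "u \<in> ?W" for t u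
    proof -
      have "t \<subseteq> u" if "?g ` t \<subseteq> ?g ` u"
      proof
        fix x assume x: "x \<in> t"
        then have "?g x \<in> ?g ` u" using that by blast
        then show "x \<in> u" using inj_on_image_mem_iff[OF inj, of x u] x \<open>t \<in> ?W\<close> \<open>u \<in> ?W\<close> by blast
      qed
      then show ?thesis by blast
    qed
    have "ocp ((`) ?g ` ?W) = (`) ((`) ?g) ` clq ?W (\<lambda>t u. ?g ` t \<subset> ?g ` u \<or> ?g ` u \<subset> ?g ` t)"
      by (rule ocp_image[symmetric, OF inj2]) simp
    moreover have "ocp ?W = (`) id ` clq ?W (\<lambda>t u. ?g ` t \<subset> ?g ` u \<or> ?g ` u \<subset> ?g ` t)"
      using ocp_image[of id ?W "\<lambda>t u. ?g ` t \<subset> ?g ` u \<or> ?g ` u \<subset> ?g ` t"] ss by (simp add: less_le_not_le)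
    moreover have "sq ((`) id ` clq ?W (\<lambda>t u. ?g ` t \<subset> ?g ` u \<or> ?g ` u \<subset> ?g ` t))
        ((`) ((`) ?g) ` clq ?W (\<lambda>t u. ?g ` t \<subset> ?g ` u \<or> ?g ` u \<subset> ?g ` t))"
    proof (rule sq_map[OF sq_refl fam_clq infinite_sets[OF inf], where f = id and f' = "(`) ?g"])
      show "finite ?W" using fK by (simp add: fam_unit)
      show "inj_on ((`) ?g) (\<Union>(clq ?W (\<lambda>t u. ?g ` t \<subset> ?g ` u \<or> ?g ` u \<subset> ?g ` t)))"
        by (rule inj_on_subset[OF inj2]) (auto simp: clq_def)
    qed simp
    ultimately show ?thesis unfolding W by simp
  qed
qed

text \<open>Invariance of dual cells, for each member of the family: the flags of simplices whose
  labels contain \<open>s\<close> are what becomes a dual cell of the vertex map.\<close>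

lemma ocp_lseq:
  fixes lab :: "'v \<Rightarrow> 'l"
  assumes "infinite (UNIV :: 'v set)" "lseq lab Z Z'"
  shows "sq (ocp {t \<in> Z X. s \<subseteq> lab ` t}) (ocp {t \<in> Z' X. s \<subseteq> lab ` t})"
  using assms(2)
proof (induction rule: lseq_induct)
  case (star Y i j z)
  then show ?case using ocp_lseq_step[OF assms(1) star(1,3,4)] sq_trans by blast
next
  case (weld Y i j z)
  then show ?case using ocp_lseq_step[OF assms(1) weld(1,3,4)] sq_trans sq_sym by blast
qed simp

section \<open>Counting simplices: links and the boundary\<close>

abbreviation fam1 :: "'v set set \<Rightarrow> bool" where
  "fam1 K \<equiv> fam (\<lambda>_ :: unit. K)"

definition lk :: "'v set \<Rightarrow> 'v set set \<Rightarrow> 'v set set" where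
  "lk t K = {s. s \<inter> t = {} \<and> s \<union> t \<in> K}"

text \<open>A count makes sense for any finite family, so the boundary can be followed through the
  moves before anything is known about the shape of links.\<close>

definition bd :: "'v set set \<Rightarrow> 'v set set" where
  "bd K = {s \<in> K. even (card (lk s K))}"

definition jn :: "'v set set \<Rightarrow> 'v set set \<Rightarrow> 'v set set" where
  "jn K J = {s \<union> t |s t. s \<in> K \<and> t \<in> J}"

definition cone :: "'v \<Rightarrow> 'v set set \<Rightarrow> 'v set set" where
  "cone v K = K \<union> insert v ` K"

text \<open>In \<open>bal m\<close> and \<open>sph m\<close> the dimension is \<open>m - 1\<close>,
  so a simplex with \<open>c\<close> vertices has a link of index \<open>m - c\<close> in either
  case. The bound \<open>m \<ge> 1\<close> reserves \<open>{{}}\<close> for the sphere of index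
  0.\<close>

definition bal :: "nat \<Rightarrow> 'v set set \<Rightarrow> bool" where
  "bal m K \<longleftrightarrow> m \<ge> 1 \<and> (\<exists>V. finite V \<and> card V = m \<and> sq (Pow V) K)"

definition sph :: "nat \<Rightarrow> 'v set set \<Rightarrow> bool" where
  "sph m K \<longleftrightarrow> (\<exists>V. finite V \<and> card V = m + 1 \<and> sq (Pow V - {V}) K)"

lemma fam1_st: "fam1 K \<Longrightarrow> fam1 (st E a K)"
  using fam_sts[of "\<lambda>_ :: unit. K" E a] by (simp add: sts_def)

lemma sq_fam1: "sq K L \<Longrightarrow> fam1 K \<Longrightarrow> fam1 L"
  unfolding sq_def by (rule lseq_fam)

lemma sq_induct [consumes 1, case_names base star weld]:
  assumes "sq K L" "P K"
    and "\<And>Y i j a. fam1 Y \<Longrightarrow> {i, j} \<in> Y \<Longrightarrow> a \<notin> \<Union>Y \<Longrightarrow> P Y \<Longrightarrow> P (st {i, j} a Y)"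
    and "\<And>Y i j a. fam1 Y \<Longrightarrow> {i, j} \<in> Y \<Longrightarrow> a \<notin> \<Union>Y \<Longrightarrow> P (st {i, j} a Y) \<Longrightarrow> P Y"
  shows "P L"
proof -
  have "P (Z ())" if "lseq (\<lambda>_. ()) (\<lambda>_ :: unit. K) Z" for Z
    using that
  proof (induction rule: lseq_induct)
    case (star Y i j a)
    have Y: "(\<lambda>_. Y ()) = Y" by auto
    show ?case using assms(3)[of "Y ()" i j a] star unfolding Y by (simp add: sts_def simps_def verts_def UNIV_unit)
  next
    case (weld Y i j a)
    have Y: "(\<lambda>_. Y ()) = Y" by auto
    show ?case using assms(4)[of "Y ()" i j a] weld unfolding Y by (simp add: sts_def simps_def verts_def UNIV_unit)
  qed (fact assms(2))
  from this[of "\<lambda>_. L"] show ?thesis using assms(1) by (simp add: sq_def)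
qed

text \<open>A simplex \<open>u\<close> through a proper edge is replaced by three: \<open>a\<close>
  added to \<open>u - {i}\<close>, to \<open>u - {j}\<close> and to \<open>u - {i, j}\<close>. One
  for three leaves the parity unchanged; a degenerate edge only renames.\<close>

lemma st_edge_parity:
  assumes K: "fam1 K" and a: "a \<notin> \<Union>K" "a \<noteq> i" "a \<noteq> j"
  shows "even (card (st {i, j} a K)) = even (card K)"
proof (cases "i = j")
  case True
  have dc: "down_closed K" and fK: "finite K" using K by (auto simp: fam_unit)
  show ?thesis
  proof (cases "{i} \<in> K")
    case False
    then have "st {i} a K = K" using a dc by (intro st_noop)
    then show ?thesis using True by simp
  next
    case iK: True
    have "sts {i} a (\<lambda>_ :: unit. K) = mapf (id(i := a)) (\<lambda>_. K)"
      using iK a by (intro sts_vertex) (auto simp: verts_def)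
    then have e: "st {i} a K = (`) (id(i := a)) ` K" unfolding sts_def mapf_def by (rule fun_cong)
    have "inj_on (id(i := a)) (\<Union>K)" using a by (auto simp: inj_on_def)
    then have "inj_on ((`) (id(i := a))) K" by (rule inj_on_subset[OF inj_on_image_Pow]) auto
    then have "card (st {i} a K) = card K" unfolding e by (rule card_image)
    then show ?thesis using True by simp
  qed
next
  case ij: False
  have dc: "down_closed K" and fK: "finite K" using K by (auto simp: fam_unit)
  define S where "S = {u \<in> K. {i, j} \<subseteq> u}"
  let ?f = "\<lambda>X u. insert a (u - X)"
  have inj: "inj_on (?f X) S" if "X \<subseteq> {i, j}" for X
  proof (rule inj_onI)
    fix u v assume uv: "u \<in> S" "v \<in> S" "?f X u = ?f X v"
    have "a \<notin> u" "a \<notin> v" using uv a by (auto simp: S_def)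
    then have "u - X = v - X" using uv(3) insert_ident[of a "u - X" "v - X"] by simp
    then show "u = v" using uv(1,2) that by (auto simp: S_def)
  qed
  have eq: "st {i, j} a K = (K - S) \<union> (?f {i} ` S \<union> ?f {j} ` S \<union> ?f {i, j} ` S)"
  proof (intro equalityI subsetI)
    fix t assume t: "t \<in> st {i, j} a K"
    show "t \<in> (K - S) \<union> (?f {i} ` S \<union> ?f {j} ` S \<union> ?f {i, j} ` S)"
    proof (cases "a \<in> t")
      case True
      define u where "u = t - {a} \<union> {i, j}"
      have "u \<in> K" using t True by (simp add: in_st u_def)
      then have u: "u \<in> S" by (simp add: S_def u_def)
      consider "i \<notin> t" "j \<notin> t" | "i \<in> t" "j \<notin> t" | "i \<notin> t" "j \<in> t" using t by (auto simp: in_st)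
      then have "t = ?f {i, j} u \<or> t = ?f {j} u \<or> t = ?f {i} u"
        using True a ij by cases (auto simp: u_def)
      then show ?thesis using u by blast
    qed (use t in \<open>auto simp: in_st S_def\<close>)
  next
    fix t assume t: "t \<in> (K - S) \<union> (?f {i} ` S \<union> ?f {j} ` S \<union> ?f {i, j} ` S)"
    have new: "?f X u \<in> st {i, j} a K" if X: "X \<subseteq> {i, j}" "X \<noteq> {}" "u \<in> S" for X u
    proof -
      have "?f X u - {a} \<union> {i, j} = u" using X a by (auto simp: S_def)
      moreover have "\<not> {i, j} \<subseteq> ?f X u" using X a by auto
      moreover have "u \<in> K" using X by (simp add: S_def)
      ultimately show ?thesis unfolding in_st by simp
    qed
    from t show "t \<in> st {i, j} a K"
    proof (elim UnE imageE)
      assume "t \<in> K - S" then show ?thesis using a by (auto simp: in_st S_def)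
    qed (use new[of "{i}"] new[of "{j}"] new[of "{i, j}"] in simp_all)
  qed
  have fS: "finite S" using fK by (simp add: S_def)
  have d: "?f {i} ` S \<inter> ?f {j} ` S = {}" "(?f {i} ` S \<union> ?f {j} ` S) \<inter> ?f {i, j} ` S = {}"
    "(K - S) \<inter> (?f {i} ` S \<union> ?f {j} ` S \<union> ?f {i, j} ` S) = {}"
    using ij a by (auto simp: S_def set_eq_iff)
  have "card (st {i, j} a K) = card (K - S) + (card S + card S + card S)"
    unfolding eq using fS fK d inj[of "{i}"] inj[of "{j}"] inj[of "{i, j}"]
    by (simp add: card_Un_disjoint card_image)
  moreover have "card K = card (K - S) + card S" using fK fS card_Diff_subset[of S K] card_mono[of K S] by (auto simp: S_def)
  ultimately show ?thesis by presburger
qed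

text \<open>Seen from an old simplex, only the part of \<open>E\<close> outside it is
  starred.\<close>

lemma lk_st_old:
  assumes "a \<notin> t" "\<not> E \<subseteq> t" shows "lk t (st E a K) = st (E - t) a (lk t K)"
proof -
  have "s \<in> lk t (st E a K) \<longleftrightarrow> s \<in> st (E - t) a (lk t K)" for s
  proof -
    have 1: "s \<union> t - {a} \<union> E = (s - {a} \<union> (E - t)) \<union> t" using assms by auto
    show ?thesis unfolding lk_def in_st mem_Collect_eq 1 using assms by auto
  qed
  then show ?thesis by blast
qed

lemma lk_st_new:
  assumes "a \<notin> E" "a \<notin> u" "a \<notin> \<Union>K"
  shows "lk (insert a u) (st E a K) = {s. s \<inter> u = {} \<and> \<not> E \<subseteq> s \<union> u \<and> s \<union> u \<union> E \<in> K}"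
proof -
  have "s \<in> lk (insert a u) (st E a K) \<longleftrightarrow> s \<inter> u = {} \<and> \<not> E \<subseteq> s \<union> u \<and> s \<union> u \<union> E \<in> K" for s
  proof (cases "a \<in> s")
    case True
    then show ?thesis using assms(3) by (auto simp: lk_def)
  next
    case False
    then have "s \<union> insert a u - {a} \<union> E = s \<union> u \<union> E" using assms by auto
    then show ?thesis using False assms by (auto simp: lk_def in_st)
  qed
  then show ?thesis by blast
qed

text \<open>The first factor is the boundary of the edge, so the new link is the suspension of an
  old one.\<close>

lemma lk_st_new_disjoint:
  assumes "a \<notin> {i, j}" "a \<notin> u" "a \<notin> \<Union>K" "i \<notin> u" "j \<notin> u" "i \<noteq> j" "down_closed K"
  shows "lk (insert a u) (st {i, j} a K) = jn {{}, {i}, {j}} (lk (insert i (insert j u)) K)"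
  unfolding lk_st_new[OF assms(1-3)]
proof (intro equalityI subsetI)
  fix s assume s: "s \<in> {s. s \<inter> u = {} \<and> \<not> {i, j} \<subseteq> s \<union> u \<and> s \<union> u \<union> {i, j} \<in> K}"
  have "s - {i, j} \<in> lk (insert i (insert j u)) K"
  proof -
    have "s - {i, j} \<union> insert i (insert j u) = s \<union> u \<union> {i, j}" by auto
    then show ?thesis using s by (auto simp: lk_def)
  qed
  moreover have "s = s \<inter> {i, j} \<union> (s - {i, j})" by auto
  moreover have "s \<inter> {i, j} \<in> {{}, {i}, {j}}" using s by auto
  ultimately show "s \<in> jn {{}, {i}, {j}} (lk (insert i (insert j u)) K)" unfolding jn_def by blast
next
  fix s assume "s \<in> jn {{}, {i}, {j}} (lk (insert i (insert j u)) K)"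
  then obtain e t where t: "s = e \<union> t" "e \<in> {{}, {i}, {j}}" "t \<in> lk (insert i (insert j u)) K" by (auto simp: jn_def)
  have "s \<union> u \<union> {i, j} = t \<union> insert i (insert j u)" using t by auto
  then show "s \<in> {s. s \<inter> u = {} \<and> \<not> {i, j} \<subseteq> s \<union> u \<and> s \<union> u \<union> {i, j} \<in> K}"
    using t assms by (auto simp: lk_def)
qed

text \<open>One end of the edge is already used up by \<open>u\<close>, or the edge is degenerate;
  so nothing is suspended.\<close>

lemma lk_st_new_touching:
  assumes "a \<notin> {i, j}" "a \<notin> u" "a \<notin> \<Union>K" "j \<notin> u" "i \<in> u \<or> i = j"
  shows "lk (insert a u) (st {i, j} a K) = lk (insert i (insert j u)) K"
proof -
  have "s \<union> u \<union> {i, j} = s \<union> insert i (insert j u)" for s by auto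
  then show ?thesis by (subst lk_st_new[OF assms(1-3)]) (use assms in \<open>auto simp: lk_def\<close>)
qed

lemma fam1_lk: "fam1 K \<Longrightarrow> fam1 (lk t K)"
  unfolding fam_unit
proof (intro conjI ballI)
  assume K: "finite K \<and> (\<forall>s\<in>K. finite s) \<and> down_closed K"
  have sub: "lk t K \<subseteq> K" using K down_closedD[of K "s \<union> t" s for s] by (auto simp: lk_def)
  then show "finite (lk t K)" "\<And>s. s \<in> lk t K \<Longrightarrow> finite s" using K finite_subset by blast+
  show "down_closed (lk t K)"
    unfolding down_closed_def
  proof (intro ballI allI impI)
    fix s u assume s: "s \<in> lk t K" "u \<subseteq> s"
    then have "u \<union> t \<in> K" using K down_closedD[of K "s \<union> t" "u \<union> t"] by (auto simp: lk_def)
    then show "u \<in> lk t K" using s by (auto simp: lk_def)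
  qed
qed

lemma lk_lk: "s \<inter> t = {} \<Longrightarrow> lk s (lk t K) = lk (s \<union> t) K"
  unfolding lk_def by (auto simp: Un_assoc)

lemma card_susp:
  assumes "i \<notin> \<Union>L" "j \<notin> \<Union>L" "i \<noteq> j" "finite L"
  shows "card (jn {{}, {i}, {j}} L) = 3 * card L"
proof -
  have eq: "jn {{}, {i}, {j}} L = L \<union> (insert i ` L \<union> insert j ` L)" by (auto simp: jn_def)
  have inj: "inj_on (insert x) L" if "x \<notin> \<Union>L" for x using that by (auto simp: inj_on_def)
  have d: "insert i ` L \<inter> insert j ` L = {}" "L \<inter> (insert i ` L \<union> insert j ` L) = {}" using assms by auto
  show ?thesis unfolding eq using assms d inj by (simp add: card_Un_disjoint card_image)
qed

text \<open>Under the move a link is starred, suspended or kept. Starring preserves the parity of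
  its size and suspension multiplies the size by three.\<close>

lemma bd_st:
  assumes K: "fam1 K" and ij: "{i, j} \<in> K" and a: "a \<notin> \<Union>K"
  shows "bd (st {i, j} a K) = st {i, j} a (bd K)"
proof -
  have aij: "a \<noteq> i" "a \<noteq> j" using ij a by auto
  have dc: "down_closed K" using K by (simp add: fam_unit)
  have bdK: "bd K \<subseteq> K" by (auto simp: bd_def)
  have "t \<in> bd (st {i, j} a K) \<longleftrightarrow> t \<in> st {i, j} a (bd K)" for t
  proof (cases "a \<in> t")
    case False
    have "even (card (lk t (st {i, j} a K))) = even (card (lk t K))" if t: "\<not> {i, j} \<subseteq> t" "t \<in> K"
    proof -
      have "{i, j} - t = {i, j} \<or> {i, j} - t = {i, i} \<or> {i, j} - t = {j, j}" using t by auto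
      moreover have "a \<notin> \<Union>(lk t K)" using a by (auto simp: lk_def)
      ultimately show ?thesis
        unfolding lk_st_old[OF False t(1)] using st_edge_parity[OF fam1_lk[OF K], of a t] aij by metis
    qed
    then show ?thesis using False by (auto simp: bd_def in_st)
  next
    case True
    define u where "u = t - {a}"
    have t: "t = insert a u" "a \<notin> u" using True by (auto simp: u_def)
    have "even (card (lk t (st {i, j} a K))) = even (card (lk (u \<union> {i, j}) K))" if n: "\<not> {i, j} \<subseteq> u"
    proof -
      have U: "u \<union> {i, j} = insert i (insert j u)" by auto
      consider "i \<notin> u" "j \<notin> u" "i \<noteq> j" | "j \<notin> u" "i \<in> u \<or> i = j" | "i \<notin> u" "j \<in> u" using n by auto
      then show ?thesis
      proof cases
        case 1
        let ?L = "lk (insert i (insert j u)) K"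
        have "card (jn {{}, {i}, {j}} ?L) = 3 * card ?L"
          using 1 fam1_lk[OF K, of "insert i (insert j u)"] by (intro card_susp) (auto simp: lk_def[of _ K] fam_unit)
        then show ?thesis unfolding t(1) U using lk_st_new_disjoint[OF _ t(2) a 1 dc] aij by simp
      next
        case 2
        then show ?thesis unfolding t(1) U using lk_st_new_touching[OF _ t(2) a 2] aij by simp
      next
        case 3
        then have "lk (insert a u) (st {j, i} a K) = lk (insert j (insert i u)) K"
          using t(2) a aij by (intro lk_st_new_touching) auto
        then show ?thesis unfolding t(1) U by (simp add: insert_commute)
      qed
    qed
    moreover have "{i, j} \<subseteq> t \<longleftrightarrow> {i, j} \<subseteq> u" using aij t by auto
    ultimately show ?thesis using True unfolding bd_def in_st mem_Collect_eq u_def[symmetric] by auto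
  qed
  then show ?thesis by blast
qed

subsection \<open>Joins, balls and spheres\<close>

lemma in_jn:
  assumes "\<Union>K \<inter> \<Union>J = {}"
  shows "t \<in> jn K J \<longleftrightarrow> t - \<Union>J \<in> K \<and> t \<inter> \<Union>J \<in> J"
proof
  assume "t \<in> jn K J"
  then obtain s u where "t = s \<union> u" "s \<in> K" "u \<in> J" by (auto simp: jn_def)
  moreover from this have "t - \<Union>J = s" "t \<inter> \<Union>J = u" using assms by auto
  ultimately show "t - \<Union>J \<in> K \<and> t \<inter> \<Union>J \<in> J" by simp
next
  assume "t - \<Union>J \<in> K \<and> t \<inter> \<Union>J \<in> J"
  moreover have "t = (t - \<Union>J) \<union> (t \<inter> \<Union>J)" by auto
  ultimately show "t \<in> jn K J" unfolding jn_def by blast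
qed

lemma st_jn:
  assumes "\<Union>K \<inter> \<Union>J = {}" "E \<inter> \<Union>J = {}" "a \<notin> \<Union>J"
  shows "st E a (jn K J) = jn (st E a K) J"
proof -
  have "\<Union>(st E a K) \<subseteq> insert a (\<Union>K)" using verts_sts_subset[of E a "\<lambda>_ :: unit. K"] by (simp add: verts_def simps_sts)
  then have d: "\<Union>(st E a K) \<inter> \<Union>J = {}" using assms by blast
  have "t \<in> st E a (jn K J) \<longleftrightarrow> t \<in> jn (st E a K) J" for t
  proof -
    have 1: "t - {a} \<union> E - \<Union>J = (t - \<Union>J) - {a} \<union> E" "(t - {a} \<union> E) \<inter> \<Union>J = t \<inter> \<Union>J"
      "E \<subseteq> t - \<Union>J \<longleftrightarrow> E \<subseteq> t" "a \<in> t - \<Union>J \<longleftrightarrow> a \<in> t" using assms by auto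
    show ?thesis unfolding in_jn[OF d] in_st[of "t - \<Union>J"] in_st[of t] in_jn[OF assms(1)] 1 by auto
  qed
  then show ?thesis by blast
qed

lemma fam1_jn:
  assumes "fam1 K" "fam1 J" shows "fam1 (jn K J)"
  unfolding fam_unit
proof (intro conjI ballI)
  have "jn K J = (\<lambda>(s, t). s \<union> t) ` (K \<times> J)" by (auto simp: jn_def)
  then show "finite (jn K J)" using assms by (simp add: fam_unit)
  show "finite s" if "s \<in> jn K J" for s using that assms by (auto simp: jn_def fam_unit)
  show "down_closed (jn K J)"
    unfolding down_closed_def
  proof (intro ballI allI impI)
    fix s t assume "s \<in> jn K J" "t \<subseteq> s"
    then obtain p q where "t = (t \<inter> p) \<union> (t \<inter> q)" "p \<in> K" "q \<in> J" by (auto simp: jn_def)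
    moreover have "t \<inter> p \<in> K" "t \<inter> q \<in> J"
      using assms calculation down_closedD[of K p "t \<inter> p"] down_closedD[of J q "t \<inter> q"] by (auto simp: fam_unit)
    ultimately show "t \<in> jn K J" unfolding jn_def by blast
  qed
qed

lemma jn_image: "(`) f ` jn K J = jn ((`) f ` K) ((`) f ` J)"
proof (intro equalityI subsetI)
  fix t assume "t \<in> jn ((`) f ` K) ((`) f ` J)"
  then obtain p q where "t = f ` p \<union> f ` q" "p \<in> K" "q \<in> J" by (auto simp: jn_def)
  then have "t = f ` (p \<union> q)" "p \<union> q \<in> jn K J" by (auto simp: jn_def image_Un)
  then show "t \<in> (`) f ` jn K J" by blast
next
  fix t assume "t \<in> (`) f ` jn K J"
  then obtain p q where "t = f ` (p \<union> q)" "p \<in> K" "q \<in> J" by (auto simp: jn_def)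
  then show "t \<in> jn ((`) f ` K) ((`) f ` J)" unfolding jn_def image_Un by blast
qed

lemma fam1_image: "fam1 K \<Longrightarrow> fam1 ((`) f ` K)"
  using fam_mapf[of "\<lambda>_ :: unit. K" f] by (simp add: mapf_def)

text \<open>A move of \<open>K\<close> may introduce a vertex that occurs in \<open>J\<close>. The
  sum type keeps the two vertex sets apart during the moves; \<open>case_sum id id\<close> leads
  back and is injective at both ends by disjointness.\<close>

lemma sq_jn:
  fixes K K' J :: "'a family"
  assumes "sq K K'" "fam1 K" "fam1 J" "\<Union>K \<inter> \<Union>J = {}" "\<Union>K' \<inter> \<Union>J = {}"
  shows "sq (jn K J) (jn K' J)"
proof -
  let ?l = "(`) ((`) Inl) :: 'a family \<Rightarrow> ('a vertex + 'a vertex) set set" and ?r = "(`) ((`) Inr) :: 'a family \<Rightarrow> ('a vertex + 'a vertex) set set"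
  have d: "\<Union>(?l Y) \<inter> \<Union>(?r J) = {}" for Y by auto
  have one: "sq (jn (?l Y) (?r J)) (jn (?l (st {i, j} a Y)) (?r J))" if Y: "fam1 Y" "{i, j} \<in> Y" "a \<notin> \<Union>Y" for Y i j a
  proof -
    have V: "{i, j} \<subseteq> - {a}" using Y by auto
    have "(Inl(a := Inl a) :: _ \<Rightarrow> 'a vertex + 'a vertex) = Inl" by auto
    then have "?l (st {i, j} a Y) = st (Inl ` {i, j}) (Inl a) (?l Y)"
      using st_image[of "Inl :: _ \<Rightarrow> 'a vertex + 'a vertex" "- {a}" Y "{i, j}" a "Inl a"] Y V by auto
    then have "?l (st {i, j} a Y) = st {Inl i, Inl j} (Inl a) (?l Y)" by simp
    then have "jn (?l (st {i, j} a Y)) (?r J) = st {Inl i, Inl j} (Inl a) (jn (?l Y) (?r J))"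
      using st_jn[OF d, of "{Inl i, Inl j}" "Inl a" Y] by auto
    moreover have "Inl a \<notin> \<Union>(jn (?l Y) (?r J))" using Y(3) by (auto simp: jn_def)
    ultimately show ?thesis
      using sq_edge[OF fam1_jn[OF fam1_image[OF Y(1)] fam1_image[OF assms(3)]], of "Inl a" Inl Inr "Inl i" "Inl j"] by simp
  qed
  have "sq (jn (?l K) (?r J)) (jn (?l K') (?r J))"
    using assms(1)
  proof (induction rule: sq_induct)
    case (star Y i j a) then show ?case using one[OF star(1-3)] sq_trans by blast
  next
    case (weld Y i j a) then show ?case using one[OF weld(1-3)] sq_trans sq_sym by blast
  qed simp
  then have "sq ((`) (case_sum id id) ` jn (?l K) (?r J)) ((`) (case_sum id id) ` jn (?l K') (?r J))"
  proof (rule sq_map[OF _ fam1_jn[OF fam1_image[OF assms(2)] fam1_image[OF assms(3)]] infinite_vertex])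
    show "inj_on (case_sum id id) (\<Union>(jn (?l K) (?r J)))" "inj_on (case_sum id id) (\<Union>(jn (?l K') (?r J)))"
    proof -
      have i1: "inj_on (case_sum id id) (Inl ` \<Union>Y \<union> Inr ` \<Union>J)" if "\<Union>Y \<inter> \<Union>J = {}" for Y
      proof (rule inj_onI)
        fix x y assume "x \<in> Inl ` \<Union>Y \<union> Inr ` \<Union>J" "y \<in> Inl ` \<Union>Y \<union> Inr ` \<Union>J" "case_sum id id x = case_sum id id y"
        then show "x = y" by (elim UnE imageE) (use that in \<open>simp_all, blast+\<close>)
      qed
      have i2: "\<Union>(jn (?l Y) (?r J)) \<subseteq> Inl ` \<Union>Y \<union> Inr ` \<Union>J" for Y by (auto simp: jn_def)
      show "inj_on (case_sum id id) (\<Union>(jn (?l K) (?r J)))" by (rule inj_on_subset[OF i1[OF assms(4)] i2])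
      show "inj_on (case_sum id id) (\<Union>(jn (?l K') (?r J)))" by (rule inj_on_subset[OF i1[OF assms(5)] i2])
    qed
  qed
  moreover have "(`) (case_sum id id) ` jn (?l Y) (?r J) = jn Y J" for Y
    unfolding jn_image by (simp add: image_image)
  ultimately show ?thesis by simp
qed

lemma fam1_Pow: "finite V \<Longrightarrow> fam1 (Pow V)"
  by (auto simp: fam_unit down_closed_def intro: finite_subset)

lemma fam1_bdPow: "finite V \<Longrightarrow> fam1 (Pow V - {V})"
  by (auto simp: fam_unit down_closed_def intro: finite_subset)

lemma sq_Pow:
  fixes V V' :: "'a vertex set"
  assumes "finite V" "finite V'" "card V = card V'"
  shows "sq (Pow V) (Pow V')" "sq (Pow V - {V}) (Pow V' - {V'})"
proof -
  obtain f where f: "bij_betw f V V'" using finite_same_card_bij[OF assms] by blast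
  have inj: "inj_on f V" and im: "f ` V = V'" using f by (auto simp: bij_betw_def)
  have P: "(`) f ` Pow V = Pow V'" using im by (rule image_Pow_surj)
  have "(`) f ` (Pow V - {V}) = (`) f ` Pow V - (`) f ` {V}"
    using inj_on_image_set_diff[OF inj_on_image_Pow[OF inj]] by simp
  then have Q: "(`) f ` (Pow V - {V}) = Pow V' - {V'}" using P im by simp
  show "sq (Pow V) (Pow V')"
    using sq_map[OF sq_refl fam1_Pow[OF assms(1)] infinite_vertex, of id f] inj P by simp
  show "sq (Pow V - {V}) (Pow V' - {V'})"
    using sq_map[OF sq_refl fam1_bdPow[OF assms(1)] infinite_vertex, of id f] Q inj_on_subset[OF inj, of "\<Union>(Pow V - {V})"] by auto
qed

lemma bal_Pow: "bal m K \<Longrightarrow> finite V \<Longrightarrow> card V = m \<Longrightarrow> sq (Pow V) (K :: 'a family)"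
  unfolding bal_def using sq_Pow sq_trans by metis

lemma sph_Pow: "sph m K \<Longrightarrow> finite V \<Longrightarrow> card V = m + 1 \<Longrightarrow> sq (Pow V - {V}) (K :: 'a family)"
  unfolding sph_def using sq_Pow sq_trans by metis

lemma ex_fresh_set: "finite A \<Longrightarrow> \<exists>V :: 'a vertex set. finite V \<and> card V = m \<and> V \<inter> A = {}"
proof -
  assume "finite A"
  then have "infinite (- A)" using infinite_vertex by (metis finite_compl)
  then obtain V where "V \<subseteq> - A" "card V = m" "finite V" using infinite_arbitrarily_large by metis
  then show ?thesis by blast
qed

definition gl :: "nat \<Rightarrow> 'v set set \<Rightarrow> bool" where
  "gl m K \<longleftrightarrow> bal m K \<or> sph m K"

lemma bal_sq: "bal m K \<Longrightarrow> sq K L \<Longrightarrow> bal m L"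
  unfolding bal_def using sq_trans by blast

lemma sph_sq: "sph m K \<Longrightarrow> sq K L \<Longrightarrow> sph m L"
  unfolding sph_def using sq_trans by blast

lemma gl_sq: "gl m K \<Longrightarrow> sq K L \<Longrightarrow> gl m L"
  unfolding gl_def using bal_sq sph_sq by blast

lemma bal_fam1: "bal m K \<Longrightarrow> fam1 K"
  unfolding bal_def using sq_fam1 fam1_Pow by blast

lemma bal_self: "finite V \<Longrightarrow> V \<noteq> {} \<Longrightarrow> bal (card V) (Pow V)"
  unfolding bal_def using card_gt_0_iff[of V] by (intro conjI exI[of _ V]) auto

lemma sph_self: "finite V \<Longrightarrow> V \<noteq> {} \<Longrightarrow> sph (card V - 1) (Pow V - {V})"
  unfolding sph_def using card_gt_0_iff[of V] by (intro exI[of _ V]) auto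

text \<open>A suspended simplex is a simplex with one edge subdivided: \<open>c\<close> acts as the
  new vertex, and \<open>i\<close>, \<open>j\<close> are the ends of the edge. The same holds for
  boundaries of simplices.\<close>

lemma susp_Pow:
  assumes "c \<in> V" "i \<notin> V" "j \<notin> V" "i \<noteq> j"
  shows "jn {{}, {i}, {j}} (Pow V) = st {i, j} c (Pow (V - {c} \<union> {i, j}))"
    and "jn {{}, {i}, {j}} (Pow V - {V}) = st {i, j} c (Pow (V - {c} \<union> {i, j}) - {V - {c} \<union> {i, j}})"
proof -
  have J: "t \<in> jn {{}, {i}, {j}} L \<longleftrightarrow> \<not> {i, j} \<subseteq> t \<and> t - {i, j} \<in> L" if "L \<subseteq> Pow V" for L t
  proof
    assume "t \<in> jn {{}, {i}, {j}} L"
    then obtain e s where "t = e \<union> s" "e \<in> {{}, {i}, {j}}" "s \<in> L" by (auto simp: jn_def)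
    moreover from this have "i \<notin> s" "j \<notin> s" using that assms by auto
    moreover from calculation have "t - {i, j} = s" by auto
    ultimately show "\<not> {i, j} \<subseteq> t \<and> t - {i, j} \<in> L" using assms by auto
  next
    assume t: "\<not> {i, j} \<subseteq> t \<and> t - {i, j} \<in> L"
    have "t = t \<inter> {i, j} \<union> (t - {i, j})" "t \<inter> {i, j} \<in> {{}, {i}, {j}}" using t by auto
    then show "t \<in> jn {{}, {i}, {j}} L" unfolding jn_def using t by blast
  qed
  have c: "c \<noteq> i" "c \<noteq> j" using assms by auto
  have "t \<in> jn {{}, {i}, {j}} (Pow V) \<longleftrightarrow> t \<in> st {i, j} c (Pow (V - {c} \<union> {i, j}))" for t
    unfolding J[OF order_refl] in_st using assms c by auto
  then show "jn {{}, {i}, {j}} (Pow V) = st {i, j} c (Pow (V - {c} \<union> {i, j}))" by blast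
  have "t \<in> jn {{}, {i}, {j}} (Pow V - {V}) \<longleftrightarrow> t \<in> st {i, j} c (Pow (V - {c} \<union> {i, j}) - {V - {c} \<union> {i, j}})" for t
    unfolding J[OF Diff_subset] in_st using assms c by auto
  then show "jn {{}, {i}, {j}} (Pow V - {V}) = st {i, j} c (Pow (V - {c} \<union> {i, j}) - {V - {c} \<union> {i, j}})" by blast
qed

lemma jn_commute: "jn K J = jn J K"
  unfolding jn_def by blast

lemma fam1_susp: "fam1 {{}, {i}, {j}}"
  by (auto simp: fam_unit down_closed_def)

lemma susp:
  fixes L :: "'a family"
  assumes "i \<notin> \<Union>L" "j \<notin> \<Union>L" "i \<noteq> j"
  shows "bal m L \<Longrightarrow> bal (Suc m) (jn {{}, {i}, {j}} L)" "sph m L \<Longrightarrow> sph (Suc m) (jn {{}, {i}, {j}} L)"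
proof -
  have ij: "{i, j} \<inter> \<Union>L = {}" using assms by auto
  { assume L: "bal m L"
    obtain V where V: "finite V" "card V = m" "V \<inter> {i, j} = {}" using ex_fresh_set[of "{i, j}" m] by auto
    have "V \<noteq> {}" using V L by (auto simp: bal_def)
    then obtain c where c: "c \<in> V" by blast
    let ?U = "V - {c} \<union> {i, j}"
    have U: "finite ?U" "card ?U = Suc m" using V c assms(3) card_Suc_Diff1[OF V(1) c] by (auto simp: card_insert_if)
    have "sq (Pow ?U) (st {i, j} c (Pow ?U))" using c V U by (intro sq_edge fam1_Pow) auto
    also have "st {i, j} c (Pow ?U) = jn (Pow V) {{}, {i}, {j}}"
      unfolding jn_commute[of "Pow V"] using susp_Pow(1)[of c V i j] c V assms by auto
    also have "sq (jn (Pow V) {{}, {i}, {j}}) (jn L {{}, {i}, {j}})"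
      using bal_Pow[OF L V(1,2)] V ij by (intro sq_jn fam1_Pow fam1_susp) auto
    finally show "bal (Suc m) (jn {{}, {i}, {j}} L)"
      unfolding bal_def jn_commute[of L] using U by (intro conjI exI[of _ ?U]) simp_all }
  { assume L: "sph m L"
    obtain V where V: "finite V" "card V = m + 1" "V \<inter> {i, j} = {}" using ex_fresh_set[of "{i, j}" "m + 1"] by auto
    then obtain c where c: "c \<in> V" by fastforce
    let ?U = "V - {c} \<union> {i, j}"
    have U: "finite ?U" "card ?U = Suc m + 1" using V c assms(3) card_Suc_Diff1[OF V(1) c] by (auto simp: card_insert_if)
    have "sq (Pow ?U - {?U}) (st {i, j} c (Pow ?U - {?U}))" using c V U by (intro sq_edge fam1_bdPow) auto
    also have "st {i, j} c (Pow ?U - {?U}) = jn (Pow V - {V}) {{}, {i}, {j}}"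
      unfolding jn_commute[of "Pow V - {V}"] using susp_Pow(2)[of c V i j] c V assms by auto
    also have "sq (jn (Pow V - {V}) {{}, {i}, {j}}) (jn L {{}, {i}, {j}})"
      using sph_Pow[OF L V(1,2)] V ij by (intro sq_jn fam1_bdPow fam1_susp) auto
    finally show "sph (Suc m) (jn {{}, {i}, {j}} L)"
      unfolding sph_def jn_commute[of L] using U by (intro conjI exI[of _ ?U]) simp_all }
qed

lemma cone_jn: "cone v K = jn K {{}, {v}}"
  by (auto simp: cone_def jn_def)

lemma fam1_pt: "fam1 {{}, {v}}"
  by (auto simp: fam_unit down_closed_def)

lemma fam1_cone: "fam1 K \<Longrightarrow> fam1 (cone v K)"
  unfolding cone_jn by (intro fam1_jn fam1_pt)

lemma sq_star:
  fixes K :: "'a family"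
  assumes "fam1 K" "F \<noteq> {}" "f \<notin> \<Union>K" shows "sq K (st F f K)"
proof -
  obtain i where "i \<in> F" using assms by blast
  then show ?thesis
    using lseq_star[OF rich_const assms(1), of f i F] assms by (simp add: sq_def sts_def verts_def)
qed

lemma cone_Pow: "v \<notin> V \<Longrightarrow> cone v (Pow V) = Pow (insert v V)"
  by (auto simp: cone_def Pow_insert)

lemma in_cone:
  assumes "v \<notin> \<Union>K" shows "t \<in> cone v K \<longleftrightarrow> t - {v} \<in> K"
proof (cases "v \<in> t")
  case True
  have "t \<in> insert v ` K \<longleftrightarrow> t - {v} \<in> K"
  proof
    assume "t \<in> insert v ` K"
    then obtain s where "s \<in> K" "t = insert v s" by blast
    moreover from this have "t - {v} = s" using assms by auto
    ultimately show "t - {v} \<in> K" by simp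
  next
    assume "t - {v} \<in> K"
    moreover have "t = insert v (t - {v})" using True by auto
    ultimately show "t \<in> insert v ` K" by blast
  qed
  moreover have "t \<notin> K" using True assms by auto
  ultimately show ?thesis by (simp add: cone_def)
qed (auto simp: cone_def)

lemma cone_bdPow: "v \<notin> V \<Longrightarrow> cone v (Pow V - {V}) = st V v (Pow V)"
proof -
  assume v: "v \<notin> V"
  have "t \<in> cone v (Pow V - {V}) \<longleftrightarrow> t \<in> st V v (Pow V)" for t
  proof -
    have "t \<in> cone v (Pow V - {V}) \<longleftrightarrow> t - {v} \<in> Pow V - {V}" using v by (intro in_cone) auto
    then show ?thesis using v by (cases "v \<in> t") (auto simp: in_st)
  qed
  then show ?thesis by blast
qed

text \<open>For a ball, the cone over the model simplex is a simplex. For a sphere, the cone over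
  the boundary of the model is the model starred at the apex; its model has \<open>m + 1\<close>
  vertices, which gives the index \<open>Suc m\<close> again.\<close>

lemma cone_gl:
  fixes L :: "'a family"
  assumes "v \<notin> \<Union>L" "gl m L" shows "bal (Suc m) (cone v L)"
  using assms(2) unfolding gl_def
proof
  assume L: "bal m L"
  obtain V where V: "finite V" "card V = m" "V \<inter> {v} = {}" using ex_fresh_set[of "{v}" m] by auto
  have "sq (jn (Pow V) {{}, {v}}) (jn L {{}, {v}})"
    using bal_Pow[OF L V(1,2)] V assms(1) by (intro sq_jn fam1_Pow fam1_pt) auto
  then have "sq (Pow (insert v V)) (cone v L)" using V cone_Pow[of v V] by (simp add: cone_jn)
  then show ?thesis unfolding bal_def using V by (intro conjI exI[of _ "insert v V"]) auto
next
  assume L: "sph m L"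
  obtain V where V: "finite V" "card V = m + 1" "V \<inter> {v} = {}" using ex_fresh_set[of "{v}" "m + 1"] by auto
  have "sq (Pow V) (st V v (Pow V))" using V by (intro sq_star fam1_Pow) auto
  also have "st V v (Pow V) = jn (Pow V - {V}) {{}, {v}}" using V cone_bdPow[of v V] by (simp add: cone_jn)
  also have "sq (jn (Pow V - {V}) {{}, {v}}) (jn L {{}, {v}})"
    using sph_Pow[OF L V(1,2)] V assms(1) by (intro sq_jn fam1_bdPow fam1_pt) auto
  finally show ?thesis unfolding bal_def cone_jn using V by (intro conjI exI[of _ V]) auto
qed

lemma sq_parity: "sq K L \<Longrightarrow> even (card K) = even (card L)"
proof (induction rule: sq_induct)
  case (star Y i j a) then show ?case using st_edge_parity[of Y a i j] by auto
next
  case (weld Y i j a) then show ?case using st_edge_parity[of Y a i j] by auto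
qed simp

text \<open>The model has \<open>2 ^ m\<close> simplices with \<open>m \<ge> 1\<close>. The model of
  a sphere lacks one simplex of such a power, so counting tells balls from spheres.\<close>

lemma bal_even: "bal m K \<Longrightarrow> even (card K)"
proof -
  assume "bal m K"
  then obtain V where V: "finite V" "card V = m" "m \<ge> 1" "sq (Pow V) K" by (auto simp: bal_def)
  then show ?thesis using sq_parity[OF V(4)] by (simp add: card_Pow)
qed

lemma sph_odd: "sph m K \<Longrightarrow> odd (card K)"
proof -
  assume "sph m K"
  then obtain V where V: "finite V" "card V = m + 1" "sq (Pow V - {V}) K" by (auto simp: sph_def)
  have "card (Pow V - {V}) = 2 ^ (m + 1) - 1" using V by (simp add: card_Pow card_Diff_singleton)
  then show ?thesis using sq_parity[OF V(3)] by simp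
qed

definition gl_links :: "nat \<Rightarrow> 'v set set \<Rightarrow> bool" where
  "gl_links m K \<longleftrightarrow> (\<forall>t\<in>K. card t \<le> m \<and> gl (m - card t) (lk t K))"

text \<open>Links of old simplices are kept up to starring. Links of new ones are old links, or
  suspensions of links of a simplex with one more vertex, so the index is right.\<close>

lemma gl_links_star:
  fixes K :: "'a family"
  assumes K: "fam1 K" "{i, j} \<in> K" "a \<notin> \<Union>K" and L: "gl_links m K"
  shows "gl_links m (st {i, j} a K)"
  unfolding gl_links_def
proof
  fix t assume t: "t \<in> st {i, j} a K"
  have dc: "down_closed K" and fin: "\<And>s. s \<in> K \<Longrightarrow> finite s" using K by (auto simp: fam_unit)
  have aij: "a \<noteq> i" "a \<noteq> j" using K by auto
  have tn: "\<not> {i, j} \<subseteq> t" using t by (simp add: in_st)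
  show "card t \<le> m \<and> gl (m - card t) (lk t (st {i, j} a K))"
  proof (cases "a \<in> t")
    case False
    then have tK: "t \<in> K" using t by (simp add: in_st)
    have "sq (lk t K) (st ({i, j} - t) a (lk t K))"
      using K tn by (intro sq_star fam1_lk) (auto simp: lk_def)
    then show ?thesis unfolding lk_st_old[OF False tn] using L tK gl_sq by (auto simp: gl_links_def)
  next
    case True
    define u where "u = t - {a}"
    have tu: "t = insert a u" "a \<notin> u" using True by (auto simp: u_def)
    define w where "w = insert i (insert j u)"
    have wK: "w \<in> K" using t True by (simp add: in_st u_def w_def insert_commute)
    then have fu: "finite u" using fin[OF wK] by (simp add: w_def)
    have gw: "card w \<le> m" "gl (m - card w) (lk w K)" using L wK by (auto simp: gl_links_def)
    consider "i \<notin> u" "j \<notin> u" "i \<noteq> j" | "j \<notin> u" "i \<in> u \<or> i = j" | "i \<notin> u" "j \<in> u" using tn tu by auto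
    then show ?thesis
    proof cases
      case 1
      have c: "card w = Suc (card t)" using 1 fu tu by (simp add: w_def)
      have "gl (Suc (m - card w)) (jn {{}, {i}, {j}} (lk w K))"
        using gw(2) susp[of i "lk w K" j "m - card w"] 1 unfolding gl_def by (auto simp: lk_def w_def)
      then show ?thesis unfolding tu(1) using lk_st_new_disjoint[OF _ tu(2) K(3) 1 dc] aij c gw tu by (simp add: w_def Suc_diff_Suc)
    next
      case 2
      have "card w = card t" using 2 fu tu by (auto simp: w_def insert_absorb)
      then show ?thesis unfolding tu(1) using lk_st_new_touching[OF _ tu(2) K(3) 2] aij gw tu by (simp add: w_def)
    next
      case 3
      have "card w = card t" using 3 fu tu by (auto simp: w_def insert_absorb)
      moreover have "lk (insert a u) (st {j, i} a K) = lk (insert j (insert i u)) K"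
        using 3 tu(2) K aij by (intro lk_st_new_touching) auto
      ultimately show ?thesis unfolding tu(1) using gw tu by (simp add: w_def insert_commute)
    qed
  qed
qed

text \<open>A simplex through the edge has the same link as the new simplex in which
  \<open>a\<close> replaces one end of the edge.\<close>

lemma gl_links_weld:
  fixes K :: "'a family"
  assumes K: "fam1 K" "{i, j} \<in> K" "a \<notin> \<Union>K" and L: "gl_links m (st {i, j} a K)"
  shows "gl_links m K"
  unfolding gl_links_def
proof
  fix t assume t: "t \<in> K"
  have fin: "finite t" using K t by (auto simp: fam_unit)
  have aij: "a \<noteq> i" "a \<noteq> j" "a \<notin> t" using K t by auto
  show "card t \<le> m \<and> gl (m - card t) (lk t K)"
  proof (cases "{i, j} \<subseteq> t")
    case False
    then have tK: "t \<in> st {i, j} a K" using t aij by (simp add: in_st)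
    have "sq (lk t K) (st ({i, j} - t) a (lk t K))"
      using K False by (intro sq_star fam1_lk) (auto simp: lk_def)
    then show ?thesis using L tK gl_sq sq_sym unfolding gl_links_def lk_st_old[OF aij(3) False, symmetric] by blast
  next
    case True
    define u where "u = t - {j}"
    have u: "t = insert i (insert j u)" "j \<notin> u" "i \<in> u \<or> i = j" "a \<notin> u" using True aij by (auto simp: u_def)
    have c: "card (insert a u) = card t" using card_Suc_Diff1[of t j] fin True u(4) by (simp add: u_def)
    have e: "insert a u - {a} \<union> {i, j} = t" using True u(4) by (auto simp: u_def)
    have "\<not> {i, j} \<subseteq> insert a u" using u(2) aij by auto
    then have "insert a u \<in> st {i, j} a K" unfolding in_st e using t by simp
    then have "card (insert a u) \<le> m \<and> gl (m - card (insert a u)) (lk (insert a u) (st {i, j} a K))" using L by (auto simp: gl_links_def)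
    then show ?thesis unfolding c using lk_st_new_touching[OF _ u(4) K(3) u(2,3)] aij by (simp add: u(1)[symmetric])
  qed
qed

lemma gl_links_sq: "sq K L \<Longrightarrow> gl_links m K \<Longrightarrow> gl_links m (L :: 'a family)"
  by (induction rule: sq_induct) (auto intro: gl_links_star gl_links_weld)

lemma gl_gl_links:
  fixes K :: "'a family"
  assumes "gl m K" shows "gl_links m K"
  using assms unfolding gl_def
proof
  assume "bal m K"
  then obtain V where V: "finite V" "card V = m" "sq (Pow V) K" by (auto simp: bal_def)
  have "gl_links m (Pow V)"
    unfolding gl_links_def
  proof
    fix t assume t: "t \<in> Pow V"
    have l: "lk t (Pow V) = Pow (V - t)" using t by (auto simp: lk_def)
    have c: "card (V - t) = m - card t" "card t \<le> m" using t V card_mono[of V t] by (auto simp: card_Diff_subset finite_subset)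
    show "card t \<le> m \<and> gl (m - card t) (lk t (Pow V))"
    proof (cases "V - t = {}")
      case True
      \<comment> \<open>The whole simplex has the link \<open>{{}}\<close>, the boundary of a point,
        which counts as the sphere of index 0.\<close>
      obtain w :: "'a vertex" where True by blast
      have "sph 0 {{} :: 'a vertex set}" using sph_self[of "{w}"] by (simp add: Pow_insert insert_Diff_if)
      moreover have "m - card t = 0" using True c(1) by (metis card.empty)
      moreover have "lk t (Pow V) = {{}}" unfolding l True by simp
      ultimately show ?thesis using c(2) by (simp add: gl_def)
    next
      case False
      then show ?thesis using bal_self[of "V - t"] V l c by (simp add: gl_def)
    qed
  qed
  then show ?thesis using gl_links_sq V by blast
next
  assume "sph m K"
  then obtain V where V: "finite V" "card V = m + 1" "sq (Pow V - {V}) K" by (auto simp: sph_def)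
  have "gl_links m (Pow V - {V})"
    unfolding gl_links_def
  proof
    fix t assume t: "t \<in> Pow V - {V}"
    have l: "lk t (Pow V - {V}) = Pow (V - t) - {V - t}" using t by (auto simp: lk_def)
    have "t \<subset> V" using t by auto
    then have "card t < card V" using V by (intro psubset_card_mono)
    then have c: "card (V - t) = m + 1 - card t" "card t \<le> m" using t V by (auto simp: card_Diff_subset finite_subset)
    have "V - t \<noteq> {}" using t by auto
    then have "sph (card (V - t) - 1) (Pow (V - t) - {V - t})" using V by (intro sph_self) auto
    then show "card t \<le> m \<and> gl (m - card t) (lk t (Pow V - {V}))" using l c by (simp add: gl_def)
  qed
  then show ?thesis using gl_links_sq V by blast
qed

text \<open>Each link is a ball or a sphere, and the parity in \<open>bd\<close> decides between
  them.\<close>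

lemma gl_lk:
  fixes K :: "'a family"
  assumes "gl m K" "t \<in> K"
  shows "card t \<le> m" "t \<in> bd K \<Longrightarrow> bal (m - card t) (lk t K)" "t \<notin> bd K \<Longrightarrow> sph (m - card t) (lk t K)"
proof -
  have g: "card t \<le> m" "gl (m - card t) (lk t K)" using gl_gl_links[OF assms(1)] assms(2) by (auto simp: gl_links_def)
  show "card t \<le> m" by (rule g(1))
  show "t \<in> bd K \<Longrightarrow> bal (m - card t) (lk t K)" using g(2) sph_odd by (auto simp: gl_def bd_def)
  show "t \<notin> bd K \<Longrightarrow> sph (m - card t) (lk t K)" using g(2) bal_even assms(2) by (auto simp: gl_def bd_def)
qed

section \<open>Replacing a ball by the cone over its boundary inside a family\<close>

abbreviation seq :: "('i \<Rightarrow> 'v set set) \<Rightarrow> ('i \<Rightarrow> 'v set set) \<Rightarrow> bool" where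
  "seq \<equiv> lseq (\<lambda>_. ())"

definition glue :: "'v set set \<Rightarrow> ('i \<Rightarrow> 'v set set) \<Rightarrow> ('i \<Rightarrow> 'v set set) \<Rightarrow> 'i \<Rightarrow> 'v set set" where
  "glue K J L = (\<lambda>X. jn K (J X) \<union> L X)"

text \<open>Describes how a cell \<open>K\<close> with boundary \<open>S\<close> sits in a family:
  in the member \<open>X\<close> it is joined with \<open>J X\<close>, and \<open>L X\<close> is the
  rest. A void \<open>J X\<close> means that this member does not involve the interior of
  \<open>K\<close>.\<close>

definition env :: "'v set set \<Rightarrow> 'v set set \<Rightarrow> ('i \<Rightarrow> 'v set set) \<Rightarrow> ('i \<Rightarrow> 'v set set) \<Rightarrow> bool" where
  "env K S J L \<longleftrightarrow> fam J \<and> fam L \<and> \<Union>K \<inter> verts J = {} \<and> (\<forall>X. jn S (J X) \<subseteq> L X) \<and> (\<forall>X. (K - S) \<inter> L X = {})"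

text \<open>All surroundings are quantified over, because the induction over moves shifts parts of
  the ball into the surroundings. The \<open>itself\<close> argument fixes the index type of the
  families.\<close>

definition conable :: "'i itself \<Rightarrow> 'a family \<Rightarrow> bool" where
  "conable _ K \<longleftrightarrow> (\<forall>(J :: 'i \<Rightarrow> 'a family) L v. env K (bd K) J L \<longrightarrow> v \<notin> \<Union>K \<union> verts J \<union> verts L \<longrightarrow>
     seq (glue K J L) (glue (cone v (bd K)) J L))"

lemma jn_un: "jn (K \<union> K') J = jn K J \<union> jn K' J"
  by (auto simp: jn_def)

lemma jn_mono: "K \<subseteq> K' \<Longrightarrow> jn K J \<subseteq> jn K' J"
  by (auto simp: jn_def)

lemma jn_assoc: "jn (jn K J) L = jn K (jn J L)"
proof (intro equalityI subsetI)
  fix t assume "t \<in> jn (jn K J) L"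
  then obtain a b c where "t = (a \<union> b) \<union> c" "a \<in> K" "b \<in> J" "c \<in> L" by (auto simp: jn_def)
  moreover from this have "t = a \<union> (b \<union> c)" "b \<union> c \<in> jn J L" by (auto simp: jn_def)
  ultimately show "t \<in> jn K (jn J L)" unfolding jn_def[of K] by blast
next
  fix t assume "t \<in> jn K (jn J L)"
  then obtain a b c where "t = a \<union> (b \<union> c)" "a \<in> K" "b \<in> J" "c \<in> L" by (auto simp: jn_def)
  moreover from this have "t = (a \<union> b) \<union> c" "a \<union> b \<in> jn K J" by (auto simp: jn_def)
  ultimately show "t \<in> jn (jn K J) L" unfolding jn_def[of "jn K J"] by blast
qed

lemma verts_member: "t \<in> J X \<Longrightarrow> t \<subseteq> verts J"
  by (auto simp: verts_def simps_def)

lemma verts_glue_subset: "verts (glue K J L) \<subseteq> \<Union>K \<union> verts J \<union> verts L"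
  by (auto simp: verts_def simps_def glue_def jn_def)

lemma simps_glue: "simps (glue K J L) = jn K (simps J) \<union> simps L"
  by (auto simp: simps_def glue_def jn_def)

lemma fam_glue:
  assumes "fam1 K" "fam J" "fam L" shows "fam (glue K J L)"
  unfolding fam_def
proof (intro conjI ballI allI)
  have "fam1 (simps J)" using assms(2) simps_down_closed by (auto simp: fam_def fam_unit)
  then have F: "fam1 (jn K (simps J))" using assms(1) fam1_jn by blast
  show "finite (simps (glue K J L))" "\<And>s. s \<in> simps (glue K J L) \<Longrightarrow> finite s"
    using F assms(3) by (auto simp: simps_glue fam_unit fam_def)
  fix X
  have "fam1 (J X)" using assms(2) in_simps[of J X] by (auto simp: fam_def fam_unit intro: finite_subset)
  then have "down_closed (jn K (J X))" using fam1_jn[OF assms(1)] by (simp add: fam_unit)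
  then show "down_closed (glue K J L X)" using fam_down_closed[OF assms(3), of X] by (auto simp: glue_def down_closed_def)
qed

lemma sts_glue:
  assumes "\<Union>K \<inter> verts J = {}" "E \<inter> verts J = {}" "a \<notin> verts J"
  shows "sts E a (glue K J L) = glue (st E a K) J (sts E a L)"
proof
  fix X
  have "\<Union>(J X) \<subseteq> verts J" using verts_member[of _ J X] by blast
  then have "st E a (jn K (J X)) = jn (st E a K) (J X)" using assms by (intro st_jn) auto
  then show "sts E a (glue K J L) X = glue (st E a K) J (sts E a L) X" by (simp add: sts_def glue_def st_un)
qed

lemma seq_star:
  fixes Z :: "'i \<Rightarrow> 'a family"
  assumes "fam Z" "F \<noteq> {}" "f \<notin> verts Z" shows "seq Z (sts F f Z)"
  using lseq_star[OF rich_const assms(1,3)] assms(2) by blast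

lemma st_noop1: "fam1 K \<Longrightarrow> E \<notin> K \<Longrightarrow> a \<notin> \<Union>K \<Longrightarrow> st E a K = K"
  by (rule st_noop) (simp_all add: fam_unit)

lemma bd_sub: "bd K \<subseteq> K"
  by (auto simp: bd_def)

lemma bd_lk: "lk t (bd K) = bd (lk t K)"
proof -
  have "s \<in> lk t (bd K) \<longleftrightarrow> s \<in> bd (lk t K)" for s
  proof (cases "s \<inter> t = {}")
    case True then show ?thesis using lk_lk[OF True, of K] by (auto simp: bd_def lk_def[of t])
  qed (auto simp: lk_def bd_def)
  then show ?thesis by blast
qed

text \<open>The link of a simplex of \<open>L\<close> in the cone is itself a cone, hence of even
  size; a simplex through the apex has the link of its base in \<open>L\<close>.\<close>

lemma bd_cone:
  assumes "fam1 L" "x \<notin> \<Union>L" shows "bd (cone x L) = L \<union> insert x ` bd L"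
proof -
  have inj: "inj_on (insert x) M" if "M \<subseteq> L" for M using that assms(2) by (auto simp: inj_on_def)
  have 1: "even (card (lk t (cone x L)))" if t: "t \<in> L" for t
  proof -
    have xt: "x \<notin> t" using t assms by auto
    have x: "x \<notin> \<Union>(lk t L)" using assms(2) by (auto simp: lk_def)
    have "s \<in> lk t (cone x L) \<longleftrightarrow> s \<in> cone x (lk t L)" for s
    proof -
      have "s \<union> t - {x} = (s - {x}) \<union> t" using xt by auto
      then show ?thesis using xt unfolding in_cone[OF x] by (auto simp: lk_def in_cone[OF assms(2)])
    qed
    then have e: "lk t (cone x L) = cone x (lk t L)" by blast
    have fin: "finite (lk t L)" using fam1_lk[OF assms(1)] by (simp add: fam_unit)
    have "inj_on (insert x) (lk t L)" using x by (auto simp: inj_on_def)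
    moreover have "lk t L \<inter> insert x ` lk t L = {}" using x by auto
    ultimately have "card (cone x (lk t L)) = card (lk t L) + card (lk t L)"
      unfolding cone_def using fin by (simp add: card_Un_disjoint card_image)
    then show ?thesis unfolding e by simp
  qed
  have 2: "lk (insert x s) (cone x L) = lk s L" if s: "s \<in> L" for s
  proof -
    have "u \<in> lk (insert x s) (cone x L) \<longleftrightarrow> u \<in> lk s L" for u
    proof (cases "x \<in> u")
      case True then show ?thesis using assms(2) by (auto simp: lk_def)
    next
      case False
      then have "u \<union> insert x s - {x} = u \<union> s" using s assms(2) by auto
      then show ?thesis using False by (auto simp: lk_def in_cone[OF assms(2)])
    qed
    then show ?thesis by blast
  qed
  have "t \<in> bd (cone x L) \<longleftrightarrow> t \<in> L \<or> t \<in> insert x ` bd L" for t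
  proof (cases "x \<in> t")
    case True
    have "t \<notin> L" using True assms by auto
    moreover have "t \<in> bd (cone x L) \<longleftrightarrow> (\<exists>s\<in>L. t = insert x s \<and> even (card (lk t (cone x L))))"
      using calculation by (auto simp: bd_def cone_def)
    moreover have "\<dots> \<longleftrightarrow> t \<in> insert x ` bd L" using 2 by (auto simp: bd_def)
    ultimately show ?thesis by blast
  next
    case False
    then show ?thesis using 1 by (auto simp: bd_def cone_def)
  qed
  then show ?thesis by blast
qed

text \<open>Starring the top simplex at \<open>v\<close> is exactly this replacement, and it does
  not touch the rest, which lacks \<open>V\<close>.\<close>

lemma conable_Pow:
  fixes V :: "'a vertex set"
  assumes "finite V" "V \<noteq> {}" shows "conable TYPE('i) (Pow V)"
  unfolding conable_def
proof (intro allI impI)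
  fix J L :: "'i \<Rightarrow> 'a family" and v
  have b: "bd (Pow V) = Pow V - {V}"
  proof -
    have "even (card (lk s (Pow V))) \<longleftrightarrow> s \<noteq> V" if "s \<in> Pow V" for s
    proof -
      have "lk s (Pow V) = Pow (V - s)" using that by (auto simp: lk_def)
      then show ?thesis using assms that by (auto simp: card_Pow)
    qed
    then show ?thesis by (auto simp: bd_def)
  qed
  assume "env (Pow V) (bd (Pow V)) J L" and v: "v \<notin> \<Union>(Pow V) \<union> verts J \<union> verts L"
  then have e: "fam J" "fam L" "V \<inter> verts J = {}" "\<And>X. V \<notin> L X" by (auto simp: env_def b)
  have "seq (glue (Pow V) J L) (sts V v (glue (Pow V) J L))"
    using v verts_glue_subset[of "Pow V" J L] assms by (intro seq_star fam_glue fam1_Pow e) auto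
  also have "sts V v (glue (Pow V) J L) = glue (st V v (Pow V)) J (sts V v L)"
    using e v by (intro sts_glue) auto
  also have "sts V v L = L" using e v by (intro sts_noop) (auto simp: simps_def)
  also have "st V v (Pow V) = cone v (bd (Pow V))" using cone_bdPow[of v V] v b by simp
  finally show "seq (glue (Pow V) J L) (glue (cone v (bd (Pow V))) J L)" .
qed

lemma st_cone:
  assumes "v \<notin> \<Union>S" "v \<notin> E" "v \<noteq> a" "v \<notin> \<Union>(st E a S)"
  shows "st E a (cone v S) = cone v (st E a S)"
proof -
  have "t \<in> st E a (cone v S) \<longleftrightarrow> t \<in> cone v (st E a S)" for t
  proof -
    have "t - {a} \<union> E - {v} = t - {v} - {a} \<union> E" "E \<subseteq> t - {v} \<longleftrightarrow> E \<subseteq> t" "a \<in> t - {v} \<longleftrightarrow> a \<in> t" using assms by auto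
    then show ?thesis unfolding in_cone[OF assms(4)] in_st in_cone[OF assms(1)] by simp
  qed
  then show ?thesis by blast
qed

lemma Union_st_subset: "\<Union>(st E a K) \<subseteq> insert a (\<Union>K)"
  using verts_sts_subset[of E a "\<lambda>_ :: unit. K"] by (simp add: verts_def simps_sts)

text \<open>Starring at a new vertex commutes with \<open>bd\<close> and turns no non-empty family
  into the empty one.\<close>

lemma sq_bd_empty: "sq K L \<Longrightarrow> bd K = {} \<Longrightarrow> bd L = {}"
proof (induction rule: sq_induct)
  case (star Y i j a)
  then show ?case using bd_st[of Y i j a] by (auto simp: st_def)
next
  case (weld Y i j a)
  have e: "st {i, j} a (bd Y) = {}" using weld bd_st[of Y i j a] by simp
  show ?case
  proof (rule ccontr)
    assume "bd Y \<noteq> {}"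
    then obtain t where t: "t \<in> bd Y" by blast
    then have at: "a \<notin> t" using weld(3) by (auto simp: bd_def)
    show False
    proof (cases "{i, j} \<subseteq> t")
      case False
      then have "t \<in> st {i, j} a (bd Y)" using t at by (simp add: in_st)
      then show False using e by simp
    next
      case True
      have "insert a (t - {i}) - {a} \<union> {i, j} = t" using True at by blast
      moreover have "\<not> {i, j} \<subseteq> insert a (t - {i})" using True at by blast
      ultimately have "insert a (t - {i}) \<in> st {i, j} a (bd Y)" using t by (simp only: in_st insertI1 if_True not_False_eq_True simp_thms)
      then show False using e by simp
    qed
  qed
qed

lemma sph_bd: "sph m K \<Longrightarrow> bd K = {}"
proof -
  assume "sph m K"
  then obtain V where V: "finite V" "sq (Pow V - {V}) K" by (auto simp: sph_def)
  have "bd (Pow V - {V}) = {}"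
  proof -
    have "odd (card (lk t (Pow V - {V})))" if "t \<in> Pow V - {V}" for t
    proof -
      have l: "lk t (Pow V - {V}) = Pow (V - t) - {V - t}" using that by (auto simp: lk_def)
      have "card (V - t) \<noteq> 0" using that V(1) by auto
      then show ?thesis unfolding l using V(1) by (simp add: card_Pow card_Diff_singleton)
    qed
    then show ?thesis by (auto simp: bd_def)
  qed
  then show ?thesis using sq_bd_empty V by blast
qed

text \<open>An interior simplex has a sphere as its link. Spheres have no boundary, so no simplex
  above it lies in the boundary of \<open>K\<close>.\<close>

lemma bd_down_closed:
  fixes K :: "'a family"
  assumes "gl m K" "fam1 K" shows "down_closed (bd K)"
  unfolding down_closed_def
proof (intro ballI allI impI)
  fix t s assume t: "t \<in> bd K" "s \<subseteq> t"
  have sK: "s \<in> K" using t assms(2) bd_sub[of K] down_closedD[of K t s] by (auto simp: fam_unit)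
  show "s \<in> bd K"
  proof (rule ccontr)
    assume "s \<notin> bd K"
    then have "bd (lk s K) = {}" using gl_lk(3)[OF assms(1) sK] sph_bd by blast
    then have "lk s (bd K) = {}" by (simp add: bd_lk)
    moreover have "t - s \<in> lk s (bd K)" using t by (auto simp: lk_def Un_absorb2)
    ultimately show False by blast
  qed
qed

lemma fam1_bd: "gl m K \<Longrightarrow> fam1 K \<Longrightarrow> fam1 (bd (K :: 'a family))"
  using bd_down_closed[of m K] bd_sub[of K] by (auto simp: fam_unit intro: finite_subset)

lemma Union_cone_subset: "\<Union>(cone v S) \<subseteq> insert v (\<Union>S)"
  by (auto simp: cone_def)

text \<open>The edge is starred in the whole family, the hypothesis is applied there, and the
  starring is undone; coning the boundary commutes with it.\<close>

lemma conable_weld: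
  fixes K :: "'a family" and J L :: "'i \<Rightarrow> 'a family"
  assumes K: "fam1 K" "gl m K" "{p, q} \<in> K" and b: "b \<notin> \<Union>K \<union> verts J \<union> verts L \<union> {v}"
    and c: "conable TYPE('i) (st {p, q} b K)" and e: "env K (bd K) J L" and v: "v \<notin> \<Union>K \<union> verts J \<union> verts L"
  shows "seq (glue K J L) (glue (cone v (bd K)) J L)"
proof -
  let ?E = "{p, q}" let ?K = "st ?E b K" let ?L = "sts ?E b L" let ?S = "bd K"
  have E: "fam J" "fam L" "\<Union>K \<inter> verts J = {}" "\<And>X. jn ?S (J X) \<subseteq> L X" "\<And>X. (K - ?S) \<inter> L X = {}"
    using e by (auto simp: env_def)
  have pq: "?E \<subseteq> \<Union>K" using K(3) by auto
  have EJ: "?E \<inter> verts J = {}" using pq E(3) by blast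
  have S': "bd ?K = st ?E b ?S" using bd_st[OF K(1,3)] b by simp
  have fS: "fam1 ?S" using fam1_bd K by blast
  have dS: "\<Union>?S \<inter> verts J = {}" using E(3) bd_sub[of K] by auto
  have "env ?K (bd ?K) J ?L"
    unfolding env_def S'
  proof (intro conjI allI)
    show "fam J" "fam ?L" using E by (auto intro: fam_sts)
    show "\<Union>?K \<inter> verts J = {}" using Union_st_subset[of ?E b K] E(3) b by auto
    fix X
    have "\<Union>(J X) \<subseteq> verts J" using verts_member[of _ J X] by blast
    then have "jn (st ?E b ?S) (J X) = st ?E b (jn ?S (J X))"
      using dS EJ b by (intro st_jn[symmetric]) auto
    then show "jn (st ?E b ?S) (J X) \<subseteq> ?L X" using E(4)[of X] st_mono unfolding sts_def by metis
    show "(?K - st ?E b ?S) \<inter> ?L X = {}"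
    proof (rule ccontr)
      assume "(?K - st ?E b ?S) \<inter> ?L X \<noteq> {}"
      then obtain s where s: "s \<in> ?K" "s \<notin> st ?E b ?S" "s \<in> ?L X" by blast
      then show False using E(5)[of X] by (cases "b \<in> s") (auto simp: in_st sts_def)
    qed
  qed
  moreover have "v \<notin> \<Union>?K \<union> verts J \<union> verts ?L"
    using v b Union_st_subset[of ?E b K] verts_sts_subset[of ?E b L] by auto
  ultimately have 1: "seq (glue ?K J ?L) (glue (cone v (bd ?K)) J ?L)" using c unfolding conable_def by blast
  have "b \<notin> verts (glue K J L)" using b verts_glue_subset[of K J L] by auto
  then have 2: "seq (glue K J L) (glue ?K J ?L)"
    using seq_star[OF fam_glue[OF K(1) E(1,2)], of ?E b] sts_glue[OF E(3) EJ, of b L] b by simp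
  have vS: "v \<notin> \<Union>?S" using v bd_sub[of K] by auto
  have "cone v (bd ?K) = st ?E b (cone v ?S)"
    unfolding S' using vS v b pq Union_st_subset[of ?E b ?S] by (intro st_cone[symmetric]) auto
  moreover have dc: "\<Union>(cone v ?S) \<inter> verts J = {}" using dS v by (auto simp: cone_def)
  ultimately have "glue (cone v (bd ?K)) J ?L = sts ?E b (glue (cone v ?S) J L)"
    using sts_glue[OF dc EJ, of b L] b by simp
  moreover have "b \<notin> verts (glue (cone v ?S) J L)"
    using b verts_glue_subset[of "cone v ?S" J L] bd_sub[of K] Union_cone_subset[of v ?S] by blast
  ultimately have "seq (glue (cone v ?S) J L) (glue (cone v (bd ?K)) J ?L)"
    using seq_star[OF fam_glue[OF fam1_cone[OF fS] E(1,2)], of ?E b] by simp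
  then show ?thesis using 1 2 lseq_trans lseq_sym by metis
qed

lemma in_jn_bdPow:
  assumes "E = {p, q}" "p \<noteq> q" "\<Union>K \<inter> E = {}"
  shows "t \<in> jn K {{}, {p}, {q}} \<longleftrightarrow> \<not> E \<subseteq> t \<and> t - E \<in> K"
proof -
  have "\<Union>K \<inter> \<Union>{{}, {p}, {q}} = {}" "\<Union>{{}, {p}, {q}} = E" using assms by auto
  then show ?thesis using in_jn[of K "{{}, {p}, {q}}" t] assms by auto
qed

text \<open>
  The ball \<open>K'\<close> obtained by starring a boundary edge \<open>E\<close> of \<open>K\<close> at \<open>x\<close> is traded for \<open>K\<close> together
  with a layer \<open>Q\<close> that separates \<open>K\<close> from the old boundary; this uses the statement one dimension
  lower, for the cone from \<open>x\<close> over the link of \<open>E\<close>.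
\<close>

lemma conable_star_boundary:
  fixes K :: "'a family" and J L :: "'i \<Rightarrow> 'a family"
  assumes K: "fam1 K" "gl m K" and E: "E = {p, q}" "p \<noteq> q" "E \<in> bd K" and x: "x \<notin> \<Union>K"
    and cK: "conable TYPE('i) K" and cl: "conable TYPE('i) (cone x (lk E K))"
    and e: "env (st E x K) (bd (st E x K)) J L" and v: "v \<notin> \<Union>(st E x K) \<union> verts J \<union> verts L"
    and EL: "\<And>X. E \<notin> L X"
  shows "seq (glue (st E x K) J L) (glue (cone v (bd (st E x K))) J L)"
proof -
  define S where "S = bd K"
  define D where "D = {{}, {p}, {q}}"
  define Lk where "Lk = lk E K"
  define M where "M = lk E S"
  define K1 where "K1 = cone x Lk"
  define K0 where "K0 = {s \<in> K. \<not> E \<subseteq> s}"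
  \<comment> \<open>The cone from \<open>x\<close> over the star of \<open>E\<close> in the old
    boundary; it fills the gap between the old boundary and the starred one.\<close>
  define Q where "Q = jn (cone x M) (Pow E)"
  let ?K = "st E x K"
  have EK: "{p, q} \<in> K" using E bd_sub[of K] by auto
  have dcK: "down_closed K" using K by (simp add: fam_unit)
  have fS: "fam1 S" unfolding S_def using fam1_bd K by blast
  have dcS: "down_closed S" using fS by (simp add: fam_unit)
  have SK: "S \<subseteq> K" unfolding S_def by (rule bd_sub)
  have S': "bd ?K = st E x S" unfolding S_def E(1) using bd_st[OF K(1) EK x] .
  have xE: "x \<notin> E" "E \<subseteq> \<Union>K" using E EK x by auto
  have UK: "\<Union>?K = insert x (\<Union>K)"
  proof (intro equalityI Union_st_subset subsetI)
    fix w assume w: "w \<in> insert x (\<Union>K)"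
    have "{w} \<in> ?K"
    proof (cases "w = x")
      case True then show ?thesis using E EK xE by (auto simp: in_st)
    next
      case False
      then have "{w} \<in> K" using w down_closedD[OF dcK, of _ "{w}"] by auto
      then show ?thesis using False E by (auto simp: in_st)
    qed
    then show "w \<in> \<Union>?K" by blast
  qed
  have en: "fam J" "fam L" "\<Union>?K \<inter> verts J = {}" "\<And>X. jn (st E x S) (J X) \<subseteq> L X" "\<And>X. (?K - st E x S) \<inter> L X = {}"
    using e by (auto simp: env_def S')
  have xJ: "x \<notin> verts J" "E \<inter> verts J = {}" "\<Union>K \<inter> verts J = {}" using en(3) UK xE by auto
  have vx: "v \<noteq> x" "v \<notin> \<Union>K" "v \<notin> E" "v \<notin> \<Union>S" using v UK xE SK by auto
  have xS: "x \<notin> \<Union>S" using x SK by auto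
  have xLk: "x \<notin> \<Union>Lk" "x \<notin> \<Union>M" "\<Union>Lk \<inter> E = {}" "\<Union>M \<inter> E = {}" using x xS by (auto simp: Lk_def M_def lk_def)
  have bdLk: "bd Lk = M" unfolding Lk_def M_def S_def by (rule bd_lk[symmetric])
  have fLk: "fam1 Lk" unfolding Lk_def by (rule fam1_lk[OF K(1)])
  have fM: "fam1 M" unfolding M_def by (rule fam1_lk[OF fS])
  have bdK1: "bd K1 = Lk \<union> insert x ` M" unfolding K1_def bdLk[symmetric] by (rule bd_cone[OF fLk xLk(1)])
  have fK1: "fam1 K1" unfolding K1_def by (rule fam1_cone[OF fLk])
  have fD: "fam1 D" by (auto simp: D_def fam_unit down_closed_def)
  have fK0: "fam1 K0" using K(1) dcK by (auto simp: K0_def fam_unit down_closed_def)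
  have inLk: "u - E \<in> Lk \<longleftrightarrow> u \<union> E \<in> K" "u - E \<in> M \<longleftrightarrow> u \<union> E \<in> S" for u
  proof -
    have "u - E \<union> E = u \<union> E" by auto
    then show "u - E \<in> Lk \<longleftrightarrow> u \<union> E \<in> K" "u - E \<in> M \<longleftrightarrow> u \<union> E \<in> S" by (auto simp: Lk_def M_def lk_def)
  qed
  have inK1: "t \<in> jn K1 D \<longleftrightarrow> \<not> E \<subseteq> t \<and> t - {x} \<union> E \<in> K" for t
  proof -
    have "\<Union>K1 \<inter> E = {}" using xLk xE by (auto simp: K1_def cone_def)
    then have "t \<in> jn K1 D \<longleftrightarrow> \<not> E \<subseteq> t \<and> t - E \<in> K1" unfolding D_def by (rule in_jn_bdPow[OF E(1,2)])
    moreover have "t - E - {x} = (t - {x}) - E" by auto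
    ultimately show ?thesis unfolding K1_def in_cone[OF xLk(1)] by (simp add: inLk)
  qed
  have inbdK1: "u - E \<in> bd K1 \<longleftrightarrow> (if x \<in> u then u - {x} \<union> E \<in> S else u \<union> E \<in> K)" for u
  proof -
    have "u - E \<in> insert x ` M \<longleftrightarrow> x \<in> u \<and> u - {x} - E \<in> M"
    proof
      assume "u - E \<in> insert x ` M"
      then obtain w where w: "w \<in> M" "u - E = insert x w" by blast
      then have "u - {x} - E = w" using xLk(2) by auto
      then show "x \<in> u \<and> u - {x} - E \<in> M" using w by auto
    next
      assume "x \<in> u \<and> u - {x} - E \<in> M"
      moreover from this have "u - E = insert x (u - {x} - E)" using xE by auto
      ultimately show "u - E \<in> insert x ` M" by blast
    qed
    moreover have "u - E \<in> Lk \<Longrightarrow> x \<notin> u" using xLk(1) xE by auto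
    ultimately show ?thesis unfolding bdK1 using inLk by auto
  qed
  have inbd: "t \<in> jn (bd K1) D \<longleftrightarrow> \<not> E \<subseteq> t \<and> (if x \<in> t then t - {x} \<union> E \<in> S else t \<union> E \<in> K)" for t
  proof -
    have "\<Union>(bd K1) \<inter> E = {}" using xLk xE by (auto simp: bdK1)
    then have "t \<in> jn (bd K1) D \<longleftrightarrow> \<not> E \<subseteq> t \<and> t - E \<in> bd K1" unfolding D_def by (rule in_jn_bdPow[OF E(1,2)])
    then show ?thesis by (simp only: inbdK1)
  qed
  have inQ: "t \<in> Q \<longleftrightarrow> t - {x} \<union> E \<in> S" for t
  proof -
    have "\<Union>(cone x M) \<inter> \<Union>(Pow E) = {}" using xLk xE by (auto simp: cone_def)
    from in_jn[OF this] have "t \<in> Q \<longleftrightarrow> t - E \<in> cone x M" unfolding Q_def by auto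
    moreover have "t - E - {x} = (t - {x}) - E" by auto
    ultimately show ?thesis unfolding in_cone[OF xLk(2)] by (simp add: inLk)
  qed
  have fQ: "fam1 Q" unfolding Q_def using fM E by (intro fam1_jn fam1_cone fam1_Pow) auto
  obtain y where y: "y \<notin> \<Union>K \<union> verts J \<union> verts L \<union> {x, v}"
  proof -
    have "finite (\<Union>K)" using K(1) by (simp add: fam_unit)
    then have "finite (\<Union>K \<union> verts J \<union> verts L \<union> {x, v})"
      using fam_finite_verts[OF en(1)] fam_finite_verts[OF en(2)] by simp
    from ex_new_if_finite[OF infinite_vertex this] show thesis using that by blast
  qed
  obtain g where g: "g \<notin> \<Union>K \<union> verts J \<union> verts L \<union> {x, v}"
    using y by blast
  \<comment> \<open>\<open>L\<close> contains the join over the new boundary, so the comparisons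
    below are needed only modulo that boundary.\<close>
  have absorb: "glue A J L = glue B J L" if "A \<union> st E x S = B \<union> st E x S" for A B
  proof
    fix X
    have "jn A (J X) \<union> jn (st E x S) (J X) = jn B (J X) \<union> jn (st E x S) (J X)" using that by (simp add: jn_un[symmetric])
    then show "glue A J L X = glue B J L X" unfolding glue_def using en(4)[of X] by blast
  qed
  have K'eq: "?K = K0 \<union> jn K1 D"
  proof -
    have "t \<in> ?K \<longleftrightarrow> t \<in> K0 \<union> jn K1 D" for t
    proof (cases "x \<in> t")
      case True then show ?thesis using x by (auto simp: in_st inK1 K0_def)
    next
      case False
      then show ?thesis using down_closedD[OF dcK, of "t \<union> E" t] by (auto simp: in_st inK1 K0_def)
    qed
    then show ?thesis by blast
  qed
  \<comment> \<open>the cone over the link is replaced by the cone from \<open>y\<close> over its boundary\<close>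
  have A: "seq (glue ?K J L) (glue (K0 \<union> jn (cone y (bd K1)) D) J L)"
  proof -
    let ?J = "\<lambda>X. jn D (J X)" and ?L = "\<lambda>X. jn K0 (J X) \<union> L X"
    have gl: "glue (K0 \<union> jn A D) J L = glue A ?J ?L" for A
      unfolding glue_def by (auto simp: jn_un jn_assoc)
    have vJ: "verts ?J \<subseteq> E \<union> verts J" by (auto simp: verts_def simps_def jn_def D_def E)
    have "env K1 (bd K1) ?J ?L"
      unfolding env_def
    proof (intro conjI allI)
      have "glue D J (\<lambda>_. {}) = ?J" by (simp add: glue_def)
      then show "fam ?J" using fam_glue[OF fD en(1), of "\<lambda>_. {}"] by (simp add: fam_def simps_def down_closed_def)
      show "fam ?L" using fam_glue[OF fK0 en(1,2)] by (simp add: glue_def)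
      show "\<Union>K1 \<inter> verts ?J = {}"
      proof -
        have "\<Union>K1 \<subseteq> insert x (\<Union>Lk)" by (auto simp: K1_def cone_def)
        moreover have "\<Union>Lk \<subseteq> \<Union>K" using dcK by (auto simp: Lk_def lk_def)
        ultimately show ?thesis using vJ xJ xE xLk(3) by blast
      qed
      fix X
      have "jn (bd K1) D \<subseteq> K0 \<union> st E x S"
      proof
        fix t assume "t \<in> jn (bd K1) D"
        then show "t \<in> K0 \<union> st E x S" using down_closedD[OF dcK, of "t \<union> E" t] unfolding inbd by (auto simp: in_st K0_def split: if_splits)
      qed
      then have "jn (jn (bd K1) D) (J X) \<subseteq> jn K0 (J X) \<union> jn (st E x S) (J X)" using jn_mono jn_un by metis
      then show "jn (bd K1) (?J X) \<subseteq> ?L X" using en(4)[of X] by (auto simp: jn_assoc)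
      show "(K1 - bd K1) \<inter> ?L X = {}"
      proof (rule ccontr)
        assume "(K1 - bd K1) \<inter> ?L X \<noteq> {}"
        then obtain s where s: "s \<in> K1" "s \<notin> bd K1" "s \<in> jn K0 (J X) \<or> s \<in> L X" by blast
        have xs: "x \<in> s" using s(1,2) unfolding bdK1 by (auto simp: K1_def cone_def)
        have sE: "s - E = s" using s(1) xLk(3) xE by (auto simp: K1_def cone_def)
        have "s \<notin> jn K0 (J X)" using xs x xJ(1) verts_member[of _ J X] by (fastforce simp: jn_def K0_def)
        then have sL: "s \<in> L X" using s by blast
        have "s - {x} - E \<in> Lk" 
        proof -
          have "s - {x} \<in> Lk" using s(1) unfolding K1_def in_cone[OF xLk(1)] .
          moreover have "s - {x} - E = s - {x}" using sE by blast
          ultimately show ?thesis by simp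
        qed
        then have "s - {x} \<union> E \<in> K" using inLk(1)[of "s - {x}"] by simp
        moreover have "s - {x} \<union> E \<notin> S" using s(2) inbdK1[of s] sE xs by simp
        moreover have "\<not> E \<subseteq> s" using sE E by auto
        ultimately have "s \<in> ?K - st E x S" using xs by (simp add: in_st)
        then show False using en(5)[of X] sL by blast
      qed
    qed
    moreover have "y \<notin> \<Union>K1 \<union> verts ?J \<union> verts ?L"
    proof -
      have "\<Union>K1 \<subseteq> insert x (\<Union>K)" using dcK by (auto simp: K1_def cone_def Lk_def lk_def)
      moreover have "verts ?L \<subseteq> \<Union>K \<union> verts J \<union> verts L" using verts_glue_subset[of K0 J L] by (auto simp: glue_def K0_def)
      ultimately show ?thesis using y vJ xE by blast
    qed
    ultimately have "seq (glue K1 ?J ?L) (glue (cone y (bd K1)) ?J ?L)"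
      using cl unfolding conable_def K1_def[symmetric] Lk_def[symmetric] by blast
    then show ?thesis by (simp add: K'eq gl)
  qed
  let ?L2 = "\<lambda>X. L X \<union> jn Q (J X)"
  have L2: "glue A J ?L2 = glue (A \<union> Q) J L" for A by (auto simp: glue_def jn_un)
  have QJ: "\<Union>Q \<inter> verts J = {}"
  proof -
    have "\<Union>Q \<subseteq> insert x (\<Union>K)"
    proof
      fix w assume "w \<in> \<Union>Q"
      then obtain t where "w \<in> t" "t - {x} \<union> E \<in> S" using inQ by auto
      then show "w \<in> insert x (\<Union>K)" using SK by blast
    qed
    then show ?thesis using xJ by blast
  qed
  have starL: "sts E y L = L" "sts E g L = L" using EL en(2) y g by (auto intro!: sts_noop simp: simps_def)
  \<comment> \<open>Modulo the new boundary the present complex is \<open>K\<close> together with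
    the layer, starred along \<open>E\<close> at \<open>y\<close>; this starring is undone.\<close>
  have B: "seq (glue (K0 \<union> jn (cone y (bd K1)) D) J L) (glue K J ?L2)"
  proof -
    have "K0 \<union> jn (cone y (bd K1)) D \<union> st E x S = st E y (K \<union> Q) \<union> st E x S"
    proof -
      have yb: "y \<notin> \<Union>(bd K1)" "\<Union>(cone y (bd K1)) \<inter> E = {}"
      proof -
        have "\<Union>Lk \<subseteq> \<Union>K" "\<Union>M \<subseteq> \<Union>S" by (auto simp: Lk_def M_def lk_def)
        then have u: "\<Union>(bd K1) \<subseteq> insert x (\<Union>K)" unfolding bdK1 using SK by blast
        then show "y \<notin> \<Union>(bd K1)" using y by blast
        have "\<Union>(bd K1) \<inter> E = {}" using xLk xE by (auto simp: bdK1)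
        then show "\<Union>(cone y (bd K1)) \<inter> E = {}" using Union_cone_subset[of y "bd K1"] y xE by blast
      qed
      have in1: "t \<in> jn (cone y (bd K1)) D \<longleftrightarrow> \<not> E \<subseteq> t \<and> (if x \<in> t then t - {y} - {x} \<union> E \<in> S else t - {y} \<union> E \<in> K)" for t
      proof -
        have "t \<in> jn (cone y (bd K1)) D \<longleftrightarrow> \<not> E \<subseteq> t \<and> t - E \<in> cone y (bd K1)"
          unfolding D_def by (rule in_jn_bdPow[OF E(1,2) yb(2)])
        moreover have "t - E - {y} = (t - {y}) - E" by auto
        ultimately show ?thesis unfolding in_cone[OF yb(1)] using inbdK1[of "t - {y}"] y by (auto split: if_splits)
      qed
      have "t \<in> K0 \<union> jn (cone y (bd K1)) D \<union> st E x S \<longleftrightarrow> t \<in> st E y (K \<union> Q) \<union> st E x S" for t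
      proof -
        have xy: "x \<noteq> y" "y \<notin> E" using y xE by auto
        have 1: "t - {y} \<union> E - {x} \<union> E = t - {y} - {x} \<union> E" using xE by auto
        have 2: "t \<in> K \<Longrightarrow> x \<notin> t \<and> y \<notin> t" "t - {y} \<union> E \<in> K \<Longrightarrow> x \<notin> t" "t \<in> S \<Longrightarrow> t \<in> K" "t \<union> E \<in> K \<Longrightarrow> t \<in> K"
          "t - {x} \<union> E \<in> S \<Longrightarrow> y \<notin> t" "t - {y} \<union> E \<in> S \<Longrightarrow> t - {y} \<union> E \<in> K" "t \<union> E \<in> S \<Longrightarrow> t \<union> E \<in> K"
          using x y xy SK down_closedD[OF dcK, of "t \<union> E" t] by auto
        have 3: "x \<notin> t \<Longrightarrow> t - {x} = t" "y \<notin> t \<Longrightarrow> t - {y} = t" "x \<notin> t \<Longrightarrow> t - {y} - {x} = t - {y}" "y \<notin> t \<Longrightarrow> t - {y} - {x} = t - {x}" by auto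
        show ?thesis
          unfolding Un_iff in1 K0_def mem_Collect_eq in_st[of t E y] in_st[of t E x] inQ 1
          by (cases "x \<in> t"; cases "y \<in> t") (use 2 3 in \<open>simp_all, blast+\<close>)
      qed
      then show ?thesis by blast
    qed
    then have "glue (K0 \<union> jn (cone y (bd K1)) D) J L = glue (st E y (K \<union> Q)) J L" by (rule absorb)
    also have "\<dots> = sts E y (glue (K \<union> Q) J L)"
    proof -
      have "\<Union>(K \<union> Q) \<inter> verts J = {}" using xJ QJ by blast
      then show ?thesis using sts_glue[of "K \<union> Q" J E y L] starL xJ y by simp
    qed
    finally have eq: "glue (K0 \<union> jn (cone y (bd K1)) D) J L = sts E y (glue K J ?L2)" by (simp add: L2)
    have "fam (glue (K \<union> Q) J L)"
      using K(1) fQ en by (intro fam_glue) (auto simp: fam_unit down_closed_def)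
    moreover have "y \<notin> verts (glue (K \<union> Q) J L)"
    proof -
      have "y \<notin> \<Union>Q" using y SK by (auto simp: inQ)
      then show ?thesis using y verts_glue_subset[of "K \<union> Q" J L] by auto
    qed
    ultimately show ?thesis unfolding eq L2 using E(1) by (intro lseq_sym[OF seq_star]) auto
  qed
  \<comment> \<open>The layer is counted among the surroundings; \<open>K\<close> then meets them in
    its old boundary, and its own hypothesis applies.\<close>
  have C: "seq (glue K J ?L2) (glue (cone v S) J ?L2)"
  proof -
    have fL2: "fam ?L2" using fam_glue[OF fQ en(1,2)] by (simp add: glue_def Un_commute)
    have "env K (bd K) J ?L2"
      unfolding env_def S_def[symmetric]
    proof (intro conjI allI)
      show "fam J" "fam ?L2" "\<Union>K \<inter> verts J = {}" by (fact en(1) fL2 xJ(3))+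
      fix X
      have "S \<subseteq> st E x S \<union> Q"
      proof
        fix t assume t: "t \<in> S"
        then have "x \<notin> t" using xS by auto
        then show "t \<in> st E x S \<union> Q" using t by (cases "E \<subseteq> t") (auto simp: in_st inQ Un_absorb2)
      qed
      then have "jn S (J X) \<subseteq> jn (st E x S) (J X) \<union> jn Q (J X)" using jn_mono jn_un by metis
      then show "jn S (J X) \<subseteq> ?L2 X" using en(4)[of X] by blast
      show "(K - S) \<inter> ?L2 X = {}"
      proof (rule ccontr)
        assume "(K - S) \<inter> ?L2 X \<noteq> {}"
        then obtain s where s: "s \<in> K" "s \<notin> S" "s \<in> L X \<or> s \<in> jn Q (J X)" by blast
        have xs: "x \<notin> s" using s x by auto
        have "s \<notin> jn Q (J X)"
        proof
          assume sQ: "s \<in> jn Q (J X)"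
          have "\<Union>Q \<inter> \<Union>(J X) = {}" using QJ verts_member[of _ J X] by blast
          then have "s - \<Union>(J X) \<in> Q" using sQ in_jn[of Q "J X" s] by blast
          moreover have "s \<inter> \<Union>(J X) = {}" using s(1) xJ(3) verts_member[of _ J X] by blast
          ultimately have "s \<in> Q" by (simp add: Diff_triv)
          then have "s \<union> E \<in> S" using xs by (simp add: inQ)
          then show False using s(2) down_closedD[OF dcS, of "s \<union> E" s] by blast
        qed
        then have sL: "s \<in> L X" using s by blast
        show False
        proof (cases "E \<subseteq> s")
          case True
          then show False using EL[of X] down_closedD[OF fam_down_closed[OF en(2)] sL] by blast
        next
          case False
          then have "s \<in> ?K - st E x S" using s xs by (simp add: in_st)
          then show False using en(5)[of X] sL by blast
        qed
      qed
    qed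
    moreover have "v \<notin> \<Union>K \<union> verts J \<union> verts ?L2"
    proof -
      have "v \<notin> \<Union>Q" using vx by (auto simp: inQ)
      moreover have "verts ?L2 \<subseteq> \<Union>Q \<union> verts J \<union> verts L" using verts_glue_subset[of Q J L] by (auto simp: glue_def Un_commute)
      ultimately show ?thesis using v vx by blast
    qed
    ultimately show ?thesis using cK unfolding conable_def S_def by blast
  qed
  \<comment> \<open>Near \<open>E\<close> the cones from \<open>v\<close> and \<open>x\<close> over
    the star of \<open>E\<close> are exchanged for the join of the edge \<open>{v, x}\<close> with
    the boundary of \<open>E\<close> and the link: starring \<open>E\<close> or
    \<open>{v, x}\<close> at \<open>g\<close> gives the same complex modulo the new
    boundary.\<close>
  have F: "seq (glue (cone v S) J ?L2) (glue (cone v (st E x S)) J L)"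
  proof -
    have vS': "v \<notin> \<Union>(st E x S)" using Union_st_subset[of E x S] vx by auto
    have gn: "g \<noteq> x" "g \<noteq> v" "g \<notin> E" "g \<notin> \<Union>S" using g xE SK by auto
    have dS: "\<Union>(cone v S \<union> Q) \<inter> verts J = {}" 
      using QJ xJ SK v Union_cone_subset[of v S] by (simp only: Union_Un_distrib) blast
    have dS': "\<Union>(cone v (st E x S)) \<inter> verts J = {}"
      using Union_st_subset[of E x S] xJ SK v Union_cone_subset[of v "st E x S"] by blast
    have "st E g (cone v S \<union> Q) \<union> st E x S = st {v, x} g (cone v (st E x S)) \<union> st E x S"
    proof -
      have "t \<in> st E g (cone v S \<union> Q) \<union> st E x S \<longleftrightarrow> t \<in> st {v, x} g (cone v (st E x S)) \<union> st E x S" for t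
      proof (cases "g \<in> t")
        case True
        have nS: "t \<notin> st E x S" using True gn Union_st_subset[of E x S] by auto
        have 1: "t - {g} \<union> E - {v} = t - {g, v} \<union> E" "t - {g} \<union> E - {x} \<union> E = t - {g, x} \<union> E"
          "t - {g} \<union> {v, x} - {v} = insert x (t - {g, v})" using vx xE by auto
        have 2: "insert x (t - {g, v}) \<in> st E x S \<longleftrightarrow> \<not> E \<subseteq> t \<and> t - {g, v, x} \<union> E \<in> S"
        proof -
          have "insert x (t - {g, v}) - {x} \<union> E = t - {g, v, x} \<union> E" using xE by auto
          moreover have "E \<subseteq> insert x (t - {g, v}) \<longleftrightarrow> E \<subseteq> t" using xE vx gn by auto
          ultimately show ?thesis by (simp add: in_st)
        qed
        have 3: "t - {g, v} \<union> E \<in> S \<Longrightarrow> x \<notin> t" "t - {g, x} \<union> E \<in> S \<Longrightarrow> v \<notin> t" using xS vx gn by auto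
        have "x \<notin> t \<Longrightarrow> t - {g, v, x} = t - {g, v}" "v \<notin> t \<Longrightarrow> t - {g, v, x} = t - {g, x}" by auto
        then have 4: "x \<notin> t \<Longrightarrow> (t - {g, v, x} \<union> E \<in> S) = (t - {g, v} \<union> E \<in> S)"
          "v \<notin> t \<Longrightarrow> (t - {g, v, x} \<union> E \<in> S) = (t - {g, x} \<union> E \<in> S)" by metis+
        have 5: "{v, x} \<subseteq> t \<longleftrightarrow> v \<in> t \<and> x \<in> t" by simp
        have L: "t \<in> st E g (cone v S \<union> Q) \<longleftrightarrow> \<not> E \<subseteq> t \<and> (t - {g, v} \<union> E \<in> S \<or> t - {g, x} \<union> E \<in> S)"
          using True by (simp only: in_st[of t E g] if_True Un_iff in_cone[OF vx(4)] inQ 1)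
        have R: "t \<in> st {v, x} g (cone v (st E x S)) \<longleftrightarrow> \<not> {v, x} \<subseteq> t \<and> \<not> E \<subseteq> t \<and> t - {g, v, x} \<union> E \<in> S"
          using True by (simp only: in_st[of t "{v, x}" g] if_True in_cone[OF vS'] 1 2)
        show ?thesis unfolding Un_iff L R 5 using nS 3 4 by argo
      next
        case False
        have L: "t \<in> st E g (cone v S \<union> Q) \<longleftrightarrow> \<not> E \<subseteq> t \<and> (t - {v} \<in> S \<or> t - {x} \<union> E \<in> S)"
          using False by (simp only: in_st[of t E g] if_False Un_iff in_cone[OF vx(4)] inQ)
        have Ev: "E \<subseteq> t - {v} \<longleftrightarrow> E \<subseteq> t" "x \<in> t - {v} \<longleftrightarrow> x \<in> t" using vx by auto
        have R: "t \<in> st {v, x} g (cone v (st E x S)) \<longleftrightarrow> \<not> {v, x} \<subseteq> t \<and> \<not> E \<subseteq> t \<and> (if x \<in> t then t - {v} - {x} \<union> E \<in> S else t - {v} \<in> S)"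
          using False by (simp only: in_st[of t "{v, x}" g] if_False in_cone[OF vS'] in_st[of "t - {v}" E x] Ev)
        have S': "t \<in> st E x S \<longleftrightarrow> \<not> E \<subseteq> t \<and> (if x \<in> t then t - {x} \<union> E \<in> S else t \<in> S)" by (rule in_st)
        have 3: "t - {v} \<in> S \<Longrightarrow> x \<notin> t" "t - {x} \<union> E \<in> S \<Longrightarrow> v \<notin> t" "t \<in> S \<Longrightarrow> v \<notin> t" using xS vx by auto
        have 4: "x \<notin> t \<Longrightarrow> t - {x} = t" "v \<notin> t \<Longrightarrow> t - {v} = t" "t \<union> E \<in> S \<Longrightarrow> t \<in> S"
          using down_closedD[OF dcS, of "t \<union> E" t] by auto
        show ?thesis unfolding Un_iff L R S'
          by (cases "x \<in> t"; cases "v \<in> t") (use 3 4 in \<open>simp_all, blast+\<close>)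
      qed
      then show ?thesis by blast
    qed
    then have "glue (st E g (cone v S \<union> Q)) J L = glue (st {v, x} g (cone v (st E x S))) J L" by (rule absorb)
    moreover have "sts E g (glue (cone v S \<union> Q) J L) = glue (st E g (cone v S \<union> Q)) J L"
      using sts_glue[OF dS xJ(2), of g L] starL g by auto
    moreover have "sts {v, x} g L = L"
    proof (rule sts_noop[OF en(2)])
      show "{v, x} \<notin> simps L" using v by (auto simp: verts_def)
      show "g \<notin> verts L" using g by blast
    qed
    then have "sts {v, x} g (glue (cone v (st E x S)) J L) = glue (st {v, x} g (cone v (st E x S))) J L"
      using sts_glue[OF dS', of "{v, x}" g L] v xJ g by auto
    ultimately have eq: "sts E g (glue (cone v S \<union> Q) J L) = sts {v, x} g (glue (cone v (st E x S)) J L)" by simp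
    have "fam1 (cone v S \<union> Q)" using fam1_cone[OF fS] fQ by (auto simp: fam_unit down_closed_def)
    then have f1: "fam (glue (cone v S \<union> Q) J L)" using en by (intro fam_glue) auto
    have f2: "fam (glue (cone v (st E x S)) J L)" using en fam1_st[OF fS] by (intro fam_glue fam1_cone) auto
    have gQ: "g \<notin> \<Union>Q"
    proof
      assume "g \<in> \<Union>Q"
      then obtain t where "g \<in> t" "t - {x} \<union> E \<in> S" using inQ by blast
      then show False using gn by blast
    qed
    have g1: "g \<notin> verts (glue (cone v S \<union> Q) J L)"
      using verts_glue_subset[of "cone v S \<union> Q" J L] g gn gQ Union_cone_subset[of v S] by blast
    have g2: "g \<notin> verts (glue (cone v (st E x S)) J L)"
      using verts_glue_subset[of "cone v (st E x S)" J L] Union_st_subset[of E x S] Union_cone_subset[of v "st E x S"] g gn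
      by blast
    have "seq (glue (cone v S \<union> Q) J L) (sts E g (glue (cone v S \<union> Q) J L))" using f1 g1 E by (intro seq_star) auto
    moreover have "seq (glue (cone v (st E x S)) J L) (sts E g (glue (cone v S \<union> Q) J L))"
      unfolding eq using f2 g2 by (intro seq_star) auto
    ultimately show ?thesis unfolding L2 using lseq_trans lseq_sym by metis
  qed
  show ?thesis unfolding S' by (rule lseq_trans[OF A lseq_trans[OF B lseq_trans[OF C F]]])
qed


text \<open>Neither the boundary nor the surroundings contain \<open>E\<close>, so the starring is a
  move of the whole family that leaves both unchanged. It is undone before coning.\<close>

lemma conable_star_interior:
  fixes K :: "'a family" and J L :: "'i \<Rightarrow> 'a family"
  assumes K: "fam1 K" "gl m K" and E: "E = {p, q}" "E \<in> K" "E \<notin> bd K" and x: "x \<notin> \<Union>K"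
    and cK: "conable TYPE('i) K"
    and e: "env (st E x K) (bd (st E x K)) J L" and v: "v \<notin> \<Union>(st E x K) \<union> verts J \<union> verts L"
    and EL: "\<And>X. E \<notin> L X" and UK: "\<Union>(st E x K) = insert x (\<Union>K)"
  shows "seq (glue (st E x K) J L) (glue (cone v (bd (st E x K))) J L)"
proof -
  let ?K = "st E x K"
  have fS: "fam1 (bd K)" using fam1_bd K by blast
  have xS: "x \<notin> \<Union>(bd K)" using x bd_sub[of K] by auto
  have "bd ?K = st E x (bd K)" unfolding E(1) using bd_st[OF K(1) _ x] E by simp
  then have S': "bd ?K = bd K" using st_noop1[OF fS E(3) xS] by simp
  have en: "fam J" "fam L" "\<Union>?K \<inter> verts J = {}" "\<And>X. jn (bd K) (J X) \<subseteq> L X" "\<And>X. (?K - bd K) \<inter> L X = {}"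
    using e by (auto simp: env_def S')
  have EJ: "E \<inter> verts J = {}" "\<Union>K \<inter> verts J = {}" "x \<notin> verts J" using en(3) UK E(2) by auto
  have xE: "x \<notin> E" "E \<noteq> {}" using E x by auto
  have xL: "x \<notin> verts L"
  proof
    assume "x \<in> verts L"
    then obtain X t where "x \<in> t" "t \<in> L X" by (auto simp: verts_def simps_def)
    then have "{x} \<in> L X" using down_closedD[OF fam_down_closed[OF en(2)], of t X "{x}"] by simp
    moreover have "\<not> E \<subseteq> {x}" using xE by auto
    then have "{x} \<in> ?K" using E(2) by (simp add: in_st)
    moreover have "{x} \<notin> bd K" using xS by auto
    ultimately show False using en(5)[of X] by blast
  qed
  have "sts E x L = L" using EL xL en(2) by (intro sts_noop) (auto simp: simps_def)
  then have eq: "glue ?K J L = sts E x (glue K J L)" using sts_glue[OF EJ(2,1,3), of L] by simp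
  have "x \<notin> verts (glue K J L)" using verts_glue_subset[of K J L] x xL EJ by blast
  then have 1: "seq (glue K J L) (glue ?K J L)" unfolding eq using xE by (intro seq_star fam_glue K en)
  have "env K (bd K) J L"
    unfolding env_def
  proof (intro conjI allI en EJ)
    fix X
    show "(K - bd K) \<inter> L X = {}"
    proof (rule ccontr)
      assume "(K - bd K) \<inter> L X \<noteq> {}"
      then obtain s where s: "s \<in> K" "s \<notin> bd K" "s \<in> L X" by blast
      have "\<not> E \<subseteq> s" using s(3) down_closedD[OF fam_down_closed[OF en(2)], of s X E] EL by blast
      then have "s \<in> ?K" using s x by (auto simp: in_st)
      then show False using s en(5)[of X] by blast
    qed
  qed
  then have "seq (glue K J L) (glue (cone v (bd K)) J L)" using cK v UK unfolding conable_def by blast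
  then show ?thesis using 1 lseq_trans lseq_sym unfolding S' by metis
qed

text \<open>The surroundings may contain \<open>E\<close> although \<open>K\<close> does not.
  Starring \<open>E\<close> at a fresh vertex removes it there and affects neither \<open>K\<close>
  nor the cone over \<open>S\<close>, so its absence may be assumed.\<close>

lemma seq_glue_avoiding:
  fixes K :: "'a family" and J L :: "'i \<Rightarrow> 'a family"
  assumes K: "fam1 K" and S: "fam1 S" "S \<subseteq> K" and E: "E \<noteq> {}" "finite E" "E \<notin> K" "E \<inter> verts J = {}" "v \<notin> E"
    and e: "env K S J L" and v: "v \<notin> \<Union>K \<union> verts J \<union> verts L"
    and H: "\<And>L. env K S J L \<Longrightarrow> v \<notin> verts L \<Longrightarrow> (\<And>X. E \<notin> L X) \<Longrightarrow> seq (glue K J L) (glue (cone v S) J L)"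
  shows "seq (glue K J L) (glue (cone v S) J L)"
proof -
  have en: "fam J" "fam L" "\<Union>K \<inter> verts J = {}" "\<And>X. jn S (J X) \<subseteq> L X" "\<And>X. (K - S) \<inter> L X = {}"
    using e by (auto simp: env_def)
  have "finite (\<Union>K)" using K by (simp add: fam_unit)
  then have "finite (\<Union>K \<union> verts J \<union> verts L \<union> E \<union> {v})"
    using fam_finite_verts[OF en(1)] fam_finite_verts[OF en(2)] E by simp
  from ex_new_if_finite[OF infinite_vertex this] obtain y where y: "y \<notin> \<Union>K \<union> verts J \<union> verts L \<union> E \<union> {v}" by blast
  let ?L = "sts E y L"
  have dc: "down_closed K" using K by (simp add: fam_unit)
  have vS: "v \<notin> \<Union>S" using v S by auto
  have "env K S J ?L"
    unfolding env_def
  proof (intro conjI allI en fam_sts)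
    fix X
    show "jn S (J X) \<subseteq> ?L X"
    proof
      fix t assume t: "t \<in> jn S (J X)"
      then obtain s u where su: "t = s \<union> u" "s \<in> S" "u \<in> J X" by (auto simp: jn_def)
      have u: "u \<subseteq> verts J" by (rule verts_member[of u J X]) (rule su(3))
      have "\<not> E \<subseteq> t"
      proof
        assume "E \<subseteq> t"
        then have "E \<subseteq> s" using su u E by blast
        then show False using down_closedD[OF dc, of s E] su S E by blast
      qed
      moreover have "y \<notin> t" using su u y S by blast
      ultimately show "t \<in> ?L X" using t en(4)[of X] by (auto simp: sts_def in_st)
    qed
    show "(K - S) \<inter> ?L X = {}"
    proof (rule ccontr)
      assume "(K - S) \<inter> ?L X \<noteq> {}"
      then obtain s where s: "s \<in> K" "s \<notin> S" "s \<in> ?L X" by blast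
      have "y \<notin> s" using s y by auto
      then show False using s en(5)[of X] by (auto simp: sts_def in_st)
    qed
  qed
  moreover have "v \<notin> verts ?L" using v y verts_sts_subset[of E y L] by auto
  moreover have "E \<notin> ?L X" for X using y by (simp add: sts_def in_st)
  ultimately have 1: "seq (glue K J ?L) (glue (cone v S) J ?L)" by (rule H)
  have go: "seq (glue M J L) (glue M J ?L)" if M: "fam1 M" "E \<notin> M" "y \<notin> \<Union>M" "\<Union>M \<inter> verts J = {}" for M
  proof -
    have "glue M J ?L = sts E y (glue M J L)" using sts_glue[OF M(4) E(4), of y L] st_noop1[OF M(1-3)] y by simp
    moreover have "y \<notin> verts (glue M J L)" using verts_glue_subset[of M J L] M y by blast
    ultimately show ?thesis using seq_star[OF fam_glue[OF M(1) en(1,2)] E(1)] by simp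
  qed
  have "E \<notin> cone v S" using E S vS unfolding in_cone[OF vS] by auto
  then have "seq (glue (cone v S) J L) (glue (cone v S) J ?L)"
    using S y v en(3) Union_cone_subset[of v S] by (intro go fam1_cone) blast+
  moreover have "seq (glue K J L) (glue K J ?L)" using K E y en by (intro go) auto
  ultimately show ?thesis using 1 lseq_trans lseq_sym by metis
qed

lemma Union_st_edge:
  assumes "fam1 K" "{p, q} \<in> K" "p \<noteq> q" "x \<notin> \<Union>K"
  shows "\<Union>(st {p, q} x K) = insert x (\<Union>K)"
proof (intro equalityI Union_st_subset subsetI)
  fix w assume w: "w \<in> insert x (\<Union>K)"
  have dc: "down_closed K" using assms(1) by (simp add: fam_unit)
  have "{w} \<in> st {p, q} x K"
  proof (cases "w = x")
    case True then show ?thesis using assms by (auto simp: in_st)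
  next
    case False
    then have "{w} \<in> K" using w down_closedD[OF dc, of _ "{w}"] by auto
    then show ?thesis using False assms by (auto simp: in_st)
  qed
  then show "w \<in> \<Union>(st {p, q} x K)" by blast
qed

lemma conable_star:
  fixes K :: "'a family"
  assumes K: "fam1 K" "gl m K" and E: "E = {p, q}" "p \<noteq> q" "E \<in> K" and x: "x \<notin> \<Union>K"
    and cK: "conable TYPE('i) K" and cl: "E \<in> bd K \<Longrightarrow> conable TYPE('i) (cone x (lk E K))"
  shows "conable TYPE('i) (st E x K)"
  unfolding conable_def
proof (intro allI impI)
  fix J L :: "'i \<Rightarrow> 'a family" and v
  assume e: "env (st E x K) (bd (st E x K)) J L" and v: "v \<notin> \<Union>(st E x K) \<union> verts J \<union> verts L"
  have UK: "\<Union>(st E x K) = insert x (\<Union>K)" unfolding E(1) using Union_st_edge[OF K(1) _ E(2) x] E by simp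
  have fK': "fam1 (st E x K)" by (rule fam1_st[OF K(1)])
  have "sq K (st E x K)" using E by (intro sq_star[OF K(1) _ x]) auto
  then have g': "gl m (st E x K)" by (rule gl_sq[OF K(2)])
  have EK: "E \<subseteq> \<Union>K" using E by auto
  show "seq (glue (st E x K) J L) (glue (cone v (bd (st E x K))) J L)"
  proof (rule seq_glue_avoiding[OF fK' fam1_bd[OF g' fK'] bd_sub _ _ _ _ _ e v])
    show "E \<noteq> {}" "finite E" using E by auto
    show "E \<notin> st E x K" using x EK E by (auto simp: in_st)
    show "E \<inter> verts J = {}" using e EK UK by (auto simp: env_def)
    show "v \<notin> E" using v UK EK by auto
    fix L' :: "'i \<Rightarrow> 'a family" assume L: "env (st E x K) (bd (st E x K)) J L'" "v \<notin> verts L'" "\<And>X. E \<notin> L' X"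
    have v': "v \<notin> \<Union>(st E x K) \<union> verts J \<union> verts L'" using v L by blast
    show "seq (glue (st E x K) J L') (glue (cone v (bd (st E x K))) J L')"
    proof (cases "E \<in> bd K")
      case True then show ?thesis by (intro conable_star_boundary[OF K E(1,2) True x cK cl L(1) v' L(3)])
    next
      case False then show ?thesis by (intro conable_star_interior[OF K E(1,3) False x cK L(1) v' L(3) UK])
    qed
  qed
qed

text \<open>Outer induction on \<open>m\<close>, inner induction over the moves from the simplex to
  \<open>K\<close>. The outer hypothesis serves the subdivision of a boundary edge: the cone over
  the link of the edge is a ball of index \<open>m - 1\<close>.\<close>

lemma bal_conable:
  fixes K :: "'a family"
  shows "bal m K \<Longrightarrow> conable TYPE('i) K"
proof (induction m arbitrary: K rule: less_induct)
  case (less m)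
  \<comment> \<open>Injective images are included because the new vertex of a move may already occur
    in the surroundings and then has to be renamed.\<close>
  define P where "P = (\<lambda>Y :: 'a family. bal m Y \<and> (\<forall>f :: 'a vertex \<Rightarrow> 'a vertex. inj_on f (\<Union>Y) \<longrightarrow> conable TYPE('i) ((`) f ` Y)))"
  obtain V where V: "finite V" "card V = m" "m \<ge> 1" "sq (Pow V) K" using less.prems by (auto simp: bal_def)
  have Vn: "V \<noteq> {}" using V by auto
  have img: "gl m ((`) f ` Y)" "fam1 ((`) f ` Y)" if "bal m Y" "inj_on f (\<Union>Y)" for f :: "'a vertex \<Rightarrow> 'a vertex" and Y :: "'a family"
  proof -
    have Y: "fam1 Y" using bal_fam1 that by blast
    have "sq ((`) id ` Y) ((`) f ` Y)" using that Y by (intro sq_map infinite_vertex sq_refl) auto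
    then show "gl m ((`) f ` Y)" using gl_sq that by (auto simp: gl_def)
    show "fam1 ((`) f ` Y)" using fam1_image[OF Y] .
  qed
  from V(4) have "P K"
  proof (induction rule: sq_induct)
    case base
    have "conable TYPE('i) ((`) f ` Pow V)" for f :: "'a vertex \<Rightarrow> 'a vertex"
      using conable_Pow[of "f ` V"] V Vn image_Pow_surj[of f V "f ` V"] by simp
    then show ?case using bal_self[OF V(1) Vn] V(2) by (auto simp: P_def)
  next
    case (star Y i j a)
    have b: "bal m (st {i, j} a Y)" using star sq_star[of Y "{i, j}" a] bal_sq by (auto simp: P_def)
    have "conable TYPE('i) ((`) f ` st {i, j} a Y)" if f: "inj_on f (\<Union>(st {i, j} a Y))"
      for f :: "'a vertex \<Rightarrow> 'a vertex"
    proof (cases "i = j")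
      case True
      have i: "i \<in> \<Union>Y" using star(2) by auto
      have e: "st {i, j} a Y = (`) (id(i := a)) ` Y"
        using sts_vertex[of i "\<lambda>_ :: unit. Y" a] i star(3) True
        by (auto simp: sts_def mapf_def verts_def simps_def dest!: fun_cong[of _ _ "()"])
      have inj: "inj_on (id(i := a)) (\<Union>Y)" using star(3) by (auto simp: inj_on_def)
      have u: "\<Union>(st {i, j} a Y) = id(i := a) ` \<Union>Y" unfolding e by blast
      have "inj_on (f \<circ> id(i := a)) (\<Union>Y)" using comp_inj_on[OF inj] f unfolding u by blast
      moreover have "(`) f ` st {i, j} a Y = (`) (f \<circ> id(i := a)) ` Y" unfolding e by (simp only: image_image image_comp comp_def)
      moreover from star(4) have "inj_on g (\<Union>Y) \<Longrightarrow> conable TYPE('i) ((`) g ` Y)" for g :: "'a vertex \<Rightarrow> 'a vertex"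
        unfolding P_def by blast
      ultimately show ?thesis by (simp only: )
    next
      case False
      have u: "\<Union>(st {i, j} a Y) = insert a (\<Union>Y)" by (rule Union_st_edge[OF star(1,2) False star(3)])
      have f1: "inj_on f (\<Union>Y)" "f a \<notin> f ` \<Union>Y" using f star(3) unfolding u by (auto simp: inj_on_def)
      let ?K = "(`) f ` Y" and ?E = "{f i, f j}"
      have ij: "i \<in> \<Union>Y" "j \<in> \<Union>Y" using star(2) by auto
      have "(`) (f(a := f a)) ` st {i, j} a Y = st (f ` {i, j}) (f a) ?K"
        using f1 ij star(3) by (intro st_image[of f "\<Union>Y"]) auto
      then have e: "(`) f ` st {i, j} a Y = st ?E (f a) ?K" by simp
      have bY: "bal m Y" using star(4) by (simp add: P_def)
      have x: "f a \<notin> \<Union>?K" using f1 by auto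
      have EK: "?E \<in> ?K" using star(2) by (metis image_eqI image_empty image_insert)
      show ?thesis
        unfolding e
      proof (rule conable_star[OF img(2)[OF bY f1(1)] img(1)[OF bY f1(1)] refl _ EK x])
        show ne: "f i \<noteq> f j" using f1 False ij by (auto simp: inj_on_def)
        show "conable TYPE('i) ?K" using star(4) f1 by (simp add: P_def)
        assume "?E \<in> bd ?K"
        then have bl: "bal (m - card ?E) (lk ?E ?K)" using gl_lk(2)[OF img(1)[OF bY f1(1)] EK] by blast
        have "card ?E \<le> m" using gl_lk(1)[OF img(1)[OF bY f1(1)] EK] .
        then have m: "m \<ge> 2" "card ?E = 2" using ne by auto
        have "f a \<notin> \<Union>(lk ?E ?K)" using x by (auto simp: lk_def)
        then have "bal (Suc (m - 2)) (cone (f a) (lk ?E ?K))" using bl m by (intro cone_gl) (auto simp: gl_def)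
        then show "conable TYPE('i) (cone (f a) (lk ?E ?K))" using less.IH[of "Suc (m - 2)"] m by simp
      qed
    qed
    then show ?case using b by (simp add: P_def)
  next
    case (weld Y i j a)
    have b: "bal m Y" using weld sq_star[of Y "{i, j}" a] bal_sq sq_sym by (fastforce simp: P_def)
    have "conable TYPE('i) ((`) f ` Y)" if f: "inj_on f (\<Union>Y)" for f :: "'a vertex \<Rightarrow> 'a vertex"
      unfolding conable_def
    proof (intro allI impI)
      let ?K = "(`) f ` Y" and ?E = "{f i, f j}"
      fix J L :: "'i \<Rightarrow> 'a family" and v
      assume e: "env ?K (bd ?K) J L" and v: "v \<notin> \<Union>?K \<union> verts J \<union> verts L"
      have "fam J" "fam L" using e by (auto simp: env_def)
      moreover have "finite (\<Union>?K)" using img(2)[OF b f] by (auto simp: fam_unit)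
      ultimately have "finite (\<Union>?K \<union> verts J \<union> verts L \<union> {v})" using fam_finite_verts[of J] fam_finite_verts[of L] by simp
      from ex_new_if_finite[OF infinite_vertex this] obtain c where c: "c \<notin> \<Union>?K \<union> verts J \<union> verts L \<union> {v}" by blast
      have ij: "i \<in> \<Union>Y" "j \<in> \<Union>Y" using weld(2) by auto
      have "(`) (f(a := c)) ` st {i, j} a Y = st (f ` {i, j}) c ?K"
        using f ij weld(3) c by (intro st_image[of f "\<Union>Y"]) auto
      moreover have "inj_on (f(a := c)) (insert a (\<Union>Y))" using f c weld(3) by (auto simp: inj_on_def)
      then have "inj_on (f(a := c)) (\<Union>(st {i, j} a Y))" by (rule inj_on_subset) (rule Union_st_subset)
      ultimately have con: "conable TYPE('i) (st ?E c ?K)" using weld(4) unfolding P_def by (metis image_empty image_insert)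
      have EK: "?E \<in> ?K" using weld(2) by (metis image_eqI image_empty image_insert)
      show "seq (glue ?K J L) (glue (cone v (bd ?K)) J L)"
        by (rule conable_weld[OF img(2)[OF b f] img(1)[OF b f] EK c con e v])
    qed
    then show ?case using b by (simp add: P_def)
  qed
  then have "conable TYPE('i) ((`) id ` K)" unfolding P_def using inj_on_id by blast
  then show ?case by simp
qed

section \<open>Cell structures over the same index poset are equivalent\<close>

definition cells :: "'c set set \<Rightarrow> ('c set \<Rightarrow> 'a family) \<Rightarrow> bool" where
  "cells F A \<longleftrightarrow> (\<forall>X\<in>F. bal (card X) (A X)) \<and>
     (\<forall>X\<in>F. bd (A X) = insert {} (\<Union>Z\<in>{Z\<in>F. Z \<subset> X}. A Z)) \<and>
     (\<forall>X\<in>F. \<forall>Y\<in>F. A X \<inter> A Y = (if X \<inter> Y \<in> F then A (X \<inter> Y) else {{}}))"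

definition on :: "'i set \<Rightarrow> ('i \<Rightarrow> 'v set set) \<Rightarrow> 'i \<Rightarrow> 'v set set" where
  "on F A X = (if X \<in> F then A X else {})"

text \<open>The cells in \<open>U\<close> are already coned from the vertices \<open>w\<close>,
  those in \<open>G\<close> are untouched. A simplex is one of an old cell together with the apexes
  of a chain of coned cells above it; if \<open>G\<close> is empty this is an order complex of
  indices.\<close>

definition partial ::
  "'c set set \<Rightarrow> ('c set \<Rightarrow> 'v) \<Rightarrow> ('c set \<Rightarrow> 'v set set) \<Rightarrow> 'c set set \<Rightarrow> 'c set set \<Rightarrow> 'c set \<Rightarrow> 'v set set" where
  "partial F w A G U = on F (\<lambda>Y. {s \<union> w ` C |s C. C \<subseteq> U \<and> chain\<^sub>\<subseteq> C \<and> (\<forall>c\<in>C. c \<subseteq> Y) \<and>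
     (s = {} \<or> (\<exists>X\<in>G. s \<in> A X \<and> X \<subseteq> Y \<and> (\<forall>c\<in>C. X \<subset> c)))})"

lemma in_partial:
  "t \<in> partial F w A G U Y \<longleftrightarrow> Y \<in> F \<and> (\<exists>s C. t = s \<union> w ` C \<and> C \<subseteq> U \<and> chain\<^sub>\<subseteq> C \<and> (\<forall>c\<in>C. c \<subseteq> Y) \<and>
     (s = {} \<or> (\<exists>X\<in>G. s \<in> A X \<and> X \<subseteq> Y \<and> (\<forall>c\<in>C. X \<subset> c))))"
  by (auto simp: partial_def on_def)

lemma jnI: "s \<in> K \<Longrightarrow> u \<in> J \<Longrightarrow> s \<union> u \<in> jn K J"
  by (auto simp: jn_def)

lemma partialE:
  assumes "t \<in> partial F w A G U Y"
  obtains s C where "t = s \<union> w ` C" "Y \<in> F" "C \<subseteq> U" "chain\<^sub>\<subseteq> C" "\<forall>c\<in>C. c \<subseteq> Y"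
    "s = {} \<or> (\<exists>X\<in>G. s \<in> A X \<and> X \<subseteq> Y \<and> (\<forall>c\<in>C. X \<subset> c))"
  using assms unfolding in_partial by (elim conjE exE) (rule that)

lemma partialI:
  assumes "t = s \<union> w ` C" "Y \<in> F" "C \<subseteq> U" "chain\<^sub>\<subseteq> C" "\<forall>c\<in>C. c \<subseteq> Y"
    "s = {} \<or> (\<exists>X\<in>G. s \<in> A X \<and> X \<subseteq> Y \<and> (\<forall>c\<in>C. X \<subset> c))"
  shows "t \<in> partial F w A G U Y"
  unfolding in_partial by (intro conjI exI[of _ s] exI[of _ C] assms)

lemma partial_mono:
  assumes "G \<subseteq> G'" "U \<subseteq> U'" shows "partial F w A G U Y \<subseteq> partial F w A G' U' Y"
proof
  fix t assume t: "t \<in> partial F w A G U Y"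
  obtain s C where s: "t = s \<union> w ` C" "Y \<in> F" "C \<subseteq> U" "chain\<^sub>\<subseteq> C" "\<forall>c\<in>C. c \<subseteq> Y"
    "s = {} \<or> (\<exists>X\<in>G. s \<in> A X \<and> X \<subseteq> Y \<and> (\<forall>c\<in>C. X \<subset> c))" by (rule partialE[OF t])
  have "s = {} \<or> (\<exists>X\<in>G'. s \<in> A X \<and> X \<subseteq> Y \<and> (\<forall>c\<in>C. X \<subset> c))" using s(6) assms(1) by blast
  then show "t \<in> partial F w A G' U' Y" using s(1,2,4,5) subset_trans[OF s(3) assms(2)] by (intro partialI)
qed

lemma chain_mono: "chain\<^sub>\<subseteq> C \<Longrightarrow> C' \<subseteq> C \<Longrightarrow> chain\<^sub>\<subseteq> C'"
  by (auto simp: chain_subset_def)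

lemma down_closed_partial:
  assumes A: "\<And>X. X \<in> G \<Longrightarrow> down_closed (A X)"
  shows "down_closed (partial F w A G U Y)"
  unfolding down_closed_def
proof (intro ballI allI impI)
  fix t t' assume t: "t \<in> partial F w A G U Y" and t': "t' \<subseteq> t"
  obtain s C where s: "t = s \<union> w ` C" "Y \<in> F" "C \<subseteq> U" "chain\<^sub>\<subseteq> C" "\<forall>c\<in>C. c \<subseteq> Y"
    "s = {} \<or> (\<exists>X\<in>G. s \<in> A X \<and> X \<subseteq> Y \<and> (\<forall>c\<in>C. X \<subset> c))" by (rule partialE[OF t])
  let ?C = "{c\<in>C. w c \<in> t'}"
  have "t' = (t' \<inter> s) \<union> w ` ?C" using s(1) t' by blast
  moreover have "chain\<^sub>\<subseteq> ?C" using s(4) by (rule chain_mono) auto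
  moreover have "t' \<inter> s = {} \<or> (\<exists>X\<in>G. t' \<inter> s \<in> A X \<and> X \<subseteq> Y \<and> (\<forall>c\<in>?C. X \<subset> c))"
    using s(6)
  proof
    assume "\<exists>X\<in>G. s \<in> A X \<and> X \<subseteq> Y \<and> (\<forall>c\<in>C. X \<subset> c)"
    then obtain X where X: "X \<in> G" "s \<in> A X" "X \<subseteq> Y" "\<forall>c\<in>C. X \<subset> c" by blast
    have "t' \<inter> s \<in> A X" by (rule down_closedD[OF A[OF X(1)] X(2)]) auto
    then show ?thesis using X by blast
  qed simp
  moreover have "?C \<subseteq> U" "\<forall>c\<in>?C. c \<subseteq> Y" using s(3,5) by auto
  ultimately show "t' \<in> partial F w A G U Y" using s(2) by (intro partialI)
qed

lemma verts_partial: "verts (partial F w A G U) \<subseteq> (\<Union>X\<in>G. \<Union>(A X)) \<union> w ` U"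
proof
  fix a assume "a \<in> verts (partial F w A G U)"
  then obtain t Y where a: "a \<in> t" and t: "t \<in> partial F w A G U Y" by (auto simp: verts_def simps_def)
  show "a \<in> (\<Union>X\<in>G. \<Union>(A X)) \<union> w ` U" by (rule partialE[OF t]) (use a in blast)
qed

lemma fam_partial:
  assumes "finite G" "finite U" "\<And>X. X \<in> G \<Longrightarrow> fam1 (A X)"
  shows "fam (partial F w A G U)"
  unfolding fam_def
proof (intro conjI allI ballI)
  have f: "finite ((\<Union>X\<in>G. \<Union>(A X)) \<union> w ` U)" using assms by (auto simp: fam_unit)
  have sub: "t \<subseteq> (\<Union>X\<in>G. \<Union>(A X)) \<union> w ` U" if "t \<in> simps (partial F w A G U)" for t
    using that verts_partial[of F w A G U] by (auto simp: verts_def)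
  then have "simps (partial F w A G U) \<subseteq> Pow ((\<Union>X\<in>G. \<Union>(A X)) \<union> w ` U)" by blast
  then show "finite (simps (partial F w A G U))" using f by (meson finite_Pow_iff finite_subset)
  show "finite t" if "t \<in> simps (partial F w A G U)" for t using sub[OF that] f finite_subset by blast
  show "down_closed (partial F w A G U Y)" for Y using assms(3) by (intro down_closed_partial) (auto simp: fam_unit)
qed

lemma cells_mono: "cells F A \<Longrightarrow> X \<in> F \<Longrightarrow> Y \<in> F \<Longrightarrow> X \<subseteq> Y \<Longrightarrow> A X \<subseteq> A Y"
proof -
  assume a: "cells F A" "X \<in> F" "Y \<in> F" "X \<subseteq> Y"
  then have "A X \<inter> A Y = (if X \<inter> Y \<in> F then A (X \<inter> Y) else {{}})" unfolding cells_def by simp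
  moreover have "X \<inter> Y = X" using a(4) by blast
  ultimately have "A X \<inter> A Y = A X" using a(2) by simp
  then show ?thesis by blast
qed

lemma cells_fam1: "cells F A \<Longrightarrow> X \<in> F \<Longrightarrow> fam1 (A X)"
  by (rule bal_fam1[of "card X"]) (simp add: cells_def)

lemma cells_empty: "cells F A \<Longrightarrow> X \<in> F \<Longrightarrow> {} \<in> A X"
  using bd_sub[of "A X"] by (auto simp: cells_def)

lemma partial_none:
  assumes "cells F A" shows "partial F w A F {} = on F A"
proof
  fix Y
  have "t \<in> partial F w A F {} Y \<longleftrightarrow> t \<in> on F A Y" for t
    using cells_mono[OF assms, of _ Y] cells_empty[OF assms, of Y] by (auto simp: in_partial on_def chain_subset_def)
  then show "partial F w A F {} Y = on F A Y" by blast
qed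

text \<open>\<open>X\<close> is maximal among the cells not yet coned. In the member
  \<open>Y\<close> it is joined with the chains of coned cells above it, which give
  \<open>J Y\<close>; all other simplices form \<open>L\<close>. So \<open>bal_conable\<close>
  performs the replacement in all members at once.\<close>

lemma cells_step:
  fixes A :: "'c set \<Rightarrow> 'a family"
  assumes c: "cells F A" and F: "finite F" and U: "U \<subseteq> F" "\<And>Y Z. Y \<in> U \<Longrightarrow> Z \<in> F \<Longrightarrow> Y \<subseteq> Z \<Longrightarrow> Z \<in> U"
    and X: "X \<in> F" "X \<notin> U" "\<And>Z. Z \<in> F \<Longrightarrow> X \<subset> Z \<Longrightarrow> Z \<in> U"
    and w: "inj_on w F" "w ` F \<inter> (\<Union>X\<in>F. \<Union>(A X)) = {}"
  shows "seq (partial F w A (F - U) U) (partial F w A (F - insert X U) (insert X U))"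
proof -
  define L where "L = partial F w A (F - insert X U) U"
  define J where "J = (\<lambda>Y. if X \<subseteq> Y \<and> Y \<in> F then {w ` C |C. C \<subseteq> U \<and> chain\<^sub>\<subseteq> C \<and> (\<forall>c\<in>C. X \<subset> c \<and> c \<subseteq> Y)} else {})"
  have inJ: "t \<in> J Y \<longleftrightarrow> X \<subseteq> Y \<and> Y \<in> F \<and> (\<exists>C. t = w ` C \<and> C \<subseteq> U \<and> chain\<^sub>\<subseteq> C \<and> (\<forall>c\<in>C. X \<subset> c \<and> c \<subseteq> Y))" for t Y
    by (auto simp: J_def)
  have JE: thesis if "u \<in> J Y"
    "\<And>C. u = w ` C \<Longrightarrow> X \<subseteq> Y \<Longrightarrow> Y \<in> F \<Longrightarrow> C \<subseteq> U \<Longrightarrow> chain\<^sub>\<subseteq> C \<Longrightarrow> \<forall>c\<in>C. X \<subset> c \<and> c \<subseteq> Y \<Longrightarrow> thesis" for u Y thesis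
    using that(1) unfolding inJ by (elim conjE exE) (rule that(2))
  have b: "bd (A X) = insert {} (\<Union>Z\<in>{Z\<in>F. Z \<subset> X}. A Z)" using c X by (auto simp: cells_def)
  have lowU: "Z \<notin> U" if "Z \<in> F" "Z \<subseteq> X" for Z using that U(2)[of Z X] X by blast
  have fU: "finite U" by (rule finite_subset[OF U(1) F])
  have ws: "w d \<notin> s" if "d \<in> F" "s \<in> A Z" "Z \<in> F" for d s Z using w(2) that by blast
  have vJ: "verts J \<subseteq> w ` U"
  proof
    fix a assume "a \<in> verts J"
    then obtain t Y where "a \<in> t" "t \<in> J Y" by (auto simp: verts_def simps_def)
    then show "a \<in> w ` U" by (elim JE) blast
  qed
  have fJ: "fam J"
    unfolding fam_def
  proof (intro conjI allI ballI)
    have "\<Union>(simps J) \<subseteq> w ` U" using vJ by (simp add: verts_def)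
    then have sub: "simps J \<subseteq> Pow (w ` U)" by blast
    have fin: "finite (Pow (w ` U))" using fU by simp
    show "finite (simps J)" by (rule finite_subset[OF sub fin])
    show "finite t" if "t \<in> simps J" for t using that sub fU finite_subset[of t "w ` U"] by blast
    show "down_closed (J Y)" for Y
      unfolding down_closed_def
    proof (intro ballI allI impI)
      fix t t' assume t: "t \<in> J Y" and t': "t' \<subseteq> t"
      obtain C where C: "t = w ` C" "X \<subseteq> Y" "Y \<in> F" "C \<subseteq> U" "chain\<^sub>\<subseteq> C" "\<forall>c\<in>C. X \<subset> c \<and> c \<subseteq> Y"
        by (rule JE[OF t])
      have "t' = w ` {c\<in>C. w c \<in> t'}" using C(1) t' by blast
      moreover have "chain\<^sub>\<subseteq> {c\<in>C. w c \<in> t'}" using C(5) by (rule chain_mono) auto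
      ultimately show "t' \<in> J Y" unfolding inJ using C by (intro conjI exI[of _ "{c\<in>C. w c \<in> t'}"]) auto
    qed
  qed
  have fL: "fam L" unfolding L_def using F fU cells_fam1[OF c] by (intro fam_partial) auto
  have old: "partial F w A (F - U) U = glue (A X) J L"
  proof
    fix Y
    have "t \<in> partial F w A (F - U) U Y \<longleftrightarrow> t \<in> glue (A X) J L Y" for t
    proof
      assume t: "t \<in> partial F w A (F - U) U Y"
      obtain s C where s: "t = s \<union> w ` C" "Y \<in> F" "C \<subseteq> U" "chain\<^sub>\<subseteq> C" "\<forall>c\<in>C. c \<subseteq> Y"
        "s = {} \<or> (\<exists>X\<in>F - U. s \<in> A X \<and> X \<subseteq> Y \<and> (\<forall>c\<in>C. X \<subset> c))" by (rule partialE[OF t])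
      show "t \<in> glue (A X) J L Y"
      proof (cases "s \<in> A X \<and> X \<subseteq> Y \<and> (\<forall>c\<in>C. X \<subset> c)")
        case True
        then have "w ` C \<in> J Y" unfolding inJ using s by (intro conjI exI[of _ C]) auto
        then show ?thesis using True s(1) by (auto simp: glue_def jn_def)
      next
        case False
        then have "s = {} \<or> (\<exists>Z\<in>F - insert X U. s \<in> A Z \<and> Z \<subseteq> Y \<and> (\<forall>c\<in>C. Z \<subset> c))" using s(6) by blast
        then have "t \<in> L Y" unfolding L_def using s(1-5) by (intro partialI)
        then show ?thesis by (simp add: glue_def)
      qed
    next
      assume "t \<in> glue (A X) J L Y"
      then consider s u where "t = s \<union> u" "s \<in> A X" "u \<in> J Y" | "t \<in> L Y" by (auto simp: glue_def jn_def)
      then show "t \<in> partial F w A (F - U) U Y"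
      proof cases
        case (1 s u)
        obtain C where "u = w ` C" "X \<subseteq> Y" "Y \<in> F" "C \<subseteq> U" "chain\<^sub>\<subseteq> C" "\<forall>c\<in>C. X \<subset> c \<and> c \<subseteq> Y"
          by (rule JE[OF 1(3)])
        moreover from this have "\<exists>Z\<in>F - U. s \<in> A Z \<and> Z \<subseteq> Y \<and> (\<forall>c\<in>C. Z \<subset> c)" using 1(2) X(1,2) by blast
        ultimately show ?thesis using 1(1) by (intro partialI[of _ s w C]) simp_all
      next
        case 2
        then show ?thesis unfolding L_def by (rule subsetD[OF partial_mono, rotated 2]) auto
      qed
    qed
    then show "partial F w A (F - U) U Y = glue (A X) J L Y" by blast
  qed
  have bJ: "jn (bd (A X)) (J Y) \<subseteq> L Y" for Y
  proof
    fix t assume "t \<in> jn (bd (A X)) (J Y)"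
    then obtain s u where su: "t = s \<union> u" "s \<in> bd (A X)" "u \<in> J Y" by (auto simp: jn_def)
    obtain C where C: "u = w ` C" "X \<subseteq> Y" "Y \<in> F" "C \<subseteq> U" "chain\<^sub>\<subseteq> C" "\<forall>c\<in>C. X \<subset> c \<and> c \<subseteq> Y"
      by (rule JE[OF su(3)])
    have "s = {} \<or> (\<exists>Z\<in>F - insert X U. s \<in> A Z \<and> Z \<subseteq> Y \<and> (\<forall>c\<in>C. Z \<subset> c))"
    proof (cases "s = {}")
      case False
      then obtain Z where Z: "Z \<in> F" "Z \<subset> X" "s \<in> A Z" using su(2) unfolding b by blast
      then have "Z \<in> F - insert X U" "Z \<subseteq> Y" "\<forall>c\<in>C. Z \<subset> c" using lowU[of Z] C Z by blast+
      then show ?thesis using Z by blast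
    qed simp
    then show "t \<in> L Y" unfolding L_def using su(1) C by (intro partialI[of _ s w C]) simp_all
  qed
  have new: "partial F w A (F - insert X U) (insert X U) = glue (cone (w X) (bd (A X))) J L"
  proof
    fix Y
    have "t \<in> partial F w A (F - insert X U) (insert X U) Y \<longleftrightarrow> t \<in> glue (cone (w X) (bd (A X))) J L Y" for t
    proof
      assume t: "t \<in> partial F w A (F - insert X U) (insert X U) Y"
      obtain s C where s: "t = s \<union> w ` C" "Y \<in> F" "C \<subseteq> insert X U" "chain\<^sub>\<subseteq> C" "\<forall>c\<in>C. c \<subseteq> Y"
        "s = {} \<or> (\<exists>Z\<in>F - insert X U. s \<in> A Z \<and> Z \<subseteq> Y \<and> (\<forall>c\<in>C. Z \<subset> c))" by (rule partialE[OF t])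
      show "t \<in> glue (cone (w X) (bd (A X))) J L Y"
      proof (cases "X \<in> C")
        case False
        then have "C \<subseteq> U" using s(3) by blast
        then have "t \<in> L Y" unfolding L_def using s by (intro partialI)
        then show ?thesis by (simp add: glue_def)
      next
        case True
        let ?C = "C - {X}"
        have XY: "X \<subseteq> Y" using True s(5) by blast
        \<comment> \<open>No cell below \<open>X\<close> is coned, so \<open>X\<close> is the least
          element of the chain.\<close>
        have "\<forall>c\<in>?C. X \<subset> c"
        proof
          fix d assume d: "d \<in> ?C"
          then have "d \<in> U" using s(3) by blast
          moreover have "X \<subseteq> d \<or> d \<subseteq> X" using s(4) True d unfolding chain_subset_def by blast
          ultimately show "X \<subset> d" using lowU[of d] U(1) d by blast
        qed
        moreover have "chain\<^sub>\<subseteq> ?C" using s(4) by (rule chain_mono) auto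
        moreover have "?C \<subseteq> U" using s(3) by blast
        ultimately have "w ` ?C \<in> J Y" unfolding inJ using XY s(2,5) by (intro conjI exI[of _ ?C]) auto
        moreover have "s = {} \<or> (\<exists>Z\<in>F. Z \<subset> X \<and> s \<in> A Z)" using s(6) True by (elim disjE bexE) auto
        then have "s \<in> bd (A X)" unfolding b by auto
        then have "insert (w X) s \<in> cone (w X) (bd (A X))" by (simp add: cone_def)
        moreover have "t = insert (w X) s \<union> w ` ?C" using s(1) True by auto
        ultimately have "t \<in> jn (cone (w X) (bd (A X))) (J Y)" using jnI by metis
        then show ?thesis by (simp add: glue_def)
      qed
    next
      assume t: "t \<in> glue (cone (w X) (bd (A X))) J L Y"
      consider s u where "t = insert (w X) s \<union> u" "s \<in> bd (A X)" "u \<in> J Y" | "t \<in> L Y"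
      proof -
        have "t \<in> jn (bd (A X)) (J Y) \<or> t \<in> jn (insert (w X) ` bd (A X)) (J Y) \<or> t \<in> L Y"
          using t by (simp add: glue_def cone_def jn_un)
        then have "t \<in> jn (insert (w X) ` bd (A X)) (J Y) \<or> t \<in> L Y" using bJ[of Y] by blast
        then show thesis
        proof
          assume "t \<in> jn (insert (w X) ` bd (A X)) (J Y)"
          then obtain s' u where "t = s' \<union> u" "s' \<in> insert (w X) ` bd (A X)" "u \<in> J Y" unfolding jn_def by blast
          then show thesis using that(1) by blast
        qed (rule that(2))
      qed
      then show "t \<in> partial F w A (F - insert X U) (insert X U) Y"
      proof cases
        case (1 s u)
        obtain C where C: "u = w ` C" "X \<subseteq> Y" "Y \<in> F" "C \<subseteq> U" "chain\<^sub>\<subseteq> C" "\<forall>c\<in>C. X \<subset> c \<and> c \<subseteq> Y"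
          by (rule JE[OF 1(3)])
        have "s = {} \<or> (\<exists>Z\<in>F - insert X U. s \<in> A Z \<and> Z \<subseteq> Y \<and> (\<forall>c\<in>insert X C. Z \<subset> c))"
        proof (cases "s = {}")
          case False
          then obtain Z where Z: "Z \<in> F" "Z \<subset> X" "s \<in> A Z" using 1(2) unfolding b by blast
          then have "Z \<in> F - insert X U" "Z \<subseteq> Y" "\<forall>c\<in>insert X C. Z \<subset> c" using lowU[of Z] C(2,6) Z by blast+
          then show ?thesis using Z by blast
        qed simp
        moreover have "t = s \<union> w ` insert X C" using 1(1) C(1) by auto
        moreover have "chain\<^sub>\<subseteq> (insert X C)" using C(5,6) unfolding chain_subset_def by blast
        moreover have "insert X C \<subseteq> insert X U" "\<forall>c\<in>insert X C. c \<subseteq> Y" using C by auto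
        ultimately show ?thesis using C(3) by (intro partialI)
      next
        case 2
        then show ?thesis unfolding L_def by (rule subsetD[OF partial_mono, rotated 2]) auto
      qed
    qed
    then show "partial F w A (F - insert X U) (insert X U) Y = glue (cone (w X) (bd (A X))) J L Y" by blast
  qed
  have "env (A X) (bd (A X)) J L"
    unfolding env_def
  proof (intro conjI allI fJ fL bJ)
    show "\<Union>(A X) \<inter> verts J = {}" using vJ w(2) U(1) X(1) by blast
    fix Y
    show "(A X - bd (A X)) \<inter> L Y = {}"
    proof (rule ccontr)
      assume "(A X - bd (A X)) \<inter> L Y \<noteq> {}"
      then obtain t where t: "t \<in> A X" "t \<notin> bd (A X)" "t \<in> L Y" by blast
      obtain s C where s: "t = s \<union> w ` C" "C \<subseteq> U"
        "s = {} \<or> (\<exists>Z\<in>F - insert X U. s \<in> A Z \<and> Z \<subseteq> Y \<and> (\<forall>c\<in>C. Z \<subset> c))"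
        by (rule partialE[OF t(3)[unfolded L_def]])
      have "C = {}" using s(1,2) ws[OF _ t(1) X(1)] U(1) by blast
      then have ts: "t = s" using s(1) by simp
      have "t \<noteq> {}" using t(2) unfolding b by blast
      then obtain Z where Z: "Z \<in> F - insert X U" "t \<in> A Z" using s(3) ts by blast
      have "A Z \<inter> A X = (if Z \<inter> X \<in> F then A (Z \<inter> X) else {{}})" using c Z X by (auto simp: cells_def)
      then have ZX: "Z \<inter> X \<in> F" "t \<in> A (Z \<inter> X)" using Z(2) t(1) \<open>t \<noteq> {}\<close> by (auto split: if_splits)
      \<comment> \<open>Otherwise \<open>Z\<close> would lie properly above \<open>X\<close> and
        would be coned already.\<close>
      have "Z \<inter> X \<noteq> X" using Z(1) X(3)[of Z] by blast
      then show False using t(2) ZX unfolding b by blast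
    qed
  qed
  moreover have "w X \<notin> \<Union>(A X) \<union> verts J \<union> verts L"
  proof -
    have "w X \<notin> w ` U" using w(1) X U(1) by (auto simp: inj_on_def)
    moreover have "w X \<notin> (\<Union>X\<in>F. \<Union>(A X))" using w(2) X(1) by blast
    moreover have "verts L \<subseteq> (\<Union>X\<in>F. \<Union>(A X)) \<union> w ` U" unfolding L_def using verts_partial[of F w A "F - insert X U" U] by blast
    ultimately show ?thesis using vJ X(1) by blast
  qed
  moreover have "bal (card X) (A X)" using c X(1) by (simp add: cells_def)
  then have "conable TYPE('c set) (A X)" by (rule bal_conable)
  ultimately have "seq (glue (A X) J L) (glue (cone (w X) (bd (A X))) J L)" unfolding conable_def by simp
  then show ?thesis by (simp only: old new)
qed

lemma cells_seq_partial:
  fixes A :: "'c set \<Rightarrow> 'a family"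
  assumes c: "cells F A" and F: "finite F"
    and w: "inj_on w F" "w ` F \<inter> (\<Union>X\<in>F. \<Union>(A X)) = {}"
  shows "seq (on F A) (partial F w A {} F)"
proof -
  let ?P = "\<lambda>U. seq (on F A) (partial F w A (F - U) U)"
  have "?P F"
  proof (rule upper_set_induct[where P = ?P, OF F])
    show "?P {}" using partial_none[OF c, of w] by (simp add: lseq_refl)
    fix U X assume U: "U \<subseteq> F" "\<And>l m. l \<in> U \<Longrightarrow> m \<in> F \<Longrightarrow> l \<subseteq> m \<Longrightarrow> m \<in> U" "X \<in> F - U"
      "\<And>m. m \<in> F \<Longrightarrow> X \<subset> m \<Longrightarrow> m \<in> U" and P: "?P U"
    have "seq (partial F w A (F - U) U) (partial F w A (F - insert X U) (insert X U))"
      using U(3) by (intro cells_step[OF c F U(1,2) _ _ U(4) w]) auto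
    then show "?P (insert X U)" by (rule lseq_trans[OF P])
  qed
  then show ?thesis by simp
qed

text \<open>With no old cell left only the apexes and the index poset remain; this common end is
  what makes any two cell structures equivalent.\<close>

lemma partial_cong: "partial F w A {} U = partial F w B {} U"
  by (simp add: partial_def)

theorem cells_seq:
  fixes A B :: "'c set \<Rightarrow> 'a family"
  assumes A: "cells F A" and B: "cells F B" and F: "finite F"
  shows "seq (on F A) (on F B)"
proof -
  have fin: "finite (\<Union>X\<in>F. \<Union>(M X))" if "cells F M" for M :: "'c set \<Rightarrow> 'a family"
    using F cells_fam1[OF that] by (auto simp: fam_unit)
  \<comment> \<open>The apexes are chosen fresh for both structures, so that both end in the same
    family.\<close>
  obtain V :: "'a vertex set" where V: "finite V" "card V = card F" "V \<inter> ((\<Union>X\<in>F. \<Union>(A X)) \<union> (\<Union>X\<in>F. \<Union>(B X))) = {}"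
    using ex_fresh_set[of "(\<Union>X\<in>F. \<Union>(A X)) \<union> (\<Union>X\<in>F. \<Union>(B X))" "card F"] fin[OF A] fin[OF B] by auto
  obtain w where "bij_betw w F V" using finite_same_card_bij[OF F V(1)] V(2) by auto
  then have w: "inj_on w F" "w ` F = V" by (auto simp: bij_betw_def)
  have "seq (on F A) (partial F w A {} F)" "seq (on F B) (partial F w B {} F)"
    using cells_seq_partial[OF A F w(1)] cells_seq_partial[OF B F w(1)] V(3) w(2) by blast+
  then show ?thesis using partial_cong[of F w A F B] lseq_trans lseq_sym by metis
qed

section \<open>What moves preserve: cell structures and label sets\<close>

lemma lseq_sq: "lseq lab Z Z' \<Longrightarrow> sq (Z X) (Z' X)"
proof (induction rule: lseq_induct)
  case (star Y i j a)
  have "sq (Y X) (sts {i, j} a Y X)"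
    using star in_simps[of Y X] unfolding sts_def
    by (intro sq_edge) (auto simp: fam_def verts_def down_closed_def intro: finite_subset)
  then show ?case using star.IH sq_trans by blast
next
  case (weld Y i j a)
  have "sq (Y X) (sts {i, j} a Y X)"
    using weld in_simps[of Y X] unfolding sts_def
    by (intro sq_edge) (auto simp: fam_def verts_def down_closed_def intro: finite_subset)
  then show ?case using weld.IH sq_trans sq_sym by blast
qed simp

lemma fam_at: "fam Z \<Longrightarrow> fam1 (Z X)"
  using in_simps[of Z X] by (auto simp: fam_def down_closed_def intro: finite_subset)

text \<open>The names \<open>bary s\<close> might already occur in \<open>Z\<close>; fresh names are
  used for the starrings and exchanged afterwards.\<close>

lemma seq_sub:
  fixes Z :: "'i \<Rightarrow> 'a family"
  assumes "fam Z" shows "seq Z (sub Z)"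
proof -
  let ?S = "simps Z - {{}}" and ?O = "\<lambda>X. oc (Z X)"
  have fS: "finite ?S" "\<And>s. s \<in> ?S \<Longrightarrow> finite s" using assms by (auto simp: fam_def)
  obtain V :: "'a vertex set" where V: "finite V" "card V = card ?S" "V \<inter> verts Z = {}"
    using ex_fresh_set[OF fam_finite_verts[OF assms]] by blast
  obtain N where "bij_betw N ?S V" using finite_same_card_bij[OF fS(1) V(1)] V(2) by auto
  then have N: "inj_on N ?S" "N ` ?S = V" by (auto simp: bij_betw_def)
  have "seq Z (bs N Z)"
  proof (rule bs_induct[where P = "seq Z", OF assms N(1)])
    show "N ` ?S \<inter> verts Z = {}" using N V by simp
    fix Y :: "'i \<Rightarrow> 'a family" and F
    assume "fam Y" "seq Z Y" "F \<in> ?S" "N F \<notin> verts Y"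
    then show "seq Z (sts F (N F) Y)" using seq_star[of Y F "N F"] lseq_trans by blast
  qed simp
  also have "seq (bs N Z) (sub Z)"
    unfolding bs_def sub_def
  proof (rule lseq_rename2[OF rich_const fam_oc[OF assms]])
    have v: "verts ?O \<subseteq> ?S" by (rule verts_oc)
    show "inj_on N (verts ?O)" by (rule inj_on_subset[OF N(1) v])
    show "inj_on bary (verts ?O)" using v fS(2) by (intro inj_on_subset[OF bary_inj]) blast
  qed simp
  finally show ?thesis .
qed

lemma seq_sub_iter:
  fixes Z :: "'i \<Rightarrow> 'a family"
  shows "fam Z \<Longrightarrow> seq Z ((sub ^^ k) Z)"
proof (induction k)
  case (Suc k)
  then show ?case using seq_sub[OF fam_sub_iter[OF Suc.prems, of k]] lseq_trans by fastforce
qed simp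

text \<open>A simplex through the edge is detected by the new simplex with \<open>a\<close> in place
  of \<open>i\<close>, so starring loses no information. This allows equations between members to be
  pulled back along a move.\<close>

lemma st_inj:
  assumes "st {i, j} a K = st {i, j} a L" "a \<notin> \<Union>K" "a \<notin> \<Union>L" "a \<noteq> i" "a \<noteq> j"
  shows "K = L"
proof -
  have "t \<in> K \<longleftrightarrow> t \<in> L" for t
  proof (cases "a \<in> t")
    case True then show ?thesis using assms by auto
  next
    case at: False
    have e: "u \<in> st {i, j} a K \<longleftrightarrow> u \<in> st {i, j} a L" for u using assms(1) by simp
    show ?thesis
    proof (cases "{i, j} \<subseteq> t")
      case False
      then show ?thesis using e[of t] at by (simp add: in_st)
    next
      case True
      have 1: "insert a (t - {i}) - {a} \<union> {i, j} = t" using True at by blast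
      have 2: "\<not> {i, j} \<subseteq> insert a (t - {i})" using True at by blast
      show ?thesis using e[of "insert a (t - {i})"] 2 by (simp only: in_st insertI1 if_True 1 simp_thms)
    qed
  qed
  then show ?thesis by blast
qed

lemma st_Int: "st E a (K \<inter> L) = st E a K \<inter> st E a L"
  by (auto simp: st_def)

lemma st_insert_UN: "E \<noteq> {} \<Longrightarrow> st E a (insert {} (\<Union>Z\<in>S. A Z)) = insert {} (\<Union>Z\<in>S. st E a (A Z))"
  by (auto simp: st_def)

lemma st_single: "E \<noteq> {} \<Longrightarrow> st E a {{}} = {{}}"
  by (auto simp: st_def)

text \<open>Starring commutes with unions, intersections and boundaries and is injective, so each
  condition on a cell structure passes through a move in both directions.\<close>

lemma cells_st:
  assumes Y: "fam Y" "{i, j} \<in> simps Y" "a \<notin> verts Y"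
  shows "cells F (sts {i, j} a Y) \<longleftrightarrow> cells F (Y :: 'c set \<Rightarrow> 'a family)"
proof -
  let ?s = "st {i, j} a"
  have aij: "a \<noteq> i" "a \<noteq> j" using Y by (auto simp: verts_def)
  have f: "fam1 (Y X)" "a \<notin> \<Union>(Y X)" for X using Y fam_at in_simps[of Y X] by (auto simp: verts_def)
  have s: "sq (Y X) (?s (Y X))" for X using f by (intro sq_edge)
  have bal: "bal m (?s (Y X)) \<longleftrightarrow> bal m (Y X)" for m X using bal_sq[OF _ s] bal_sq[OF _ sq_sym[OF s]] by blast
  have bd: "bd (?s (Y X)) = ?s (bd (Y X))" for X
  proof (cases "{i, j} \<in> Y X")
    case True then show ?thesis using f by (intro bd_st)
  next
    case False
    have "?s (Y X) = Y X" using f False by (intro st_noop1)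
    moreover have "t \<in> ?s (bd (Y X)) \<longleftrightarrow> t \<in> bd (Y X)" for t
    proof -
      have dc: "down_closed (Y X)" using f(1)[of X] by (simp add: fam_unit)
      have no: "\<not> {i, j} \<subseteq> u" if "u \<in> Y X" for u using down_closedD[OF dc that, of "{i, j}"] False by blast
      show ?thesis using f(2)[of X] no bd_sub[of "Y X"] by (auto simp: in_st)
    qed
    ultimately show ?thesis by auto
  qed
  have inj: "?s K = ?s L \<longleftrightarrow> K = L" if "\<Union>K \<subseteq> verts Y" "\<Union>L \<subseteq> verts Y" for K L
    using that st_inj[of i j a K L] aij Y(3) by blast
  have sub: "\<Union>(Y X) \<subseteq> verts Y" for X using in_simps[of Y X] by (auto simp: verts_def)
  have bdeq: "bd (?s (Y X)) = insert {} (\<Union>Z\<in>{Z\<in>F. Z \<subset> X}. ?s (Y Z)) \<longleftrightarrow> bd (Y X) = insert {} (\<Union>Z\<in>{Z\<in>F. Z \<subset> X}. Y Z)" for X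
  proof -
    have 1: "insert {} (\<Union>Z\<in>{Z\<in>F. Z \<subset> X}. ?s (Y Z)) = ?s (insert {} (\<Union>Z\<in>{Z\<in>F. Z \<subset> X}. Y Z))"
      by (rule st_insert_UN[symmetric]) simp
    show ?thesis unfolding bd 1 using sub bd_sub[of "Y X"] by (intro inj) blast+
  qed
  have inteq: "?s (Y X) \<inter> ?s (Y X') = (if X \<inter> X' \<in> F then ?s (Y (X \<inter> X')) else {{}}) \<longleftrightarrow>
      Y X \<inter> Y X' = (if X \<inter> X' \<in> F then Y (X \<inter> X') else {{}})" for X X'
  proof -
    have 1: "(if X \<inter> X' \<in> F then ?s (Y (X \<inter> X')) else {{}}) = ?s (if X \<inter> X' \<in> F then Y (X \<inter> X') else {{}})"
      by (simp add: st_single)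
    show ?thesis unfolding st_Int[symmetric] 1 using sub[of X] sub[of "X \<inter> X'"] by (intro inj) auto
  qed
  show ?thesis unfolding cells_def sts_def bal bdeq inteq by (rule refl)
qed

lemma cells_seq_invariant: "seq Z Z' \<Longrightarrow> cells F Z \<Longrightarrow> cells F (Z' :: 'c set \<Rightarrow> 'a family)"
proof (induction rule: lseq_induct)
  case (star Y i j a) then show ?case using cells_st[of Y i j a F] by blast
next
  case (weld Y i j a) then show ?case using cells_st[of Y i j a F] by blast
qed

lemma bd_image:
  assumes "inj_on f (\<Union>K)" shows "bd ((`) f ` K) = (`) f ` bd K"
proof -
  have l: "lk (f ` s) ((`) f ` K) = (`) f ` lk s K" if s: "s \<in> K" for s
  proof (intro equalityI subsetI)
    fix u assume "u \<in> lk (f ` s) ((`) f ` K)"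
    then obtain t where t: "t \<in> K" "u \<union> f ` s = f ` t" "u \<inter> f ` s = {}" by (auto simp: lk_def)
    have st: "s \<subseteq> \<Union>K" "t \<subseteq> \<Union>K" using s t by auto
    have sub: "s \<subseteq> t" 
    proof
      fix x assume x: "x \<in> s"
      then obtain y where "y \<in> t" "f x = f y" using t(2) by blast
      then show "x \<in> t" using inj_onD[OF assms, of x y] x st by blast
    qed
    have "u = f ` t - f ` s" using t by blast
    also have "\<dots> = f ` (t - s)" using inj_on_image_set_diff[OF assms, of t s] st by blast
    finally have "u = f ` (t - s)" .
    moreover have "t - s \<in> lk s K" using t(1) sub by (auto simp: lk_def Un_absorb2)
    ultimately show "u \<in> (`) f ` lk s K" by blast
  next
    fix u assume "u \<in> (`) f ` lk s K"
    then obtain w where w: "u = f ` w" "w \<inter> s = {}" "w \<union> s \<in> K" by (auto simp: lk_def)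
    have "f ` w \<inter> f ` s = f ` (w \<inter> s)" using w(3) by (intro inj_on_image_Int[OF assms, symmetric]) blast+
    then show "u \<in> lk (f ` s) ((`) f ` K)" using w by (auto simp: lk_def image_Un[symmetric])
  qed
  have c: "card (lk (f ` s) ((`) f ` K)) = card (lk s K)" if "s \<in> K" for s
    unfolding l[OF that]
  proof (rule card_image[OF inj_on_image])
    show "inj_on f (\<Union>(lk s K))" by (rule inj_on_subset[OF assms]) (auto simp: lk_def)
  qed
  show ?thesis using c by (auto simp: bd_def)
qed

lemma bal_image:
  fixes f :: "'v \<Rightarrow> 'w"
  assumes "bal m K" "inj_on f (\<Union>K)" "infinite (UNIV :: 'w set)"
  shows "bal m ((`) f ` K)"
proof -
  obtain V where V: "m \<ge> 1" "finite V" "card V = m" "sq (Pow V) K" using assms(1) by (auto simp: bal_def)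
  obtain W :: "'w set" where W: "finite W" "card W = m" using infinite_arbitrarily_large[OF assms(3)] by blast
  obtain g where "bij_betw g V W" using finite_same_card_bij[OF V(2) W(1)] V(3) W(2) by auto
  then have g: "inj_on g V" "g ` V = W" by (auto simp: bij_betw_def)
  have "sq ((`) g ` Pow V) ((`) f ` K)"
    using g assms by (intro sq_map[OF V(4) fam1_Pow[OF V(2)]]) auto
  moreover have "(`) g ` Pow V = Pow W" using g(2) by (rule image_Pow_surj)
  ultimately show ?thesis unfolding bal_def using V(1) W by metis
qed

lemma cells_mapf:
  fixes Z :: "'c set \<Rightarrow> 'a family" and f :: "'a vertex \<Rightarrow> 'b vertex"
  assumes Z: "cells F Z" and f: "inj_on f (verts Z)"
  shows "cells F (mapf f Z)"
proof -
  have sub: "\<Union>(Z X) \<subseteq> verts Z" for X using in_simps[of Z X] by (auto simp: verts_def)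
  have fX: "inj_on f (\<Union>(Z X))" for X by (rule inj_on_subset[OF f sub])
  have I: "(`) f ` Z X \<inter> (`) f ` Z X' = (`) f ` (Z X \<inter> Z X')" for X X'
  proof (rule inj_on_image_Int[symmetric])
    show "inj_on ((`) f) (Pow (verts Z))" using f by (simp add: inj_on_image_Pow)
    show "Z X \<subseteq> Pow (verts Z)" "Z X' \<subseteq> Pow (verts Z)" using sub by blast+
  qed
  show ?thesis
    unfolding cells_def mapf_def
  proof (intro conjI ballI)
    fix X assume X: "X \<in> F"
    have "bal (card X) (Z X)" using Z X by (simp add: cells_def)
    then show "bal (card X) ((`) f ` Z X)" by (rule bal_image[OF _ fX infinite_vertex])
    have "bd (Z X) = insert {} (\<Union>Z'\<in>{Z\<in>F. Z \<subset> X}. Z Z')" using Z X by (simp add: cells_def)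
    then have "bd ((`) f ` Z X) = (`) f ` insert {} (\<Union>Z'\<in>{Z\<in>F. Z \<subset> X}. Z Z')" by (simp add: bd_image[OF fX])
    then show "bd ((`) f ` Z X) = insert {} (\<Union>Z'\<in>{Z\<in>F. Z \<subset> X}. (`) f ` Z Z')" by (simp only: image_insert image_empty image_UN)
    fix X' assume X': "X' \<in> F"
    have "Z X \<inter> Z X' = (if X \<inter> X' \<in> F then Z (X \<inter> X') else {{}})" using Z X X' by (simp add: cells_def)
    then show "(`) f ` Z X \<inter> (`) f ` Z X' = (if X \<inter> X' \<in> F then (`) f ` Z (X \<inter> X') else {{}})"
      unfolding I by simp
  qed
qed

text \<open>The new vertex stands in for \<open>i\<close>, so a move neither creates nor destroys a
  label set of a simplex. This will make the resulting vertex map face-preserving.\<close>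

lemma image_labels:
  assumes "lseq lab Z Z'" shows "(`) lab ` Z X = (`) lab ` Z' X"
proof -
  have "(`) lab ` Y X = (`) lab ` sts {i, j} a Y X"
    if Y: "fam Y" "{i, j} \<in> simps Y" "a \<notin> verts Y" "lab a = lab i" for Y i j a
  proof -
    have aij: "a \<noteq> i" "a \<noteq> j" using Y by (auto simp: verts_def)
    have aY: "a \<notin> t" if "t \<in> Y X" for t using that Y(3) in_simps[of Y X] by (auto simp: verts_def)
    have dc: "down_closed (Y X)" by (rule fam_down_closed[OF Y(1)])
    have "lab ` t \<in> (`) lab ` sts {i, j} a Y X" if t: "t \<in> Y X" for t
    proof (cases "{i, j} \<subseteq> t")
      case False
      then show ?thesis using t aY by (auto simp: sts_def in_st)
    next
      case True
      have 1: "insert a (t - {i}) - {a} \<union> {i, j} = t" using True aY[OF t] by blast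
      have 2: "\<not> {i, j} \<subseteq> insert a (t - {i})" using aij by blast
      have "insert a (t - {i}) \<in> sts {i, j} a Y X" unfolding sts_def in_st using 2 t by (simp only: insertI1 if_True 1 simp_thms)
      moreover have "insert i (t - {i}) = t" using True by blast
      then have "lab ` t = lab ` insert a (t - {i})" using Y(4) by (metis image_insert)
      ultimately show ?thesis by blast
    qed
    moreover have "lab ` t \<in> (`) lab ` Y X" if t: "t \<in> sts {i, j} a Y X" for t
    proof (cases "a \<in> t")
      case False
      then show ?thesis using t by (auto simp: sts_def in_st)
    next
      case True
      then have "t - {a} \<union> {i, j} \<in> Y X" using t by (simp add: sts_def in_st)
      then have "insert i (t - {a}) \<in> Y X" by (rule down_closedD[OF dc]) blast
      moreover have "insert a (t - {a}) = t" using True by blast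
      then have "lab ` t = lab ` insert i (t - {a})" using Y(4) by (metis image_insert)
      ultimately show ?thesis by blast
    qed
    ultimately show ?thesis by blast
  qed
  note step = this
  show ?thesis
    using assms
  proof (induction rule: lseq_induct)
    case (star Y i j a) then show ?case using step[of Y i j a] by simp
  next
    case (weld Y i j a) then show ?case using step[of Y i j a] by simp
  qed simp
qed



section \<open>Translation between complexes with and without the empty simplex\<close>

definition aug :: "'v set set \<Rightarrow> 'v set set" where
  "aug K = insert {} K"

lemma simplicial_complex_aug: "simplicial_complex K \<longleftrightarrow> fam1 (aug K) \<and> {} \<notin> K"
proof
  assume "simplicial_complex K"
  note sc = this[unfolded simplicial_complex_def]
  note K = conjunct1[OF sc] conjunct1[OF conjunct2[OF sc]] and c = conjunct2[OF conjunct2[OF sc]]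
  have "down_closed (aug K)"
    unfolding down_closed_def aug_def
  proof (intro ballI allI impI)
    fix s t assume "s \<in> insert {} K" "t \<subseteq> s"
    then show "t \<in> insert {} K" using c[rule_format, of s t] by (cases "t = {}"; cases "s = {}") simp_all
  qed
  then show "fam1 (aug K) \<and> {} \<notin> K" using K unfolding fam_unit by (auto simp: aug_def)
next
  assume K: "fam1 (aug K) \<and> {} \<notin> K"
  have dc: "down_closed (aug K)" using K by (simp add: fam_unit)
  have "t \<in> K" if "s \<in> K" "t \<subseteq> s" "t \<noteq> {}" for s t
    using down_closedD[OF dc, of s t] that by (simp add: aug_def)
  moreover have "finite K" "\<forall>s\<in>K. finite s \<and> s \<noteq> {}" using K unfolding fam_unit by (auto simp: aug_def)
  ultimately show "simplicial_complex K" unfolding simplicial_complex_def by metis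
qed

lemma aug_diff: "fam1 K \<Longrightarrow> t \<in> K \<Longrightarrow> aug (K - {{}}) = K"
  using down_closedD[of K t "{}"] by (auto simp: aug_def fam_unit)

lemma aug_inject: "aug K = aug L \<Longrightarrow> {} \<notin> K \<Longrightarrow> {} \<notin> L \<Longrightarrow> K = L"
  by (simp add: aug_def insert_ident)

text \<open>With the empty simplex at hand the three summands of a join merge into one.\<close>

lemma aug_join: "aug (join K L) = jn (aug K) (aug L)"
proof -
  have 1: "jn (insert {} N) M = M \<union> jn N M" for M N :: "'a family" unfolding jn_def by (intro equalityI subsetI) auto
  have 2: "jn K (insert {} L) = K \<union> jn K L" unfolding jn_commute[of K] 1 by (rule refl)
  have 3: "join K L = K \<union> L \<union> jn K L" by (simp add: join_def jn_def)
  show ?thesis unfolding aug_def 1 2 3 by (simp add: Un_ac)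
qed

lemma aug_full: "aug (full_complex V) = Pow V"
  by (auto simp: aug_def full_complex_def)

lemma aug_simplex_boundary: "V \<noteq> {} \<Longrightarrow> aug (simplex_boundary V) = Pow V - {V}"
  by (auto simp: aug_def simplex_boundary_def full_complex_def)

lemma aug_link:
  assumes "simplicial_complex K" "s \<in> K" shows "aug (link s K) = lk s (aug K)"
proof -
  have "t \<in> aug (link s K) \<longleftrightarrow> t \<in> lk s (aug K)" for t
  proof (cases "t = {}")
    case False
    have "s \<noteq> {}" using assms by (auto simp: simplicial_complex_def)
    then show ?thesis using assms(1) False unfolding simplicial_complex_def aug_def link_def lk_def by auto
  qed (use assms in \<open>auto simp: aug_def lk_def\<close>)
  then show ?thesis by blast
qed

lemma empty_starring: "simplicial_complex K \<Longrightarrow> {} \<notin> starring s a K"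
proof -
  assume K: "simplicial_complex K"
  have j: "{} \<notin> M \<Longrightarrow> {} \<notin> N \<Longrightarrow> {} \<notin> join M N" for M N :: "'a family" by (simp add: join_def)
  have n: "{} \<notin> K" using K by (simp add: simplicial_complex_aug)
  have "{} \<notin> full_complex {a}" "{} \<notin> simplex_boundary s" "{} \<notin> link s K"
    using n by (simp_all add: full_complex_def simplex_boundary_def link_def)
  then have "{} \<notin> join (full_complex {a}) (join (simplex_boundary s) (link s K))" by (intro j)
  then show ?thesis using n by (simp add: starring_def)
qed

text \<open>A set belongs to the join of the boundary of \<open>s\<close> with its link exactly if
  it does not contain \<open>s\<close> and its union with \<open>s\<close> is a simplex. This turns
  the join formula into the membership test \<open>st\<close>.\<close>

lemma aug_starring:
  assumes K: "simplicial_complex K" and s: "s \<in> K" and a: "a \<notin> \<Union>K"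
  shows "aug (starring s a K) = st s a (aug K)"
proof -
  have sn: "s \<noteq> {}" using K s by (auto simp: simplicial_complex_def)
  have as: "a \<notin> s" using s a by blast
  have dc: "down_closed (aug K)" using K by (simp add: simplicial_complex_aug fam_unit)
  have a': "a \<notin> t" if "t \<in> aug K" for t using a that by (auto simp: aug_def)
  have d: "\<Union>(Pow s - {s}) \<inter> \<Union>(lk s (aug K)) = {}" by (auto simp: lk_def)
  let ?R = "jn (Pow s - {s}) (lk s (aug K))"
  have inR: "u \<in> ?R \<longleftrightarrow> \<not> s \<subseteq> u \<and> u \<union> s \<in> aug K" for u
  proof
    assume "u \<in> ?R"
    then obtain p q where "u = p \<union> q" "p \<subseteq> s" "p \<noteq> s" "q \<inter> s = {}" "q \<union> s \<in> aug K" by (auto simp: jn_def lk_def)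
    moreover from this have "u \<union> s = q \<union> s" by blast
    ultimately show "\<not> s \<subseteq> u \<and> u \<union> s \<in> aug K" by auto
  next
    assume u: "\<not> s \<subseteq> u \<and> u \<union> s \<in> aug K"
    have "(u - s) \<union> s = u \<union> s" by blast
    then have "u - s \<in> lk s (aug K)" using u by (auto simp: lk_def)
    moreover have "u \<inter> s \<in> Pow s - {s}" using u by blast
    ultimately have "(u \<inter> s) \<union> (u - s) \<in> ?R" by (intro jnI)
    then show "u \<in> ?R" by (simp add: Int_Diff_Un)
  qed
  have "aug (starring s a K) = {t \<in> aug K. \<not> s \<subseteq> t} \<union> jn (Pow {a}) ?R"
  proof -
    have "aug (starring s a K) = aug (K - {t \<in> K. s \<subseteq> t}) \<union> aug (join (full_complex {a}) (join (simplex_boundary s) (link s K)))"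
      by (auto simp: aug_def starring_def)
    also have "aug (K - {t \<in> K. s \<subseteq> t}) = {t \<in> aug K. \<not> s \<subseteq> t}" using sn by (auto simp: aug_def)
    finally show ?thesis by (simp add: aug_join aug_full aug_simplex_boundary[OF sn] aug_link[OF K s])
  qed
  also have "\<dots> = st s a (aug K)"
  proof -
    have "t \<in> {t \<in> aug K. \<not> s \<subseteq> t} \<union> jn (Pow {a}) ?R \<longleftrightarrow> t \<in> st s a (aug K)" for t
    proof -
      have aR: "a \<notin> \<Union>?R" using a' inR by blast
      have "Pow {a} = {{}, {a}}" by auto
      then have "jn (Pow {a}) ?R = cone a ?R" using jn_commute[of "Pow {a}" ?R] cone_jn[of a ?R] by simp
      then have 1: "t \<in> jn (Pow {a}) ?R \<longleftrightarrow> \<not> s \<subseteq> t - {a} \<and> t - {a} \<union> s \<in> aug K" using in_cone[OF aR] inR by simp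
      have 2: "s \<subseteq> t - {a} \<longleftrightarrow> s \<subseteq> t" using as by blast
      show ?thesis
      proof (cases "a \<in> t")
        case True then show ?thesis unfolding Un_iff 1 2 in_st using a'[of t] by auto
      next
        case False
        then have "t - {a} = t" by simp
        then show ?thesis unfolding Un_iff 1 2 in_st using False down_closedD[OF dc, of "t \<union> s" t] by auto
      qed
    qed
    then show ?thesis by blast
  qed
  finally show ?thesis .
qed

text \<open>General starrings reduce to edges, and isomorphisms reduce to starring single
  vertices.\<close>

lemma stellar_move_sq:
  fixes Y :: "'a family"
  assumes "stellar_move Y Y'"
  shows "sq (aug Y) (aug Y') \<and> simplicial_complex Y \<and> simplicial_complex Y'"
  using assms
proof (induction rule: stellar_move.induct)
  case (star Y s a)
  have f: "fam1 (aug Y)" and n: "{} \<notin> Y" using iffD1[OF simplicial_complex_aug star(1)] by simp_all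
  have sn: "s \<noteq> {}" using star(2) n by metis
  have aY: "a \<notin> \<Union>(aug Y)" using star(3) unfolding aug_def by simp
  have e: "aug (starring s a Y) = st s a (aug Y)" by (rule aug_starring[OF star])
  have "sq (aug Y) (aug (starring s a Y))" unfolding e by (rule sq_star[OF f sn aY])
  moreover have "simplicial_complex (starring s a Y)"
    unfolding simplicial_complex_aug e by (intro conjI fam1_st[OF f] empty_starring[OF star(1)])
  ultimately show ?case using star(1) by simp
next
  case (iso Y f)
  let ?Y = "(\<lambda>s. f ` s) ` Y"
  have e: "aug ?Y = (`) f ` aug Y" by (simp add: aug_def)
  have Y: "fam1 (aug Y)" "{} \<notin> Y" using iso(1) by (simp_all add: simplicial_complex_aug)
  have "inj_on f (\<Union>(aug Y))" using iso(2) by (simp add: aug_def)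
  then have "sq ((`) id ` aug Y) ((`) f ` aug Y)" by (intro sq_map[OF sq_refl Y(1) infinite_vertex]) simp_all
  then have "sq (aug Y) (aug ?Y)" by (simp add: e)
  moreover have "fam1 (aug ?Y)" unfolding e by (rule fam1_image[OF Y(1)])
  moreover have "{} \<notin> ?Y" using Y(2) by auto
  ultimately show ?case using iso(1) by (simp add: simplicial_complex_aug)
qed

lemma stellar_equivalent_sq:
  fixes K L :: "'a family"
  assumes "stellar_equivalent K L" "simplicial_complex K"
  shows "sq (aug K) (aug L) \<and> simplicial_complex L"
proof -
  show ?thesis
    using assms(1) unfolding stellar_equivalent_def
  proof (induction rule: equivclp_induct)
    case base show ?case using assms(2) by simp
  next
    case (step Y L) then show ?case using stellar_move_sq sq_trans sq_sym by metis
  qed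
qed

lemma sq_stellar_equivalent:
  fixes K L :: "'a family"
  assumes "sq (aug K) L" "simplicial_complex K" shows "stellar_equivalent K (L - {{}})"
proof -
  have move: "stellar_move (Y - {{}}) (st {i, j} a Y - {{}})" if Y: "fam1 Y" "{i, j} \<in> Y" "a \<notin> \<Union>Y" for Y :: "'a family" and i j a
  proof -
    have e: "aug (Y - {{}}) = Y" using aug_diff[OF Y(1,2)] .
    then have sc: "simplicial_complex (Y - {{}})" using Y(1) by (simp add: simplicial_complex_aug)
    have "aug (starring {i, j} a (Y - {{}})) = st {i, j} a Y" using aug_starring[OF sc, of "{i, j}" a] Y e by auto
    then have "starring {i, j} a (Y - {{}}) = st {i, j} a Y - {{}}" using empty_starring[OF sc] by (auto simp: aug_def)
    moreover have "stellar_move (Y - {{}}) (starring {i, j} a (Y - {{}}))" using Y by (intro stellar_move.star sc) auto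
    ultimately show ?thesis by simp
  qed
  have n: "aug K - {{}} = K" using assms(2) by (auto simp: simplicial_complex_aug aug_def[of K])
  from assms(1) show ?thesis
  proof (induction rule: sq_induct)
    case base show ?case unfolding n stellar_equivalent_def by simp
  next
    case (star Y i j a)
    then show ?case using move[of Y i j a] unfolding stellar_equivalent_def by (meson equivclp_trans r_into_equivclp)
  next
    case (weld Y i j a)
    then show ?case using move[of Y i j a] unfolding stellar_equivalent_def
      by (meson equivclp_trans r_into_equivclp equivclp_sym)
  qed
qed

lemma simplicial_full: "finite V \<Longrightarrow> simplicial_complex (full_complex V)"
  unfolding simplicial_complex_aug aug_full using fam1_Pow by (simp add: full_complex_def)

lemma simplicial_boundary: "finite V \<Longrightarrow> V \<noteq> {} \<Longrightarrow> simplicial_complex (simplex_boundary V)"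
  unfolding simplicial_complex_aug using fam1_bdPow[of V] by (simp add: aug_simplex_boundary) (simp add: full_complex_def simplex_boundary_def)

text \<open>The index \<open>m\<close> is the dimension plus one.\<close>

lemma stellar_ball_bal: "stellar_ball (int m - 1) K \<longleftrightarrow> bal m (aug K) \<and> {} \<notin> (K :: 'a family)"
proof
  assume "stellar_ball (int m - 1) K"
  then obtain V where V: "finite V" "V \<noteq> {}" "card V = m" "stellar_equivalent (full_complex V) K"
    by (auto simp: stellar_ball_def)
  have "m \<ge> 1" using V card_gt_0_iff[of V] by linarith
  then show "bal m (aug K) \<and> {} \<notin> K"
    using stellar_equivalent_sq[OF V(4) simplicial_full[OF V(1)]] V
    by (auto simp: bal_def aug_full simplicial_complex_aug)
next
  assume K: "bal m (aug K) \<and> {} \<notin> K"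
  obtain V :: "'a vertex set" where V: "finite V" "card V = m" "sq (Pow V) (aug K)" "m \<ge> 1" using K by (auto simp: bal_def)
  have "stellar_equivalent (full_complex V) (aug K - {{}})"
    using V by (intro sq_stellar_equivalent simplicial_full) (simp_all add: aug_full)
  moreover have "aug K - {{}} = K" using K by (auto simp: aug_def)
  ultimately have eq: "stellar_equivalent (full_complex V) K" by (simp only:)
  have "V \<noteq> {}" "int (card V) = int m - 1 + 1" using V(2,4) by auto
  then show "stellar_ball (int m - 1) K" unfolding stellar_ball_def using V(1) eq by (intro exI[of _ V] conjI)
qed

lemma stellar_ballE:
  assumes "stellar_ball d K" obtains m where "d = int m - 1" "bal m (aug K)"
proof -
  from assms obtain V :: "'a vertex set" where "int (card V) = d + 1" by (auto simp: stellar_ball_def)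
  then have "d = int (card V) - 1" by simp
  then show thesis using that assms stellar_ball_bal by blast
qed

lemma sph_stellar_sphere:
  assumes "sph m (aug K)" "{} \<notin> (K :: 'a family)" shows "stellar_sphere (int m - 1) K"
proof -
  obtain V :: "'a vertex set" where V: "finite V" "card V = m + 1" "sq (Pow V - {V}) (aug K)" using assms by (auto simp: sph_def)
  have Vn: "V \<noteq> {}" using V by auto
  have "stellar_equivalent (simplex_boundary V) (aug K - {{}})"
    using V Vn by (intro sq_stellar_equivalent simplicial_boundary) (simp_all add: aug_simplex_boundary)
  moreover have "aug K - {{}} = K" using assms by (auto simp: aug_def)
  ultimately have eq: "stellar_equivalent (simplex_boundary V) K" by (simp only:)
  have "int (card V) = int m - 1 + 2" using V(2) by simp
  then show ?thesis unfolding stellar_sphere_def using V(1) Vn eq by (intro exI[of _ V] conjI)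
qed

context
  fixes m :: nat and K :: "'a family"
  assumes bal: "bal m (aug K)" and empty: "{} \<notin> K"
begin

lemma bal_simplicial: "simplicial_complex K"
  using bal empty bal_fam1 by (simp add: simplicial_complex_aug)

lemma bal_manifold: "stellar_manifold (int m - 1) K"
  unfolding stellar_manifold_def
proof (intro conjI ballI bal_simplicial)
  fix v assume "v \<in> \<Union>K"
  then obtain s where s: "s \<in> K" "v \<in> s" by blast
  have dc: "down_closed (aug K)" using bal_simplicial by (simp add: simplicial_complex_aug fam_unit)
  have v: "{v} \<in> K" using down_closedD[OF dc, of s "{v}"] s by (simp add: aug_def)
  have g: "gl m (aug K)" using bal by (simp add: gl_def)
  have va: "{v} \<in> aug K" using v by (simp add: aug_def)
  have e: "aug (link {v} K) = lk {v} (aug K)" by (rule aug_link[OF bal_simplicial v])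
  have n: "{} \<notin> link {v} K" using empty by (simp add: link_def)
  \<comment> \<open>A vertex in the complex forces \<open>m \<ge> 1\<close>, so subtraction on
    natural numbers does not truncate.\<close>
  have m: "int m - 1 - 1 = int (m - 1) - 1" using gl_lk(1)[OF g va] by simp
  show "stellar_ball (int m - 1 - 1) (link {v} K) \<or> stellar_sphere (int m - 1 - 1) (link {v} K)"
    unfolding m using gl_lk(2,3)[OF g va] n by (cases "{v} \<in> bd (aug K)") (simp_all add: stellar_ball_bal sph_stellar_sphere e)
qed

text \<open>Links in a ball are balls or spheres, and of these only balls have evenly many
  simplices; so the boundary by counting is the geometric one. The empty simplex belongs to it
  because its link is the ball itself.\<close>

lemma bal_boundary: "aug (manifold_boundary K) = bd (aug K)"
proof -
  have g: "gl m (aug K)" using bal by (simp add: gl_def)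
  have "s \<in> manifold_boundary K \<longleftrightarrow> s \<in> bd (aug K)" if s: "s \<in> K" for s
  proof -
    have sa: "s \<in> aug K" using s by (simp add: aug_def)
    have e: "aug (link s K) = lk s (aug K)" by (rule aug_link[OF bal_simplicial s])
    have n: "{} \<notin> link s K" using empty by (simp add: link_def)
    show ?thesis
    proof
      assume "s \<in> manifold_boundary K"
      then obtain d where "stellar_ball d (link s K)" by (auto simp: manifold_boundary_def)
      then obtain m' where "bal m' (lk s (aug K))" using e by (metis stellar_ballE)
      then show "s \<in> bd (aug K)" using bal_even sa by (auto simp: bd_def)
    next
      assume "s \<in> bd (aug K)"
      then have "bal (m - card s) (aug (link s K))" using gl_lk(2)[OF g sa] e by simp
      then have "stellar_ball (int (m - card s) - 1) (link s K)" using n by (simp add: stellar_ball_bal)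
      then show "s \<in> manifold_boundary K" using s by (auto simp: manifold_boundary_def)
    qed
  qed
  moreover have "{} \<in> bd (aug K)" using bal_even[OF bal] by (simp add: bd_def lk_def) (simp add: aug_def)
  ultimately show ?thesis using bd_sub[of "aug K"] by (auto simp: aug_def manifold_boundary_def)
qed

end

text \<open>The value \<open>A {} = {}\<close> turns into \<open>{{}}\<close> under
  \<open>aug\<close>; this is why \<open>cells\<close> assigns the intersection \<open>{{}}\<close>
  to disjoint indices.\<close>

lemma stellar_simplex_cells:
  "stellar_simplex n A \<longleftrightarrow> A {} = {} \<and> (\<forall>X\<in>Delta n. {} \<notin> A X) \<and> cells (Delta n) (\<lambda>X. aug (A X))"
proof -
  have D: "X \<inter> Y \<in> Delta n \<longleftrightarrow> X \<inter> Y \<noteq> {}" if "X \<in> Delta n" for X Y using that by (auto simp: full_complex_def)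
  have sub: "Z \<in> Delta n" if "X \<in> Delta n" "Z \<subset> X" "Z \<noteq> {}" for X Z using that unfolding full_complex_def by blast
  have bd: "manifold_boundary (A X) = (\<Union>Z\<in>{Z. Z \<subset> X}. A Z) \<longleftrightarrow>
      bd (aug (A X)) = insert {} (\<Union>Z\<in>{Z\<in>Delta n. Z \<subset> X}. aug (A Z))"
    if X: "X \<in> Delta n" "A {} = {}" "bal (card X) (aug (A X))" "\<forall>X\<in>Delta n. {} \<notin> A X" for X
  proof -
    have e: "{} \<notin> A X" using X by blast
    have "insert {} (\<Union>Z\<in>{Z\<in>Delta n. Z \<subset> X}. aug (A Z)) = aug (\<Union>Z\<in>{Z. Z \<subset> X}. A Z)"
    proof -
      have "t \<in> (\<Union>Z\<in>{Z\<in>Delta n. Z \<subset> X}. A Z) \<longleftrightarrow> t \<in> (\<Union>Z\<in>{Z. Z \<subset> X}. A Z)" for t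
      proof
        assume "t \<in> (\<Union>Z\<in>{Z. Z \<subset> X}. A Z)"
        then obtain Z where Z: "Z \<subset> X" "t \<in> A Z" by blast
        then have "Z \<noteq> {}" using X(2) by (metis empty_iff)
        then have "Z \<in> Delta n" by (rule sub[OF X(1) Z(1)])
        then show "t \<in> (\<Union>Z\<in>{Z\<in>Delta n. Z \<subset> X}. A Z)" using Z by blast
      qed blast
      then have "(\<Union>Z\<in>{Z\<in>Delta n. Z \<subset> X}. A Z) = (\<Union>Z\<in>{Z. Z \<subset> X}. A Z)" by blast
      moreover have "insert {} (\<Union>Z\<in>{Z\<in>Delta n. Z \<subset> X}. insert {} (A Z)) = insert {} (\<Union>Z\<in>{Z\<in>Delta n. Z \<subset> X}. A Z)" by blast
      ultimately show ?thesis unfolding aug_def by (simp only:)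
    qed
    moreover have "{} \<notin> (\<Union>Z\<in>{Z. Z \<subset> X}. A Z)"
    proof
      assume "{} \<in> (\<Union>Z\<in>{Z. Z \<subset> X}. A Z)"
      then obtain Z where Z: "Z \<subset> X" "{} \<in> A Z" by blast
      then have "Z \<noteq> {}" using X(2) by (metis empty_iff)
      then have "Z \<in> Delta n" by (rule sub[OF X(1) Z(1)])
      then show False using Z X(4) by blast
    qed
    moreover have "{} \<notin> manifold_boundary (A X)" using e by (auto simp: manifold_boundary_def)
    ultimately show ?thesis unfolding bal_boundary[OF X(3) e, symmetric] using aug_inject by metis
  qed
  have int: "A (X \<inter> Y) = A X \<inter> A Y \<longleftrightarrow> aug (A X) \<inter> aug (A Y) = (if X \<inter> Y \<in> Delta n then aug (A (X \<inter> Y)) else {{}})"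
    if X: "X \<in> Delta n" "Y \<in> Delta n" "A {} = {}" "\<forall>X\<in>Delta n. {} \<notin> A X" for X Y
  proof -
    have "aug (A X) \<inter> aug (A Y) = aug (A X \<inter> A Y)" by (auto simp: aug_def)
    moreover have "(if X \<inter> Y \<in> Delta n then aug (A (X \<inter> Y)) else {{}}) = aug (A (X \<inter> Y))"
      using D[OF X(1), of Y] X(3) by (auto simp: aug_def)
    moreover have "{} \<notin> A X \<inter> A Y" "{} \<notin> A (X \<inter> Y)" using X(1,3,4) D[OF X(1), of Y] by (metis IntD1, metis empty_iff)
    ultimately show ?thesis using aug_inject by metis
  qed
  show ?thesis
  proof
    assume A: "stellar_simplex n A"
    then have "A {} = {}" "\<And>X. X \<in> Delta n \<Longrightarrow> bal (card X) (aug (A X)) \<and> {} \<notin> A X"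
      by (simp_all add: stellar_simplex_def stellar_ball_bal)
    then show "A {} = {} \<and> (\<forall>X\<in>Delta n. {} \<notin> A X) \<and> cells (Delta n) (\<lambda>X. aug (A X))"
      unfolding cells_def using A bd int unfolding stellar_simplex_def by simp
  next
    assume "A {} = {} \<and> (\<forall>X\<in>Delta n. {} \<notin> A X) \<and> cells (Delta n) (\<lambda>X. aug (A X))"
    then show "stellar_simplex n A"
      unfolding cells_def stellar_simplex_def stellar_ball_bal using bd int by simp
  qed
qed



section \<open>Subdivided stellar simplexes, dual cells and the conclusion\<close>

lemma cells_cong: "(\<And>X. X \<in> F \<Longrightarrow> A X = A' X) \<Longrightarrow> cells F A \<Longrightarrow> cells F A'"
proof -
  assume e: "\<And>X. X \<in> F \<Longrightarrow> A X = A' X" and c: "cells F A"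
  have "(\<Union>Z\<in>{Z\<in>F. Z \<subset> X}. A Z) = (\<Union>Z\<in>{Z\<in>F. Z \<subset> X}. A' Z)" for X using e by (intro SUP_cong) auto
  then show "cells F A'" using c unfolding cells_def by (simp add: e)
qed

lemma cells_on: "cells F A \<Longrightarrow> cells F (on F A)"
  by (rule cells_cong[of F A]) (simp_all add: on_def)

lemma fam_on: "cells F A \<Longrightarrow> finite F \<Longrightarrow> fam (on F A)"
proof -
  assume c: "cells F A" and F: "finite F"
  have s: "simps (on F A) = (\<Union>X\<in>F. A X)" by (auto simp: simps_def on_def split: if_splits)
  have f: "finite (A X)" "\<And>s. s \<in> A X \<Longrightarrow> finite s" "down_closed (A X)" if "X \<in> F" for X
    using cells_fam1[OF c that] by (simp_all add: fam_unit)
  have "down_closed (on F A X)" for X using f(3) by (cases "X \<in> F") (simp_all add: on_def down_closed_def)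
  moreover have "finite (\<Union>X\<in>F. A X)" "\<forall>s\<in>(\<Union>X\<in>F. A X). finite s" using F f(1,2) by auto
  ultimately show ?thesis unfolding fam_def s by (intro conjI allI)
qed

lemma aug_subdivision: "{} \<notin> K \<Longrightarrow> aug (subdivision K) = (`) bary ` oc (aug K)"
proof -
  assume "{} \<notin> K"
  then have "oc (aug K) = insert {} (flags K)" by (auto simp: oc_def flags_def aug_def chain_subset_def)
  then show ?thesis by (simp add: aug_def subdivision_def)
qed

lemma empty_subdivision: "{} \<notin> subdivision K"
  by (auto simp: subdivision_def flags_def)

lemma sub_iter_on:
  assumes "\<forall>X\<in>F. {} \<notin> B X"
  shows "(sub ^^ k) (on F (\<lambda>X. aug (B X))) = on F (\<lambda>X. aug ((subdivision ^^ k) (B X))) \<and>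
    (\<forall>X\<in>F. {} \<notin> (subdivision ^^ k) (B X))"
proof (induction k)
  case 0 then show ?case using assms by simp
next
  case (Suc k)
  let ?M = "\<lambda>X. (subdivision ^^ k) (B X)"
  have e: "{} \<notin> ?M X" if "X \<in> F" for X using Suc.IH that by blast
  have "sub (on F (\<lambda>X. aug (?M X))) = on F (\<lambda>X. aug (subdivision (?M X)))"
  proof
    fix X
    show "sub (on F (\<lambda>X. aug (?M X))) X = on F (\<lambda>X. aug (subdivision (?M X))) X"
    proof (cases "X \<in> F")
      case True
      then show ?thesis by (simp add: sub_def bs_def mapf_def on_def aug_subdivision[OF e])
    next
      case False
      then show ?thesis by (simp add: sub_def bs_def mapf_def on_def oc_def)
    qed
  qed
  moreover have "{} \<notin> subdivision (?M X)" for X by (rule empty_subdivision)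
  ultimately show ?case using Suc.IH by simp
qed

lemma finite_Delta: "finite (Delta n)"
  by (rule finite_subset[of _ "Pow {0..n}"]) (auto simp: full_complex_def)

text \<open>Subdivision is a sequence of moves made in all faces simultaneously, and these preserve
  cell structures.\<close>

lemma stellar_simplex_subdivision:
  assumes "stellar_simplex n B" shows "stellar_simplex n (\<lambda>X. (subdivision ^^ k) (B X))"
proof -
  let ?F = "Delta n" and ?M = "\<lambda>X. (subdivision ^^ k) (B X)"
  have B: "B {} = {}" "\<forall>X\<in>?F. {} \<notin> B X" "cells ?F (\<lambda>X. aug (B X))" using assms by (simp_all add: stellar_simplex_cells)
  have it: "(sub ^^ k) (on ?F (\<lambda>X. aug (B X))) = on ?F (\<lambda>X. aug (?M X))" "\<forall>X\<in>?F. {} \<notin> ?M X"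
    using sub_iter_on[OF B(2), of k] by simp_all
  have "cells ?F (on ?F (\<lambda>X. aug (?M X)))"
    unfolding it(1)[symmetric]
    by (rule cells_seq_invariant[OF seq_sub_iter[OF fam_on[OF B(3) finite_Delta]] cells_on[OF B(3)]])
  then have "cells ?F (\<lambda>X. aug (?M X))" by (rule cells_cong[rotated]) (simp add: on_def)
  moreover have "(subdivision ^^ k) {} = ({} :: 'a family)" by (induction k) (simp_all add: subdivision_def flags_def)
  ultimately show ?thesis unfolding stellar_simplex_cells using it(2) B(1) by simp
qed

lemma ocp_image_embedding:
  assumes "\<And>x y. x \<in> S \<Longrightarrow> y \<in> S \<Longrightarrow> g x \<subseteq> g y \<longleftrightarrow> x \<subseteq> y"
  shows "ocp (g ` S) = (`) g ` ocp S"
proof (intro equalityI subsetI)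
  fix C assume "C \<in> ocp (g ` S)"
  then have C: "C \<subseteq> g ` S" "chain\<^sub>\<subseteq> C" by (simp_all add: ocp_def)
  from C(1) obtain D where D: "D \<subseteq> S" "C = g ` D" unfolding subset_image_iff by (elim exE conjE)
  have "chain\<^sub>\<subseteq> D"
    unfolding chain_subset_def
  proof (intro ballI)
    fix x y assume xy: "x \<in> D" "y \<in> D"
    then have "g x \<subseteq> g y \<or> g y \<subseteq> g x" using C(2) D(2) unfolding chain_subset_def by blast
    then show "x \<subseteq> y \<or> y \<subseteq> x" using assms[of x y] assms[of y x] xy D(1) by blast
  qed
  then show "C \<in> (`) g ` ocp S" using D by (auto simp: ocp_def)
next
  fix C assume "C \<in> (`) g ` ocp S"
  then obtain D where D: "C = g ` D" "D \<subseteq> S" "chain\<^sub>\<subseteq> D" by (auto simp: ocp_def)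
  have "chain\<^sub>\<subseteq> (g ` D)"
    unfolding chain_subset_def
  proof (intro ballI)
    fix u w assume "u \<in> g ` D" "w \<in> g ` D"
    then obtain x y where xy: "u = g x" "w = g y" "x \<in> D" "y \<in> D" by blast
    then have "x \<subseteq> y \<or> y \<subseteq> x" using D(3) unfolding chain_subset_def by blast
    then show "u \<subseteq> w \<or> w \<subseteq> u" unfolding xy(1,2) using assms[of x y] assms[of y x] xy(3,4) D(2) by blast
  qed
  then show "C \<in> ocp (g ` S)" unfolding D(1) using D(2) by (auto simp: ocp_def)
qed

lemma Union_ocp: "\<Union>(ocp S) \<subseteq> S"
  by (auto simp: ocp_def)

text \<open>The simplices above \<open>t\<close> correspond to its link with the empty simplex as
  least element. Hence the order complex is a cone over the subdivided link, with apex
  \<open>bary {}\<close>, and a cone over a ball or a sphere is a ball.\<close>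

lemma bal_ocp_star:
  fixes K :: "'a family"
  assumes g: "gl m K" "fam1 K" and t: "t \<in> K"
  shows "\<exists>m'. bal m' ((`) bary ` ocp {s \<in> K. t \<subseteq> s})"
proof -
  let ?L = "lk t K" and ?v = "bary {}"
  have fL: "fam1 ?L" by (rule fam1_lk[OF g(2)])
  have fin: "finite ?L" "\<And>s. s \<in> ?L \<Longrightarrow> finite s" using fL by (simp_all add: fam_unit)
  have eL: "{} \<in> ?L" using t by (simp add: lk_def)
  have gL: "gl (m - card t) ?L" using gl_lk(2,3)[OF g(1) t] by (cases "t \<in> bd K") (simp_all add: gl_def)
  have "sq ?L (sub (\<lambda>_ :: unit. ?L) ())" using lseq_sq[OF seq_sub[OF fL], of "()"] by simp
  then have sd: "sq ?L ((`) bary ` oc ?L)" by (simp add: sub_def bs_def mapf_def)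
  have v: "?v \<notin> \<Union>((`) bary ` oc ?L)"
  proof
    assume "?v \<in> \<Union>((`) bary ` oc ?L)"
    then obtain s where s: "s \<in> ?L - {{}}" "bary {} = bary s" unfolding oc_def by blast
    then have "{} = s" using inj_onD[OF bary_inj s(2)] fin(2) by simp
    then show False using s(1) by simp
  qed
  have "cone ?v ((`) bary ` oc ?L) = (`) bary ` ocp ?L"
  proof -
    have "ocp ?L = oc ?L \<union> insert {} ` oc ?L"
    proof (intro equalityI subsetI)
      fix C assume "C \<in> ocp ?L"
      then have C: "C \<subseteq> ?L" "chain\<^sub>\<subseteq> C" by (simp_all add: ocp_def)
      show "C \<in> oc ?L \<union> insert {} ` oc ?L"
      proof (cases "{} \<in> C")
        case True
        have "chain\<^sub>\<subseteq> (C - {{}})" using C(2) by (rule chain_mono) blast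
        then have "C - {{}} \<in> oc ?L" using C(1) eL by (auto simp: oc_def)
        then show ?thesis using True by (metis UnI2 imageI insert_Diff)
      next
        case False then show ?thesis using C eL by (auto simp: oc_def)
      qed
    next
      fix C assume "C \<in> oc ?L \<union> insert {} ` oc ?L"
      then obtain D where D: "D \<in> oc ?L" "C = D \<or> C = insert {} D" by blast
      have "D \<subseteq> ?L" "chain\<^sub>\<subseteq> D" "chain\<^sub>\<subseteq> (insert {} D)" using D(1) by (auto simp: oc_def chain_subset_def)
      then show "C \<in> ocp ?L" using D(2) eL by (auto simp: ocp_def)
    qed
    then show ?thesis by (simp add: cone_def image_Un image_image)
  qed
  then have b: "bal (Suc (m - card t)) ((`) bary ` ocp ?L)" using cone_gl[OF v gl_sq[OF gL sd]] by simp
  have star: "{s \<in> K. t \<subseteq> s} = (\<lambda>r. r \<union> t) ` ?L"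
  proof (intro equalityI subsetI)
    fix s assume "s \<in> {s \<in> K. t \<subseteq> s}"
    then have "s = (s - t) \<union> t" "s - t \<in> ?L" by (auto simp: lk_def Un_absorb2)
    then show "s \<in> (\<lambda>r. r \<union> t) ` ?L" by (rule image_eqI)
  qed (auto simp: lk_def)
  have oi: "ocp {s \<in> K. t \<subseteq> s} = (`) (\<lambda>r. r \<union> t) ` ocp ?L"
    unfolding star by (rule ocp_image_embedding) (auto simp: lk_def)
  have ft: "finite t" using g(2) t by (simp add: fam_unit)
  have i1: "inj_on bary (\<Union>(ocp ?L))"
    by (rule inj_on_subset[OF bary_inj]) (use Union_ocp[of ?L] fin in blast)
  have i2: "inj_on (\<lambda>r. bary (r \<union> t)) (\<Union>(ocp ?L))"
  proof (rule inj_onI)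
    fix r r' assume r: "r \<in> \<Union>(ocp ?L)" "r' \<in> \<Union>(ocp ?L)" "bary (r \<union> t) = bary (r' \<union> t)"
    then have rL: "r \<in> ?L" "r' \<in> ?L" using Union_ocp[of ?L] by blast+
    then have "r \<union> t = r' \<union> t" using inj_onD[OF bary_inj r(3)] fin(2) ft by simp
    then show "r = r'" using rL by (auto simp: lk_def)
  qed
  have "sq ((`) bary ` ocp ?L) ((`) (\<lambda>r. bary (r \<union> t)) ` ocp ?L)"
    by (rule sq_map[OF sq_refl fam_ocp[OF fin(1)] infinite_vertex i1 i2])
  then have "sq ((`) bary ` ocp ?L) ((`) bary ` ocp {s \<in> K. t \<subseteq> s})" by (simp add: oi image_image)
  then show ?thesis using b bal_sq by blast
qed

text \<open>Images grow along a flag, so the condition on its least element passes to all its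
  members; conversely a non-empty finite chain has a least element. So a dual cell is the order
  complex of an upper set.\<close>

lemma aug_dual_cell:
  assumes M: "simplicial_complex M" and s: "s \<noteq> {}"
  shows "aug (dual_cell M s f) = (`) bary ` ocp {t \<in> M. s \<subseteq> f ` t}"
proof -
  have fM: "finite M" using M by (simp add: simplicial_complex_def)
  have e: "insert {} {C \<in> flags M. \<exists>t\<in>C. (\<forall>u\<in>C. t \<subseteq> u) \<and> s \<subseteq> f ` t} = ocp {t \<in> M. s \<subseteq> f ` t}"
  proof (intro equalityI subsetI)
    fix C assume "C \<in> insert {} {C \<in> flags M. \<exists>t\<in>C. (\<forall>u\<in>C. t \<subseteq> u) \<and> s \<subseteq> f ` t}"
    then consider "C = {}" | t where "C \<subseteq> M" "chain\<^sub>\<subseteq> C" "\<forall>u\<in>C. t \<subseteq> u" "s \<subseteq> f ` t" unfolding flags_def by blast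
    then show "C \<in> ocp {t \<in> M. s \<subseteq> f ` t}"
    proof cases
      case 1 then show ?thesis by (simp add: ocp_def chain_subset_def)
    next
      case (2 t)
      have "s \<subseteq> f ` u" if "u \<in> C" for u using 2(3,4) that by (meson image_mono order_trans)
      then show ?thesis using 2(1,2) by (auto simp: ocp_def)
    qed
  next
    fix C assume "C \<in> ocp {t \<in> M. s \<subseteq> f ` t}"
    then have C: "C \<subseteq> M" "chain\<^sub>\<subseteq> C" "\<And>t. t \<in> C \<Longrightarrow> s \<subseteq> f ` t" by (auto simp: ocp_def)
    show "C \<in> insert {} {C \<in> flags M. \<exists>t\<in>C. (\<forall>u\<in>C. t \<subseteq> u) \<and> s \<subseteq> f ` t}"
    proof (cases "C = {}")
      case False
      obtain t where t: "t \<in> C" "\<forall>b\<in>C. b \<subseteq> t \<longrightarrow> t = b" using finite_has_minimal[OF finite_subset[OF C(1) fM] False] by blast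
      have least: "t \<subseteq> u" if "u \<in> C" for u using C(2) t that unfolding chain_subset_def by (metis order_refl)
      have "\<exists>t\<in>C. (\<forall>u\<in>C. t \<subseteq> u) \<and> s \<subseteq> f ` t" by (intro bexI[OF _ t(1)] conjI ballI least C(3)[OF t(1)])
      moreover have "C \<in> flags M" using C(1,2) False by (simp add: flags_def)
      ultimately show ?thesis by simp
    qed simp
  qed
  show ?thesis unfolding dual_cell_def aug_def e[symmetric] by (simp only: image_insert image_empty)
qed

text \<open>The first projection forgets the labels without changing inclusions, so results about
  labelled pairs carry over to the complexes themselves.\<close>

lemma ocp_graph:
  fixes g :: "'b vertex \<Rightarrow> 'c" and T :: "'b family"
  assumes "finite T" "\<forall>t\<in>T. finite t"
  defines "S \<equiv> (`) (\<lambda>x. (x, g x)) ` T"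
  shows "(`) (\<lambda>t. bary (fst ` t)) ` ocp S = (`) bary ` ocp T"
    and "inj_on (\<lambda>t. bary (fst ` t)) (\<Union>(ocp S))" and "fam1 (ocp S)"
proof -
  let ?p = "(`) (\<lambda>x. (x, g x))"
  have fst: "fst ` ?p t = t" for t by (simp add: image_image)
  have "ocp S = (`) ?p ` ocp T"
    unfolding S_def by (rule ocp_image_embedding) (use fst in \<open>metis image_mono\<close>)
  then show "(`) (\<lambda>t. bary (fst ` t)) ` ocp S = (`) bary ` ocp T" by (simp add: image_image)
  show "fam1 (ocp S)" unfolding S_def using assms(1) by (intro fam_ocp) simp
  show "inj_on (\<lambda>t. bary (fst ` t)) (\<Union>(ocp S))"
  proof (rule inj_on_subset[OF _ Union_ocp], rule inj_onI)
    fix x y assume xy: "x \<in> S" "y \<in> S" "bary (fst ` x) = bary (fst ` y)"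
    then obtain t u where tu: "x = ?p t" "y = ?p u" "t \<in> T" "u \<in> T" by (auto simp: S_def)
    have "bary t = bary u" using xy(3) unfolding tu(1,2) fst .
    then have "t = u" by (rule inj_onD[OF bary_inj]) (use assms(2) tu in auto)
    then show "x = y" using tu by simp
  qed
qed

theorem theorem6p7:
  fixes n :: nat
    and A :: "nat set \<Rightarrow> 'a family"
    and B :: "nat set \<Rightarrow> 'b family"
  assumes "stellar_simplex n A" and "stellar_simplex n B"
  shows "\<exists>(k::nat) (h :: 'b vertex \<Rightarrow> 'a vertex).
           C_star n (\<lambda>X. (subdivision ^^ k) (B X)) A h"
proof -
  let ?F = "Delta n"
  have A: "\<forall>X\<in>?F. {} \<notin> A X" "cells ?F (\<lambda>X. aug (A X))" using assms(1) by (simp_all add: stellar_simplex_cells)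
  have B: "\<forall>X\<in>?F. {} \<notin> B X" "cells ?F (\<lambda>X. aug (B X))" using assms(2) by (simp_all add: stellar_simplex_cells)
  define ZA where "ZA = on ?F (\<lambda>X. aug (A X))"
  define ZB where "ZB = on ?F (\<lambda>X. aug (B X))"
  have fA: "fam ZA" and fB: "fam ZB" unfolding ZA_def ZB_def by (intro fam_on A B finite_Delta)+
  let ?V = "verts ZA"
  \<comment> \<open>Moves compare complexes on one vertex type, so \<open>A\<close> is copied into
    the vertices of \<open>B\<close>; \<open>\<psi>\<close> will undo the copying.\<close>
  obtain W :: "'b vertex set" where W: "finite W" "card W = card ?V"
    using infinite_arbitrarily_large[OF infinite_vertex] by blast
  obtain \<phi> where "bij_betw \<phi> ?V W" using finite_same_card_bij[OF fam_finite_verts[OF fA] W(1)] W(2) by auto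
  then have \<phi>: "inj_on \<phi> ?V" by (simp add: bij_betw_def)
  define \<psi> where "\<psi> = inv_into ?V \<phi>"
  have inV: "t \<subseteq> ?V" if "t \<in> ZA X" for t X using that in_simps[of ZA X] by (auto simp: verts_def)
  have \<psi>: "\<psi> ` \<phi> ` t = t" if "t \<in> ZA X" for t X
    unfolding \<psi>_def by (rule inv_into_image_cancel[OF \<phi> inV[OF that]])
  define ZC where "ZC = mapf \<phi> ZA"
  have cC: "cells ?F ZC" unfolding ZC_def by (rule cells_mapf[OF _ \<phi>]) (unfold ZA_def, rule cells_on[OF A(2)])
  have "on ?F ZC = ZC" by (simp add: fun_eq_iff ZC_def ZA_def mapf_def on_def)
  then have "seq ZB ZC" using cells_seq[OF B(2) cC finite_Delta] by (simp add: ZB_def)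
  then have "reach ZB ZC" by (rule reach_lseq[OF _ fB])
  then obtain k h0 where kh: "lseq snd (lift h0 ((sub ^^ k) ZB)) (lift id ZC)" unfolding reach_def by blast
  define M where "M = (\<lambda>X. (subdivision ^^ k) (B X))"
  define Z where "Z = (sub ^^ k) ZB"
  have Z: "Z = on ?F (\<lambda>X. aug (M X))" and M0: "\<forall>X\<in>?F. {} \<notin> M X"
    using sub_iter_on[OF B(1), of k] by (simp_all add: Z_def ZB_def M_def)
  have fZ: "fam Z" unfolding Z_def by (rule fam_sub_iter[OF fB])
  define h where "h = \<psi> \<circ> h0"
  \<comment> \<open>Equality of label sets in each face says that \<open>h0\<close> is simplicial
    and maps the face onto its target.\<close>
  have img: "(`) h0 ` Z X = (`) \<phi> ` ZA X" for X
  proof -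
    have "(`) snd ` lift h0 Z X = (`) snd ` lift id ZC X" using image_labels[OF kh, of X] by (simp add: Z_def)
    then show ?thesis by (simp add: lift_def mapf_def image_image ZC_def)
  qed
  have hZ: "\<exists>r\<in>ZA X. h0 ` t = \<phi> ` r \<and> h ` t = r" if t: "t \<in> Z X" for t X
  proof -
    have "h0 ` t \<in> (`) \<phi> ` ZA X" using t unfolding img[symmetric] by (rule imageI)
    then obtain r where r: "r \<in> ZA X" "h0 ` t = \<phi> ` r" by blast
    have "h ` t = \<psi> ` h0 ` t" by (simp add: h_def image_comp)
    also have "\<dots> = r" unfolding r(2) by (rule \<psi>[OF r(1)])
    finally show ?thesis using r by blast
  qed
  have hM: "(`) h ` M X = A X" if X: "X \<in> ?F" for X
  proof -
    have "(`) h ` Z X = ZA X"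
    proof -
      have "(`) h ` Z X = (`) \<psi> ` ((`) h0 ` Z X)" by (simp add: h_def image_image image_comp[symmetric])
      also have "\<dots> = (\<lambda>t. \<psi> ` \<phi> ` t) ` ZA X" unfolding img by (simp only: image_image)
      also have "\<dots> = ZA X" using \<psi> by simp
      finally show ?thesis .
    qed
    then have "aug ((`) h ` M X) = aug (A X)" using X by (simp add: Z ZA_def on_def aug_def)
    then show ?thesis by (rule aug_inject) (use X M0 A(1) in auto)
  qed
  have sM: "stellar_simplex n M" unfolding M_def by (rule stellar_simplex_subdivision[OF assms(2)])
  have cM: "cells ?F (\<lambda>X. aug (M X))" using sM by (simp add: stellar_simplex_cells)
  have top: "{0..n} \<in> ?F" by (simp add: full_complex_def)
  have smap: "simplicial_map (M X) (A X) h" if "X \<in> ?F" for X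
    using hM[OF that] unfolding simplicial_map_def by blast
  have "cellular (M X) (A X) h" if X: "X \<in> ?F" for X
    unfolding cellular_def
  proof (intro conjI smap[OF X] ballI)
    have bM: "bal (card X) (aug (M X))" "{} \<notin> M X" using cM M0 X by (simp_all add: cells_def)
    have bA: "bal (card X) (aug (A X))" "{} \<notin> A X" using A X by (simp_all add: cells_def)
    show "\<exists>d. stellar_manifold d (M X)" using bal_manifold[OF bM] by blast
    show "\<exists>d. stellar_manifold d (A X)" using bal_manifold[OF bA] by blast
    fix s assume s: "s \<in> A X"
    have sn: "s \<noteq> {}" using s bA(2) by metis
    let ?s = "\<phi> ` s"
    have sZ: "s \<in> ZA X" using s X by (simp add: ZA_def on_def aug_def)
    let ?T = "{t \<in> Z X. ?s \<subseteq> h0 ` t}" and ?R = "{t \<in> ZC X. ?s \<subseteq> id ` t}"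
    \<comment> \<open>The augmented family also contains \<open>{}\<close>, which neither side
      admits because \<open>s\<close> is not empty.\<close>
    have T: "{t \<in> M X. s \<subseteq> h ` t} = ?T"
    proof -
      have "t \<in> M X \<and> s \<subseteq> h ` t \<longleftrightarrow> t \<in> Z X \<and> ?s \<subseteq> h0 ` t" for t
      proof (cases "t = {}")
        case True then show ?thesis using sn by simp
      next
        case False
        then have "t \<in> M X \<longleftrightarrow> t \<in> Z X" using X by (simp add: Z on_def aug_def)
        moreover have "s \<subseteq> h ` t \<longleftrightarrow> ?s \<subseteq> h0 ` t" if t: "t \<in> Z X"
        proof -
          obtain r where r: "r \<in> ZA X" "h0 ` t = \<phi> ` r" "h ` t = r" using hZ[OF t] by blast
          have "s \<subseteq> r" if "?s \<subseteq> \<phi> ` r"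
          proof -
            have "\<psi> ` ?s \<subseteq> \<psi> ` \<phi> ` r" using that by (rule image_mono)
            then show ?thesis unfolding \<psi>[OF sZ] \<psi>[OF r(1)] .
          qed
          then show ?thesis unfolding r(2,3) by (meson image_mono)
        qed
        ultimately show ?thesis by metis
      qed
      then show ?thesis by (simp only:)
    qed
    have S: "{t \<in> lift g Y X. ?s \<subseteq> snd ` t} = (`) (\<lambda>x. (x, g x)) ` {t \<in> Y X. ?s \<subseteq> g ` t}" for g and Y :: "nat set \<Rightarrow> 'b family"
    proof -
      have "snd ` (\<lambda>x. (x, g x)) ` t = g ` t" for t by (simp add: image_image)
      then show ?thesis unfolding lift_def mapf_def by auto
    qed
    have fC: "fam1 (ZC X)" using cells_fam1[OF cC X] .
    have fT: "finite ?T" "\<forall>t\<in>?T. finite t" using fam_at[OF fZ, of X] by (simp_all add: fam_unit)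
    have fR: "finite ?R" "\<forall>t\<in>?R. finite t" using fC by (simp_all add: fam_unit)
    have inf: "infinite (UNIV :: ('b vertex \<times> 'b vertex) set)" using infinite_vertex by (simp add: finite_prod)
    \<comment> \<open>Labelled moves connect the dual cell of \<open>h0\<close> with that of the
      identity on the copy of \<open>A\<close>; the latter is a ball by
      \<open>bal_ocp_star\<close>.\<close>
    have "sq (ocp ((`) (\<lambda>x. (x, h0 x)) ` ?T)) (ocp ((`) (\<lambda>x. (x, id x)) ` ?R))"
      using ocp_lseq[OF inf kh, of X ?s] unfolding Z_def[symmetric] S .
    from sq_map[OF this ocp_graph(3)[OF fT] infinite_vertex ocp_graph(2)[OF fT] ocp_graph(2)[OF fR]]
    have eq: "sq ((`) bary ` ocp ?T) ((`) bary ` ocp ?R)" unfolding ocp_graph(1)[OF fT] ocp_graph(1)[OF fR] .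
    have sC: "?s \<in> ZC X" using sZ by (simp add: ZC_def mapf_def)
    have "gl (card X) (ZC X)" using cC X by (simp add: gl_def cells_def)
    from bal_ocp_star[OF this fC sC] obtain m where "bal m ((`) bary ` ocp {t \<in> ZC X. ?s \<subseteq> t})" by (rule exE)
    then have "bal m ((`) bary ` ocp ?R)" by simp
    from bal_sq[OF this sq_sym[OF eq]] have "bal m ((`) bary ` ocp ?T)" .
    then have "bal m (aug (dual_cell (M X) s h))" unfolding aug_dual_cell[OF bal_simplicial[OF bM] sn] T .
    moreover have "{} \<notin> dual_cell (M X) s h" by (auto simp: dual_cell_def flags_def)
    ultimately have "stellar_ball (int m - 1) (dual_cell (M X) s h)" by (simp only: stellar_ball_bal simp_thms)
    then show "\<exists>d. stellar_ball d (dual_cell (M X) s h)" by (rule exI)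
  qed
  then have "C_star n M A h"
    unfolding C_star_def face_preserving_def using sM assms(1) smap[OF top] hM by (intro conjI ballI)
  then show ?thesis unfolding M_def by blast
qed

end
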